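(* Assume $\mathsf{ZF}$. Let $\delta$ be a limit ordinal with $\mathrm{cof}(\delta)=\omega$, let $\bar\delta\leq\delta$, and let $j:V_{\bar\delta}\to V_\delta$ be $\Sigma_1$-elementary and $\in$-cofinal. Let $\theta$ be the least ordinal such that $\mathcal{J}_\theta(V_\delta)$ is admissible. Then $j\notin\mathcal{J}_\theta(V_\delta)$; moreover, $j$ is neither $\Sigma_1$-definable from parameters over $\mathcal{J}_\theta(V_\delta)$ nor $\Pi_1$-definable from parameters over $\mathcal{J}_\theta(V_\delta)$.
   Context: $\in$-cofinal: for every $y\in V_\delta$ there is $x\in V_{\bar\delta}$ with $y\in j(x)$. $\mathcal{J}_\alpha(X)$ is Jensen's constructible hierarchy over the transitive set $X$. A transitive set $M$ is admissible iff it satisfies Pairing, Infinity, $\Sigma_0$-Separation and $\Sigma_1$-Collection (whenever $M\models\forall x\in d\,\exists y\,\varphi(x,y,p)$ with $\varphi$ $\Sigma_1$, there is $e\in M$ with $M\models\forall x\in d\,\exists y\in e\,\varphi(x,y,p)$).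
   Formalization: The embedding j is assumed non-trivial (j(x) ≠ x for some x); otherwise the identity on V_δ with δ̄ = δ, which is Σ_1-elementary and ∈-cofinal, lies in J_1(V_δ) and refutes the claim. No other case is excluded. *)

theory Defs
  imports Main
begin

datatype fo =
    FMem nat nat
  | FEq nat nat
  | FNeg fo
  | FAnd fo fo
  | FEx nat fo

primrec fo_sat :: "('a \<Rightarrow> 'a \<Rightarrow> bool) \<Rightarrow> fo \<Rightarrow> (nat \<Rightarrow> 'a) \<Rightarrow> bool" where
  "fo_sat E (FMem m n) e \<longleftrightarrow> E (e m) (e n)"
| "fo_sat E (FEq m n) e \<longleftrightarrow> e m = e n"
| "fo_sat E (FNeg \<phi>) e \<longleftrightarrow> \<not> fo_sat E \<phi> e"
| "fo_sat E (FAnd \<phi> \<psi>) e \<longleftrightarrow> fo_sat E \<phi> e \<and> fo_sat E \<psi> e"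
| "fo_sat E (FEx n \<phi>) e \<longleftrightarrow> (\<exists>x. fo_sat E \<phi> (e(n := x)))"

text \<open>
  A type of this class is an arbitrary model of ZF. Separation and Replacement range over
  first-order formulas with parameters only. Stating them for all HOL predicates would give
  second-order ZF and, through Hilbert choice, the Axiom of Choice.
\<close>

class zf =
  fixes mem :: "'a \<Rightarrow> 'a \<Rightarrow> bool"  (infix "\<^bold>\<in>" 50)
  assumes zf_extensionality: "(\<forall>z. z \<^bold>\<in> x \<longleftrightarrow> z \<^bold>\<in> y) \<Longrightarrow> x = y"
    and zf_foundation: "\<exists>y. y \<^bold>\<in> x \<Longrightarrow> \<exists>y. y \<^bold>\<in> x \<and> (\<forall>z. z \<^bold>\<in> y \<longrightarrow> \<not> z \<^bold>\<in> x)"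
    and zf_pairing: "\<exists>z. \<forall>w. w \<^bold>\<in> z \<longleftrightarrow> w = x \<or> w = y"
    and zf_union: "\<exists>u. \<forall>w. w \<^bold>\<in> u \<longleftrightarrow> (\<exists>y. y \<^bold>\<in> x \<and> w \<^bold>\<in> y)"
    and zf_power: "\<exists>p. \<forall>y. y \<^bold>\<in> p \<longleftrightarrow> (\<forall>w. w \<^bold>\<in> y \<longrightarrow> w \<^bold>\<in> x)"
    and zf_infinity: "\<exists>I. (\<exists>e. e \<^bold>\<in> I \<and> (\<forall>w. \<not> w \<^bold>\<in> e)) \<and>
          (\<forall>x. x \<^bold>\<in> I \<longrightarrow> (\<exists>y. y \<^bold>\<in> I \<and> (\<forall>w. w \<^bold>\<in> y \<longleftrightarrow> w \<^bold>\<in> x \<or> w = x)))"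
    and zf_separation: "\<exists>b. \<forall>x. x \<^bold>\<in> b \<longleftrightarrow> x \<^bold>\<in> a \<and> fo_sat mem \<phi> (e(0 := x))"
    and zf_replacement: "(\<forall>x. x \<^bold>\<in> a \<longrightarrow> (\<exists>!y. fo_sat mem \<phi> (e(0 := x, 1 := y)))) \<Longrightarrow>
          \<exists>b. \<forall>y. y \<^bold>\<in> b \<longleftrightarrow> (\<exists>x. x \<^bold>\<in> a \<and> fo_sat mem \<phi> (e(0 := x, 1 := y)))"

text \<open>
  The set with a given extension. It is used only for classes that ZF proves to be sets.
\<close>

definition setof :: "('a::zf \<Rightarrow> bool) \<Rightarrow> 'a" where
  "setof P = (THE x. \<forall>y. y \<^bold>\<in> x \<longleftrightarrow> P y)"

definition subset :: "'a::zf \<Rightarrow> 'a \<Rightarrow> bool"  (infix "\<^bold>\<subseteq>" 50) where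
  "x \<^bold>\<subseteq> y \<longleftrightarrow> (\<forall>z. z \<^bold>\<in> x \<longrightarrow> z \<^bold>\<in> y)"

definition empty :: "'a::zf" where
  "empty = setof (\<lambda>x. False)"

definition upair :: "'a::zf \<Rightarrow> 'a \<Rightarrow> 'a" where
  "upair a b = setof (\<lambda>x. x = a \<or> x = b)"

definition opair :: "'a::zf \<Rightarrow> 'a \<Rightarrow> 'a" where
  "opair a b = upair (upair a a) (upair a b)"

definition diff :: "'a::zf \<Rightarrow> 'a \<Rightarrow> 'a" where
  "diff a b = setof (\<lambda>x. x \<^bold>\<in> a \<and> \<not> x \<^bold>\<in> b)"

definition set_union :: "'a::zf \<Rightarrow> 'a" where
  "set_union a = setof (\<lambda>x. \<exists>y. y \<^bold>\<in> a \<and> x \<^bold>\<in> y)"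

definition adjoin_self :: "'a::zf \<Rightarrow> 'a" where
  "adjoin_self a = setof (\<lambda>x. x \<^bold>\<in> a \<or> x = a)"

definition big_union :: "'a::zf \<Rightarrow> ('a \<Rightarrow> 'a) \<Rightarrow> 'a" where
  "big_union a F = setof (\<lambda>w. \<exists>z. z \<^bold>\<in> a \<and> w \<^bold>\<in> F z)"

definition transitive :: "'a::zf \<Rightarrow> bool" where
  "transitive x \<longleftrightarrow> (\<forall>y. y \<^bold>\<in> x \<longrightarrow> y \<^bold>\<subseteq> x)"

definition Ord :: "'a::zf \<Rightarrow> bool" where
  "Ord x \<longleftrightarrow> transitive x \<and> (\<forall>y. y \<^bold>\<in> x \<longrightarrow> transitive y)"

definition Limit :: "'a::zf \<Rightarrow> bool" where
  "Limit x \<longleftrightarrow> Ord x \<and> x \<noteq> empty \<and> (\<forall>y. y \<^bold>\<in> x \<longrightarrow> adjoin_self y \<^bold>\<in> x)"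

definition is_inductive :: "'a::zf \<Rightarrow> bool" where
  "is_inductive I \<longleftrightarrow> empty \<^bold>\<in> I \<and> (\<forall>x. x \<^bold>\<in> I \<longrightarrow> adjoin_self x \<^bold>\<in> I)"

definition omega :: "'a::zf" where
  "omega = setof (\<lambda>x. \<forall>I. is_inductive I \<longrightarrow> x \<^bold>\<in> I)"

definition fun_on :: "'a::zf \<Rightarrow> 'a \<Rightarrow> bool" where
  "fun_on f A \<longleftrightarrow> (\<forall>p. p \<^bold>\<in> f \<longrightarrow> (\<exists>x y. x \<^bold>\<in> A \<and> p = opair x y)) \<and>
     (\<forall>x. x \<^bold>\<in> A \<longrightarrow> (\<exists>!y. opair x y \<^bold>\<in> f))"

definition app :: "'a::zf \<Rightarrow> 'a \<Rightarrow> 'a" where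
  "app f x = (THE y. opair x y \<^bold>\<in> f)"

definition maps :: "'a::zf \<Rightarrow> 'a \<Rightarrow> 'a \<Rightarrow> bool" where
  "maps f A B \<longleftrightarrow> fun_on f A \<and> (\<forall>x. x \<^bold>\<in> A \<longrightarrow> app f x \<^bold>\<in> B)"

definition cofinal_map :: "'a::zf \<Rightarrow> 'a \<Rightarrow> 'a \<Rightarrow> bool" where
  "cofinal_map f \<gamma> \<delta> \<longleftrightarrow> maps f \<gamma> \<delta> \<and> (\<forall>\<beta>. \<beta> \<^bold>\<in> \<delta> \<longrightarrow> (\<exists>\<xi>. \<xi> \<^bold>\<in> \<gamma> \<and> \<beta> \<^bold>\<subseteq> app f \<xi>))"

definition cofinality :: "'a::zf \<Rightarrow> 'a" where
  "cofinality \<delta> = (THE \<gamma>. Ord \<gamma> \<and> (\<exists>f. cofinal_map f \<gamma> \<delta>) \<and>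
     (\<forall>\<beta>. \<beta> \<^bold>\<in> \<gamma> \<longrightarrow> \<not> (\<exists>f. cofinal_map f \<beta> \<delta>)))"

text \<open>
  Transfinite recursion: \<open>G \<beta> F\<close> may use \<open>F\<close> only at arguments below \<open>\<beta>\<close>.
\<close>

definition transrec :: "('a::zf \<Rightarrow> ('a \<Rightarrow> 'a) \<Rightarrow> 'a) \<Rightarrow> 'a \<Rightarrow> 'a" where
  "transrec G \<alpha> = (THE y. \<exists>f. fun_on f (adjoin_self \<alpha>) \<and>
     (\<forall>\<beta>. \<beta> \<^bold>\<in> adjoin_self \<alpha> \<longrightarrow> app f \<beta> = G \<beta> (app f)) \<and> y = app f \<alpha>)"

definition V_level :: "'a::zf \<Rightarrow> 'a" where
  "V_level = transrec (\<lambda>\<beta> F. setof (\<lambda>x. \<exists>\<gamma>. \<gamma> \<^bold>\<in> \<beta> \<and> x \<^bold>\<subseteq> F \<gamma>))"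

inductive rudimentary :: "nat \<Rightarrow> ('a::zf list \<Rightarrow> 'a) \<Rightarrow> bool" where
  rud_proj: "i < n \<Longrightarrow> rudimentary n (\<lambda>xs. xs ! i)"
| rud_diff: "i < n \<Longrightarrow> k < n \<Longrightarrow> rudimentary n (\<lambda>xs. diff (xs ! i) (xs ! k))"
| rud_pair: "i < n \<Longrightarrow> k < n \<Longrightarrow> rudimentary n (\<lambda>xs. upair (xs ! i) (xs ! k))"
| rud_comp: "rudimentary (length gs) h \<Longrightarrow> (\<forall>g\<in>set gs. rudimentary n g) \<Longrightarrow>
    rudimentary n (\<lambda>xs. h (map (\<lambda>g. g xs) gs))"
| rud_union: "rudimentary (Suc n) g \<Longrightarrow>
    rudimentary (Suc n) (\<lambda>xs. big_union (hd xs) (\<lambda>z. g (z # tl xs)))"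

definition rud_closed :: "'a::zf \<Rightarrow> bool" where
  "rud_closed S \<longleftrightarrow> (\<forall>n f xs. rudimentary n f \<and> length xs = n \<and> (\<forall>x\<in>set xs. x \<^bold>\<in> S) \<longrightarrow> f xs \<^bold>\<in> S)"

definition rud_closure :: "'a::zf \<Rightarrow> 'a" where
  "rud_closure X = setof (\<lambda>y. \<forall>S. X \<^bold>\<subseteq> S \<and> rud_closed S \<longrightarrow> y \<^bold>\<in> S)"

text \<open>
  The hierarchy starts with the transitive closure of \<open>{X}\<close>, so \<open>X\<close> belongs to every level.
  Starting with \<open>X\<close> itself gives the same levels from index 1 on. At a successor ordinal
  \<open>\<beta>\<close>, \<open>set_union \<beta>\<close> is its predecessor.
\<close>

definition J_level :: "'a::zf \<Rightarrow> 'a \<Rightarrow> 'a" where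
  "J_level X = transrec (\<lambda>\<beta> F.
     if \<beta> = empty then adjoin_self X
     else if Limit \<beta> then big_union \<beta> F
     else rud_closure (adjoin_self (F (set_union \<beta>))))"

text \<open>
  Formulas of the language of set theory are coded by sets of the model, with variable indices
  in the \<open>omega\<close> of the model, which need not be standard. Least classes of codes are taken as
  intersections of sets of the model.
\<close>

primrec std_num :: "nat \<Rightarrow> 'a::zf" where
  "std_num 0 = empty"
| "std_num (Suc n) = adjoin_self (std_num n)"

definition cMem :: "'a::zf \<Rightarrow> 'a \<Rightarrow> 'a" where
  "cMem i k = opair (std_num 0) (opair i k)"

definition cEq :: "'a::zf \<Rightarrow> 'a \<Rightarrow> 'a" where
  "cEq i k = opair (std_num 1) (opair i k)"

definition cNeg :: "'a::zf \<Rightarrow> 'a" where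
  "cNeg \<phi> = opair (std_num 2) \<phi>"

definition cAnd :: "'a::zf \<Rightarrow> 'a \<Rightarrow> 'a" where
  "cAnd \<phi> \<psi> = opair (std_num 3) (opair \<phi> \<psi>)"

definition cEx :: "'a::zf \<Rightarrow> 'a \<Rightarrow> 'a" where
  "cEx i \<phi> = opair (std_num 4) (opair i \<phi>)"

definition cAll :: "'a::zf \<Rightarrow> 'a \<Rightarrow> 'a" where
  "cAll i \<phi> = cNeg (cEx i (cNeg \<phi>))"

definition boolean_closed :: "'a::zf \<Rightarrow> bool" where
  "boolean_closed S \<longleftrightarrow>
     (\<forall>i k. i \<^bold>\<in> omega \<and> k \<^bold>\<in> omega \<longrightarrow> cMem i k \<^bold>\<in> S \<and> cEq i k \<^bold>\<in> S) \<and>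
     (\<forall>\<phi>. \<phi> \<^bold>\<in> S \<longrightarrow> cNeg \<phi> \<^bold>\<in> S) \<and>
     (\<forall>\<phi> \<psi>. \<phi> \<^bold>\<in> S \<and> \<psi> \<^bold>\<in> S \<longrightarrow> cAnd \<phi> \<psi> \<^bold>\<in> S)"

definition Form :: "'a::zf" where
  "Form = setof (\<lambda>\<phi>. \<forall>S. boolean_closed S \<and>
     (\<forall>i \<psi>. i \<^bold>\<in> omega \<and> \<psi> \<^bold>\<in> S \<longrightarrow> cEx i \<psi> \<^bold>\<in> S) \<longrightarrow> \<phi> \<^bold>\<in> S)"

definition Sigma0 :: "'a::zf" where
  "Sigma0 = setof (\<lambda>\<phi>. \<forall>S. boolean_closed S \<and>
     (\<forall>i k \<psi>. i \<^bold>\<in> omega \<and> k \<^bold>\<in> omega \<and> i \<noteq> k \<and> \<psi> \<^bold>\<in> S \<longrightarrow> cEx i (cAnd (cMem i k) \<psi>) \<^bold>\<in> S)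
     \<longrightarrow> \<phi> \<^bold>\<in> S)"

definition Sigma1 :: "'a::zf" where
  "Sigma1 = setof (\<lambda>\<phi>. \<forall>S. Sigma0 \<^bold>\<subseteq> S \<and>
     (\<forall>i \<psi>. i \<^bold>\<in> omega \<and> \<psi> \<^bold>\<in> S \<longrightarrow> cEx i \<psi> \<^bold>\<in> S) \<longrightarrow> \<phi> \<^bold>\<in> S)"

definition Pi1 :: "'a::zf" where
  "Pi1 = setof (\<lambda>\<phi>. \<forall>S. Sigma0 \<^bold>\<subseteq> S \<and>
     (\<forall>i \<psi>. i \<^bold>\<in> omega \<and> \<psi> \<^bold>\<in> S \<longrightarrow> cAll i \<psi> \<^bold>\<in> S) \<longrightarrow> \<phi> \<^bold>\<in> S)"

definition upd :: "'a::zf \<Rightarrow> 'a \<Rightarrow> 'a \<Rightarrow> 'a" where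
  "upd s i a = setof (\<lambda>p. p = opair i a \<or> (p \<^bold>\<in> s \<and> (\<forall>y. p \<noteq> opair i y)))"

text \<open>
  Tarski's clauses for the structure \<open>(A, \<in>)\<close>: \<open>g\<close> sends each formula to the set of assignments
  \<open>s : omega \<rightarrow> A\<close> satisfying it.
\<close>

definition sat_map :: "'a::zf \<Rightarrow> 'a \<Rightarrow> bool" where
  "sat_map A g \<longleftrightarrow> fun_on g Form \<and>
     (\<forall>i k s. i \<^bold>\<in> omega \<and> k \<^bold>\<in> omega \<longrightarrow>
        (s \<^bold>\<in> app g (cMem i k) \<longleftrightarrow> maps s omega A \<and> app s i \<^bold>\<in> app s k)) \<and>
     (\<forall>i k s. i \<^bold>\<in> omega \<and> k \<^bold>\<in> omega \<longrightarrow>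
        (s \<^bold>\<in> app g (cEq i k) \<longleftrightarrow> maps s omega A \<and> app s i = app s k)) \<and>
     (\<forall>\<phi> s. \<phi> \<^bold>\<in> Form \<longrightarrow>
        (s \<^bold>\<in> app g (cNeg \<phi>) \<longleftrightarrow> maps s omega A \<and> \<not> s \<^bold>\<in> app g \<phi>)) \<and>
     (\<forall>\<phi> \<psi> s. \<phi> \<^bold>\<in> Form \<and> \<psi> \<^bold>\<in> Form \<longrightarrow>
        (s \<^bold>\<in> app g (cAnd \<phi> \<psi>) \<longleftrightarrow> maps s omega A \<and> s \<^bold>\<in> app g \<phi> \<and> s \<^bold>\<in> app g \<psi>)) \<and>
     (\<forall>i \<phi> s. i \<^bold>\<in> omega \<and> \<phi> \<^bold>\<in> Form \<longrightarrow>
        (s \<^bold>\<in> app g (cEx i \<phi>) \<longleftrightarrow>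
           maps s omega A \<and> (\<exists>a. a \<^bold>\<in> A \<and> upd s i a \<^bold>\<in> app g \<phi>)))"

definition Sat :: "'a::zf \<Rightarrow> 'a \<Rightarrow> 'a \<Rightarrow> bool" where
  "Sat A \<phi> s \<longleftrightarrow> (\<exists>g. sat_map A g \<and> s \<^bold>\<in> app g \<phi>)"

definition push :: "'a::zf \<Rightarrow> 'a \<Rightarrow> 'a" where
  "push j s = setof (\<lambda>p. \<exists>k. k \<^bold>\<in> omega \<and> p = opair k (app j (app s k)))"

definition Sigma1_elementary :: "'a::zf \<Rightarrow> 'a \<Rightarrow> 'a \<Rightarrow> bool" where
  "Sigma1_elementary j A B \<longleftrightarrow> maps j A B \<and>
     (\<forall>\<phi> s. \<phi> \<^bold>\<in> Sigma1 \<and> maps s omega A \<longrightarrow> (Sat A \<phi> s \<longleftrightarrow> Sat B \<phi> (push j s)))"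

definition mem_cofinal :: "'a::zf \<Rightarrow> 'a \<Rightarrow> 'a \<Rightarrow> bool" where
  "mem_cofinal j A B \<longleftrightarrow> (\<forall>y. y \<^bold>\<in> B \<longrightarrow> (\<exists>x. x \<^bold>\<in> A \<and> y \<^bold>\<in> app j x))"

text \<open>
  Variable 0 is the free variable of the definition. The values of the assignment \<open>s\<close> at the
  other variables are the parameters.
\<close>

definition definable_over :: "'a::zf \<Rightarrow> 'a \<Rightarrow> 'a \<Rightarrow> bool" where
  "definable_over \<Gamma> M D \<longleftrightarrow> (\<exists>\<phi> s. \<phi> \<^bold>\<in> \<Gamma> \<and> maps s omega M \<and>
     (\<forall>x. x \<^bold>\<in> D \<longleftrightarrow> x \<^bold>\<in> M \<and> Sat M \<phi> (upd s (std_num 0) x)))"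

definition sat_Pairing :: "'a::zf \<Rightarrow> bool" where
  "sat_Pairing M \<longleftrightarrow> (\<forall>x y. x \<^bold>\<in> M \<and> y \<^bold>\<in> M \<longrightarrow>
     (\<exists>z. z \<^bold>\<in> M \<and> (\<forall>w. w \<^bold>\<in> M \<longrightarrow> (w \<^bold>\<in> z \<longleftrightarrow> w = x \<or> w = y))))"

definition sat_Infinity :: "'a::zf \<Rightarrow> bool" where
  "sat_Infinity M \<longleftrightarrow> (\<exists>I. I \<^bold>\<in> M \<and>
     (\<exists>e. e \<^bold>\<in> M \<and> e \<^bold>\<in> I \<and> (\<forall>w. w \<^bold>\<in> M \<longrightarrow> \<not> w \<^bold>\<in> e)) \<and>
     (\<forall>x. x \<^bold>\<in> M \<and> x \<^bold>\<in> I \<longrightarrow>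
        (\<exists>y. y \<^bold>\<in> M \<and> y \<^bold>\<in> I \<and> (\<forall>w. w \<^bold>\<in> M \<longrightarrow> (w \<^bold>\<in> y \<longleftrightarrow> w \<^bold>\<in> x \<or> w = x)))))"

definition sat_Sigma0_Separation :: "'a::zf \<Rightarrow> bool" where
  "sat_Sigma0_Separation M \<longleftrightarrow> (\<forall>\<phi> s d. \<phi> \<^bold>\<in> Sigma0 \<and> maps s omega M \<and> d \<^bold>\<in> M \<longrightarrow>
     (\<exists>e. e \<^bold>\<in> M \<and>
        (\<forall>x. x \<^bold>\<in> M \<longrightarrow> (x \<^bold>\<in> e \<longleftrightarrow> x \<^bold>\<in> d \<and> Sat M \<phi> (upd s (std_num 0) x)))))"

definition sat_Sigma1_Collection :: "'a::zf \<Rightarrow> bool" where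
  "sat_Sigma1_Collection M \<longleftrightarrow> (\<forall>\<phi> s d. \<phi> \<^bold>\<in> Sigma1 \<and> maps s omega M \<and> d \<^bold>\<in> M \<longrightarrow>
     (\<forall>x. x \<^bold>\<in> M \<and> x \<^bold>\<in> d \<longrightarrow>
        (\<exists>y. y \<^bold>\<in> M \<and> Sat M \<phi> (upd (upd s (std_num 0) x) (std_num 1) y))) \<longrightarrow>
     (\<exists>e. e \<^bold>\<in> M \<and> (\<forall>x. x \<^bold>\<in> M \<and> x \<^bold>\<in> d \<longrightarrow>
        (\<exists>y. y \<^bold>\<in> M \<and> y \<^bold>\<in> e \<and> Sat M \<phi> (upd (upd s (std_num 0) x) (std_num 1) y)))))"

definition admissible :: "'a::zf \<Rightarrow> bool" where
  "admissible M \<longleftrightarrow> transitive M \<and> sat_Pairing M \<and> sat_Infinity M \<and>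
     sat_Sigma0_Separation M \<and> sat_Sigma1_Collection M"

end

theory Submission imports Defs begin

text \<open>
  Let \<open>U = V\<^sub>\<delta>\<close> and let \<open>l\<close> be the least limit ordinal such that \<open>J\<^sub>l(U)\<close> has no failure of collection
  for truth at its levels. Then \<open>J\<^sub>l(U)\<close> is admissible, and a map as in the theorem that is definable over
  \<open>J\<^sub>\<theta>(U)\<close> belongs to \<open>J\<^sub>l(U)\<close>. By minimality of \<open>l\<close> every limit level below \<open>l\<close> is pinned down by a failure of
  collection, so every element of \<open>J\<^sub>l(U)\<close> has a code in \<open>U\<close>, and the codes form a structure on \<open>U\<close>
  with a first-order axiomatization every model of which has an initial part isomorphic to \<open>J\<^sub>l(U)\<close>.

  As \<open>\<delta>\<close> has cofinality \<open>\<omega>\<close>, a cofinal embedding \<open>k : U' \<rightarrow> U\<close> lifts to a fully elementary embedding of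
  \<open>(U', A')\<close> into \<open>(U, A)\<close> for every \<open>A' \<subseteq> U'\<close>. Take for \<open>A'\<close> the structure of codes. If \<open>k\<close> is in \<open>J\<^sub>l(U)\<close>, then
  \<open>(U, A)\<close> sees \<open>k\<close>. When \<open>U' \<in> U\<close>, elementarity yields an embedding into \<open>U'\<close> in the hierarchy over \<open>U'\<close>, and
  \<open>\<in>\<close>-induction finishes the argument. When \<open>U' = U\<close>, let \<open>x\<close> be \<open>\<in>\<close>-minimal among the sets moved by some embedding \<open>k\<close> in
  \<open>J\<^sub>l(U)\<close>. No element of \<open>k(x)\<close> is moved by an embedding that \<open>(U, A)\<close> sees, so \<open>k\<close> fixes the elements of \<open>x\<close>
  and of \<open>k(x)\<close>, whence \<open>k(x) = x\<close>.
\<close>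

text \<open>Separation and Replacement hold for first-order formulas only, and the model may be
  nonstandard. So every class, recursion and induction must be shown definable (\<open>D\<close>,
  \<open>dt\<close>), and the formulas of the model have indices in an internal
  \<open>omega\<close>. There is no choice either; codes are chosen only for internally finitely
  many sets at once, by induction.

  The ordinal l stands in for \<theta> because a failure of collection names its level: the least
  stages at which a formula becomes true for the elements of a set are cofinal in it. Admissibility
  of level l gives \<theta> \<le> l, which is where minimality of \<theta> enters.

  A lift preserves first-order truth but not well-foundedness, so the lifted structure of codes may
  have an ill-founded part. The axioms must therefore force a correct initial part by themselves,
  and that part is recovered by recursion on real sets.

  Cofinality \<omega> lets unbounded quantifiers survive the lift: an \<omega>-sequence of truth
  sets, one for each bound on the witnesses, is a single set, and the embedding fixes \<omega> and
  its elements.\<close>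

notation (input) mem (infix ":." 50) and iff (infixr "<->" 25)

section \<open>Definable predicates\<close>

text \<open>De Bruijn variables avoid the renaming of bound variables. With one unary predicate and
  an evaluation relativised to a class, the language serves both the axiom schemes of ZF (all sets,
  empty predicate) and the structures \<open>(U, A)\<close> to which embeddings are lifted.\<close>

datatype fm = mMem nat nat | mEq nat nat | mPr nat | mNeg fm | mAnd fm fm | mEx fm

primrec eval :: "('a::zf => bool) => ('a => bool) => fm => (nat => 'a) => bool" where
  "eval B A (mMem i j) e = (e i :. e j)"
| "eval B A (mEq i j) e = (e i = e j)"
| "eval B A (mPr i) e = A (e i)"
| "eval B A (mNeg \<phi>) e = (~ eval B A \<phi> e)"
| "eval B A (mAnd \<phi> \<psi>) e = (eval B A \<phi> e & eval B A \<psi> e)"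
| "eval B A (mEx \<phi>) e = (EX x. B x & eval B A \<phi> (case_nat x e))"

primrec ren :: "fm => (nat => nat) => fm" where
  "ren (mMem i j) f = mMem (f i) (f j)"
| "ren (mEq i j) f = mEq (f i) (f j)"
| "ren (mPr i) f = mPr (f i)"
| "ren (mNeg \<phi>) f = mNeg (ren \<phi> f)"
| "ren (mAnd \<phi> \<psi>) f = mAnd (ren \<phi> f) (ren \<psi> f)"
| "ren (mEx \<phi>) f = mEx (ren \<phi> (case_nat 0 (%n. Suc (f n))))"

lemma case_nat_ren: "(%n. case_nat x e (case_nat 0 (%n. Suc (f n)) n)) = case_nat x (%n. e (f n))"
  by (auto split: nat.split)

lemma eval_ren: "eval B A (ren \<phi> f) e = eval B A \<phi> (%n. e (f n))"
  by (induction \<phi> arbitrary: f e) (simp_all add: case_nat_ren)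

text \<open>Only indices below this bound matter, by \<open>eval_cong\<close>; this is what allows
  finite tuples to replace infinite environments.\<close>

primrec fvb :: "fm => nat" where
  "fvb (mMem i j) = Suc (max i j)"
| "fvb (mEq i j) = Suc (max i j)"
| "fvb (mPr i) = Suc i"
| "fvb (mNeg \<phi>) = fvb \<phi>"
| "fvb (mAnd \<phi> \<psi>) = max (fvb \<phi>) (fvb \<psi>)"
| "fvb (mEx \<phi>) = fvb \<phi> - 1"

lemma eval_cong: "(\<forall>n<fvb \<phi>. e n = e' n) ==> eval B A \<phi> e = eval B A \<phi> e'"
proof (induction \<phi> arbitrary: e e')
  case (mEx \<phi>)
  have "\<forall>n<fvb \<phi>. case_nat x e n = case_nat x e' n" for x
    using mEx.prems by (auto split: nat.split simp: less_diff_conv)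
  then show ?case using mEx.IH[of "case_nat _ e" "case_nat _ e'"] by (simp only: eval.simps) metis
next
  case (mAnd \<phi> \<psi>)
  then have "eval B A \<phi> e = eval B A \<phi> e'" "eval B A \<psi> e = eval B A \<psi> e'" by simp_all
  then show ?case by simp
next
  case (mNeg \<phi>) then show ?case by (metis eval.simps(4) fvb.simps(4))
qed auto

lemma fresh_index: "EX m. \<forall>n<k. f n \<noteq> m" for f :: "nat => nat" and k :: nat
proof -
  have "finite (f ` {..<k})" by simp
  then obtain m where "m \<notin> f ` {..<k}" using ex_new_if_finite infinite_UNIV_nat by blast
  then show ?thesis by (metis imageI lessThan_iff)
qed

text \<open>The axiom schemes use named variables. The map \<open>f\<close> gives a name to each de
  Bruijn index; below a quantifier the new name only has to avoid the names of the finitely many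
  free indices.\<close>

lemma fo_of_fm: "EX \<psi>. ALL e. fo_sat mem \<psi> e = eval (%_. True) (%_. False) \<phi> (%n. e (f n :: nat) :: 'a::zf)"
proof (induction \<phi> arbitrary: f)
  case (mMem i j) show ?case by (rule exI[of _ "FMem (f i) (f j)"]) simp
next
  case (mEq i j) show ?case by (rule exI[of _ "FEq (f i) (f j)"]) simp
next
  case (mPr i) show ?case by (rule exI[of _ "FNeg (FEq 0 0)"]) simp
next
  case (mNeg \<phi>) then obtain \<psi> where "ALL e. fo_sat mem \<psi> e = eval (%_. True) (%_. False) \<phi> (%n. e (f n) :: 'a)" by blast
  then show ?case by (intro exI[of _ "FNeg \<psi>"]) simp
next
  case (mAnd \<phi>1 \<phi>2)
  obtain \<psi>1 where "ALL e. fo_sat mem \<psi>1 e = eval (%_. True) (%_. False) \<phi>1 (%n. e (f n) :: 'a)" using mAnd(1) by blast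
  moreover obtain \<psi>2 where "ALL e. fo_sat mem \<psi>2 e = eval (%_. True) (%_. False) \<phi>2 (%n. e (f n) :: 'a)" using mAnd(2) by blast
  ultimately show ?case by (intro exI[of _ "FAnd \<psi>1 \<psi>2"]) simp
next
  case (mEx \<phi>)
  obtain m where m: "\<forall>n<fvb \<phi>. f n \<noteq> m" using fresh_index by blast
  obtain \<psi> where \<psi>: "ALL e. fo_sat mem \<psi> e = eval (%_. True) (%_. False) \<phi> (%n. e (case_nat m f n) :: 'a)" using mEx by blast
  have "eval (%_. True) (%_. False) \<phi> (%n. (e(m:=x)) (case_nat m f n)) = eval (%_. True) (%_. False) \<phi> (case_nat x (%n. e (f n)))"
    for e :: "nat => 'a" and x
    by (rule eval_cong) (use m in \<open>auto split: nat.split dest: Suc_lessD\<close>)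
  then show ?case by (intro exI[of _ "FEx m \<psi>"]) (simp add: \<psi>)
qed

text \<open>Even places carry variables and odd places parameters. Both supplies are infinite, so
  the parameters of two formulas can be merged by interleaving once more.\<close>

definition mix :: "(nat => 'a) => (nat => 'a) => nat => 'a" where
  "mix e p n = (if even n then e (n div 2) else p (n div 2))"

lemma mix_simps [simp]: "mix e p (2*n) = e n" "mix e p (Suc (2*n)) = p n"
  by (auto simp: mix_def)

text \<open>First-order definability with parameters over the model, the precondition for
  Separation, Replacement, induction and recursion. The rules collected in \<open>Di\<close> derive
  it from the shape of a predicate.\<close>

definition D :: "((nat => 'a::zf) => bool) => bool" where
  "D P <-> (EX \<phi> p. ALL e. P e = eval (%_. True) (%_. False) \<phi> (mix e p))"

lemma D_ren: assumes "D P" shows "D (%e. P (%n. e (f n)))"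
proof -
  obtain \<phi> p where \<phi>: "!!e. P e = eval (%_. True) (%_. False) \<phi> (mix e p)" using assms by (auto simp: D_def)
  let ?g = "%n. if even n then 2 * f (n div 2) else n"
  have "(%n. mix e p (?g n)) = mix (%n. e (f n)) p" for e by (auto simp: mix_def)
  then show ?thesis unfolding D_def
    by (intro exI[of _ "ren \<phi> ?g"] exI[of _ p]) (simp add: eval_ren \<phi>)
qed

named_theorems Di

lemma D_mem0: "D (%e. e i :. e j)"
  unfolding D_def by (rule exI[of _ "mMem (2*i) (2*j)"]) simp

lemma D_eq0: "D (%e. e i = e j)"
  unfolding D_def by (rule exI[of _ "mEq (2*i) (2*j)"]) simp

lemma D_const0: "D (%e. e i = c)"
  unfolding D_def by (rule exI[of _ "mEq (2*i) (Suc (2*0))"], rule exI[of _ "%_. c"]) (simp only: eval.simps mix_simps, simp)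

lemma D_not [Di]: "D P ==> D (%e. ~ P e)"
  unfolding D_def by (metis eval.simps(4))

lemma D_and [Di]: assumes "D P" "D Q" shows "D (%e. P e & Q e)"
proof -
  obtain \<phi> p where \<phi>: "!!e. P e = eval (%_. True) (%_. False) \<phi> (mix e p)" using assms by (auto simp: D_def)
  obtain \<psi> q where \<psi>: "!!e. Q e = eval (%_. True) (%_. False) \<psi> (mix e q)" using assms by (auto simp: D_def)
  let ?f = "%n. if even n then n else Suc (2 * (2 * (n div 2)))"
  let ?g = "%n. if even n then n else Suc (2 * (Suc (2 * (n div 2))))"
  have "(%n. mix e (mix p q) (?f n)) = mix e p" for e by (rule ext) (auto simp: mix_def elim!: oddE)
  moreover have "(%n. mix e (mix p q) (?g n)) = mix e q" for e by (rule ext) (auto simp: mix_def elim!: oddE)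
  ultimately show ?thesis unfolding D_def
    by (intro exI[of _ "mAnd (ren \<phi> ?f) (ren \<psi> ?g)"] exI[of _ "mix p q"]) (simp add: eval_ren \<phi> \<psi>)
qed

text \<open>The bound variable is a separate argument of \<open>Q\<close>, so that the rule applies
  by unification under nested quantifiers; it becomes index 0 and the other variables move
  up.\<close>

lemma D_ex [Di]: assumes "D (%e. Q (e 0) (%n. e (Suc n)))" shows "D (%e. EX x. Q x e)"
proof -
  obtain \<phi> p where \<phi>: "!!e. Q (e 0) (%n. e (Suc n)) = eval (%_. True) (%_. False) \<phi> (mix e p)"
    using assms by (auto simp: D_def)
  let ?f = "%n. if even n then (if n = 0 then 0 else Suc (2 * (n div 2 - 1))) else Suc n"
  have "(%n. case_nat x (mix e p) (?f n)) = mix (case_nat x e) p" for x e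
    by (rule ext) (auto simp: mix_def split: nat.split)
  then show ?thesis unfolding D_def
    by (intro exI[of _ "mEx (ren \<phi> ?f)"] exI[of _ p]) (simp add: eval_ren \<phi>[symmetric])
qed

lemma D_or [Di]: assumes "D P" "D Q" shows "D (%e. P e | Q e)"
proof -
  have "D (%e. ~ (~ P e & ~ Q e))" by (rule D_not[OF D_and[OF D_not[OF assms(1)] D_not[OF assms(2)]]])
  then show ?thesis by simp
qed
lemma D_imp [Di]: assumes "D P" "D Q" shows "D (%e. P e --> Q e)"
  unfolding imp_conv_disj by (rule D_or[OF D_not[OF assms(1)] assms(2)])
lemma D_iff [Di]: assumes "D P" "D Q" shows "D (%e. P e = Q e)"
  unfolding iff_conv_conj_imp by (rule D_and[OF D_imp[OF assms] D_imp[OF assms(2,1)]])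
lemma D_all [Di]: assumes "D (%e. Q (e 0) (%n. e (Suc n)))" shows "D (%e. ALL x. Q x e)"
proof -
  have "D (%e. ~ (EX x. ~ Q x e))" by (rule D_not, rule D_ex, rule D_not, rule assms)
  then show ?thesis by simp
qed

text \<open>Definability of the graph: place 0 holds the value, and the arguments are shifted by one
  place.\<close>

definition dt :: "((nat => 'a::zf) => 'a) => bool" where
  "dt t <-> D (%e. e 0 = t (%n. e (Suc n)))"

lemma dt_var [Di]: "dt (%e. e i)" unfolding dt_def by (rule D_eq0)
lemma dt_const [Di]: "dt (%e. c)" unfolding dt_def by (rule D_const0)

lemma dt_ren: "dt t ==> dt (%e. t (%n. e (f n)))"
  unfolding dt_def using D_ren[of "%e. e 0 = t (%n. e (Suc n))" "case_nat 0 (%n. Suc (f n))"] by simp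

lemma D_subst: assumes "D (%e. P (e 0) (%n. e (Suc n)))" "dt t" shows "D (%e. P (t e) e)"
proof -
  have "D (%e. EX x. x = t e & P x e)"
    by (rule D_ex, rule D_and) (use assms in \<open>simp_all add: dt_def\<close>)
  then show ?thesis by simp
qed

lemma D_app1: "D (%e. P (e 0)) ==> dt t ==> D (%e. P (t e))"
  by (rule D_subst[of "%x e. P x"]) simp

lemma D_app2: assumes "D (%e. R (e 0) (e 1))" "dt s" "dt t" shows "D (%e. R (s e) (t e))"
proof (rule D_subst[of "%x e. R x (t e)", OF _ assms(2)])
  show "D (%e. R (e 0) (t (%n. e (Suc n))))"
    by (rule D_subst[of "%y e. R (e 0) y", OF _ dt_ren[OF assms(3)]])
      (use D_ren[OF assms(1), of "%n. if n = 0 then 1 else 0"] in simp)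
qed

lemma D_app3: assumes "D (%e. R (e 0) (e 1) (e 2))" "dt s" "dt t" "dt u" shows "D (%e. R (s e) (t e) (u e))"
  apply (rule D_subst[of "%x e. R x (t e) (u e)", OF _ assms(2)])
  apply (rule D_subst[of "%x e. R (e 0) x (u (%n. e (Suc n)))", OF _ dt_ren[OF assms(3)]])
  apply (rule D_subst[of "%x e. R (e (Suc 0)) (e 0) x", OF _ dt_ren[OF assms(4)]])
  using D_ren[OF assms(1), of "%n. 2 - n"] by (simp add: numeral_2_eq_2)

lemma D_app4: assumes "D (%e. R (e 0) (e 1) (e 2) (e 3))" "dt s" "dt t" "dt u" "dt v"
  shows "D (%e. R (s e) (t e) (u e) (v e))"
  apply (rule D_subst[of "%x e. R x (t e) (u e) (v e)", OF _ assms(2)])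
  apply (rule D_subst[of "%x e. R (e 0) x (u (%n. e (Suc n))) (v (%n. e (Suc n)))", OF _ dt_ren[OF assms(3)]])
  apply (rule D_subst[of "%x e. R (e (Suc 0)) (e 0) x (v (%n. e (Suc (Suc n))))", OF _ dt_ren[OF assms(4)]])
  apply (rule D_subst[of "%x e. R (e (Suc (Suc 0))) (e (Suc 0)) (e 0) x", OF _ dt_ren[OF assms(5)]])
  using D_ren[OF assms(1), of "%n. 3 - n"] by (simp add: numeral_2_eq_2 numeral_3_eq_3)

lemma D_mem [Di]: "dt s ==> dt t ==> D (%e. s e :. t e)" by (rule D_app2[where R=mem, OF D_mem0])
lemma D_eq [Di]: "dt s ==> dt t ==> D (%e. s e = t e)" by (rule D_app2[where R="(=)", OF D_eq0])

lemma D_True [Di]: "D (%e. True)" using D_eq0[of 0 0] by simp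
lemma D_False [Di]: "D (%e. False)" using D_not[OF D_True] by simp

lemma dt_Suc: "dt t ==> dt (%e. t (%n. e (Suc n)))" by (rule dt_ren)

lemma dt_app1: assumes "dt (%e. F (e 0))" "dt t" shows "dt (%e. F (t e))"
  unfolding dt_def
  by (rule D_app2[of "%x y. x = F y", OF _ dt_var dt_Suc[OF assms(2)]]) (use assms(1) in \<open>simp add: dt_def\<close>)
lemma dt_app2: assumes "dt (%e. F (e 0) (e 1))" "dt s" "dt t" shows "dt (%e. F (s e) (t e))"
  unfolding dt_def
  by (rule D_app3[of "%x y z. x = F y z", OF _ dt_var dt_Suc[OF assms(2)] dt_Suc[OF assms(3)]])
    (use assms(1) in \<open>simp add: dt_def numeral_2_eq_2\<close>)
lemma dt_app3: assumes "dt (%e. F (e 0) (e 1) (e 2))" "dt s" "dt t" "dt u" shows "dt (%e. F (s e) (t e) (u e))"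
  unfolding dt_def
  by (rule D_app4[of "%x y z w. x = F y z w", OF _ dt_var dt_Suc[OF assms(2)] dt_Suc[OF assms(3)] dt_Suc[OF assms(4)]])
    (use assms(1) in \<open>simp add: dt_def numeral_2_eq_2 numeral_3_eq_3\<close>)

definition isset :: "('a::zf => bool) => bool" where
  "isset P <-> (EX x. ALL y. y :. x <-> P y)"

lemma mem_setof: "isset P ==> y :. setof P <-> P y"
proof -
  assume "isset P"
  then obtain x where x: "ALL y. y :. x <-> P y" by (auto simp: isset_def)
  then have "EX! x. ALL y. y :. x <-> P y" using zf_extensionality by metis
  then have "ALL y. y :. setof P <-> P y" unfolding setof_def by (rule theI')
  then show ?thesis by blast
qed

lemma set_eqI: "(!!z. z :. x <-> z :. y) ==> x = y" using zf_extensionality by blast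

lemma sub_refl [simp]: "x \<^bold>\<subseteq> x" by (simp add: subset_def)
lemma subD: "x \<^bold>\<subseteq> y ==> z :. x ==> z :. y" by (simp add: subset_def)
lemma subI: "(!!z. z :. x ==> z :. y) ==> x \<^bold>\<subseteq> y" by (simp add: subset_def)
lemma sub_antisym: "x \<^bold>\<subseteq> y ==> y \<^bold>\<subseteq> x ==> x = y" by (auto intro!: set_eqI dest: subD)
lemma sub_trans: "x \<^bold>\<subseteq> y ==> y \<^bold>\<subseteq> z ==> x \<^bold>\<subseteq> z" by (simp add: subset_def)

text \<open>A definite description is described by its elements only where it denotes. Hence the
  second premise, for all values of the parameters.\<close>

lemma dt_setof: assumes "D (%e. P (%n. e (Suc n)) (e 0))" "!!e. isset (P e)" shows "dt (%e. setof (P e))"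
proof -
  have "(x = setof (P e)) = (ALL y. y :. x <-> P e y)" for x e
    using mem_setof[OF assms(2)] by (auto intro: set_eqI)
  moreover have "D (%e. ALL y. y :. e 0 <-> P (%n. e (Suc n)) y)"
    by (intro Di) (use D_ren[OF assms(1), of "case_nat 0 (%n. Suc (Suc n))"] in simp)
  ultimately show ?thesis unfolding dt_def by simp
qed

lemma separation: assumes "D (%e. P (e 0))" shows "EX b. ALL x. x :. b <-> x :. a & P (x::'a::zf)"
proof -
  obtain \<phi> p where \<phi>: "!!e::nat => 'a. P (e 0) = eval (%_. True) (%_. False) \<phi> (mix e p)" using assms by (auto simp: D_def)
  obtain \<psi> where \<psi>: "!!e::nat => 'a. fo_sat mem \<psi> e = eval (%_. True) (%_. False) \<phi> (%n. e (if n = 0 then 0 else Suc n))"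
    using fo_of_fm[of \<phi> "%n. if n = 0 then 0 else Suc n"] by auto
  \<comment> \<open>The scheme overwrites place 0 by the element, so the mixed environment is moved
    up by one place, except for its index 0.\<close>
  let ?e = "%n. mix (%_. a) p (n - 1)"
  have "(%n. (?e(0 := x)) (if n = 0 then 0 else Suc n)) = mix (%n. if n = 0 then x else a) p" for x
    by (rule ext) (auto simp: mix_def)
  then have "fo_sat mem \<psi> (?e(0 := x)) = P x" for x using \<phi>[of "%n. if n = 0 then x else a"] by (simp add: \<psi>)
  then show ?thesis using zf_separation[of a \<psi> ?e] by auto
qed

lemma isset_sub: "D (%e. P (e 0)) ==> (!!x. P x ==> x :. a) ==> isset P"
  using separation[of P a] by (auto simp: isset_def)

lemma replacement: assumes "D (%e. R (e 0) (e 1))" "!!x. x :. a ==> EX! y. R x y"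
  shows "isset (%y::'a::zf. EX x. x :. a & R x y)"
proof -
  obtain \<phi> p where \<phi>: "!!e. R (e 0) (e 1) = eval (%_. True) (%_. False) \<phi> (mix e p)" using assms by (auto simp: D_def)
  \<comment> \<open>Variables 0 and 1 sit at places 0 and 2 of \<open>mix\<close>, whereas the
    scheme reads argument and value at places 0 and 1.\<close>
  let ?f = "%n. if n = 0 then 0 else if n = 2 then 1 else Suc (Suc n)"
  obtain \<psi> where \<psi>: "!!e::nat => 'a. fo_sat mem \<psi> e = eval (%_. True) (%_. False) \<phi> (%n. e (?f n))"
    using fo_of_fm[of \<phi> ?f] by auto
  let ?e = "%n. mix (%_. a) p (n - 2)"
  have "(%n. (?e(0 := x, 1 := y)) (?f n)) = mix (%n. if n = 0 then x else if n = 1 then y else a) p" for x y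
    by (rule ext) (auto simp: mix_def)
  then have *: "fo_sat mem \<psi> (?e(0 := x, 1 := y)) = R x y" for x y
    using \<phi>[of "%n. if n = 0 then x else if n = 1 then y else a"] by (simp add: \<psi>)
  show ?thesis unfolding isset_def using zf_replacement[of a \<psi> ?e] assms(2) unfolding * by blast
qed

section \<open>Elementary set theory\<close>

lemma isset_empty: "isset (%x. False)"
proof -
  obtain b :: 'a where "ALL x. x :. b <-> x :. undefined & x \<noteq> x" using separation[of "%x. x \<noteq> x" undefined] D_not[OF D_eq0[of 0 0]] by blast
  then show ?thesis by (auto simp: isset_def)
qed

lemma mem_empty [simp]: "~ x :. empty" unfolding empty_def by (simp add: mem_setof isset_empty)
lemma eq_emptyI: "(!!z. ~ z :. x) ==> x = empty" by (rule set_eqI) simp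
lemma ne_emptyD: "x \<noteq> empty ==> EX z. z :. x" using eq_emptyI by blast
lemma empty_sub [simp]: "empty \<^bold>\<subseteq> x" by (simp add: subset_def)

lemma isset_upair: "isset (%x. x = a | x = b)" using zf_pairing[of a b] by (simp add: isset_def)
lemma mem_upair [simp]: "x :. upair a b <-> x = a | x = b"
  unfolding upair_def by (simp add: mem_setof isset_upair)
lemma dt_upair [Di]: "dt s ==> dt t ==> dt (%e. upair (s e) (t e))"
  by (rule dt_app2, unfold upair_def, rule dt_setof, (intro Di)[1], rule isset_upair)

lemma opair_inj [simp]: "opair a b = opair c d <-> a = c & b = d"
proof
  assume h: "opair a b = opair c d"
  have *: "z :. opair a b <-> z = upair a a | z = upair a b" "z :. opair c d <-> z = upair c c | z = upair c d" for z
    by (auto simp: opair_def)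
  have "upair a a = upair c c | upair a a = upair c d" using h * by metis
  then have ac: "a = c" by (metis mem_upair)
  have "upair a b = upair c c | upair a b = upair c d" "upair c d = upair a a | upair c d = upair a b" using h * by metis+
  then have "b = d" using ac by (metis mem_upair)
  then show "a = c & b = d" using ac by simp
qed simp
lemma dt_opair [Di]: "dt s ==> dt t ==> dt (%e. opair (s e) (t e))"
  unfolding opair_def by (intro Di)

lemma isset_union: "isset (%x. EX y. y :. a & x :. y)" using zf_union[of a] by (simp add: isset_def)
lemma mem_union [simp]: "x :. set_union a <-> (EX y. y :. a & x :. y)"
  unfolding set_union_def by (simp add: mem_setof isset_union)
lemma dt_union [Di]: "dt t ==> dt (%e. set_union (t e))"
  by (rule dt_app1, unfold set_union_def, rule dt_setof, (intro Di)[1], rule isset_union)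

lemma isset_diff: "isset (%x. x :. a & ~ x :. b)"
  by (rule isset_sub[of _ a], (intro Di)[1], auto)
lemma mem_diff [simp]: "x :. diff a b <-> x :. a & ~ x :. b"
  unfolding diff_def by (simp add: mem_setof isset_diff)
lemma dt_diff [Di]: "dt s ==> dt t ==> dt (%e. diff (s e) (t e))"
  by (rule dt_app2, unfold diff_def, rule dt_setof, (intro Di)[1], rule isset_diff)

definition un :: "'a::zf => 'a => 'a" where "un a b = set_union (upair a b)"
lemma mem_un [simp]: "x :. un a b <-> x :. a | x :. b" by (auto simp: un_def)
lemma dt_un [Di]: "dt s ==> dt t ==> dt (%e. un (s e) (t e))" unfolding un_def by (intro Di)

lemma isset_adj: "isset (%x. x :. a | x = a)"
  by (rule isset_sub[of _ "un a (upair a a)"], (intro Di)[1], auto)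
lemma mem_adj [simp]: "x :. adjoin_self a <-> x :. a | x = a"
  unfolding adjoin_self_def by (simp add: mem_setof isset_adj)
lemma dt_adj [Di]: "dt t ==> dt (%e. adjoin_self (t e))"
  by (rule dt_app1, unfold adjoin_self_def, rule dt_setof, (intro Di)[1], rule isset_adj)

definition pw :: "'a::zf => 'a" where "pw a = setof (%x. x \<^bold>\<subseteq> a)"
lemma isset_pw: "isset (%x. x \<^bold>\<subseteq> a)" using zf_power[of a] by (simp add: isset_def subset_def)
lemma mem_pw [simp]: "x :. pw a <-> x \<^bold>\<subseteq> a" unfolding pw_def by (simp add: mem_setof isset_pw)
lemma D_sub [Di]: "dt s ==> dt t ==> D (%e. s e \<^bold>\<subseteq> t e)"
  by (rule D_app2, unfold subset_def, (intro Di)[1])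
lemma dt_pw [Di]: "dt t ==> dt (%e. pw (t e))"
  by (rule dt_app1, unfold pw_def, rule dt_setof, (intro Di)[1], rule isset_pw)

lemma foundation: "D (%e. P (e 0)) ==> x :. a ==> P x ==> EX x. x :. a & P x & (ALL y. y :. a & y :. x --> ~ P y)"
proof -
  assume h: "D (%e. P (e 0))" "x :. a" "P x"
  obtain b where b: "ALL x. x :. b <-> x :. a & P x" using separation[OF h(1)] by blast
  then show ?thesis using zf_foundation[of b] h by blast
qed

lemma mem_not_refl [simp]: "~ x :. x"
  using foundation[of "%_. True" x "upair x x"] D_True by fastforce
lemma mem_asym: "x :. y ==> ~ y :. x"
  using foundation[of "%_. True" x "upair x y"] D_True by fastforce

lemma adj_inj: "adjoin_self x = adjoin_self y ==> x = y"
  by (metis mem_adj mem_asym)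

lemma D_trans [Di]: "dt t ==> D (%e. transitive (t e))"
  by (rule D_app1, unfold transitive_def, (intro Di)[1])
lemma transD: "transitive x ==> y :. x ==> z :. y ==> z :. x" by (auto simp: transitive_def subset_def)
lemma transI: "(!!y z. y :. x ==> z :. y ==> z :. x) ==> transitive x" by (auto simp: transitive_def subset_def)

lemma opair_trans: assumes "transitive T" "opair x y :. T" shows "x :. T" "y :. T"
proof -
  have "upair x y :. opair x y" by (simp add: opair_def)
  then have "upair x y :. T" using assms transD by blast
  then show "x :. T" "y :. T" using assms(1) transD[of T "upair x y"] by auto
qed

lemma opair_mem_Un: assumes "opair x y :. f" shows "x :. set_union (set_union f)" "y :. set_union (set_union f)"
proof -
  have "upair x y :. opair x y" by (simp add: opair_def)
  then have "upair x y :. set_union f" using assms by auto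
  then show "x :. set_union (set_union f)" "y :. set_union (set_union f)" by auto
qed

definition prd :: "'a::zf => 'a => 'a" where "prd a b = setof (%p. EX x y. p = opair x y & x :. a & y :. b)"
lemma opair_in_pw: "x :. a ==> y :. b ==> opair x y :. pw (pw (un a b))" by (auto simp: opair_def subset_def)
lemma isset_prd: "isset (%p. EX x y. p = opair x y & x :. a & y :. b)"
  by (rule isset_sub[of _ "pw (pw (un a b))"]) (intro Di | (elim exE conjE, simp add: opair_in_pw del: mem_pw))+
lemma mem_prd: "p :. prd a b <-> (EX x y. p = opair x y & x :. a & y :. b)"
  unfolding prd_def by (simp add: mem_setof isset_prd)
lemma opair_prd [simp]: "opair x y :. prd a b <-> x :. a & y :. b" by (auto simp: mem_prd)
lemma dt_prd [Di]: "dt s ==> dt t ==> dt (%e. prd (s e) (t e))"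
  by (rule dt_app2, unfold prd_def, rule dt_setof, (intro Di)[1], rule isset_prd)

text \<open>A total, definable application: the value is \<open>empty\<close> outside the domain.\<close>

definition ap :: "'a::zf => 'a => 'a" where "ap f x = setof (%z. EX y. opair x y :. f & z :. y)"
lemma isset_ap: "isset (%z. EX y. opair x y :. f & z :. y)"
  by (rule isset_sub[of _ "set_union (set_union (set_union f))"]) (intro Di | (elim exE conjE, auto dest!: opair_mem_Un(2)))+
lemma mem_ap: "z :. ap f x <-> (EX y. opair x y :. f & z :. y)"
  unfolding ap_def by (simp add: mem_setof isset_ap)
lemma dt_ap [Di]: "dt s ==> dt t ==> dt (%e. ap (s e) (t e))"
  by (rule dt_app2, unfold ap_def, rule dt_setof, (intro Di)[1], rule isset_ap)

lemma ap_eqI: "opair x y :. f ==> (!!y'. opair x y' :. f ==> y' = y) ==> ap f x = y"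
  by (rule set_eqI, unfold mem_ap) blast
lemma ap_none: "(!!y. ~ opair x y :. f) ==> ap f x = empty"
  by (rule eq_emptyI) (auto simp: mem_ap)

lemma fun_onD: assumes "fun_on f A" "x :. A" shows "opair x (ap f x) :. f" "opair x y :. f ==> y = ap f x" "app f x = ap f x"
proof -
  have ex: "EX! y. opair x y :. f" using assms by (auto simp: fun_on_def)
  then obtain z where z: "opair x z :. f" "!!y. opair x y :. f ==> y = z" by blast
  have a: "ap f x = z" using z by (rule ap_eqI)
  then show "opair x (ap f x) :. f" "opair x y :. f ==> y = ap f x" using z by blast+
  show "app f x = ap f x" unfolding app_def a by (rule the_equality) (use z in blast)+
qed

lemma fun_on_dom: "fun_on f A ==> opair x y :. f ==> x :. A" by (auto simp: fun_on_def)
lemma fun_on_mem: "fun_on f A ==> opair x y :. f <-> x :. A & y = ap f x"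
  using fun_onD fun_on_dom by metis
lemma fun_on_mem': "fun_on f A ==> p :. f <-> (EX x. x :. A & p = opair x (ap f x))"
proof
  assume h: "fun_on f A" "p :. f"
  then obtain x y where "x :. A" "p = opair x y" unfolding fun_on_def by blast
  then show "EX x. x :. A & p = opair x (ap f x)" using fun_onD(2) h by blast
qed (use fun_onD(1) in blast)
lemma fun_on_ext: assumes "fun_on f A" "fun_on g A" "!!x. x :. A ==> ap f x = ap g x" shows "f = g"
  by (rule set_eqI, unfold fun_on_mem'[OF assms(1)] fun_on_mem'[OF assms(2)]) (use assms(3) in metis)
lemma D_fun_on [Di]: "dt s ==> dt t ==> D (%e. fun_on (s e) (t e))"
  by (rule D_app2, unfold fun_on_def Ex1_def, (intro Di)[1])

definition lam :: "'a::zf => ('a => 'a) => 'a" where "lam A F = setof (%p. EX x. x :. A & p = opair x (F x))"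

lemma isset_image: "dt (%e. F (e 0)) ==> isset (%y. EX x. x :. A & y = F x)"
  by (rule replacement, rule D_app2[of "%x y. y = F x" "%e. e 0" "%e. e 1"])
    (use D_ren[of "%e. e 0 = F (e (Suc 0))" "%n. 1 - n"] in \<open>auto simp: dt_def dt_var intro: D_eq0\<close>)

lemma lam_props: assumes "dt (%e. F (e 0))"
  shows mem_lam: "p :. lam A F <-> (EX x. x :. A & p = opair x (F x))" and fun_on_lam: "fun_on (lam A F) A"
    and ap_lam: "x :. A ==> ap (lam A F) x = F x"
proof -
  have *: "p :. lam A F <-> (EX x. x :. A & p = opair x (F x))" for p
    unfolding lam_def using isset_image[of "%x. opair x (F x)" A] assms by (simp add: mem_setof dt_opair dt_var)
  then show "p :. lam A F <-> (EX x. x :. A & p = opair x (F x))" .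
  show "fun_on (lam A F) A" by (auto simp: fun_on_def *)
  then show "x :. A ==> ap (lam A F) x = F x" using fun_onD(2) * by fastforce
qed

definition sep :: "'a::zf => ('a => bool) => 'a" where "sep a P = setof (%x. x :. a & P x)"
lemma mem_sep: "D (%e. P (e 0)) ==> x :. sep a P <-> x :. a & P x"
  unfolding sep_def by (subst mem_setof, rule isset_sub[of _ a], rule D_and[OF D_mem[OF dt_var dt_const]]) auto

definition img :: "'a::zf => ('a => 'a) => 'a" where "img a F = setof (%y. EX x. x :. a & y = F x)"
lemma mem_img: "dt (%e. F (e 0)) ==> y :. img a F <-> (EX x. x :. a & y = F x)"
  unfolding img_def by (simp add: mem_setof isset_image)

lemma big_union_img: "big_union a F = set_union (img a F)" if "dt (%e. F (e 0))"
proof -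
  have "(%w. EX z. z :. a & w :. F z) = (%w. EX y. y :. img a F & w :. y)" using mem_img[OF that] by auto
  then show ?thesis unfolding big_union_def by (simp add: set_union_def)
qed
lemma mem_big_union: "dt (%e. F (e 0)) ==> w :. big_union a F <-> (EX z. z :. a & w :. F z)"
  using big_union_img mem_img by fastforce

section \<open>Natural numbers, recursion and ordinals\<close>

lemma D_is_inductive [Di]: "dt t ==> D (%e. is_inductive (t e))"
  by (rule D_app1, unfold is_inductive_def, (intro Di)[1])

lemma ex_inductive: "EX I. is_inductive (I::'a::zf)"
proof -
  obtain I e :: 'a where I: "e :. I" "ALL w. ~ w :. e"
    "ALL x. x :. I --> (EX y. y :. I & (ALL w. w :. y <-> w :. x | w = x))" using zf_infinity by metis
  have "e = empty" by (rule eq_emptyI) (use I(2) in blast)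
  moreover have "adjoin_self x :. I" if xI: "x :. I" for x
  proof -
    obtain y where y: "y :. I" "ALL w. w :. y <-> w :. x | w = x" using I(3)[rule_format, OF xI] by metis
    have "y = adjoin_self x" by (rule set_eqI, unfold mem_adj) (use y(2) in blast)
    then show ?thesis using y(1) by blast
  qed
  ultimately show ?thesis using I(1) by (auto simp: is_inductive_def)
qed

lemma mem_omega: "x :. omega <-> (ALL I. is_inductive I --> x :. I)"
proof -
  obtain I :: 'a where I: "is_inductive I" using ex_inductive by blast
  have "isset (%x::'a. ALL I. is_inductive I --> x :. I)"
    by (rule isset_sub[of _ I], (intro Di)[1]) (use I in blast)
  then show ?thesis unfolding omega_def by (rule mem_setof)
qed

lemma empty_omega [simp]: "empty :. omega" by (auto simp: mem_omega is_inductive_def)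
lemma adj_omega [simp]: "n :. omega ==> adjoin_self n :. omega" by (auto simp: mem_omega is_inductive_def)

lemma omega_induct: assumes "n :. omega" "D (%e. P (e 0))" "P empty" "!!n. n :. omega ==> P n ==> P (adjoin_self n)" shows "P n"
proof -
  have "is_inductive (sep omega P)" using assms by (simp add: is_inductive_def mem_sep)
  then have "n :. sep omega P" using assms(1) mem_omega by blast
  then show ?thesis using assms(2) by (simp add: mem_sep)
qed

lemma trans_omega: "transitive omega"
proof (rule transI)
  fix n m :: 'a assume "n :. omega" "m :. n"
  have "n \<^bold>\<subseteq> omega" using \<open>n :. omega\<close>
    by (rule omega_induct) ((intro Di)[1], auto simp: subset_def)
  then show "m :. omega" using \<open>m :. n\<close> subD by blast
qed

lemma trans_nat: "n :. omega ==> transitive n"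
  by (rule omega_induct[of n], assumption, (intro Di)[1]) (auto intro!: transI dest: transD)

lemma omega_cases: "n :. omega ==> n = empty | (EX m. m :. omega & n = adjoin_self m)"
  by (rule omega_induct[of n], assumption, (intro Di)[1]) auto

text \<open>Foundation excludes further elements: a least one outside \<open>omega\<close> would be
  neither zero nor a successor. The premises quantify over elements of \<open>x\<close> only, which
  later makes being \<open>omega\<close> a bounded condition.\<close>

lemma omega_eq: assumes "empty :. x" "!!n. n :. x ==> adjoin_self n :. x" "!!n. n :. x ==> n = empty | (EX m. m :. x & n = adjoin_self m)"
  shows "x = omega"
proof (rule sub_antisym)
  show "omega \<^bold>\<subseteq> x" using assms(1,2) by (auto simp: subset_def mem_omega is_inductive_def)
  show "x \<^bold>\<subseteq> omega"
  proof (rule subI, rule ccontr)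
    fix n assume n: "n :. x" "~ n :. omega"
    obtain n where n: "n :. x" "~ n :. omega" "ALL y. y :. x & y :. n --> y :. omega"
      using foundation[of "%n. ~ n :. omega", OF D_not[OF D_mem[OF dt_var dt_const]] n] by auto
    then show False using assms(3)[OF n(1)] by auto
  qed
qed

lemma std_omega [simp]: "std_num n :. omega" by (induction n) auto
lemma std_mem: "std_num m :. std_num n <-> m < n"
proof -
  have "x :. std_num n <-> (\<exists>m<n. x = std_num m)" for n and x :: 'a
    by (induction n) (auto simp: less_Suc_eq)
  then have 1: "m < n ==> std_num m :. (std_num n :: 'a)" for m n by blast
  then show ?thesis by (metis linorder_neqE_nat mem_asym mem_not_refl)
qed
lemma std_inj [simp]: "std_num m = std_num n <-> m = n"
  using std_mem by (metis linorder_neqE_nat mem_not_refl)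
lemma std_inj0 [simp]: "empty = std_num n <-> n = 0" "std_num n = empty <-> n = 0"
  using std_inj[of 0 n] std_inj[of n 0] by simp_all

section \<open>Recursion on the membership relation\<close>

definition approx :: "('a::zf => ('a => 'a) => 'a) => 'a => 'a => bool" where
  "approx G f T <-> transitive T & fun_on f T & (ALL x. x :. T --> ap f x = G x (ap f))"

text \<open>The value at \<open>x\<close> may use \<open>F\<close> on any transitive set that
  includes \<open>x\<close>, not only on elements of \<open>x\<close>: recursions on codes look up
  components that lie deep inside nested pairs.\<close>

definition loc :: "('a::zf => ('a => 'a) => 'a) => bool" where
  "loc G <-> (ALL x F F' S. transitive S & x \<^bold>\<subseteq> S & (ALL z. z :. S --> F z = F' z) --> G x F = G x F')"

lemma approxI: "transitive T ==> fun_on f T ==> (!!x. x :. T ==> ap f x = G x (ap f)) ==> approx G f T"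
  by (simp add: approx_def)
lemma approxD: "approx G f T ==> x :. T ==> ap f x = G x (ap f)" by (simp add: approx_def)

lemma approx_agree: assumes "loc G" "approx G f T" "approx G f' T'" "x :. T" "x :. T'" shows "ap f x = ap f' x"
proof -
  \<comment> \<open>Agreement at single points is too weak as an induction hypothesis, because
    \<open>loc\<close> asks for agreement on a transitive set.\<close>
  let ?P = "%z. EX S. transitive S & z :. S & S \<^bold>\<subseteq> T & S \<^bold>\<subseteq> T' & (ALL w. w :. S --> ap f w = ap f' w)"
  have Dp: "D (%e. ?P (e 0))" by (intro Di)
  have tr: "transitive T" "transitive T'" using assms by (auto simp: approx_def)
  have "?P x"
  proof (rule ccontr)
    assume "~ ?P x"
    then obtain x where x: "x :. T & x :. T'" "~ ?P x" "ALL y. y :. T & y :. x --> y :. T' --> ?P y"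
      using foundation[of "%x. x :. T' & ~ ?P x" x T] D_and[OF D_mem[OF dt_var dt_const] D_not[OF Dp]] assms(4,5) by blast
    let ?S = "sep T ?P"
    have S: "z :. ?S <-> z :. T & ?P z" for z by (rule mem_sep[OF Dp])
    have trS: "transitive ?S"
    proof (rule transI)
      fix y z assume y: "y :. ?S" "z :. y"
      then obtain S where "transitive S" "y :. S" "S \<^bold>\<subseteq> T" "S \<^bold>\<subseteq> T'" "ALL w. w :. S --> ap f w = ap f' w" using S by blast
      moreover then have "z :. S" using transD y(2) by blast
      ultimately show "z :. ?S" unfolding S using subD by blast
    qed
    have eq: "ap f w = ap f' w" if "w :. ?S" for w using that S by blast
    have xS: "x \<^bold>\<subseteq> ?S"
    proof (rule subI)
      fix y assume "y :. x"
      then have "y :. T" "y :. T'" using x(1) tr transD by blast+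
      then show "y :. ?S" unfolding S using x(3) \<open>y :. x\<close> by simp
    qed
    have "G x (ap f) = G x (ap f')" using assms(1) trS xS eq unfolding loc_def by blast
    then have fx: "ap f x = ap f' x" using x(1) assms(2,3) by (auto simp: approx_def)
    let ?S' = "un ?S (upair x x)"
    have "transitive ?S'" using trS xS by (auto intro!: transI dest: transD subD)
    moreover have "x :. ?S'" "?S' \<^bold>\<subseteq> T" "?S' \<^bold>\<subseteq> T'" using S x(1) by (auto simp: subset_def)
    ultimately have "?P x" using eq fx by (intro exI[of _ ?S']) auto
    then show False using x(2) by simp
  qed
  then show ?thesis by blast
qed

lemma D_approx: assumes "D (%e. e 0 = G (e 1) (e 2) (ap (e 3)))" "dt p" "dt f" "dt T"
  shows "D (%e. approx (G (p e)) (f e) (T e))"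
proof (rule D_app3[of "%p f T. approx (G p) f T", OF _ assms(2,3,4)])
  have *: "D (%e. e i = G (e j) (e k) (ap (e l)))" for i j k l
    using D_ren[OF assms(1), of "%n. if n = 0 then i else if n = 1 then j else if n = 2 then k else l"] by simp
  have "D (%e. ap (e 2) (e 0) = G (e 1) (e 0) (ap (e 2)))"
    by (rule D_subst[of "%x e. x = G (e 1) (e 0) (ap (e 2))"], rule *) (intro Di)
  then have "D (%e. ALL x. x :. e 2 --> ap (e 1) x = G (e 0) x (ap (e 1)))"
    by (intro D_all D_imp[OF D_mem[OF dt_var dt_var]]) (simp add: numeral_2_eq_2)
  then show "D (%e. approx (G (e 0)) (e 1) (e 2))"
    unfolding approx_def by (intro D_and[OF D_trans[OF dt_var] D_and[OF D_fun_on[OF dt_var dt_var]]])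
qed

lemma ex1_opair: "EX! y. R y ==> EX! p. EX y. p = opair z y & R y" by (metis opair_inj)

text \<open>Approximations agree where both are defined, so they glue to one approximation
  \<open>g\<close> on the set \<open>S\<close> of all points of \<open>T\<close> that some
  approximation reaches. A least point outside \<open>S\<close> has its elements in
  \<open>S\<close>, and adding the value that \<open>G\<close> prescribes there reaches it.\<close>

lemma approx_exists: assumes "loc G" "D (%e. e 0 = G (e 1) (ap (e 2)))" "transitive T" shows "EX f. approx G f T"
proof -
  have Da: "dt f ==> dt T ==> D (%e. approx G (f e) (T e))" for f T
    using D_approx[of "%_. G" "%e. empty" f T] D_ren[OF assms(2), of "%n. if n = 0 then 0 else Suc n"]
    by (simp add: dt_const numeral_2_eq_2 numeral_3_eq_3)
  let ?P = "%z. EX f T. approx G f T & z :. T"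
  have Dp: "D (%e. ?P (e 0))" by (intro D_ex D_and Da D_mem dt_var)
  define S where "S = sep T ?P"
  have Sm: "z :. S <-> z :. T & ?P z" for z unfolding S_def by (rule mem_sep[OF Dp])
  have trS: "transitive S"
  proof (rule transI)
    fix y z assume h: "y :. S" "z :. y"
    then obtain f T' where f: "approx G f T'" "y :. T'" "y :. T" using Sm by blast
    then have "z :. T'" "z :. T" using h(2) transD assms(3) unfolding approx_def by blast+
    then show "z :. S" unfolding Sm using f(1) by blast
  qed
  let ?R = "%z y. EX f T. approx G f T & z :. T & y = ap f z"
  have R1: "EX! y. ?R z y" if "z :. S" for z
  proof -
    obtain f T' where f: "approx G f T'" "z :. T'" using Sm \<open>z :. S\<close> by blast
    show ?thesis
    proof (rule ex1I[of _ "ap f z"])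
      show "?R z (ap f z)" using f by blast
      fix y assume "?R z y" then show "y = ap f z" using approx_agree[OF assms(1)] f by blast
    qed
  qed
  have DR: "D (%e. ?R (e 0) (e 1))" by (intro D_ex D_and Da Di)
  define g where "g = setof (%p. EX z. z :. S & (EX y. p = opair z y & ?R z y))"
  have "isset (%p. EX z. z :. S & (EX y. p = opair z y & ?R z y))"
  proof (rule replacement[of "%z p. EX y. p = opair z y & ?R z y"], (intro D_ex D_and Da Di)[1])
    fix z assume "z :. S"
    then show "EX! p. EX y. p = opair z y & ?R z y" by (rule ex1_opair[OF R1])
  qed
  then have gm: "p :. g <-> (EX z y. z :. S & p = opair z y & ?R z y)" for p unfolding g_def by (subst mem_setof) auto
  have g': "opair x y :. g <-> x :. S & ?R x y" for x y unfolding gm by simp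
  have fg: "fun_on g S" unfolding fun_on_def
  proof (intro conjI allI impI)
    show "EX x y. x :. S & p = opair x y" if "p :. g" for p using that gm by blast
    fix x assume x: "x :. S" then have "(%y. opair x y :. g) = ?R x" using g' by simp
    then show "EX! y. opair x y :. g" using R1[OF x] by simp
  qed
  have apg: "ap g z = ap f z" if "approx G f T'" "z :. T'" "z :. T" for f T' z
  proof -
    have "z :. S" using Sm that by blast
    then have "opair z (ap f z) :. g" using gm that by blast
    then show ?thesis using fun_onD(2)[OF fg \<open>z :. S\<close>] by simp
  qed
  have ag: "approx G g S"
  proof (rule approxI[OF trS fg])
    fix z assume "z :. S"
    then obtain f T' where f: "approx G f T'" "z :. T'" "z :. T" using Sm by blast
    let ?I = "diff T (diff T T')"
    have trT': "transitive T'" using f(1) by (simp add: approx_def)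
    then have "transitive ?I" using assms(3) by (auto intro!: transI dest: transD)
    moreover have "z \<^bold>\<subseteq> ?I" using trT' assms(3) f by (auto intro!: subI dest: transD)
    moreover have "ap g w = ap f w" if "w :. ?I" for w using that apg[OF f(1)] by simp
    ultimately have "G z (ap g) = G z (ap f)" using assms(1) unfolding loc_def by blast
    then show "ap g z = G z (ap g)" using apg[OF f] approxD[OF f(1,2)] by simp
  qed
  have all: "z :. S" if "z :. T" for z
  proof (rule ccontr)
    assume "~ z :. S"
    then obtain z where z: "z :. T" "~ ?P z" "ALL y. y :. T & y :. z --> ?P y"
      using foundation[of "%z. ~ ?P z" z T] D_not[OF Dp] Sm \<open>z :. T\<close> by blast
    have zS: "z \<^bold>\<subseteq> S" by (rule subI, subst Sm) (use z(3) transD[OF assms(3) z(1)] in simp)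
    define v T' h where "v = G z (ap g)" and "T' = un S (upair z z)" and "h = un g (upair (opair z v) (opair z v))"
    have [simp]: "x :. T' <-> x :. S | x = z" "x :. h <-> x :. g | x = opair z v" for x by (auto simp: T'_def h_def)
    have nz: "~ z :. S" using z Sm by blast
    then have nz': "~ opair z y :. g" for y using gm by auto
    have ga: "opair x y :. g ==> x :. S" for x y using gm by auto
    have fh: "fun_on h T'" unfolding fun_on_def
    proof (intro conjI allI impI)
      show "EX x y. x :. T' & p = opair x y" if "p :. h" for p using that gm by auto
      fix x assume x: "x :. T'"
      show "EX! y. opair x y :. h"
      proof (cases "x = z")
        case True then show ?thesis using nz' by auto
      next
        case False then have "x :. S" using x by simp
        then have "EX! y. opair x y :. g" using fg by (auto simp: fun_on_def)
        then show ?thesis using False by simp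
      qed
    qed
    have hg: "ap h w = ap g w" if "w :. S" for w
    proof -
      have "w \<noteq> z" using nz that by blast
      then show ?thesis by (auto intro!: set_eqI simp: mem_ap)
    qed
    have hz: "ap h z = v" by (rule ap_eqI) (use nz' in auto)
    have trT: "transitive T'" using trS zS by (auto intro!: transI dest: transD subD)
    have "approx G h T'"
    proof (rule approxI[OF trT fh])
      fix x assume x: "x :. T'"
      have "G x (ap h) = G x (ap g)"
      proof -
        have "x \<^bold>\<subseteq> S" using x zS transD[OF trS] by (auto intro: subI)
        then show ?thesis using assms(1) trS hg unfolding loc_def by blast
      qed
      then show "ap h x = G x (ap h)" using x hz hg approxD[OF ag] v_def by auto
    qed
    then have "?P z" by (intro exI[of _ h] exI[of _ T']) simp
    then show False using z by simp
  qed
  have "S = T" by (rule set_eqI) (use all Sm in blast)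
  then show ?thesis using ag by metis
qed

text \<open>The recursion runs along \<open>omega\<close>, which is already known to be transitive.
  General recursion needs a transitive domain around each argument, and this lemma supplies
  it.\<close>

lemma ex_trans: "EX T. transitive T & (a::'a::zf) :. T"
proof -
  define G :: "'a => ('a => 'a) => 'a" where "G n F = setof (%z. z = a | (EX m. m :. n & (EX y. y :. F m & z :. y)))" for n F
  have loc: "loc G" unfolding loc_def
  proof (intro allI impI)
    fix n S :: 'a and F F' :: "'a => 'a" assume h: "transitive S & n \<^bold>\<subseteq> S & (ALL z. z :. S --> F z = F' z)"
    then have "(%z. z = a | (EX m. m :. n & (EX y. y :. F m & z :. y))) = (%z. z = a | (EX m. m :. n & (EX y. y :. F' m & z :. y)))"
      using subD by metis
    then show "G n F = G n F'" by (simp add: G_def)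
  qed
  have ist: "isset (%z. z = a | (EX m. m :. n & (EX y. y :. ap f m & z :. y)))" for n f
    by (rule isset_sub[of _ "un (upair a a) (set_union (set_union (img n (ap f))))"], (intro Di)[1])
      (auto simp: mem_img dt_ap dt_const dt_var)
  have "dt (%e. G (e 0) (ap (e 1)))" unfolding G_def by (rule dt_setof[OF _ ist]) (intro Di)
  then have "D (%e. e 0 = G (e 1) (ap (e 2)))" by (simp add: dt_def numeral_2_eq_2)
  then obtain f where f: "approx G f omega" using approx_exists[OF loc _ trans_omega] by blast
  have mf: "z :. ap f n <-> z = a | (EX m. m :. n & (EX y. y :. ap f m & z :. y))" if "n :. omega" for n z
  proof -
    have "ap f n = G n (ap f)" using f that by (simp add: approx_def)
    then show ?thesis using mem_setof[OF ist] by (simp add: G_def)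
  qed
  define T where "T = set_union (img omega (ap f))"
  have T: "z :. T <-> (EX n. n :. omega & z :. ap f n)" for z by (auto simp: T_def mem_img dt_ap dt_const dt_var)
  have "transitive T"
  proof (rule transI)
    fix y z assume "y :. T" "z :. y"
    then obtain n where n: "n :. omega" "y :. ap f n" using T by blast
    then have "z :. ap f (adjoin_self n)" using mf[of "adjoin_self n"] \<open>z :. y\<close> by auto
    then show "z :. T" using T n(1) adj_omega by blast
  qed
  moreover have "a :. T" using T mf[of empty] empty_omega by blast
  ultimately show ?thesis by blast
qed

lemma mem_induct: assumes "D (%e. P (e 0))" "!!x. (!!y. y :. x ==> P y) ==> P x" shows "P x"
proof (rule ccontr)
  assume "~ P x"
  obtain T where T: "transitive T" "x :. T" using ex_trans by blast
  then obtain x where "x :. T" "~ P x" "ALL y. y :. T & y :. x --> ~ ~ P y"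
    using foundation[of "%x. ~ P x", OF D_not[OF assms(1)]] \<open>~ P x\<close> by blast
  then show False using assms(2) T transD by blast
qed

definition recr :: "('a::zf => ('a => 'a) => 'a) => 'a => 'a" where
  "recr G x = (THE y. EX f T. approx G f T & x :. T & y = ap f x)"

lemma recr_eq: assumes "loc G" "approx G f T" "x :. T" shows "recr G x = ap f x"
  unfolding recr_def by (rule the_equality) (use assms approx_agree[OF assms(1)] in blast)+

lemma recr_iff: assumes "loc G" "D (%e. e 0 = G (e 1) (ap (e 2)))"
  shows "y = recr G x <-> (EX f T. approx G f T & x :. T & y = ap f x)"
proof -
  obtain T where T: "transitive T" "x :. T" using ex_trans by blast
  obtain f where "approx G f T" using approx_exists[OF assms T(1)] by blast
  then show ?thesis using recr_eq[OF assms(1)] T(2) by metis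
qed

lemma recr_unfold: assumes "loc G" "D (%e. e 0 = G (e 1) (ap (e 2)))" shows "recr G x = G x (recr G)"
proof -
  obtain T where T: "transitive T" "x :. T" using ex_trans by blast
  obtain f where f: "approx G f T" using approx_exists[OF assms T(1)] by blast
  have "x \<^bold>\<subseteq> T" using T transD by (metis subI)
  then have "G x (ap f) = G x (recr G)" using assms(1) recr_eq[OF assms(1) f] T(1) unfolding loc_def by metis
  then show ?thesis using recr_eq[OF assms(1) f T(2)] f T(2) by (simp add: approx_def)
qed

text \<open>The parameter stays an argument of \<open>G\<close>, so that a function of two variables
  defined by recursion on one of them is definable in both.\<close>

lemma dt_recr: assumes "!!p. loc (G p)" "D (%e. e 0 = G (e 1) (e 2) (ap (e 3)))" "dt s" "dt t"
  shows "dt (%e. recr (G (s e)) (t e))"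
proof (rule dt_app2[of "%p x. recr (G p) x", OF _ assms(3,4)])
  have "D (%e. e 0 = G p (e 1) (ap (e 2)))" for p
    by (rule D_subst[of "%x e. e 0 = G x (e 1) (ap (e 2))", OF _ dt_const])
      (use D_ren[OF assms(2), of "%n. if n = 0 then 1 else if n = 1 then 0 else n"] in \<open>simp add: numeral_2_eq_2 numeral_3_eq_3\<close>)
  then have *: "y = recr (G p) x <-> (EX f T. approx (G p) f T & x :. T & y = ap f x)" for p x y
    using recr_iff[OF assms(1)] by blast
  show "dt (%e. recr (G (e 0)) (e 1))" unfolding dt_def *
    by (intro D_ex D_and D_approx[OF assms(2)] Di)
qed

section \<open>Ordinals\<close>

lemma D_Ord [Di]: "dt t ==> D (%e. Ord (t e))" by (rule D_app1, unfold Ord_def, (intro Di)[1])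
lemma D_Limit [Di]: "dt t ==> D (%e. Limit (t e))" by (rule D_app1, unfold Limit_def, (intro Di)[1])

lemma Ord_mem: "Ord x ==> y :. x ==> Ord y" unfolding Ord_def using transD by blast
lemma Ord_trans: "Ord x ==> y :. x ==> z :. y ==> z :. x" unfolding Ord_def using transD by blast
lemma Ord_empty [simp]: "Ord empty" by (simp add: Ord_def transitive_def)
lemma Ord_adj [simp]: "Ord x ==> Ord (adjoin_self x)"
  unfolding Ord_def by (auto intro!: transI dest: transD)

lemma ord_induct: assumes "Ord x" "D (%e. P (e 0))" "!!x. Ord x ==> (!!y. y :. x ==> P y) ==> P x" shows "P x"
proof -
  have "Ord x --> P x"
  proof (rule mem_induct[of "%x. Ord x --> P x"])
    show "D (%e. Ord (e 0) --> P (e 0))" by (rule D_imp[OF D_Ord[OF dt_var] assms(2)])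
    show "!!x. (!!y. y :. x ==> Ord y --> P y) ==> Ord x --> P x" using assms(3) Ord_mem by blast
  qed
  then show ?thesis using assms(1) by blast
qed

lemma Ord_linear: assumes "Ord x" "Ord y" shows "x :. y | x = y | y :. x"
proof -
  have "ALL y. Ord y --> x :. y | x = y | y :. x" using assms(1)
  proof (rule ord_induct)
    show "D (%e. ALL y. Ord y --> e 0 :. y | e 0 = y | y :. e 0)" by (intro Di)
    fix x assume x: "Ord x" "!!z. z :. x ==> ALL y. Ord y --> z :. y | z = y | y :. z"
    have "x :. y | x = y | y :. x" if "Ord y" for y using that
    proof (rule ord_induct[of y "%y. x :. y | x = y | y :. x"])
      show "D (%e. x :. e 0 | x = e 0 | e 0 :. x)" by (intro Di)
      fix y assume y: "Ord y" "!!z. z :. y ==> x :. z | x = z | z :. x"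
      show "x :. y | x = y | y :. x"
      proof (rule ccontr)
        assume n: "~ (x :. y | x = y | y :. x)"
        have "z :. x <-> z :. y" for z using n x y Ord_trans by metis
        then have "x = y" by (rule set_eqI)
        then show False using n by simp
      qed
    qed
    then show "ALL y. Ord y --> x :. y | x = y | y :. x" by blast
  qed
  then show ?thesis using assms(2) by blast
qed

lemma Ord_cases: assumes "Ord x" shows "x = empty | Limit x | (EX y. y :. x & Ord y & x = adjoin_self y)"
proof (rule ccontr)
  assume n: "~ ?thesis"
  then obtain y where y: "y :. x" "~ adjoin_self y :. x" using assms by (auto simp: Limit_def)
  then have "Ord y" using assms Ord_mem by blast
  then show False using Ord_linear[of "adjoin_self y" x] y n assms mem_asym by auto
qed

lemma Limit_not_adj: "~ Limit (adjoin_self x)" unfolding Limit_def by (metis mem_adj mem_not_refl)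
lemma union_adj: "transitive x ==> set_union (adjoin_self x) = x" by (rule set_eqI) (auto dest: transD)
lemma adj_ne_empty [simp]: "adjoin_self x \<noteq> empty" using mem_adj mem_empty by metis

lemma least_ord: assumes "Ord x" "P x" "D (%e. P (e 0))" shows "EX x. Ord x & P x & (ALL y. y :. x --> ~ P y)"
proof (rule ccontr)
  assume n: "~ ?thesis"
  have "~ P x" using assms(1)
  proof (rule ord_induct)
    show "D (%e. ~ P (e 0))" by (rule D_not[OF assms(3)])
    show "~ P x" if "Ord x" "!!y. y :. x ==> ~ P y" for x using n that by metis
  qed
  then show False using assms(2) by simp
qed

text \<open>The Burali-Forti argument; it is the source of the contradiction in
  \<open>astar_ex\<close>.\<close>

lemma no_set_of_ords: "EX x. Ord x & ~ x :. a"
proof (rule ccontr)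
  assume n: "~ ?thesis"
  have s: "x :. sep a Ord <-> Ord x" for x using n by (auto simp: mem_sep[OF D_Ord[OF dt_var]])
  have "Ord (sep a Ord)"
  proof (rule Ord_def[THEN iffD2], intro conjI)
    show "transitive (sep a Ord)" by (rule transI) (metis s Ord_mem)
    show "ALL y. y :. sep a Ord --> transitive y" using s by (simp add: Ord_def)
  qed
  then show False using s mem_not_refl by blast
qed

lemma Ord_sub: "Ord x ==> Ord y ==> x \<^bold>\<subseteq> y <-> x :. y | x = y"
  using Ord_linear Ord_trans unfolding subset_def by (metis mem_not_refl)

lemma Ord_nat: "n :. omega ==> Ord n"
  by (rule omega_induct[of n], assumption, (intro Di)[1]) auto
lemma Ord_omega: "Ord omega" using trans_omega Ord_nat by (auto simp: Ord_def)
lemma Limit_omega: "Limit omega" using Ord_omega by (auto simp: Limit_def dest: ne_emptyD) (metis empty_omega mem_empty)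
lemma Limit_omega_sub: assumes "Limit x" shows "omega :. x | omega = x"
proof -
  have e: "empty :. x" using assms Ord_linear[of empty x] by (auto simp: Limit_def)
  have "n :. x" if "n :. omega" for n using that
    by (rule omega_induct[of n]) ((intro Di)[1], use e assms in \<open>auto simp: Limit_def\<close>)
  then show ?thesis using Ord_sub[OF Ord_omega, of x] assms by (simp add: Limit_def subset_def)
qed

section \<open>Bounded formulas and rudimentary functions\<close>

text \<open>Bounded formulas. Their evaluation \<open>bev\<close> takes membership and equality as
  arguments, because it is also used in structures of codes, where equality is having the same
  elements.\<close>

datatype bf = bMem nat nat | bEq nat nat | bNeg bf | bAnd bf bf | bEx nat bf

primrec bev :: "('a => 'a => bool) => ('a => 'a => bool) => bf => (nat => 'a) => bool" where
  "bev E Q (bMem i j) e = E (e i) (e j)"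
| "bev E Q (bEq i j) e = Q (e i) (e j)"
| "bev E Q (bNeg \<phi>) e = (~ bev E Q \<phi> e)"
| "bev E Q (bAnd \<phi> \<psi>) e = (bev E Q \<phi> e & bev E Q \<psi> e)"
| "bev E Q (bEx i \<phi>) e = (EX x. E x (e i) & bev E Q \<phi> (case_nat x e))"

primrec bren :: "bf => (nat => nat) => bf" where
  "bren (bMem i j) f = bMem (f i) (f j)"
| "bren (bEq i j) f = bEq (f i) (f j)"
| "bren (bNeg \<phi>) f = bNeg (bren \<phi> f)"
| "bren (bAnd \<phi> \<psi>) f = bAnd (bren \<phi> f) (bren \<psi> f)"
| "bren (bEx i \<phi>) f = bEx (f i) (bren \<phi> (case_nat 0 (%n. Suc (f n))))"

lemma bev_bren: "bev E Q (bren \<phi> f) e = bev E Q \<phi> (%n. e (f n))"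
  by (induction \<phi> arbitrary: f e) (simp_all add: case_nat_ren)

primrec fmb :: "bf => fm" where
  "fmb (bMem i j) = mMem i j"
| "fmb (bEq i j) = mEq i j"
| "fmb (bNeg \<phi>) = mNeg (fmb \<phi>)"
| "fmb (bAnd \<phi> \<psi>) = mAnd (fmb \<phi>) (fmb \<psi>)"
| "fmb (bEx i \<phi>) = mEx (mAnd (mMem 0 (Suc i)) (fmb \<phi>))"

lemma eval_fmb: assumes "!!x y. B y ==> x :. y ==> B x" shows "ALL n. B (e n) ==> eval B A (fmb \<phi>) e = bev mem (=) \<phi> e"
proof (induction \<phi> arbitrary: e)
  case (bEx i \<phi>)
  have "ALL n. B (case_nat x e n)" if "x :. e i" for x using bEx.prems assms[of "e i" x] that by (auto split: nat.split)
  then have *: "x :. e i ==> eval B A (fmb \<phi>) (case_nat x e) = bev mem (=) \<phi> (case_nat x e)" for x using bEx.IH by blast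
  have "B x" if "x :. e i" for x using bEx.prems assms[of "e i" x] that by blast
  then show ?case using * by (simp only: fmb.simps eval.simps bev.simps) auto
qed auto

text \<open>In contrast to \<open>D\<close> there are no parameters: the formula must be one that
  can be read in two structures related by an embedding.\<close>

definition d0 :: "((nat => 'a::zf) => bool) => bool" where
  "d0 P <-> (EX \<phi>. ALL e. P e = bev mem (=) \<phi> e)"

lemma d0_ren: "d0 P ==> d0 (%e. P (%n. e (f n)))"
  unfolding d0_def by (metis bev_bren)

named_theorems Bi

lemma d0_not [Bi]: "d0 P ==> d0 (%e. ~ P e)" unfolding d0_def by (metis bev.simps(3))
lemma d0_and [Bi]: "d0 P ==> d0 Q ==> d0 (%e. P e & Q e)" unfolding d0_def by (metis bev.simps(4))
lemma d0_or [Bi]: assumes "d0 P" "d0 Q" shows "d0 (%e. P e | Q e)"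
proof -
  have "d0 (%e. ~ (~ P e & ~ Q e))" by (rule d0_not[OF d0_and[OF d0_not[OF assms(1)] d0_not[OF assms(2)]]])
  then show ?thesis by simp
qed
lemma d0_imp [Bi]: assumes "d0 P" "d0 Q" shows "d0 (%e. P e --> Q e)"
  unfolding imp_conv_disj by (rule d0_or[OF d0_not[OF assms(1)] assms(2)])
lemma d0_iff [Bi]: assumes "d0 P" "d0 Q" shows "d0 (%e. P e = Q e)"
  unfolding iff_conv_conj_imp by (rule d0_and[OF d0_imp[OF assms] d0_imp[OF assms(2,1)]])
lemma d0_eq0: "d0 (%e. e i = e j)" unfolding d0_def by (rule exI[of _ "bEq i j"]) simp
lemma d0_True [Bi]: "d0 (%e. True)" using d0_eq0[of 0 0] by simp
lemma d0_False [Bi]: "d0 (%e. False)" using d0_not[OF d0_True] by simp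
lemma d0_bex0: assumes "d0 (%e. Q (e 0) (%n. e (Suc n)))" shows "d0 (%e. EX x. x :. e i & Q x e)"
proof -
  obtain \<phi> where \<phi>: "!!e. Q (e 0) (%n. e (Suc n)) = bev mem (=) \<phi> e" using assms by (auto simp: d0_def)
  show ?thesis unfolding d0_def by (rule exI[of _ "bEx i \<phi>"]) (simp add: \<phi>[symmetric])
qed

lemma d0_D: assumes "d0 P" shows "D P"
proof -
  obtain \<phi> where \<phi>: "!!e. P e = bev mem (=) \<phi> e" using assms by (auto simp: d0_def)
  have "P e = eval (%_. True) (%_. False) (ren (fmb \<phi>) (%n. 2 * n)) (mix e e)" for e
    using eval_fmb[of "%_. True" e "%_. False" \<phi>] by (simp add: eval_ren \<phi>)
  moreover have "eval (%_. True) (%_. False) (ren (fmb \<phi>) (%n. 2 * n)) (mix e p) = eval (%_. True) (%_. False) (ren (fmb \<phi>) (%n. 2 * n)) (mix e e)" for e p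
    by (simp add: eval_ren)
  ultimately show ?thesis unfolding D_def by blast
qed

text \<open>All variables from index \<open>k\<close> on are frozen at the values \<open>e0\<close>
  and become parameters.\<close>

lemma D_fixk: assumes "D P" shows "D (%e. P (%n. if n < k then e n else e0 n))"
proof -
  obtain \<phi> p where \<phi>: "!!e. P e = eval (%_. True) (%_. False) \<phi> (mix e p)" using assms by (auto simp: D_def)
  let ?f = "%n. if even n then (if n div 2 < k then n else Suc (2 * (2 * (n div 2)))) else Suc (2 * (Suc (2 * (n div 2))))"
  have "(%n. mix e (mix e0 p) (?f n)) = mix (%n. if n < k then e n else e0 n) p" for e
    by (rule ext) (auto simp: mix_def elim!: oddE)
  then show ?thesis unfolding D_def
    by (intro exI[of _ "ren \<phi> ?f"] exI[of _ "mix e0 p"]) (simp add: eval_ren \<phi>)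
qed

lemma D_fix': assumes "D (%e. P (e 0) (%n. e (Suc n)))" shows "D (%e. P (e 0) e0)"
  using D_fixk[OF assms, of 1 "%n. e0 (n - 1)"] by simp
lemma dt_fix: assumes "dt (%e. F (e 0) (%n. e (Suc n)))" shows "dt (%e. F (e 0) e0)"
  using D_fixk[OF assms[unfolded dt_def], of 2 "%n. e0 (n - 2)"] by (simp add: dt_def)

lemma d0_fix: "d0 (%e. P (e 0) (%n. e (Suc n))) ==> D (%e. P (e 0) e0)"
  by (rule D_fix'[OF d0_D])

text \<open>Simple terms: bounded quantification over them stays bounded. The renaming \<open>f\<close> makes the
  notion stable under passing below a quantifier.\<close>

definition bt :: "((nat => 'a::zf) => 'a) => bool" where
  "bt t <-> (ALL f Q. d0 (%e. Q (e 0) (%n. e (Suc n))) --> d0 (%e. EX x. x :. t (%n. e (f n)) & Q x e))"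

lemma btI: "(!!f Q. d0 (%e. Q (e 0) (%n. e (Suc n))) ==> d0 (%e. EX x. x :. t (%n. e (f n)) & Q x e)) ==> bt t"
  by (auto simp: bt_def)
lemma bt_ren: assumes "bt t" shows "bt (%e::nat => 'a::zf. t (%n. e (f n)))"
proof (rule btI)
  fix g :: "nat => nat" and Q :: "'a => (nat => 'a) => bool" assume "d0 (%e. Q (e 0) (%n. e (Suc n)))"
  then show "d0 (%e. EX x. x :. t (%n. e (g (f n))) & Q x e)" using assms[unfolded bt_def, THEN spec[of _ "%n. g (f n)"], THEN spec[of _ Q]] by simp
qed
lemma d0_bex [Bi]: "bt t ==> d0 (%e. Q (e 0) (%n. e (Suc n))) ==> d0 (%e. EX x. x :. t e & Q x e)"
  unfolding bt_def by (drule spec[of _ "%n. n"]) simp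
lemma d0_ball [Bi]: assumes "bt t" "d0 (%e. Q (e 0) (%n. e (Suc n)))" shows "d0 (%e. ALL x. x :. t e --> Q x e)"
proof -
  have "d0 (%e. ~ (EX x. x :. t e & ~ Q x e))" by (intro d0_not d0_bex[OF assms(1)] assms(2))
  then show ?thesis by simp
qed
lemma bt_var [Bi]: "bt (%e. e i)" by (rule btI) (rule d0_bex0)

lemma bt_shift: "bt t ==> bt (%e. t (%n. e (Suc n)))" by (rule bt_ren)
lemma d0_mem_var: "bt t ==> d0 (%e. e i :. t e)"
  using d0_bex[of t "%x e. x = e i"] d0_eq0[of 0 "Suc i"] by simp
lemma d0_var_eq: assumes "bt t" shows "d0 (%e. e i = t e)"
proof -
  have "d0 (%e. (ALL x. x :. e i --> x :. t e) & (ALL x. x :. t e --> x :. e i))"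
    by (intro d0_and d0_ball bt_var assms d0_mem_var bt_shift)
  moreover have "((ALL x. x :. e i --> x :. t e) & (ALL x. x :. t e --> x :. e i)) = (e i = t e)" for e by (auto intro: set_eqI)
  ultimately show ?thesis by simp
qed
lemma d0_mem [Bi]: assumes "bt s" "bt t" shows "d0 (%e. s e :. t e)"
  using d0_bex[OF assms(2), of "%x e. x = s e"] d0_var_eq[OF bt_shift[OF assms(1)], of 0] by simp
lemma d0_eq [Bi]: assumes "bt s" "bt t" shows "d0 (%e. s e = t e)"
proof -
  have "d0 (%e. (ALL x. x :. s e --> x :. t e) & (ALL x. x :. t e --> x :. s e))"
    by (intro d0_and d0_ball assms d0_mem_var bt_shift)
  moreover have "((ALL x. x :. s e --> x :. t e) & (ALL x. x :. t e --> x :. s e)) = (s e = t e)" for e by (auto intro: set_eqI)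
  ultimately show ?thesis by simp
qed

text \<open>A quantifier bounded by a variable becomes one bounded by a simple term, and staying
  bounded in that case is just what \<open>bt\<close> demands. Substituting for all variables at
  once keeps the induction uniform.\<close>

lemma d0_substs: "(!!n. bt (\<sigma> n)) ==> d0 (%e. bev mem (=) \<phi> (%n. \<sigma> n e))"
proof (induction \<phi> arbitrary: \<sigma>)
  case (bMem i j) then show ?case by (simp add: d0_mem)
next
  case (bEq i j) then show ?case by (simp add: d0_eq)
next
  case (bNeg \<phi>) then show ?case by (simp add: d0_not)
next
  case (bAnd \<phi> \<psi>) then show ?case by (simp add: d0_and)
next
  case (bEx i \<phi>)
  have "d0 (%e. bev mem (=) \<phi> (%n. (case n of 0 => (%e. e 0) | Suc n => (%e. \<sigma> n (%n. e (Suc n)))) e))"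
    by (rule bEx.IH) (auto split: nat.split intro: bt_var bt_shift bEx.prems)
  moreover have "(%n. (case n of 0 => (%e. e 0) | Suc n => (%e. \<sigma> n (%n. e (Suc n)))) e) = case_nat (e 0) (%n. \<sigma> n (%n. e (Suc n)))" for e
    by (auto split: nat.split)
  ultimately show ?case using d0_bex[OF bEx.prems, of "%x e. bev mem (=) \<phi> (case_nat x (%n. \<sigma> n e))"] by simp
qed

lemma d0_subst: assumes "d0 (%e. P (e 0) (%n. e (Suc n)))" "bt t" shows "d0 (%e. P (t e) e)"
proof -
  obtain \<phi> where \<phi>: "!!e. P (e 0) (%n. e (Suc n)) = bev mem (=) \<phi> e" using assms by (auto simp: d0_def)
  have "d0 (%e. bev mem (=) \<phi> (%n. (case n of 0 => t | Suc n => (%e. e n)) e))"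
    by (rule d0_substs) (auto split: nat.split intro: bt_var assms)
  moreover have "(%n. (case n of 0 => t | Suc n => (%e. e n)) e) = case_nat (t e) e" for e by (auto split: nat.split)
  ultimately show ?thesis using \<phi>[of "case_nat (t _) _"] by simp
qed

lemma bt_subst: assumes "bt (%e. F (e 0) (%n. e (Suc n)))" "bt t" shows "bt (%e::nat => 'a::zf. F (t e) e)"
proof (rule btI)
  fix f :: "nat => nat" and Q :: "'a => (nat => 'a) => bool" assume Q: "d0 (%e. Q (e 0) (%n. e (Suc n)))"
  have 1: "d0 (%e. Q (e 0) (%n. e (Suc (Suc n))))" using d0_ren[OF Q, of "case_nat 0 (%n. Suc (Suc n))"] by simp
  have "d0 (%e. EX x. x :. F (e 0) (%n. e (Suc (f n))) & Q x (%n. e (Suc n)))"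
    by (rule d0_bex[OF _ 1]) (use bt_ren[OF assms(1), of "case_nat 0 (%n. Suc (f n))"] in simp)
  from d0_subst[of "%y e. EX x. x :. F y (%n. e (f n)) & Q x e", OF this bt_ren[OF assms(2)]]
  show "d0 (%e. EX x. x :. F (t (%n. e (f n))) (%n. e (f n)) & Q x e)" by simp
qed

lemma bt_dt: "bt t ==> dt t"
  unfolding dt_def by (rule d0_D, rule d0_var_eq, rule bt_shift)

lemma bt_empty [Bi]: "bt (%e. empty)" by (rule btI) (simp add: d0_False)
lemma bt_upair [Bi]: assumes "bt s" "bt t" shows "bt (%e::nat => 'a::zf. upair (s e) (t e))"
proof (rule btI)
  fix f :: "nat => nat" and Q :: "'a => (nat => 'a) => bool" assume Q: "d0 (%e. Q (e 0) (%n. e (Suc n)))"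
  have "d0 (%e. Q (s (%n. e (f n))) e | Q (t (%n. e (f n))) e)"
    by (rule d0_or; rule d0_subst[OF Q bt_ren]; rule assms)
  moreover have "(EX x. x :. upair (s (%n. e (f n))) (t (%n. e (f n))) & Q x e) = (Q (s (%n. e (f n))) e | Q (t (%n. e (f n))) e)" for e by auto
  ultimately show "d0 (%e. EX x. x :. upair (s (%n. e (f n))) (t (%n. e (f n))) & Q x e)" by simp
qed
lemma bt_opair [Bi]: "bt s ==> bt t ==> bt (%e. opair (s e) (t e))" unfolding opair_def by (intro Bi)

lemma bt_sep [Bi]: assumes "bt t" "d0 (%e. P (e 0) (%n. e (Suc n)))" shows "bt (%e::nat => 'a::zf. sep (t e) (%z. P z e))"
proof (rule btI)
  fix f :: "nat => nat" and Q :: "'a => (nat => 'a) => bool" assume Q: "d0 (%e. Q (e 0) (%n. e (Suc n)))"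
  have "d0 (%e. P (e 0) (%n. e (Suc (f n))))" using d0_ren[OF assms(2), of "case_nat 0 (%n. Suc (f n))"] by simp
  then have "d0 (%e. EX x. x :. t (%n. e (f n)) & (P x (%n. e (f n)) & Q x e))"
    by (intro d0_bex[OF bt_ren[OF assms(1)]] d0_and Q)
  then show "d0 (%e. EX x. x :. sep (t (%n. e (f n))) (%z. P z (%n. e (f n))) & Q x e)"
    by (simp add: mem_sep[OF d0_fix[OF assms(2)]] conj_assoc)
qed

lemma bt_mem_big_union: assumes "bt (%e. F (e 0) (%n. e (Suc n)))" shows "x :. big_union y (%z. F z e) <-> (EX z. z :. y & x :. F z e)"
  by (rule mem_big_union, rule dt_fix, rule bt_dt, rule assms)
lemma bt_big_union [Bi]: assumes "bt t" "bt (%e. F (e 0) (%n. e (Suc n)))" shows "bt (%e::nat => 'a::zf. big_union (t e) (%z. F z e))"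
proof (rule btI)
  fix f :: "nat => nat" and Q :: "'a => (nat => 'a) => bool" assume Q: "d0 (%e. Q (e 0) (%n. e (Suc n)))"
  have 1: "d0 (%e. Q (e 0) (%n. e (Suc (Suc n))))" using d0_ren[OF Q, of "case_nat 0 (%n. Suc (Suc n))"] by simp
  have "d0 (%e. EX z. z :. t (%n. e (f n)) & (EX x. x :. F z (%n. e (f n)) & Q x e))"
    by (rule d0_bex[OF bt_ren[OF assms(1)]], rule d0_bex[OF _ 1])
      (use bt_ren[OF assms(2), of "case_nat 0 (%n. Suc (f n))"] in simp)
  moreover have "(EX x. x :. big_union (t (%n. e (f n))) (%z. F z (%n. e (f n))) & Q x e) =
    (EX z. z :. t (%n. e (f n)) & (EX x. x :. F z (%n. e (f n)) & Q x e))" for e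
    unfolding bt_mem_big_union[OF assms(2)] by blast
  ultimately show "d0 (%e. EX x. x :. big_union (t (%n. e (f n))) (%z. F z (%n. e (f n))) & Q x e)" by simp
qed

lemma img_big_union: "dt (%e. F (e 0)) ==> img a F = big_union a (%z. upair (F z) (F z))"
  by (rule set_eqI, subst mem_big_union) (auto simp: mem_img intro: dt_upair)
lemma bt_img [Bi]: assumes "bt t" "bt (%e. F (e 0) (%n. e (Suc n)))" shows "bt (%e. img (t e) (%z. F z e))"
  unfolding img_big_union[OF dt_fix[OF bt_dt[OF assms(2)]]] by (intro bt_big_union bt_upair assms)

lemma set_union_big: "set_union a = big_union a (%z. z)"
  by (rule set_eqI, subst mem_big_union) (auto intro: dt_var)
lemma bt_union [Bi]: "bt t ==> bt (%e. set_union (t e))" unfolding set_union_big by (intro Bi)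
lemma bt_un [Bi]: "bt s ==> bt t ==> bt (%e. un (s e) (t e))" unfolding un_def by (intro Bi)
lemma adj_un: "adjoin_self a = un a (upair a a)" by (rule set_eqI) auto
lemma bt_adj [Bi]: "bt t ==> bt (%e. adjoin_self (t e))" unfolding adj_un by (intro Bi)
lemma diff_sep: "diff a b = sep a (%z. ~ z :. b)"
  by (rule set_eqI, subst mem_sep, (intro Di)[1]) auto
lemma bt_diff [Bi]: "bt s ==> bt t ==> bt (%e. diff (s e) (t e))" unfolding diff_sep by (intro Bi bt_shift)
lemma bt_std [Bi]: "bt (%e. std_num k)" by (induction k) (auto intro: Bi)
lemma d0_sub [Bi]: "bt s ==> bt t ==> d0 (%e. s e \<^bold>\<subseteq> t e)" unfolding subset_def by (intro Bi bt_shift)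
lemma bt_if [Bi]: assumes "d0 P" "bt s" "bt t" shows "bt (%e::nat => 'a::zf. if P e then s e else t e)"
proof (rule btI)
  fix f :: "nat => nat" and Q :: "'a => (nat => 'a) => bool" assume Q: "d0 (%e. Q (e 0) (%n. e (Suc n)))"
  have "d0 (%e. (P (%n. e (f n)) & (EX x. x :. s (%n. e (f n)) & Q x e)) | (~ P (%n. e (f n)) & (EX x. x :. t (%n. e (f n)) & Q x e)))"
    by (rule d0_or[OF d0_and[OF d0_ren[OF assms(1)] d0_bex[OF bt_ren[OF assms(2)] Q]] d0_and[OF d0_not[OF d0_ren[OF assms(1)]] d0_bex[OF bt_ren[OF assms(3)] Q]]])
  then show "d0 (%e. EX x. x :. (if P (%n. e (f n)) then s (%n. e (f n)) else t (%n. e (f n))) & Q x e)"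
    by (rule back_subst[of d0]) auto
qed
text \<open>Both components of a pair in \<open>f\<close> lie in
  \<open>set_union (set_union f)\<close>, so the quantifiers hidden in application can be
  bounded.\<close>

lemma ap_sep: "ap f x = sep (set_union (set_union (set_union f))) (%z. EX y. y :. set_union (set_union f) & (opair x y :. f & z :. y))"
  by (rule set_eqI, subst mem_sep, (intro Di)[1]) (use opair_mem_Un(2) in \<open>fastforce simp: mem_ap\<close>)
lemma bt_ap [Bi]: "bt s ==> bt t ==> bt (%e. ap (s e) (t e))" unfolding ap_sep by (intro Bi bt_shift)


lemma bt_app4: assumes "bt (%e. F (e 0) (e 1) (e 2) (e 3))" "bt s" "bt t" "bt u" "bt v" shows "bt (%e. F (s e) (t e) (u e) (v e))"
  apply (rule bt_subst[of "%x e. F x (t e) (u e) (v e)", OF _ assms(2)])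
  apply (rule bt_subst[of "%x e. F (e 0) x (u (%n. e (Suc n))) (v (%n. e (Suc n)))", OF _ bt_ren[OF assms(3)]])
  apply (rule bt_subst[of "%x e. F (e (Suc 0)) (e 0) x (v (%n. e (Suc (Suc n))))", OF _ bt_ren[OF assms(4)]])
  apply (rule bt_subst[of "%x e. F (e (Suc (Suc 0))) (e (Suc 0)) (e 0) x", OF _ bt_ren[OF assms(5)]])
  using bt_ren[OF assms(1), of "%n. 3 - n"] by (simp add: numeral_2_eq_2 numeral_3_eq_3)

lemma dt_subst: assumes "dt (%e. F (e 0) (%n. e (Suc n)))" "dt t" shows "dt (%e. F (t e) e)"
  unfolding dt_def
  by (rule D_subst[of "%x e. e 0 = F x (%n. e (Suc n))", OF _ dt_Suc[OF assms(2)]])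
    (use D_ren[OF assms(1)[unfolded dt_def], of "%n. if n = 0 then 1 else if n = 1 then 0 else n"] in simp)

lemma dt_app4: assumes "dt (%e. F (e 0) (e 1) (e 2) (e 3))" "dt s" "dt t" "dt u" "dt v" shows "dt (%e. F (s e) (t e) (u e) (v e))"
  apply (rule dt_subst[of "%x e. F x (t e) (u e) (v e)", OF _ assms(2)])
  apply (rule dt_subst[of "%x e. F (e 0) x (u (%n. e (Suc n))) (v (%n. e (Suc n)))", OF _ dt_ren[OF assms(3)]])
  apply (rule dt_subst[of "%x e. F (e (Suc 0)) (e 0) x (v (%n. e (Suc (Suc n))))", OF _ dt_ren[OF assms(4)]])
  apply (rule dt_subst[of "%x e. F (e (Suc (Suc 0))) (e (Suc 0)) (e 0) x", OF _ dt_ren[OF assms(5)]])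
  using dt_ren[OF assms(1), of "%n. 3 - n"] by (simp add: numeral_2_eq_2 numeral_3_eq_3)

text \<open>Jensen's fact that rudimentary functions are simple: substituted into bounded formulas
  they give bounded formulas. The arguments are arbitrary simple terms, so that the induction passes
  through composition.\<close>

lemma rud_simple: "rudimentary n f ==> length ts = n ==> (!!t. t \<in> set ts ==> bt t) ==> bt (%e. f (map (%t. t e) ts))"
proof (induction n f arbitrary: ts rule: rudimentary.induct)
  case (rud_proj i n) then show ?case by simp
next
  case (rud_diff i n k) then show ?case by (simp add: bt_diff)
next
  case (rud_pair i n k) then show ?case by (simp add: bt_upair)
next
  case (rud_comp gs h n)
  have "bt (%e. h (map (%t. t e) (map (%g e. g (map (%t. t e) ts)) gs)))"
    by (rule rud_comp.IH) (use rud_comp in auto)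
  then show ?case by (simp add: comp_def)
next
  case (rud_union n g)
  then obtain t ts' where ts: "ts = t # ts'" by (cases ts) auto
  have "bt (%e. g (map (%t. t e) ((%e. e 0) # map (%t e. t (%n. e (Suc n))) ts')))"
    by (rule rud_union.IH) (use rud_union ts in \<open>auto intro: bt_var bt_shift\<close>)
  then have "bt (%e. big_union (t e) (%z. g (z # map (%t. t e) ts')))"
    by (intro bt_big_union) (use rud_union ts in \<open>simp_all add: comp_def\<close>)
  then show ?case by (simp add: ts)
qed

text \<open>The predicate \<open>rudimentary\<close> fixes a function on lists of every length,
  although only the values at length \<open>n\<close> matter. Forgetting the others gives a notion
  closed under the obvious term constructions.\<close>

definition rf :: "nat => ('a::zf list => 'a) => bool" where
  "rf n t <-> (EX g. rudimentary n g & (ALL xs. length xs = n --> g xs = t xs))"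

lemma rf_var: "i < n ==> rf n (%xs. xs ! i)" unfolding rf_def using rud_proj by blast

lemma rf_cong: "rf n s ==> (!!xs. length xs = n ==> s xs = t xs) ==> rf n t" unfolding rf_def by metis

lemma rf_comp: assumes "rudimentary k h" "length ts = k" "!!t. t \<in> set ts ==> rf n t" shows "rf n (%xs. h (map (%t. t xs) ts))"
proof -
  obtain G where G: "!!t. t \<in> set ts ==> rudimentary n (G t) & (ALL xs. length xs = n --> G t xs = t xs)"
    using assms(3) unfolding rf_def by metis
  have "rudimentary n (%xs. h (map (%g. g xs) (map G ts)))" by (rule rud_comp) (use assms G in auto)
  then show ?thesis unfolding rf_def
    by (rule_tac exI) (auto intro!: arg_cong[of _ _ h] simp: G)
qed

lemma rf_upair: "rf n s ==> rf n t ==> rf n (%xs. upair (s xs) (t xs))"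
  using rf_comp[OF rud_pair[of 0 2 1], of "[s, t]" n] by auto
lemma rf_diff: "rf n s ==> rf n t ==> rf n (%xs. diff (s xs) (t xs))"
  using rf_comp[OF rud_diff[of 0 2 1], of "[s, t]" n] by auto
lemma rf_weak: assumes "rf n t" shows "rf (Suc n) (%xs. t (tl xs))"
proof -
  obtain g where g: "rudimentary n g" "ALL xs. length xs = n --> g xs = t xs" using assms by (auto simp: rf_def)
  have "rf (Suc n) (%xs. g (map (%t. t xs) (map (%i xs. xs ! Suc i) [0..<n])))"
    by (rule rf_comp[OF g(1)]) (auto intro: rf_var)
  then show ?thesis
  proof (rule rf_cong)
    fix xs :: "'a list" assume l: "length xs = Suc n"
    then have "map (%t. t xs) (map (%i xs. xs ! Suc i) [0..<n]) = tl xs" by (auto intro!: nth_equalityI simp: nth_tl)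
    then show "g (map (%t. t xs) (map (%i xs. xs ! Suc i) [0..<n])) = t (tl xs)" using g(2) l by simp
  qed
qed

lemma rf_big_union: assumes "rf n s" "rf (Suc n) t" shows "rf n (%xs. big_union (s xs) (%z. t (z # xs)))"
proof -
  obtain g where g: "rudimentary (Suc n) g" "ALL xs. length xs = Suc n --> g xs = t xs" using assms(2) by (auto simp: rf_def)
  have "rf n (%xs. (%xs. big_union (hd xs) (%z. g (z # tl xs))) (map (%t. t xs) (s # map (%i xs. xs ! i) [0..<n])))"
    by (rule rf_comp[OF rud_union[OF g(1)]]) (use assms(1) in \<open>auto intro: rf_var\<close>)
  then show ?thesis
  proof (rule rf_cong)
    fix xs :: "'a list" assume l: "length xs = n"
    then have "map (%t. t xs) (map (%i xs. xs ! i) [0..<n]) = xs" by (auto intro!: nth_equalityI)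
    then show "(%xs. big_union (hd xs) (%z. g (z # tl xs))) (map (%t. t xs) (s # map (%i xs. xs ! i) [0..<n])) = big_union (s xs) (%z. t (z # xs))"
      using g(2) l by simp
  qed
qed

lemma rf_dt: assumes "rf (Suc n) t" "length xs = n" shows "dt (%e. t (e 0 # xs))"
proof -
  obtain g where g: "rudimentary (Suc n) g" "ALL xs. length xs = Suc n --> g xs = t xs" using assms(1) by (auto simp: rf_def)
  have "dt (%e. g (map (%t. t e) (map (%i e. e i) [0..<Suc n])))" by (rule bt_dt, rule rud_simple[OF g(1)]) (auto intro: bt_var)
  then have "dt (%e. (%x e. g (x # map e [0..<n])) (e 0) (%n. e (Suc n)))"
    by (rule back_subst[of dt]) (auto intro!: ext arg_cong[of _ _ g] nth_equalityI simp: nth_Cons' simp del: upt_Suc)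
  from dt_fix[OF this, of "%i. xs ! i"] have "dt (%e. g (e 0 # map ((!) xs) [0..<n]))" .
  moreover have "map ((!) xs) [0..<n] = xs" using assms(2) by (auto intro!: nth_equalityI)
  ultimately show ?thesis using g(2) assms(2) by simp
qed

lemma rf_empty: "0 < n ==> rf n (%xs. empty)"
  by (rule rf_cong[OF rf_diff[OF rf_var[of 0 n] rf_var[of 0 n]]]) (auto intro: eq_emptyI)
lemma rf_union: "rf n t ==> rf n (%xs. set_union (t xs))"
  unfolding set_union_big using rf_big_union[of n t "%xs. xs ! 0", OF _ rf_var] by simp
lemma rf_un: "rf n s ==> rf n t ==> rf n (%xs. un (s xs) (t xs))" unfolding un_def by (intro rf_union rf_upair)

text \<open>Rudimentary relations, by their characteristic functions with
  \<open>upair empty empty\<close> for truth.\<close>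

definition rr :: "nat => ('a::zf list => bool) => bool" where
  "rr n P <-> rf n (%xs. if P xs then upair empty empty else empty)"

lemma rr_cong: "rr n P ==> (!!xs. length xs = n ==> P xs = Q xs) ==> rr n Q"
  unfolding rr_def by (erule rf_cong) simp
lemma rr_D: assumes "rr (Suc n) P" "length xs = n" shows "D (%e. P ((e 0::'a::zf) # xs))"
proof -
  have "D (%e. (empty::'a) :. (if P (e 0 # xs) then upair empty empty else empty))"
    by (rule D_mem[OF dt_const]) (use rf_dt[OF assms(1)[unfolded rr_def] assms(2)] in simp)
  then show ?thesis by (rule back_subst[of D]) auto
qed
text \<open>A union indexed by a characteristic function is the given value or empty; two such
  unions, for the condition and its negation, give the definition by cases.\<close>

lemma rf_if: assumes "rr n P" "rf n s" "rf n t" "0 < n" shows "rf n (%xs. if P xs then s xs else t xs)"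
proof -
  have 1: "rf n (%xs. if ~ P xs then upair empty empty else empty)"
    by (rule rf_cong[OF rf_diff[OF rf_upair[OF rf_empty rf_empty] assms(1)[unfolded rr_def]]]) (use assms(4) in \<open>auto intro: set_eqI\<close>)
  have *: "big_union (if b then upair empty empty else empty) (%_. y) = (if b then y else empty)" for b and y :: 'a
    by (rule set_eqI, subst mem_big_union) (auto intro: dt_const)
  have "rf n (%xs. un (big_union (if P xs then upair empty empty else empty) (%z. s (tl (z # xs)))) (big_union (if ~ P xs then upair empty empty else empty) (%z. t (tl (z # xs)))))"
    by (intro rf_un rf_big_union assms(1)[unfolded rr_def] 1 rf_weak assms)
  then show ?thesis by (rule rf_cong) (auto simp: * intro: set_eqI)
qed
lemma rr_not: "rr n P ==> 0 < n ==> rr n (%xs. ~ P xs)"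
  unfolding rr_def by (rule rf_cong[OF rf_if[of n P, OF _ rf_empty rf_upair[OF rf_empty rf_empty]]]) (auto simp: rr_def)
lemma rr_and: "rr n P ==> rr n Q ==> 0 < n ==> rr n (%xs. P xs & Q xs)"
  unfolding rr_def by (rule rf_cong[OF rf_if[of n P "%xs. if Q xs then upair empty empty else empty", OF _ _ rf_empty]]) (auto simp: rr_def)
lemma rr_bex: assumes "rf n s" "rr (Suc n) P" shows "rr n (%xs. EX z. z :. s xs & P (z # xs))"
  unfolding rr_def
proof (rule rf_cong[OF rf_big_union[OF assms(1) assms(2)[unfolded rr_def]]])
  fix xs :: "'a list" assume l: "length xs = n"
  show "big_union (s xs) (%z. if P (z # xs) then upair empty empty else empty) = (if EX z. z :. s xs & P (z # xs) then upair empty empty else empty)"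
    by (rule set_eqI, subst mem_big_union[OF rf_dt[OF assms(2)[unfolded rr_def] l]]) auto
qed
lemma rr_empty: assumes "rf n t" "0 < n" shows "rr n (%xs. t xs = empty)"
proof -
  have "rr n (%xs. ~ (EX z. z :. t xs & (%_. True) (z # xs)))"
    by (intro rr_not rr_bex assms) (simp add: rr_def rf_upair rf_empty)
  then show ?thesis by (rule rr_cong) (auto dest: ne_emptyD)
qed
lemma rr_eq: assumes "rf n s" "rf n t" "0 < n" shows "rr n (%xs. s xs = t xs)"
proof -
  have "rr n (%xs. un (diff (s xs) (t xs)) (diff (t xs) (s xs)) = empty)" by (intro rr_empty rf_un rf_diff assms)
  then show ?thesis
  proof (rule rr_cong)
    fix xs
    have "s xs = t xs" if h: "un (diff (s xs) (t xs)) (diff (t xs) (s xs)) = empty"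
    proof (rule set_eqI)
      fix z have "~ z :. un (diff (s xs) (t xs)) (diff (t xs) (s xs))" using h by simp
      then show "z :. s xs <-> z :. t xs" by auto
    qed
    then show "(un (diff (s xs) (t xs)) (diff (t xs) (s xs)) = empty) = (s xs = t xs)" by (auto intro: eq_emptyI)
  qed
qed
lemma rr_mem: assumes "rf n s" "rf n t" "0 < n" shows "rr n (%xs. s xs :. t xs)"
proof -
  have "rr n (%xs. EX z. z :. t xs & (%ys. ys ! 0 = s (tl ys)) (z # xs))"
    by (intro rr_bex rr_eq rf_var rf_weak assms) auto
  then show ?thesis by (rule rr_cong) auto
qed

lemma rr_bev: "(!!i. rf n (\<sigma> i)) ==> 0 < n ==> rr n (%xs. bev mem (=) \<phi> (%i. \<sigma> i xs))"
proof (induction \<phi> arbitrary: n \<sigma>)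
  case (bMem i j) then show ?case by (simp add: rr_mem)
next
  case (bEq i j) then show ?case by (simp add: rr_eq)
next
  case (bNeg \<phi>) then show ?case by (simp add: rr_not)
next
  case (bAnd \<phi> \<psi>) then show ?case by (simp add: rr_and)
next
  case (bEx i \<phi>)
  have "rr (Suc n) (%xs. bev mem (=) \<phi> (%i. (case i of 0 => (%xs. xs ! 0) | Suc i => (%xs. \<sigma> i (tl xs))) xs))"
    by (rule bEx.IH) (auto split: nat.split intro: rf_var rf_weak bEx.prems)
  from rr_bex[OF bEx.prems(1)[of i] this]
  show ?case by (rule rr_cong) (auto elim!: back_subst[of "bev mem (=) \<phi>"] intro!: ext split: nat.split)
qed

text \<open>Formulas read an infinite environment but rudimentary functions read a list; the index
  \<open>min i (n - 1)\<close> repeats the last entry for ever.\<close>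

lemma rr_d0: assumes "d0 P" "0 < n" shows "rr n (%xs. P (%i. xs ! min i (n - 1)))"
proof -
  obtain \<phi> where \<phi>: "!!e. P e = bev mem (=) \<phi> e" using assms(1) by (auto simp: d0_def)
  show ?thesis unfolding \<phi> by (rule rr_bev[of n "%i xs. xs ! min i (n - 1)"]) (use assms(2) in \<open>auto intro: rf_var\<close>)
qed

lemma rf_img: assumes "rf n s" "rf (Suc n) t" shows "rf n (%xs. img (s xs) (%z. t (z # xs)))"
  by (rule rf_cong[OF rf_big_union[OF assms(1) rf_upair[OF assms(2) assms(2)]]])
    (simp add: img_big_union[OF rf_dt[OF assms(2)]])
lemma rf_sep: assumes "rf n s" "rr (Suc n) P" shows "rf n (%xs. sep (s xs) (%z. P (z # xs)))"
proof -
  have r: "rf (Suc n) (%ys. if P ys then upair (ys ! 0) (ys ! 0) else empty)" by (intro rf_if assms rf_upair rf_var rf_empty) auto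
  show ?thesis
  proof (rule rf_cong[OF rf_big_union[OF assms(1) r]])
    fix xs :: "'a list" assume l: "length xs = n"
    show "big_union (s xs) (%z. if P (z # xs) then upair ((z # xs) ! 0) ((z # xs) ! 0) else empty) = sep (s xs) (%z. P (z # xs))"
      by (rule set_eqI, subst mem_big_union[OF rf_dt[OF r l]]) (auto simp: mem_sep[OF rr_D[OF assms(2) l]])
  qed
qed

section \<open>The step operator and rudimentary closures\<close>

definition inter :: "'a::zf => 'a => 'a" where "inter a b = diff a (diff a b)"
lemma mem_inter [simp]: "z :. inter a b <-> z :. a & z :. b" by (auto simp: inter_def)
text \<open>Here the elements of \<open>p\<close> are read as assignments, that is, as functions
  from indices to sets. The selections \<open>msel\<close>, \<open>esel\<close> and
  \<open>psel\<close> express atomic formulas, \<open>xsel\<close> is projection and hence an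
  existential quantifier, and \<open>ext1\<close> adds a coordinate.\<close>

definition msel :: "'a::zf => 'a => 'a => 'a" where "msel p q r = sep p (%a. ap a q :. ap a r)"
definition esel :: "'a::zf => 'a => 'a => 'a" where "esel p q r = sep p (%a. ap a q = ap a r)"
definition psel :: "'a::zf => 'a => 'a => 'a" where "psel p q r = sep p (%a. ap a q :. r)"
definition xsel :: "'a::zf => 'a => 'a" where "xsel p q = sep p (%a. EX b. b :. q & a \<^bold>\<subseteq> b)"
definition adj1 :: "'a::zf => 'a => 'a => 'a" where "adj1 p q r = un p (upair (opair q r) (opair q r))"
definition ext1 :: "'a::zf => 'a => 'a => 'a" where "ext1 p q r = big_union p (%a. img q (%y. adj1 a r y))"
definition vl :: "'a::zf => 'a => 'a" where "vl a q = sep (set_union (set_union a)) (%z. opair q z :. a)"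
definition vals :: "'a::zf => 'a => 'a" where "vals p q = big_union p (%a. vl a q)"
definition rng :: "'a::zf => 'a" where "rng p = sep (set_union (set_union p)) (%z. EX m. m :. set_union (set_union p) & opair m z :. p)"

text \<open>The selector \<open>s\<close> packs all operations into one function. So a single
  bounded formula describes them, and one clause suffices to say that an embedding preserves them or
  that a structure of codes computes them.\<close>

definition OP :: "'a::zf => 'a => 'a => 'a => 'a" where
  "OP s p q r = (if s = std_num 0 then upair p q else if s = std_num 1 then diff p q
    else if s = std_num 2 then set_union p else if s = std_num 3 then msel p q r
    else if s = std_num 4 then esel p q r else if s = std_num 5 then xsel p q
    else if s = std_num 6 then adj1 p q r else if s = std_num 7 then ext1 p q r
    else if s = std_num 8 then vals p q else if s = std_num 9 then rng p
    else if s = std_num 10 then psel p q r else empty)"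

lemma OP_simps: "OP (std_num 0) p q r = upair p q" "OP (std_num 1) p q r = diff p q" "OP (std_num 2) p q r = set_union p"
  "OP (std_num 3) p q r = msel p q r" "OP (std_num 4) p q r = esel p q r" "OP (std_num 5) p q r = xsel p q"
  "OP (std_num 6) p q r = adj1 p q r" "OP (std_num 7) p q r = ext1 p q r" "OP (std_num 8) p q r = vals p q"
  "OP (std_num 9) p q r = rng p" "OP (std_num 10) p q r = psel p q r"
  by (auto simp: OP_def std_inj simp del: std_num.simps)

lemma bt_inter [Bi]: "bt s ==> bt t ==> bt (%e. inter (s e) (t e))" unfolding inter_def by (intro Bi)
lemma bt_adj1 [Bi]: "bt s ==> bt t ==> bt u ==> bt (%e. adj1 (s e) (t e) (u e))" unfolding adj1_def by (intro Bi)
lemma bt_vl [Bi]: "bt s ==> bt t ==> bt (%e. vl (s e) (t e))" unfolding vl_def by (intro Bi bt_shift)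

lemma mem_msel [simp]: "a :. msel p q r <-> a :. p & ap a q :. ap a r" unfolding msel_def by (subst mem_sep, (intro Di)[1], simp)
lemma mem_esel [simp]: "a :. esel p q r <-> a :. p & ap a q = ap a r" unfolding esel_def by (subst mem_sep, (intro Di)[1], simp)
lemma mem_psel [simp]: "a :. psel p q r <-> a :. p & ap a q :. r" unfolding psel_def by (subst mem_sep, (intro Di)[1], simp)
lemma mem_xsel [simp]: "a :. xsel p q <-> a :. p & (EX b. b :. q & a \<^bold>\<subseteq> b)" unfolding xsel_def by (subst mem_sep, (intro Di)[1], simp)
lemma mem_adj1 [simp]: "z :. adj1 p q r <-> z :. p | z = opair q r" by (auto simp: adj1_def)
lemma dt_adj1 [Di]: "dt s ==> dt t ==> dt u ==> dt (%e. adj1 (s e) (t e) (u e))" unfolding adj1_def by (intro Di)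
lemma mem_ext1 [simp]: "z :. ext1 p q r <-> (EX a y. a :. p & y :. q & z = adj1 a r y)"
proof -
  have "bt (%e. img (e 1) (%y. adj1 (e 0) (e 2) y))" by (intro Bi)
  then have "z :. ext1 p q r <-> (EX a. a :. p & z :. img q (%y. adj1 a r y))"
    unfolding ext1_def using bt_mem_big_union[of "%a e. img (e 0) (%y. adj1 a (e 1) y)" z p "%n. if n = 0 then q else r"]
    by (simp add: numeral_2_eq_2)
  then show ?thesis by (subst (asm) mem_img, (intro Di)[1]) auto
qed
lemma mem_vl [simp]: "z :. vl a q <-> opair q z :. a"
  unfolding vl_def by (subst mem_sep, (intro Di)[1]) (use opair_mem_Un(2) in blast)
lemma mem_vals [simp]: "z :. vals p q <-> (EX a. a :. p & opair q z :. a)"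
  unfolding vals_def using bt_mem_big_union[of "%a e. vl a (e 0)" z p "%n. q"] by (simp add: bt_vl bt_var)
lemma mem_rng [simp]: "z :. rng p <-> (EX m. opair m z :. p)"
  unfolding rng_def by (subst mem_sep, (intro Di)[1]) (use opair_mem_Un in blast)

lemma bt_OP [Bi]: "bt s ==> bt t ==> bt u ==> bt v ==> bt (%e. OP (s e) (t e) (u e) (v e))"
  apply (rule bt_app4[of OP], unfold OP_def msel_def esel_def psel_def xsel_def ext1_def vals_def rng_def)
  by (intro Bi)+
lemma dt_OP [Di]: "dt s ==> dt t ==> dt u ==> dt v ==> dt (%e. OP (s e) (t e) (u e) (v e))"
  by (rule dt_app4[of OP], rule bt_dt, (intro Bi)[1])

text \<open>Intersecting with \<open>X\<close> makes every new set a subset of \<open>X\<close>,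
  whence \<open>step X\<close> is transitive if \<open>X\<close> is. A value that is already a
  subset of \<open>X\<close> is not changed.\<close>

definition step :: "'a::zf => 'a" where
  "step X = un (adjoin_self X) (big_union X (%s. big_union X (%p. big_union X (%q. img X (%r. inter X (OP s p q r))))))"

lemma bt_step [Bi]: "bt t ==> bt (%e. step (t e))"
  by (rule bt_subst[of "%x e. step x"], unfold step_def) (intro Bi)+
lemma dt_step [Di]: "dt t ==> dt (%e. step (t e))"
  by (rule dt_app1, rule bt_dt, (intro Bi)[1])

lemma dt_inter [Di]: "dt s ==> dt t ==> dt (%e. inter (s e) (t e))" unfolding inter_def by (intro Di)

lemma mem_big4: "z :. big_union X (%s. big_union X (%p. big_union X (%q. img X (%r. inter X (OP s p q r))))) <->
   (EX s p q r. s :. X & p :. X & q :. X & r :. X & z = inter X (OP s p q r))"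
proof -
  let ?e = "%n. X"
  have 0: "y :. img X (%r. inter X (OP s p q r)) <-> (EX r. r :. X & y = inter X (OP s p q r))" for s p q y
    by (rule mem_img) (intro Di)
  have 1: "y :. big_union X (%q. img X (%r. inter X (OP s p q r))) <-> (EX q. q :. X & y :. img X (%r. inter X (OP s p q r)))" for s p y
  proof -
    have "bt (%e. img (e 1) (%r. inter (e 1) (OP (e 2) (e 3) (e 0) r)))" by (intro Bi)
    then show ?thesis using bt_mem_big_union[of "%q e. img (e 0) (%r. inter (e 0) (OP (e 1) (e 2) q r))" y X "%n. if n = 0 then X else if n = 1 then s else p"]
      by (simp add: numeral_2_eq_2 numeral_3_eq_3)
  qed
  have 2: "y :. big_union X (%p. big_union X (%q. img X (%r. inter X (OP s p q r)))) <-> (EX p. p :. X & y :. big_union X (%q. img X (%r. inter X (OP s p q r))))" for s y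
  proof -
    have "bt (%e. big_union (e 1) (%q. img (e 1) (%r. inter (e 1) (OP (e 2) (e 0) q r))))" by (intro Bi)
    then show ?thesis using bt_mem_big_union[of "%p e. big_union (e 0) (%q. img (e 0) (%r. inter (e 0) (OP (e 1) p q r)))" y X "%n. if n = 0 then X else s"]
      by (simp add: numeral_2_eq_2)
  qed
  have "bt (%e. big_union (e 1) (%p. big_union (e 1) (%q. img (e 1) (%r. inter (e 1) (OP (e 0) p q r)))))" by (intro Bi)
  then show ?thesis using bt_mem_big_union[of "%s e. big_union (e 0) (%p. big_union (e 0) (%q. img (e 0) (%r. inter (e 0) (OP s p q r))))" z X ?e]
    by (simp add: 0 1 2) blast
qed

lemma mem_step: "z :. step X <-> z :. X | z = X | (EX s p q r. s :. X & p :. X & q :. X & r :. X & z = inter X (OP s p q r))"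
  unfolding step_def by (simp add: mem_big4 disj_assoc)

lemma trans_step: assumes "transitive X" shows "transitive (step X)" and step_sub: "z :. step X ==> y :. z ==> y :. X"
proof -
  show *: "z :. step X ==> y :. z ==> y :. X" for z y using transD[OF assms] unfolding mem_step by auto
  show "transitive (step X)" by (rule transI, subst mem_step) (use * in blast)
qed

lemma rf_opair: "rf n s ==> rf n t ==> rf n (%xs. opair (s xs) (t xs))" unfolding opair_def by (intro rf_upair)
lemma rf_std: "0 < n ==> rf n (%xs. std_num k)"
  by (induction k) (auto simp: adj_un intro: rf_empty rf_un rf_upair)
lemma rf_adj: "rf n t ==> rf n (%xs. adjoin_self (t xs))" unfolding adj_un by (intro rf_un rf_upair)
lemma rf_inter: "rf n s ==> rf n t ==> rf n (%xs. inter (s xs) (t xs))" unfolding inter_def by (intro rf_diff)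
lemma rf_adj1: "rf n s ==> rf n t ==> rf n u ==> rf n (%xs. adj1 (s xs) (t xs) (u xs))" unfolding adj1_def by (intro rf_un rf_upair rf_opair)

lemma rf_sep_d0: assumes "d0 P" "rf n s" shows "rf n (%xs. sep (s xs) (%z. P (%i. (z # xs) ! min i n)))"
  by (rule rf_sep[OF assms(2), of "%ys. P (%i. ys ! min i n)"]) (use rr_d0[OF assms(1), of "Suc n"] in simp)

lemma rf_subst1: assumes "rf 1 (%xs. F (xs ! 0))" "rf n s" shows "rf n (%xs. F (s xs))"
proof -
  obtain g where g: "rudimentary 1 g" "ALL xs. length xs = 1 --> g xs = F (xs ! 0)" using assms(1) by (auto simp: rf_def)
  show ?thesis by (rule rf_cong[OF rf_comp[OF g(1), of "[s]"]]) (use assms g(2) in auto)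
qed
lemma rf_subst3: assumes "rf 3 (%xs. F (xs ! 0) (xs ! 1) (xs ! 2))" "rf n s" "rf n t" "rf n u" shows "rf n (%xs. F (s xs) (t xs) (u xs))"
proof -
  obtain g where g: "rudimentary 3 g" "ALL xs. length xs = 3 --> g xs = F (xs ! 0) (xs ! 1) (xs ! 2)" using assms(1) by (auto simp: rf_def)
  show ?thesis by (rule rf_cong[OF rf_comp[OF g(1), of "[s, t, u]"]]) (use assms g(2) in auto)
qed
lemma rf_subst4: assumes "rf 4 (%xs. F (xs ! 0) (xs ! 1) (xs ! 2) (xs ! 3))" "rf n s" "rf n t" "rf n u" "rf n v" shows "rf n (%xs. F (s xs) (t xs) (u xs) (v xs))"
proof -
  obtain g where g: "rudimentary 4 g" "ALL xs. length xs = 4 --> g xs = F (xs ! 0) (xs ! 1) (xs ! 2) (xs ! 3)" using assms(1) by (auto simp: rf_def)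
  show ?thesis by (rule rf_cong[OF rf_comp[OF g(1), of "[s, t, u, v]"]]) (use assms g(2) in auto)
qed

lemma rf_sep3: assumes "d0 (%e. P (e 0) (e 2) (e 3))" "rf n s" "rf n t" "rf n u" shows "rf n (%xs. sep (s xs) (%z. P z (t xs) (u xs)))"
  by (rule rf_subst3[of "%p q r. sep p (%z. P z q r)", OF _ assms(2,3,4)])
    (use rf_sep_d0[OF assms(1) rf_var[of 0 3]] in \<open>simp add: numeral_2_eq_2 numeral_3_eq_3\<close>)

lemma rf_msel: "rf n s ==> rf n t ==> rf n u ==> rf n (%xs. msel (s xs) (t xs) (u xs))"
  unfolding msel_def by (rule rf_sep3[of "%z q r. ap z q :. ap z r"]) (intro Bi)
lemma rf_esel: "rf n s ==> rf n t ==> rf n u ==> rf n (%xs. esel (s xs) (t xs) (u xs))"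
  unfolding esel_def by (rule rf_sep3[of "%z q r. ap z q = ap z r"]) (intro Bi)
lemma rf_psel: "rf n s ==> rf n t ==> rf n u ==> rf n (%xs. psel (s xs) (t xs) (u xs))"
  unfolding psel_def by (rule rf_sep3[of "%z q r. ap z q :. r"]) (intro Bi)
lemma rf_xsel: "rf n s ==> rf n t ==> rf n (%xs. xsel (s xs) (t xs))"
  unfolding xsel_def by (rule rf_sep3[of "%z q r. EX b. b :. q & z \<^bold>\<subseteq> b"]) ((intro Bi)[1])
lemma rf_vl: "rf n s ==> rf n t ==> rf n (%xs. vl (s xs) (t xs))"
  unfolding vl_def by (rule rf_sep3[of "%z q r. opair q z :. r"]) ((intro Bi)[1], (intro rf_union)[1])
lemma rf_rng: "rf n s ==> rf n (%xs. rng (s xs))"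
  unfolding rng_def by (rule rf_sep3[of "%z q r. EX m. m :. set_union (set_union q) & opair m z :. q" n _ s s]) ((intro Bi)[1], (intro rf_union)[1])
lemma rf_vals: assumes "rf n s" "rf n t" shows "rf n (%xs. vals (s xs) (t xs))"
  using rf_big_union[OF assms(1), of "%ys. vl (ys ! 0) (t (tl ys))"] unfolding vals_def
  by (simp add: rf_vl rf_var rf_weak[OF assms(2)])
lemma rf_big_union': "m = Suc n ==> rf n s ==> rf m t ==> rf n (%xs. big_union (s xs) (%z. t (z # xs)))"
  using rf_big_union by blast
lemma rf_img': "m = Suc n ==> rf n s ==> rf m t ==> rf n (%xs. img (s xs) (%z. t (z # xs)))"
  using rf_img by blast

lemma rf_ext1: "rf n s ==> rf n t ==> rf n u ==> rf n (%xs. ext1 (s xs) (t xs) (u xs))"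
proof (rule rf_subst3[of ext1])
  have 1: "rf 5 (%ys. adj1 (ys ! 1) (ys ! 4) (ys ! 0))" by (intro rf_adj1 rf_var) auto
  have 2: "rf 4 (%xs. img (xs ! 2) (%z. adj1 (xs ! 0) (xs ! 3) z))"
    using rf_img'[OF _ rf_var[of 2 4] 1] by simp
  show "rf 3 (%xs. ext1 (xs ! 0) (xs ! 1) (xs ! 2))" unfolding ext1_def
    using rf_big_union'[OF _ rf_var[of 0 3] 2] by (simp add: eval_nat_numeral)
qed

lemma rf_OP: "rf n s ==> rf n t ==> rf n u ==> rf n v ==> rf n (%xs. OP (s xs) (t xs) (u xs) (v xs))"
proof (rule rf_subst4[of OP])
  have "rr 4 (%xs. xs ! 0 = std_num k)" for k by (intro rr_eq rf_var rf_std) auto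
  then show "rf 4 (%xs. OP (xs ! 0) (xs ! 1) (xs ! 2) (xs ! 3))" unfolding OP_def
    by (intro rf_if rf_upair rf_diff rf_union rf_msel rf_esel rf_xsel rf_adj1 rf_ext1 rf_vals rf_rng rf_psel rf_empty rf_var)
      (auto simp del: std_num.simps)
qed

lemma rf_step: "rf n t ==> rf n (%xs. step (t xs))"
proof (rule rf_subst1[of step])
  have 0: "rf 5 (%ys. inter (ys ! 4) (OP (ys ! 3) (ys ! 2) (ys ! 1) (ys ! 0)))" by (intro rf_inter rf_OP rf_var) auto
  have 1: "rf 4 (%xs. img (xs ! 3) (%r. inter (xs ! 3) (OP (xs ! 2) (xs ! 1) (xs ! 0) r)))"
    using rf_img'[OF _ rf_var[of 3 4] 0] by simp
  have 2: "rf 3 (%xs. big_union (xs ! 2) (%q. img (xs ! 2) (%r. inter (xs ! 2) (OP (xs ! 1) (xs ! 0) q r))))"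
    using rf_big_union'[OF _ rf_var[of 2 3] 1] by (simp add: eval_nat_numeral)
  have 3: "rf 2 (%xs. big_union (xs ! 1) (%p. big_union (xs ! 1) (%q. img (xs ! 1) (%r. inter (xs ! 1) (OP (xs ! 0) p q r)))))"
    using rf_big_union'[OF _ rf_var[of 1 2] 2] by (simp add: eval_nat_numeral)
  have "rf 1 (%xs. big_union (xs ! 0) (%s. big_union (xs ! 0) (%p. big_union (xs ! 0) (%q. img (xs ! 0) (%r. inter (xs ! 0) (OP s p q r))))))"
    using rf_big_union'[OF _ rf_var[of 0 1] 3] by (simp add: eval_nat_numeral)
  then show "rf 1 (%xs. step (xs ! 0))" unfolding step_def by (intro rf_un rf_adj rf_var) auto
qed

lemma dt_if [Di]: assumes "D P" "dt s" "dt t" shows "dt (%e. if P e then s e else t e)"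
proof -
  have "D (%e. (P (%n. e (Suc n)) & e 0 = s (%n. e (Suc n))) | (~ P (%n. e (Suc n)) & e 0 = t (%n. e (Suc n))))"
    by (rule D_or[OF D_and[OF D_ren[OF assms(1)] assms(2)[unfolded dt_def]] D_and[OF D_not[OF D_ren[OF assms(1)]] assms(3)[unfolded dt_def]]])
  then show ?thesis unfolding dt_def by (rule back_subst[of D]) auto
qed

lemma dt_sep [Di]: assumes "dt t" "D (%e. P (e 0) (%n. e (Suc n)))" shows "dt (%e. sep (t e) (%z. P z e))"
  unfolding sep_def
proof (rule dt_setof)
  show "D (%e. e 0 :. t (%n. e (Suc n)) & P (e 0) (%n. e (Suc n)))" by (rule D_and[OF D_mem[OF dt_var dt_Suc[OF assms(1)]] assms(2)])
  show "isset (%z. z :. t e & P z e)" for e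
    by (rule isset_sub[of _ "t e"], rule D_and[OF D_mem[OF dt_var dt_const] D_fix'[OF assms(2)]]) simp
qed

lemma dt_img [Di]: assumes "dt t" "dt (%e. F (e 0) (%n. e (Suc n)))" shows "dt (%e. img (t e) (%z. F z e))"
  unfolding img_def
proof (rule dt_setof)
  have "D (%e. EX x. x :. t (%n. e (Suc n)) & e 0 = F x (%n. e (Suc n)))"
    by (intro D_ex D_and D_mem dt_var dt_ren[OF assms(1)])
      (use D_ren[OF assms(2)[unfolded dt_def], of "%n. if n = 0 then 1 else if n = 1 then 0 else n"] in simp)
  then show "D (%e. EX x. x :. t (%n. e (Suc n)) & e 0 = F x (%n. e (Suc n)))" .
  show "isset (%z. EX x. x :. t e & z = F x e)" for e by (rule isset_image, rule dt_fix, rule assms(2))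
qed
lemma dt_big_union [Di]: assumes "dt t" "dt (%e. F (e 0) (%n. e (Suc n)))" shows "dt (%e. big_union (t e) (%z. F z e))"
  unfolding big_union_img[OF dt_fix[OF assms(2)]] by (intro dt_union dt_img assms)

definition pd :: "'a::zf => 'a" where "pd n = set_union (sep n (%m. n = adjoin_self m))"
lemma dt_pd [Di]: "dt t ==> dt (%e. pd (t e))" by (rule dt_app1, unfold pd_def, (intro Di)[1])
lemma pd_adj [simp]: "pd (adjoin_self m) = m"
proof -
  have "x :. sep (adjoin_self m) (%k. adjoin_self m = adjoin_self k) <-> x = m" for x
    by (subst mem_sep, (intro Di)[1]) (auto dest: adj_inj)
  then show ?thesis by (intro set_eqI) (auto simp: pd_def)
qed

section \<open>Iterating the step operator along the internal natural numbers\<close>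

definition itG :: "'a::zf => 'a => ('a => 'a) => 'a" where
  "itG X n F = (if EX m. m :. n & n = adjoin_self m then step (F (pd n)) else X)"
definition it :: "'a::zf => 'a => 'a" where "it X n = recr (itG X) n"

lemma loc_itG: "loc (itG X)" unfolding loc_def itG_def by (auto dest: subD)
lemma D_itG: "D (%e. e 0 = itG (e 1) (e 2) (ap (e 3)))" unfolding itG_def by (intro Di)
lemma D_itG': "D (%e. e 0 = itG X (e 1) (ap (e 2)))" unfolding itG_def by (intro Di)
lemma dt_it [Di]: "dt s ==> dt t ==> dt (%e. it (s e) (t e))" unfolding it_def by (rule dt_recr[OF loc_itG D_itG])
lemma it_0 [simp]: "it X empty = X" unfolding it_def by (subst recr_unfold[OF loc_itG D_itG']) (simp add: itG_def)
lemma it_Suc [simp]: "it X (adjoin_self n) = step (it X n)"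
  unfolding it_def by (subst recr_unfold[OF loc_itG D_itG']) (auto simp: itG_def)

text \<open>For good \<open>X\<close> this is the rudimentary closure of
  \<open>adjoin_self X\<close>, see \<open>rud_closure_nx\<close>, but reached in stages instead of
  as an intersection. The stages are what receives codes later.\<close>

definition nx :: "'a::zf => 'a" where "nx X = big_union omega (it X)"
lemma mem_nx: "z :. nx X <-> (EX n. n :. omega & z :. it X n)" unfolding nx_def by (rule mem_big_union) (intro Di)
lemma dt_nx [Di]: "dt t ==> dt (%e. nx (t e))" unfolding nx_def by (rule dt_app1[of "%X. big_union omega (it X)"], intro Di)

lemma trans_it: assumes "transitive X" "n :. omega" shows "transitive (it X n)"
  using assms(2) by (rule omega_induct) ((intro Di)[1], use assms trans_step in auto)
lemma it_mono: assumes "m :. omega" "n :. omega" "m :. n | m = n" "z :. it X m" shows "z :. it X n"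
proof -
  have "ALL m. m :. omega & (m :. n | m = n) & z :. it X m --> z :. it X n" using assms(2)
    by (rule omega_induct) ((intro Di)[1], simp, auto simp: mem_step)
  then show ?thesis using assms by blast
qed
lemma trans_nx: assumes "transitive X" shows "transitive (nx X)"
  by (rule transI) (use transD[OF trans_it[OF assms]] in \<open>auto simp: mem_nx\<close>)
lemma sub_nx: "z :. X ==> z :. nx X" using mem_nx it_0 empty_omega by metis
lemma it_in_nx: "n :. omega ==> it X n :. nx X" using mem_nx it_Suc adj_omega mem_step by metis
lemma self_nx: "X :. nx X" using it_in_nx[OF empty_omega, of X] by simp

lemma rud_closed_rf: "rud_closed S ==> rf n t ==> length xs = n ==> (!!x. x \<in> set xs ==> x :. S) ==> t xs :. S"
  unfolding rud_closed_def rf_def by metis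

text \<open>Each stage is shown to be both an element and a subset of \<open>S\<close>. The next
  stage is a rudimentary function of the present one, and its new elements are rudimentary functions
  of elements of \<open>S\<close>.\<close>

lemma nx_least: assumes "rud_closed S" "X :. S" "X \<^bold>\<subseteq> S" shows "nx X \<^bold>\<subseteq> S"
proof (rule subI)
  fix z assume "z :. nx X"
  then obtain n where n: "n :. omega" "z :. it X n" using mem_nx by blast
  have "it X n :. S & it X n \<^bold>\<subseteq> S" using n(1)
  proof (rule omega_induct)
    show "D (%e. it X (e 0) :. S & it X (e 0) \<^bold>\<subseteq> S)" by (intro Di)
    show "it X empty :. S & it X empty \<^bold>\<subseteq> S" using assms by simp
    fix n assume h: "it X n :. S & it X n \<^bold>\<subseteq> S"
    let ?Y = "it X n"
    have 1: "step ?Y :. S" using rud_closed_rf[OF assms(1) rf_step[OF rf_var[of 0 1]], of "[?Y]"] h by simp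
    have "inter ?Y (OP s p q r) :. S" if "s :. ?Y" "p :. ?Y" "q :. ?Y" "r :. ?Y" for s p q r
      using rud_closed_rf[OF assms(1) rf_inter[OF rf_var[of 0 5] rf_OP[OF rf_var[of 1 5] rf_var[of 2 5] rf_var[of 3 5] rf_var[of 4 5]]], of "[?Y, s, p, q, r]"]
        h that by (auto dest: subD)
    then have "step ?Y \<^bold>\<subseteq> S" using h by (auto simp: mem_step intro!: subI dest: subD)
    then show "it X (adjoin_self n) :. S & it X (adjoin_self n) \<^bold>\<subseteq> S" using 1 by simp
  qed
  then show "z :. S" using n(2) subD by blast
qed

section \<open>Rudimentary functions are reached in finitely many steps\<close>

definition good :: "'a::zf => bool" where "good Z <-> transitive Z & omega :. Z"

text \<open>The selectors of \<open>OP\<close> are at hand in a good set; this is the reason why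
  \<open>good\<close> asks for \<open>omega\<close>.\<close>

lemma good_std: "good Z ==> std_num k :. Z" using std_omega transD unfolding good_def by blast
lemma good_step: "good Z ==> good (step Z)" using trans_step by (auto simp: good_def mem_step)
lemma good_steps: "good Z ==> good ((step ^^ m) Z)" by (induction m) (auto intro: good_step)
lemma steps_mono: "z :. Z ==> z :. (step ^^ m) Z" by (induction m) (auto simp: mem_step)
lemma steps_le: "m \<le> k ==> z :. (step ^^ m) Z ==> z :. (step ^^ k) Z"
  using steps_mono[of z "(step ^^ m) Z" "k - m"] by (metis comp_apply funpow_add le_add_diff_inverse2)

text \<open>The intersection built into \<open>step\<close> does no harm to a value that is included
  in \<open>Z\<close>. What remains for each operation is to bound its value by some later
  stage.\<close>

lemma OP_step: assumes "good Z" "p :. Z" "q :. Z" "r :. Z" "OP (std_num k) p q r \<^bold>\<subseteq> Z" shows "OP (std_num k) p q r :. step Z"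
proof -
  have "inter Z (OP (std_num k) p q r) = OP (std_num k) p q r" by (rule set_eqI) (use assms(5) subD in auto)
  then show ?thesis unfolding mem_step using good_std[OF assms(1)] assms by metis
qed

text \<open>The number of steps is standard and independent of \<open>Z\<close> and of the
  arguments. The function may use \<open>Z\<close> itself, as the set of all tuples over
  \<open>Z\<close> does.\<close>

definition fin :: "('a::zf => 'a list => 'a) => nat => bool" where
  "fin F n <-> (EX m. ALL Z xs. good Z --> length xs = n --> (\<forall>x\<in>set xs. x :. Z) --> F Z xs :. (step ^^ m) Z)"

lemma fin_OP: assumes "fin F n" "fin G n" "fin H n"
  "!!Z xs Y. good Z ==> length xs = n ==> (\<forall>x\<in>set xs. x :. Z) ==> good Y ==> Z \<^bold>\<subseteq> Y ==> F Z xs :. Y ==> G Z xs :. Y ==> H Z xs :. Y ==> OP (std_num k) (F Z xs) (G Z xs) (H Z xs) \<^bold>\<subseteq> (step ^^ m) Y"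
  shows "fin (%Z xs. OP (std_num k) (F Z xs) (G Z xs) (H Z xs)) n"
proof -
  obtain m1 where "ALL Z xs. good Z --> length xs = n --> (\<forall>x\<in>set xs. x :. Z) --> F Z xs :. (step ^^ m1) Z"
    using assms(1)[unfolded fin_def] by (elim exE)
  note m1 = this[rule_format]
  obtain m2 where "ALL Z xs. good Z --> length xs = n --> (\<forall>x\<in>set xs. x :. Z) --> G Z xs :. (step ^^ m2) Z"
    using assms(2)[unfolded fin_def] by (elim exE)
  note m2 = this[rule_format]
  obtain m3 where "ALL Z xs. good Z --> length xs = n --> (\<forall>x\<in>set xs. x :. Z) --> H Z xs :. (step ^^ m3) Z"
    using assms(3)[unfolded fin_def] by (elim exE)
  note m3 = this[rule_format]
  let ?M = "m1 + m2 + m3"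
  have "OP (std_num k) (F Z xs) (G Z xs) (H Z xs) :. (step ^^ (Suc (m + ?M))) Z"
    if h: "good Z" "length xs = n" "\<forall>x\<in>set xs. x :. Z" for Z xs
  proof -
    let ?Y = "(step ^^ ?M) Z"
    have Y: "good ?Y" "Z \<^bold>\<subseteq> ?Y" using good_steps[OF h(1)] steps_mono by (auto intro!: subI)
    have in': "F Z xs :. ?Y" "G Z xs :. ?Y" "H Z xs :. ?Y"
      using steps_le[OF _ m1[OF h(1,2)]] steps_le[OF _ m2[OF h(1,2)]] steps_le[OF _ m3[OF h(1,2)]] h(3) by simp_all
    have "OP (std_num k) (F Z xs) (G Z xs) (H Z xs) \<^bold>\<subseteq> (step ^^ m) ?Y" by (rule assms(4)[OF h Y in'])
    then have "OP (std_num k) (F Z xs) (G Z xs) (H Z xs) :. step ((step ^^ m) ?Y)"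
      by (intro OP_step good_steps Y steps_mono in')
    then show ?thesis by (simp add: funpow_add)
  qed
  then show ?thesis unfolding fin_def by blast
qed

lemma fin_self: "fin (%Z xs. Z) n" unfolding fin_def by (rule exI[of _ 1]) (simp add: mem_step)
lemma fin_nth: "i < n ==> fin (%Z xs. xs ! i) n" unfolding fin_def by (rule exI[of _ 0]) simp
lemma fin_std: "fin (%Z xs. std_num k) n" unfolding fin_def by (rule exI[of _ 0]) (simp add: good_std)
lemma fin_tl: assumes "fin F n" shows "fin (%Z xs. F Z (tl xs)) (Suc n)"
  using assms unfolding fin_def by (metis length_tl diff_Suc_1 list.set_sel(2) tl_Nil)

lemma good_trans: "good Y ==> x :. Y ==> z :. x ==> z :. Y" using transD by (auto simp: good_def)

lemma fin_upair: "fin F n ==> fin G n ==> fin (%Z xs. upair (F Z xs) (G Z xs)) n"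
  by (rule fin_OP[of F n G G 0 0, unfolded OP_simps], assumption+, rule subI, auto)
lemma fin_diff: "fin F n ==> fin G n ==> fin (%Z xs. diff (F Z xs) (G Z xs)) n"
  by (rule fin_OP[of F n G G 1 0, unfolded OP_simps], assumption+, rule subI, simp, metis good_trans)
lemma fin_inter: "fin F n ==> fin G n ==> fin (%Z xs. inter (F Z xs) (G Z xs)) n"
  unfolding inter_def by (intro fin_diff)
lemma fin_msel: "fin F n ==> fin G n ==> fin H n ==> fin (%Z xs. msel (F Z xs) (G Z xs) (H Z xs)) n"
  by (rule fin_OP[of F n G H 3 0, unfolded OP_simps], assumption+, rule subI, simp, metis good_trans)
lemma fin_esel: "fin F n ==> fin G n ==> fin H n ==> fin (%Z xs. esel (F Z xs) (G Z xs) (H Z xs)) n"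
  by (rule fin_OP[of F n G H 4 0, unfolded OP_simps], assumption+, rule subI, simp, metis good_trans)
lemma fin_xsel: "fin F n ==> fin G n ==> fin (%Z xs. xsel (F Z xs) (G Z xs)) n"
  by (rule fin_OP[of F n G G 5 0, unfolded OP_simps], assumption+, rule subI, simp, metis good_trans)

lemma opair_step2: assumes "good Y" "q :. Y" "r :. Y" shows "opair q r :. step (step Y)"
proof -
  have 1: "upair x y :. step Y" if "x :. Y" "y :. Y" "good Y" for x y Y
    using OP_step[OF that(3,1,2,1), of 0, unfolded OP_simps] that by (simp add: subset_def)
  show ?thesis unfolding opair_def by (intro 1 assms good_step)
qed
lemma adj1_step3: assumes "good Y" "p :. Y" "q :. Y" "r :. Y" shows "adj1 p q r :. (step ^^ 3) Y"
proof -
  let ?Z = "step (step Y)"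
  have *: "x :. Y ==> x :. ?Z" for x by (simp add: mem_step)
  have "adj1 p q r \<^bold>\<subseteq> ?Z" using opair_step2[OF assms(1,3,4)] *[OF good_trans[OF assms(1,2)]] by (auto intro!: subI)
  then have "adj1 p q r :. step ?Z"
    using OP_step[OF good_step[OF good_step[OF assms(1)]] *[OF assms(2)] *[OF assms(3)] *[OF assms(4)], of 6, unfolded OP_simps] by blast
  then show ?thesis by (simp add: eval_nat_numeral)
qed
lemma fin_adj1: "fin F n ==> fin G n ==> fin H n ==> fin (%Z xs. adj1 (F Z xs) (G Z xs) (H Z xs)) n"
proof (rule fin_OP[of F n G H 6 2, unfolded OP_simps], assumption+)
  fix Z Y xs assume h: "good Y" "F Z xs :. Y" "G Z xs :. Y" "H Z xs :. Y"
  have "opair (G Z xs) (H Z xs) :. (step ^^ 2) Y" using opair_step2[OF h(1,3,4)] by (simp add: numeral_2_eq_2)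
  moreover have "z :. (step ^^ 2) Y" if "z :. F Z xs" for z using good_trans[OF h(1,2) that] steps_mono by blast
  ultimately show "adj1 (F Z xs) (G Z xs) (H Z xs) \<^bold>\<subseteq> (step ^^ 2) Y" by (auto intro!: subI)
qed
lemma fin_ext1: "fin F n ==> fin G n ==> fin H n ==> fin (%Z xs. ext1 (F Z xs) (G Z xs) (H Z xs)) n"
proof (rule fin_OP[of F n G H 7 3, unfolded OP_simps], assumption+)
  fix Z Y xs assume h: "good Y" "F Z xs :. Y" "G Z xs :. Y" "H Z xs :. Y"
  have "adj1 a (H Z xs) y :. (step ^^ 3) Y" if "a :. F Z xs" "y :. G Z xs" for a y
    by (rule adj1_step3[OF h(1) good_trans[OF h(1,2) that(1)] h(4) good_trans[OF h(1,3) that(2)]])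
  then show "ext1 (F Z xs) (G Z xs) (H Z xs) \<^bold>\<subseteq> (step ^^ 3) Y" by (auto intro!: subI)
qed
lemma fin_vals: "fin F n ==> fin G n ==> fin (%Z xs. vals (F Z xs) (G Z xs)) n"
proof (rule fin_OP[of F n G G 8 0, unfolded OP_simps], assumption+)
  fix Z Y xs assume h: "good Y" "F Z xs :. Y"
  have "z :. Y" if "a :. F Z xs" "opair (G Z xs) z :. a" for a z
    using good_trans[OF h(1) good_trans[OF h that(1)] that(2)] opair_trans(2) h(1) unfolding good_def by blast
  then show "vals (F Z xs) (G Z xs) \<^bold>\<subseteq> (step ^^ 0) Y" by (auto intro!: subI)
qed

text \<open>Keys count from the end of the list. Putting an entry in front, as happens below a
  quantifier, leaves the keys of the old entries alone, so the longer tuple includes the shorter one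
  as a set.\<close>

primrec tupr :: "'a::zf list => 'a" where
  "tupr [] = empty"
| "tupr (y # ys) = adj1 (tupr ys) (std_num (length ys)) y"

lemma mem_tupr: "opair k z :. tupr ys <-> (\<exists>i<length ys. k = std_num (length ys - Suc i) & z = ys ! i)"
proof (induction ys)
  case (Cons y ys)
  have "(\<exists>i<Suc (length ys). k = std_num (Suc (length ys) - Suc i) & z = (y # ys) ! i) <->
    (k = std_num (length ys) & z = y) | (\<exists>i<length ys. k = std_num (length ys - Suc i) & z = ys ! i)"
    by (auto simp: less_Suc_eq_0_disj)
  then show ?case using Cons by auto
qed simp
lemma mem_tupr': "p :. tupr ys ==> EX k z. p = opair k z"
  by (induction ys) auto

lemma ap_tupr: "i < length ys ==> ap (tupr ys) (std_num (length ys - Suc i)) = ys ! i"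
proof (rule ap_eqI)
  assume i: "i < length ys"
  then show "opair (std_num (length ys - Suc i)) (ys ! i) :. tupr ys" by (auto simp: mem_tupr)
  fix y assume "opair (std_num (length ys - Suc i)) y :. tupr ys"
  then obtain k where k: "k < length ys" "length ys - Suc i = length ys - Suc k" "y = ys ! k" by (auto simp: mem_tupr)
  then have "k = i" using i by arith
  then show "y = ys ! i" using k by simp
qed

text \<open>By this, inclusion between tuples of adjacent lengths means extension by one front
  entry, and \<open>xsel\<close> computes projections.\<close>

lemma tupr_sub: assumes "tupr ys \<^bold>\<subseteq> tupr zs" "length zs = Suc (length ys)" shows "EX y. zs = y # ys"
proof -
  have "zs ! Suc i = ys ! i" if "i < length ys" for i
  proof -
    have "opair (std_num (length ys - Suc i)) (ys ! i) :. tupr zs" using that assms(1) subD mem_tupr by blast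
    then obtain i' where "i' < length zs" "length ys - Suc i = length zs - Suc i'" "ys ! i = zs ! i'" by (auto simp: mem_tupr)
    moreover then have "i' = Suc i" using assms(2) that by auto
    ultimately show ?thesis by simp
  qed
  moreover obtain y zs' where "zs = y # zs'" using assms(2) by (cases zs) auto
  ultimately have "zs' = ys" using assms(2) by (auto intro!: nth_equalityI)
  then show ?thesis using \<open>zs = y # zs'\<close> by blast
qed
lemma tupr_inj: "length ys = length zs ==> tupr ys = tupr zs ==> ys = zs"
proof (induction ys arbitrary: zs)
  case (Cons y ys)
  then obtain z zs' where zs: "zs = z # zs'" by (cases zs) auto
  have "opair k w :. tupr ys <-> opair k w :. tupr (y # ys) & k \<noteq> std_num (length ys)" for k w unfolding mem_tupr by (auto simp: less_Suc_eq_0_disj)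
  moreover have "opair k w :. tupr zs' <-> opair k w :. tupr (z # zs') & k \<noteq> std_num (length zs')" for k w unfolding mem_tupr by (auto simp: less_Suc_eq_0_disj)
  ultimately have "tupr ys = tupr zs'" using Cons.prems zs by (intro set_eqI) (metis length_Cons mem_tupr' nat.inject)
  then have "ys = zs'" using Cons zs by simp
  moreover have "y = z" using ap_tupr[of 0 "y # ys"] ap_tupr[of 0 zs] Cons.prems zs by simp
  ultimately show ?case using zs by simp
qed simp

primrec W :: "nat => 'a::zf => 'a" where
  "W 0 Z = upair empty empty"
| "W (Suc n) Z = ext1 (W n Z) Z (std_num n)"

lemma mem_W: "a :. W n Z <-> (EX ys. length ys = n & (\<forall>y\<in>set ys. y :. Z) & a = tupr ys)"
proof (induction n arbitrary: a)
  case (Suc n)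
  have "a :. W (Suc n) Z <-> (EX ys y. length ys = n & (\<forall>y\<in>set ys. y :. Z) & y :. Z & a = adj1 (tupr ys) (std_num n) y)"
    using Suc by auto
  also have "... <-> (EX ys. length ys = Suc n & (\<forall>y\<in>set ys. y :. Z) & a = tupr ys)"
  proof
    assume "EX ys y. length ys = n & (\<forall>y\<in>set ys. y :. Z) & y :. Z & a = adj1 (tupr ys) (std_num n) y"
    then obtain ys y where "length ys = n" "\<forall>y\<in>set ys. y :. Z" "y :. Z" "a = adj1 (tupr ys) (std_num n) y" by blast
    then show "EX ys. length ys = Suc n & (\<forall>y\<in>set ys. y :. Z) & a = tupr ys" by (intro exI[of _ "y # ys"]) auto
  next
    assume "EX ys. length ys = Suc n & (\<forall>y\<in>set ys. y :. Z) & a = tupr ys"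
    then obtain y ys where "length ys = n" "\<forall>y\<in>set (y # ys). y :. Z" "a = tupr (y # ys)" by (metis length_Suc_conv)
    then show "EX ys y. length ys = n & (\<forall>y\<in>set ys. y :. Z) & y :. Z & a = adj1 (tupr ys) (std_num n) y"
      by (intro exI[of _ ys] exI[of _ y]) simp
  qed
  finally show ?case .
qed auto

text \<open>Truth sets of formulas in \<open>Z\<close> with membership, built by operations of
  \<open>OP\<close> only; the unary predicate is read as empty.\<close>

primrec T :: "fm => nat => 'a::zf => 'a" where
  "T (mMem i j) n Z = msel (W n Z) (std_num (n - Suc i)) (std_num (n - Suc j))"
| "T (mEq i j) n Z = esel (W n Z) (std_num (n - Suc i)) (std_num (n - Suc j))"
| "T (mPr i) n Z = diff (W n Z) (W n Z)"
| "T (mNeg \<phi>) n Z = diff (W n Z) (T \<phi> n Z)"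
| "T (mAnd \<phi> \<psi>) n Z = inter (T \<phi> n Z) (T \<psi> n Z)"
| "T (mEx \<phi>) n Z = xsel (W n Z) (T \<phi> (Suc n) Z)"

lemma tupr_mono: "tupr ys \<^bold>\<subseteq> tupr (y # ys)" by (auto intro!: subI)

lemma T_sub: "T \<phi> n Z \<^bold>\<subseteq> W n Z" by (induction \<phi> arbitrary: n) (auto simp: subset_def)

lemma tupr_W: "length ys = n ==> \<forall>y\<in>set ys. y :. Z ==> tupr ys :. W n Z" using mem_W by blast

lemma mem_T: "fvb \<phi> \<le> n ==> length ys = n ==> \<forall>y\<in>set ys. y :. Z ==>
  tupr ys :. T \<phi> n Z <-> eval (%x. x :. Z) (%_. False) \<phi> (%i. ys ! i)"
proof (induction \<phi> arbitrary: n ys)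
  case (mMem i j)
  then have "tupr ys :. W n Z" "i < n" "j < n" by (auto intro: tupr_W)
  then show ?case using mMem ap_tupr[of i ys] ap_tupr[of j ys] by simp
next
  case (mEq i j)
  then have "tupr ys :. W n Z" "i < n" "j < n" by (auto intro: tupr_W)
  then show ?case using mEq ap_tupr[of i ys] ap_tupr[of j ys] by simp
next
  case (mPr i) then show ?case by simp
next
  case (mNeg \<phi>)
  then have "tupr ys :. W n Z" by (auto intro: tupr_W)
  then show ?case using mNeg by simp
next
  case (mAnd \<phi> \<psi>) then show ?case by simp
next
  case (mEx \<phi>)
  have w: "tupr ys :. W n Z" by (rule tupr_W) (use mEx in auto)
  have ev: "eval (%x. x :. Z) (%_. False) \<phi> (%i. (y # ys) ! i) = eval (%x. x :. Z) (%_. False) \<phi> (case_nat y (%i. ys ! i))" for y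
    by (rule arg_cong[of _ _ "eval (%x. x :. Z) (%_. False) \<phi>"]) (auto split: nat.split simp: nth_Cons)
  have IH: "tupr (y # ys) :. T \<phi> (Suc n) Z <-> eval (%x. x :. Z) (%_. False) \<phi> (case_nat y (%i. ys ! i))" if "y :. Z" for y
    using mEx.IH[of "Suc n" "y # ys"] mEx.prems that unfolding ev by auto
  have "(EX b. b :. T \<phi> (Suc n) Z & tupr ys \<^bold>\<subseteq> b) <-> (EX y. y :. Z & tupr (y # ys) :. T \<phi> (Suc n) Z)"
  proof
    assume "EX b. b :. T \<phi> (Suc n) Z & tupr ys \<^bold>\<subseteq> b"
    then obtain b where b: "b :. T \<phi> (Suc n) Z" "tupr ys \<^bold>\<subseteq> b" by blast
    then obtain zs where zs: "length zs = Suc n" "\<forall>y\<in>set zs. y :. Z" "b = tupr zs" using T_sub subD mem_W by metis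
    then obtain y where "zs = y # ys" using tupr_sub b(2) mEx.prems(2) by metis
    then show "EX y. y :. Z & tupr (y # ys) :. T \<phi> (Suc n) Z" using zs b by auto
  next
    assume "EX y. y :. Z & tupr (y # ys) :. T \<phi> (Suc n) Z"
    then show "EX b. b :. T \<phi> (Suc n) Z & tupr ys \<^bold>\<subseteq> b" using tupr_mono by blast
  qed
  then show ?case using w IH by auto
qed

lemma fin_W: "fin (%Z xs. W n Z) k" by (induction n) (auto intro: fin_upair fin_ext1 fin_self fin_std fin_std[of 0, simplified])
lemma fin_T: "fin (%Z xs. T \<phi> n Z) k"
  by (induction \<phi> arbitrary: n) (auto intro: fin_msel fin_esel fin_diff fin_inter fin_xsel fin_W fin_std)
lemma fin_cong: "fin F n ==> (!!Z xs. length xs = n ==> F Z xs = G Z xs) ==> fin G n" by (simp add: fin_def)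

lemma fin_tupr: "fin (%Z xs::'a::zf list. tupr xs) n"
proof (induction n)
  case 0 show ?case unfolding fin_def by (rule exI[of _ 0]) (use good_std[of _ 0] in auto)
next
  case (Suc n)
  have "fin (%Z xs::'a list. adj1 (tupr (tl xs)) (std_num n) (xs ! 0)) (Suc n)"
    using fin_adj1[OF fin_tl[OF Suc] fin_std[of n] fin_nth[of 0 "Suc n"]] by simp
  then show ?case
  proof (rule fin_cong)
    fix Z and xs :: "'a list" assume "length xs = Suc n"
    then show "adj1 (tupr (tl xs)) (std_num n) (xs ! 0) = tupr xs" by (cases xs) auto
  qed
qed

lemma fvb_ren: "(!!i. f i < k) ==> fvb (ren \<phi> f) \<le> k"
proof (induction \<phi> arbitrary: f k)
  case (mEx \<phi>)
  have "fvb (ren \<phi> (case_nat 0 (%n. Suc (f n)))) \<le> Suc k"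
    by (rule mEx.IH) (use mEx.prems in \<open>auto split: nat.split\<close>)
  then show ?case by simp
next
  case (mMem i j) then show ?case by (simp add: Suc_le_eq)
next
  case (mEq i j) then show ?case by (simp add: Suc_le_eq)
next
  case (mPr i) then show ?case by (simp add: Suc_le_eq)
qed auto

text \<open>A bounded formula means the same in the transitive set \<open>Z\<close> as in the
  universe. So the subset it defines is a slice of a truth set: extend the parameter tuple by all
  elements of \<open>Z\<close>, keep the extensions in the truth set, and collect the values
  added.\<close>

lemma fin_defsep: assumes "d0 P" shows "fin (%Z xs. sep Z (%z. P (%i. (z # xs) ! min i n))) n"
proof -
  obtain \<phi> where \<phi>: "!!e. P e = bev mem (=) \<phi> e" using assms by (auto simp: d0_def)
  define \<psi> where "\<psi> = ren (fmb \<phi>) (%i. min i n)"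
  have fv: "fvb \<psi> \<le> Suc n" unfolding \<psi>_def by (rule fvb_ren) simp
  \<comment> \<open>The key \<open>std_num n\<close> belongs to the entry in front of the
    \<open>n\<close> parameters, that is, to variable 0.\<close>
  let ?F = "%Z xs. vals (inter (ext1 (upair (tupr xs) (tupr xs)) Z (std_num n)) (T \<psi> (Suc n) Z)) (std_num n)"
  have "fin ?F n" by (intro fin_vals fin_inter fin_ext1 fin_upair fin_tupr fin_self fin_std fin_T)
  moreover have "?F Z xs = sep Z (%z. P (%i. (z # xs) ! min i n))" if h: "good Z" "length xs = n" "\<forall>x\<in>set xs. x :. Z" for Z xs
  proof (rule set_eqI)
    fix z
    have Dp: "D (%e. P (%i. (e 0 # xs) ! min i n))"
      using rr_D[of n "%ys. P (%i. ys ! min i n)" xs] rr_d0[OF assms, of "Suc n"] h(2) by simp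
    have *: "tupr (z # xs) :. T \<psi> (Suc n) Z <-> P (%i. (z # xs) ! min i n)" if z: "z :. Z" for z
    proof -
      have "tupr (z # xs) :. T \<psi> (Suc n) Z <-> eval (%x. x :. Z) (%_. False) (fmb \<phi>) (%i. (z # xs) ! min i n)"
        using mem_T[OF fv, of "z # xs" Z] h z unfolding \<psi>_def eval_ren by simp
      also have "... <-> bev mem (=) \<phi> (%i. (z # xs) ! min i n)"
      proof (rule eval_fmb)
        show "!!x y. y :. Z ==> x :. y ==> x :. Z" using h(1) good_trans by blast
        have "(z # xs) ! min i n \<in> set (z # xs)" for i by (rule nth_mem) (use h in auto)
        then show "ALL i. (z # xs) ! min i n :. Z" using h z by (metis set_ConsD)
      qed
      finally show ?thesis by (simp add: \<phi>)
    qed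
    have "z :. ?F Z xs <-> (EX y. y :. Z & adj1 (tupr xs) (std_num n) y :. T \<psi> (Suc n) Z & opair (std_num n) z :. adj1 (tupr xs) (std_num n) y)" by auto
    also have "... <-> z :. Z & tupr (z # xs) :. T \<psi> (Suc n) Z" using h(2) by (auto simp: mem_tupr)
    finally show "z :. ?F Z xs <-> z :. sep Z (%z. P (%i. (z # xs) ! min i n))" using * by (auto simp: mem_sep[OF Dp])
  qed
  ultimately show ?thesis unfolding fin_def by metis
qed

text \<open>In the union case it is only clear that the value is a subset of a later stage.
  Rudimentary functions are simple, so membership in the value is a bounded condition, and
  \<open>fin_defsep\<close> turns the subset into an element; this is \<open>key\<close>.\<close>

lemma fin_rud: "rudimentary n f ==> fin (%Z xs. f xs) n"
proof -
  have key: "fin (%Z xs. f xs) n" if r: "rudimentary n f"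
    and b: "EX m. ALL Z xs. good Z --> length xs = n --> (\<forall>x\<in>set xs. x :. Z) --> f xs \<^bold>\<subseteq> (step ^^ m) Z" for n and f :: "'a list => 'a"
  proof -
    obtain m where m: "ALL Z xs. good Z --> length xs = n --> (\<forall>x\<in>set xs. x :. Z) --> f xs \<^bold>\<subseteq> (step ^^ m) Z" using b by blast
    let ?ts = "map (%i e. e (Suc i)) [0..<n]"
    have bt: "bt (%e. f (map (%t. t e) ?ts))" by (rule rud_simple[OF r]) (auto intro: bt_var)
    have "d0 (%e. e 0 :. f (map (%t. t e) ?ts))" by (rule d0_mem[OF bt_var bt])
    from fin_defsep[OF this, of n] obtain m' where "ALL Z xs. good Z --> length xs = n --> (\<forall>x\<in>set xs. x :. Z) -->
      sep Z (%z. (z # xs) ! min 0 n :. f (map (%t. t (%i. (z # xs) ! min i n)) ?ts)) :. (step ^^ m') Z" unfolding fin_def by (elim exE)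
    note m' = this[rule_format]
    have "f xs :. (step ^^ (m' + m)) Z" if h: "good Z" "length xs = n" "\<forall>x\<in>set xs. x :. Z" for Z xs
    proof -
      let ?Y = "(step ^^ m) Z"
      have e: "map (%t. t (%i. (z # xs) ! min i n)) ?ts = xs" for z
        by (rule nth_equalityI) (use h(2) in auto)
      have sub: "z :. f xs ==> z :. ?Y" for z using m[rule_format, OF h(1,2)] h(3) subD by blast
      have "sep ?Y (%z. (z # xs) ! min 0 n :. f (map (%t. t (%i. (z # xs) ! min i n)) ?ts)) = f xs"
        unfolding e by (rule set_eqI, subst mem_sep, simp, (intro Di)[1]) (use sub in auto)
      moreover have "\<forall>x\<in>set xs. x :. ?Y" using h(3) steps_mono by blast
      ultimately show ?thesis using m'[of ?Y xs, OF good_steps[OF h(1)] h(2)] by (simp add: funpow_add)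
    qed
    then show ?thesis unfolding fin_def by blast
  qed
  show "rudimentary n f ==> fin (%Z xs. f xs) n"
  proof (induction n f rule: rudimentary.induct)
    case (rud_proj i n) then show ?case by (rule fin_nth)
  next
    case (rud_diff i n k) then show ?case by (intro fin_diff fin_nth)
  next
    case (rud_pair i n k) then show ?case by (intro fin_upair fin_nth)
  next
    case (rud_comp gs h n)
    obtain mh where "ALL Z xs. good Z --> length xs = length gs --> (\<forall>x\<in>set xs. x :. Z) --> h xs :. (step ^^ mh) Z"
      using rud_comp.IH unfolding fin_def by (elim exE)
    note mh = this[rule_format]
    have "EX M. \<forall>g\<in>set gs'. ALL Z xs. good Z --> length xs = n --> (\<forall>x\<in>set xs. x :. Z) --> g xs :. (step ^^ M) Z"
      if "set gs' \<subseteq> set gs" for gs' using that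
    proof (induction gs')
      case (Cons g gs')
      then obtain M where M: "\<forall>g\<in>set gs'. ALL Z xs. good Z --> length xs = n --> (\<forall>x\<in>set xs. x :. Z) --> g xs :. (step ^^ M) Z" by auto
      have "fin (%Z xs. g xs) n" using Cons.prems rud_comp.IH by auto
      then obtain M' where M': "ALL Z xs. good Z --> length xs = n --> (\<forall>x\<in>set xs. x :. Z) --> g xs :. (step ^^ M') Z" unfolding fin_def by blast
      show ?case
      proof (rule exI[of _ "M + M'"], intro ballI allI impI)
        fix g' Z and xs :: "'a list" assume g': "g' \<in> set (g # gs')" and h: "good Z" "length xs = n" "\<forall>x\<in>set xs. x :. Z"
        show "g' xs :. (step ^^ (M + M')) Z"
        proof (cases "g' = g")
          case True then show ?thesis using steps_le[of M' "M + M'"] M'[rule_format, OF h(1,2)] h(3) by simp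
        next
          case False then show ?thesis using steps_le[of M "M + M'"] M[rule_format, OF _ h(1,2), of g'] h(3) g' by simp
        qed
      qed
    qed simp
    then obtain M where M: "\<forall>g\<in>set gs. ALL Z xs. good Z --> length xs = n --> (\<forall>x\<in>set xs. x :. Z) --> g xs :. (step ^^ M) Z" by blast
    have "h (map (%g. g xs) gs) :. (step ^^ (mh + M)) Z" if h: "good Z" "length xs = n" "\<forall>x\<in>set xs. x :. Z" for Z xs
    proof -
      have "x :. (step ^^ M) Z" if "x \<in> set (map (%g. g xs) gs)" for x using that M[rule_format, OF _ h(1,2)] h(3) by auto
      then show ?thesis using mh[OF good_steps[OF h(1)], of "map (%g. g xs) gs" M] by (simp add: funpow_add)
    qed
    then show ?case unfolding fin_def by blast
  next
    case (rud_union n g)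
    obtain m where "ALL Z xs. good Z --> length xs = Suc n --> (\<forall>x\<in>set xs. x :. Z) --> g xs :. (step ^^ m) Z"
      using rud_union.IH unfolding fin_def by (elim exE)
    note m = this[rule_format]
    show ?case
    proof (rule key[OF rudimentary.rud_union[OF rud_union.hyps]], rule exI[of _ m], intro allI impI)
      fix Z and xs :: "'a list" assume h: "good Z" "length xs = Suc n" "\<forall>x\<in>set xs. x :. Z"
      obtain y ys where xs: "xs = y # ys" using h(2) by (cases xs) auto
      have dg: "dt (%e. g (e 0 # tl xs))" by (rule rf_dt[of n]) (use rud_union.hyps h in \<open>auto simp: rf_def\<close>)
      have "g (z # ys) :. (step ^^ m) Z" if "z :. y" for z
        by (rule m) (use h xs good_trans[OF h(1) _ that] in auto)
      then have "w :. (step ^^ m) Z" if "z :. y" "w :. g (z # ys)" for z w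
        using good_trans[OF good_steps[OF h(1)] _ that(2)] that by blast
      then show "big_union (hd xs) (%z. g (z # tl xs)) \<^bold>\<subseteq> (step ^^ m) Z"
        using mem_big_union[OF dg, of _ "hd xs"] by (intro subI) (auto simp: xs)
    qed
  qed
qed

lemma it_steps: "n :. omega ==> EX k. k :. omega & it X k = (step ^^ m) (it X n)"
proof (induction m)
  case (Suc m)
  then obtain k where "k :. omega" "it X k = (step ^^ m) (it X n)" by blast
  then show ?case by (intro exI[of _ "adjoin_self k"]) simp
qed auto

text \<open>The finitely many arguments lie in a common stage, and standardly many further steps
  along \<open>omega\<close> do not leave the union.\<close>

lemma rud_closed_nx: assumes "good X" shows "rud_closed (nx X)"
  unfolding rud_closed_def
proof (intro allI impI)
  fix n and f :: "'a list => 'a" and xs assume h: "rudimentary n f & length xs = n & (\<forall>x\<in>set xs. x :. nx X)"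
  have "\<forall>x\<in>set xs. x :. nx X" using h by blast
  then have "EX k. k :. omega & (\<forall>x\<in>set xs. x :. it X k)"
  proof (induction xs)
    case Nil show ?case by (rule exI[of _ empty]) simp
  next
    case (Cons x xs)
    then obtain k where k: "k :. omega" "\<forall>x\<in>set xs. x :. it X k" by auto
    obtain l where l: "l :. omega" "x :. it X l" using Cons.prems unfolding mem_nx by auto
    consider "k :. l | k = l" | "l :. k" using Ord_linear[OF Ord_nat[OF k(1)] Ord_nat[OF l(1)]] by blast
    then show ?case
    proof cases
      case 1 then show ?thesis using l k it_mono[OF k(1) l(1)] by (intro exI[of _ l]) auto
    next
      case 2 then show ?thesis using l k it_mono[OF l(1) k(1)] by (intro exI[of _ k]) auto
    qed
  qed
  then obtain k where k: "k :. omega" "\<forall>x\<in>set xs. x :. it X k" by blast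
  have "good (it X k)"
    unfolding good_def using trans_it[OF _ k(1)] assms it_mono[OF empty_omega k(1), of omega X] k(1)
    by (metis Ord_linear Ord_empty Ord_nat good_def it_0 mem_empty)
  then obtain m where "f xs :. (step ^^ m) (it X k)" using fin_rud[of n f] h k unfolding fin_def by metis
  then show "f xs :. nx X" using it_steps[OF k(1)] mem_nx by metis
qed

lemma setof_mem: "setof (%y. y :. a) = a" by (rule set_eqI, subst mem_setof) (auto simp: isset_def)

lemma rud_closure_nx: assumes "good X" shows "rud_closure (adjoin_self X) = nx X"
proof -
  have "(ALL S. adjoin_self X \<^bold>\<subseteq> S & rud_closed S --> y :. S) <-> y :. nx X" for y
  proof
    assume "ALL S. adjoin_self X \<^bold>\<subseteq> S & rud_closed S --> y :. S"
    moreover have "adjoin_self X \<^bold>\<subseteq> nx X" using sub_nx self_nx by (auto intro!: subI)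
    ultimately show "y :. nx X" using rud_closed_nx[OF assms] by blast
  next
    assume y: "y :. nx X"
    show "ALL S. adjoin_self X \<^bold>\<subseteq> S & rud_closed S --> y :. S"
    proof (intro allI impI)
      fix S assume h: "adjoin_self X \<^bold>\<subseteq> S & rud_closed S"
      then have "nx X \<^bold>\<subseteq> S" by (intro nx_least) (auto simp: subset_def)
      then show "y :. S" using y subD by blast
    qed
  qed
  then show ?thesis unfolding rud_closure_def by (simp add: setof_mem)
qed

section \<open>The hierarchies\<close>

text \<open>The operator \<open>transrec\<close> is a definite description and works with
  \<open>app\<close>, which is arbitrary outside the domain. It is therefore only assumed that
  \<open>G'\<close> agrees with the recursion at an actual function whose earlier values are
  right.\<close>

lemma transrec_recr: assumes "loc G" "D (%e. e 0 = G (e 1) (ap (e 2)))" "transitive (adjoin_self a)"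
  and "!!f b. fun_on f (adjoin_self a) ==> b :. adjoin_self a ==> (!!c. c :. b ==> app f c = recr G c) ==> G' b (app f) = recr G b"
  shows "transrec G' a = recr G a"
proof -
  let ?T = "adjoin_self a"
  have dtr: "dt (%e. recr G (e 0))"
    using dt_recr[of "%_. G" "%e. empty" "%e. e 0"] assms(1) D_ren[OF assms(2), of "%n. if n = 0 then 0 else Suc n"]
    by (simp add: dt_const dt_var numeral_2_eq_2 numeral_3_eq_3)
  have Dr: "D (%e. e 0 = recr G (e 1))" using dtr D_ren[of "%e. e 0 = recr G (e (Suc 0))" "%n. n"] by (simp add: dt_def)
  define h where "h = lam ?T (recr G)"
  have h: "fun_on h ?T" "x :. ?T ==> app h x = recr G x" for x
    using fun_on_lam[OF dtr] ap_lam[OF dtr] fun_onD(3) unfolding h_def by metis+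
  have eqf: "app f b = recr G b" if f: "fun_on f ?T" "ALL b. b :. ?T --> app f b = G' b (app f)" and b: "b :. ?T" for f b
  proof (rule ccontr)
    assume n: "app f b \<noteq> recr G b"
    have Dn: "D (%e. ap f (e 0) \<noteq> recr G (e 0))"
      by (rule D_not, rule D_eq[OF dt_ap[OF dt_const dt_var] dtr])
    obtain b where b: "b :. ?T" "ap f b \<noteq> recr G b" "ALL c. c :. ?T & c :. b --> ~ ap f c \<noteq> recr G c"
      using foundation[OF Dn b] n fun_onD(3)[OF f(1) b] by auto
    then have "app f c = recr G c" if "c :. b" for c
      using that transD[OF assms(3) b(1) that] fun_onD(3)[OF f(1), of c] by auto
    then have "G' b (app f) = recr G b" by (intro assms(4)[OF f(1) b(1)])
    then show False using f(2)[rule_format, OF b(1)] b(2) fun_onD(3)[OF f(1) b(1)] by metis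
  qed
  have G'h: "app h b = G' b (app h)" if "b :. ?T" for b
    using assms(4)[OF h(1) that] h(2) transD[OF assms(3) that] that by metis
  show ?thesis unfolding transrec_def
  proof (rule the_equality)
    show "EX f. fun_on f ?T & (ALL b. b :. ?T --> app f b = G' b (app f)) & recr G a = app f a"
      using h G'h by (intro exI[of _ h]) auto
    fix y assume "EX f. fun_on f ?T & (ALL b. b :. ?T --> app f b = G' b (app f)) & y = app f a"
    then show "y = recr G a" using eqf by auto
  qed
qed

section \<open>The cumulative hierarchy and its closure properties\<close>

definition VG :: "'a::zf => ('a => 'a) => 'a" where "VG b F = setof (%x. EX c. c :. b & x \<^bold>\<subseteq> F c)"

lemma loc_VG: "loc VG" unfolding loc_def VG_def
proof (intro allI impI)
  fix x S :: 'a and F F' :: "'a => 'a" assume h: "transitive S & x \<^bold>\<subseteq> S & (ALL z. z :. S --> F z = F' z)"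
  have "(%y. EX c. c :. x & y \<^bold>\<subseteq> F c) = (%y. EX c. c :. x & y \<^bold>\<subseteq> F' c)" using h subD by metis
  then show "setof (%y. EX c. c :. x & y \<^bold>\<subseteq> F c) = setof (%y. EX c. c :. x & y \<^bold>\<subseteq> F' c)" by simp
qed
lemma isset_VG: assumes "dt (%e. F (e 0))" shows "isset (%x. EX c. c :. b & x \<^bold>\<subseteq> F c)"
  by (rule isset_sub[of _ "pw (big_union b F)"])
    (intro D_ex D_and D_mem D_sub dt_app1[OF assms] dt_var dt_const, auto simp: subset_def mem_big_union[OF assms])
lemma D_VG: "D (%e. e 0 = VG (e 1) (ap (e 2)))"
proof -
  have "dt (%e. VG (e 0) (ap (e 1)))" unfolding VG_def
    by (rule dt_setof[of "%e x. EX c. c :. e 0 & x \<^bold>\<subseteq> ap (e 1) c"], (intro Di)[1], rule isset_VG, intro Di)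
  then show ?thesis by (simp add: dt_def numeral_2_eq_2)
qed
lemma dt_VV: "dt (%e. recr VG (e 0))"
  using dt_recr[of "%_. VG" "%e. empty" "%e. e 0"] loc_VG D_ren[OF D_VG, of "%n. if n = 0 then 0 else Suc n"]
  by (simp add: dt_const dt_var numeral_2_eq_2 numeral_3_eq_3)

lemma V_level_recr: "Ord a ==> V_level a = recr VG a"
  unfolding V_level_def
proof (rule transrec_recr[OF loc_VG D_VG])
  assume a: "Ord a"
  then show "transitive (adjoin_self a)" using Ord_adj Ord_def by blast
  fix f b assume f: "fun_on f (adjoin_self a)" "b :. adjoin_self a" "!!c. c :. b ==> app f c = recr VG c"
  then have "transitive b" using a unfolding Ord_def by auto
  then have "VG b (app f) = VG b (recr VG)" using f(3) loc_VG unfolding loc_def by (metis sub_refl)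
  then have "VG b (app f) = recr VG b" using recr_unfold[OF loc_VG D_VG, of b] by metis
  then show "setof (%x. EX c. c :. b & x \<^bold>\<subseteq> app f c) = recr VG b" unfolding VG_def[of b "app f"] .
qed

lemma mem_V: assumes "Ord a" shows "x :. V_level a <-> (EX c. c :. a & x \<^bold>\<subseteq> V_level c)"
proof -
  have "x :. recr VG a <-> (EX c. c :. a & x \<^bold>\<subseteq> recr VG c)"
    unfolding recr_unfold[OF loc_VG D_VG, of a] VG_def[of a] by (rule mem_setof[OF isset_VG[OF dt_VV]])
  then show ?thesis using V_level_recr assms Ord_mem by metis
qed

lemma V_mono: "Ord a ==> b :. a ==> x :. V_level b ==> x :. V_level a"
  using mem_V Ord_trans Ord_mem by metis
lemma V_trans: assumes "Ord a" shows "transitive (V_level a)"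
proof (rule transI)
  fix y z assume "y :. V_level a" "z :. y"
  then obtain c where "c :. a" "z :. V_level c" using mem_V[OF assms] subD by blast
  then show "z :. V_level a" using V_mono assms by blast
qed
lemma V_mem: "Ord a ==> b :. a ==> V_level b :. V_level a" using mem_V sub_refl by blast
lemma Ord_sub_V: assumes "Ord a" shows "a \<^bold>\<subseteq> V_level a"
proof -
  have "a \<^bold>\<subseteq> recr VG a" using assms
  proof (rule ord_induct)
    show "D (%e. e 0 \<^bold>\<subseteq> recr VG (e 0))" by (rule D_sub[OF dt_var dt_VV])
    fix a assume a: "Ord a" "!!b. b :. a ==> b \<^bold>\<subseteq> recr VG b"
    then show "a \<^bold>\<subseteq> recr VG a" by (intro subI) (metis V_level_recr mem_V Ord_mem)
  qed
  then show ?thesis using V_level_recr[OF assms] by simp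
qed

text \<open>The closure properties of ranks of limit height above \<open>omega\<close> on which the
  argument rests. They are first order, so they can be expressed inside such a set about its
  elements; see \<open>Bu\<close>.\<close>

definition Base :: "'a::zf => bool" where
  "Base U <-> transitive U & omega :. U & (ALL x. x :. U --> pw x :. U) & (ALL x y. x :. U & y :. U --> upair x y :. U) & (ALL x. x :. U --> set_union x :. U) & Form :. U"

lemma V_upair: assumes "Limit d" "x :. V_level d" "y :. V_level d" shows "upair x y :. V_level d"
proof -
  have o: "Ord d" and L: "c :. d ==> adjoin_self c :. d" for c using assms(1) by (auto simp: Limit_def)
  obtain c c' where c: "c :. d" "x \<^bold>\<subseteq> V_level c" "c' :. d" "y \<^bold>\<subseteq> V_level c'" using assms(2,3) mem_V[OF o] by auto
  have oc: "Ord c" "Ord c'" using c o Ord_mem by blast+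
  have xy: "x :. V_level (adjoin_self c)" "y :. V_level (adjoin_self c')" using mem_V[of "adjoin_self c"] mem_V[of "adjoin_self c'"] c oc by auto
  have "EX b. b :. d & Ord b & x :. V_level b & y :. V_level b"
    using Ord_linear[of "adjoin_self c" "adjoin_self c'"] V_mono xy oc L c Ord_adj by metis
  then obtain b where "b :. d" "x :. V_level b" "y :. V_level b" by blast
  then show ?thesis unfolding mem_V[OF o] by (intro exI[of _ b]) (auto intro!: subI)
qed

section \<open>Jensen's hierarchy\<close>

definition JG :: "'a::zf => 'a => ('a => 'a) => 'a" where
  "JG U b F = (if b = empty then adjoin_self U else if Limit b then big_union b F
    else if EX m. m :. b & b = adjoin_self m then nx (F (pd b)) else empty)"
definition JJ :: "'a::zf => 'a => 'a" where "JJ U b = recr (JG U) b"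

lemma big_union_cong: "(!!z. z :. a ==> F z = F' z) ==> big_union a F = big_union a F'"
proof -
  assume "!!z. z :. a ==> F z = F' z"
  then have "(%w. EX z. z :. a & w :. F z) = (%w. EX z. z :. a & w :. F' z)" by metis
  then show ?thesis by (simp add: big_union_def)
qed
lemma loc_JG: "loc (JG U)" unfolding loc_def JG_def
proof (intro allI impI)
  fix x S :: 'a and F F' :: "'a => 'a" assume h: "transitive S & x \<^bold>\<subseteq> S & (ALL z. z :. S --> F z = F' z)"
  then have 1: "z :. x ==> F z = F' z" for z using subD by metis
  then have "big_union x F = big_union x F'" by (rule big_union_cong)
  moreover have "(EX m. m :. x & x = adjoin_self m) ==> F (pd x) = F' (pd x)" using 1 by auto
  ultimately show "(if x = empty then adjoin_self U else if Limit x then big_union x F else if EX m. m :. x & x = adjoin_self m then nx (F (pd x)) else empty) =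
    (if x = empty then adjoin_self U else if Limit x then big_union x F' else if EX m. m :. x & x = adjoin_self m then nx (F' (pd x)) else empty)" by (cases "EX m. m :. x & x = adjoin_self m") (simp_all only: if_True if_False)
qed
lemma D_JG: "D (%e. e 0 = JG (e 1) (e 2) (ap (e 3)))" unfolding JG_def by (intro Di)
lemma D_JG': "D (%e. e 0 = JG U (e 1) (ap (e 2)))" unfolding JG_def by (intro Di)
lemma dt_JJ [Di]: "dt s ==> dt t ==> dt (%e. JJ (s e) (t e))" unfolding JJ_def by (rule dt_recr[OF loc_JG D_JG])
lemma JJ_unfold: "JJ U b = JG U b (JJ U)" unfolding JJ_def by (rule recr_unfold[OF loc_JG D_JG'])
lemma JJ_0 [simp]: "JJ U empty = adjoin_self U" by (subst JJ_unfold) (simp add: JG_def)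
lemma JJ_Suc [simp]: "JJ U (adjoin_self b) = nx (JJ U b)" by (subst JJ_unfold) (auto simp: JG_def Limit_not_adj)
lemma mem_JJ_Limit: assumes "Limit b" shows "x :. JJ U b <-> (EX c. c :. b & x :. JJ U c)"
proof -
  have "b \<noteq> empty" using assms by (simp add: Limit_def)
  moreover have "x :. big_union b (JJ U) <-> (EX c. c :. b & x :. JJ U c)" by (rule mem_big_union) (intro Di)
  ultimately show ?thesis using assms by (subst JJ_unfold) (simp add: JG_def)
qed

lemma good_JJ: assumes "transitive U" "omega :. U" "Ord b" shows "good (JJ U b)"
  using assms(3)
proof (rule ord_induct)
  show "D (%e. good (JJ U (e 0)))" unfolding good_def by (intro Di)
  fix b assume b: "Ord b" "!!c. c :. b ==> good (JJ U c)"
  consider "b = empty" | "Limit b" | c where "c :. b" "b = adjoin_self c" using Ord_cases[OF b(1)] by blast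
  then show "good (JJ U b)"
  proof cases
    case 1 then show ?thesis using assms by (auto simp: good_def intro!: transI dest: transD)
  next
    case 2
    then obtain c where "c :. b" unfolding Limit_def using ne_emptyD by blast
    moreover have "transitive (JJ U b)" by (rule transI) (use 2 b(2) good_trans mem_JJ_Limit in blast)
    ultimately show ?thesis using b(2) mem_JJ_Limit[OF 2] by (auto simp: good_def)
  next
    case 3 then show ?thesis using b(2) trans_nx sub_nx by (auto simp: good_def)
  qed
qed

lemma JJ_mem: assumes "transitive U" "omega :. U" "Ord b" "c :. b" shows "JJ U c :. JJ U b"
proof -
  have "ALL c. c :. b --> JJ U c :. JJ U b" using assms(3)
  proof (rule ord_induct)
    show "D (%e. ALL c. c :. e 0 --> JJ U c :. JJ U (e 0))" by (intro Di)
    fix b assume b: "Ord b" "!!d. d :. b ==> ALL c. c :. d --> JJ U c :. JJ U d"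
    consider "b = empty" | "Limit b" | c where "c :. b" "b = adjoin_self c" using Ord_cases[OF b(1)] by blast
    then show "ALL c. c :. b --> JJ U c :. JJ U b"
    proof cases
      case 1 then show ?thesis by simp
    next
      case 2
      then show ?thesis using mem_JJ_Limit[OF 2] self_nx JJ_Suc unfolding Limit_def by metis
    next
      case 3 then show ?thesis using b(2)[OF 3(1)] self_nx sub_nx by auto
    qed
  qed
  then show ?thesis using assms(4) by blast
qed

lemma J_level_JJ: assumes "transitive U" "omega :. U" "Ord a" shows "J_level U a = JJ U a"
  unfolding J_level_def JJ_def
proof (rule transrec_recr[OF loc_JG D_JG'])
  show "transitive (adjoin_self a)" using assms(3) Ord_adj Ord_def by blast
  fix f b assume f: "fun_on f (adjoin_self a)" "b :. adjoin_self a" "!!c. c :. b ==> app f c = recr (JG U) c"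
  then have b: "Ord b" using assms(3) Ord_adj Ord_mem by blast
  have f': "c :. b ==> app f c = JJ U c" for c using f(3) by (simp add: JJ_def)
  have "(if b = empty then adjoin_self U else if Limit b then big_union b (app f) else rud_closure (adjoin_self (app f (set_union b)))) = JJ U b"
  proof (cases "b = empty | Limit b")
    case True then show ?thesis using big_union_cong[of b "app f" "JJ U"] f' by (subst JJ_unfold) (auto simp: JG_def)
  next
    case False
    then obtain c where c: "c :. b" "Ord c" "b = adjoin_self c" using Ord_cases[OF b] by blast
    then have "set_union b = c" using union_adj Ord_def by blast
    then show ?thesis using False c f' rud_closure_nx[OF good_JJ[OF assms(1,2) c(2)]] by simp
  qed
  then show "(if b = empty then adjoin_self U else if Limit b then big_union b (app f) else rud_closure (adjoin_self (app f (set_union b)))) = recr (JG U) b"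
    by (simp add: JJ_def)
qed

lemma JJ_sub: assumes "transitive U" "omega :. U" "Ord b" "c :. b" "x :. JJ U c" shows "x :. JJ U b"
  using JJ_mem[OF assms(1-4)] good_trans[OF good_JJ[OF assms(1-3)]] assms(5) by blast

section \<open>Coded formulas\<close>

lemmas code_defs = cMem_def cEq_def cNeg_def cAnd_def cEx_def
lemma code_inj: "cMem i k = cMem i' k' <-> i = i' & k = k'" "cEq i k = cEq i' k' <-> i = i' & k = k'"
  "cNeg p = cNeg p' <-> p = p'" "cAnd p q = cAnd p' q' <-> p = p' & q = q'" "cEx i p = cEx i' p' <-> i = i' & p = p'"
  "cMem i k \<noteq> cEq i' k'" "cMem i k \<noteq> cNeg p" "cMem i k \<noteq> cAnd p q" "cMem i k \<noteq> cEx i' p"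
  "cEq i k \<noteq> cMem i' k'" "cEq i k \<noteq> cNeg p" "cEq i k \<noteq> cAnd p q" "cEq i k \<noteq> cEx i' p"
  "cNeg p \<noteq> cMem i k" "cNeg p \<noteq> cEq i k" "cNeg p \<noteq> cAnd p' q" "cNeg p \<noteq> cEx i p'"
  "cAnd p q \<noteq> cMem i k" "cAnd p q \<noteq> cEq i k" "cAnd p q \<noteq> cNeg p'" "cAnd p q \<noteq> cEx i p'"
  "cEx i p \<noteq> cMem i' k" "cEx i p \<noteq> cEq i' k" "cEx i p \<noteq> cNeg p'" "cEx i p \<noteq> cAnd p' q"
  unfolding code_defs opair_inj std_inj by auto

lemma dt_codes [Di]: "dt s ==> dt t ==> dt (%e. cMem (s e) (t e))" "dt s ==> dt t ==> dt (%e. cEq (s e) (t e))"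
  "dt s ==> dt (%e. cNeg (s e))" "dt s ==> dt t ==> dt (%e. cAnd (s e) (t e))" "dt s ==> dt t ==> dt (%e. cEx (s e) (t e))"
  unfolding code_defs by (intro Di, assumption+)+
lemma bt_codes [Bi]: "bt s ==> bt t ==> bt (%e. cMem (s e) (t e))" "bt s ==> bt t ==> bt (%e. cEq (s e) (t e))"
  "bt s ==> bt (%e. cNeg (s e))" "bt s ==> bt t ==> bt (%e. cAnd (s e) (t e))" "bt s ==> bt t ==> bt (%e. cEx (s e) (t e))"
  unfolding code_defs by (intro Bi, assumption+)+
lemma D_bc [Di]: "dt t ==> D (%e. boolean_closed (t e))"
  by (rule D_app1, unfold boolean_closed_def, (intro Di)[1])

lemma Vw: "n :. omega ==> n :. V_level omega" using Ord_sub_V[OF Ord_omega] subD by blast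
lemma Vw_opair: "x :. V_level omega ==> y :. V_level omega ==> opair x y :. V_level omega"
  unfolding opair_def by (intro V_upair Limit_omega)
text \<open>A set closed under the formation rules bounds the intersections that define
  \<open>Form\<close> and \<open>Sigma0\<close>, so that they are sets.\<close>

lemma bc_Vw: "boolean_closed (V_level omega)" "i :. omega ==> p :. V_level omega ==> cEx i p :. V_level omega"
  unfolding boolean_closed_def code_defs by (auto intro!: Vw_opair intro: Vw std_omega simp del: std_num.simps)

lemma mem_Form: "p :. Form <-> (ALL S. boolean_closed S & (ALL i q. i :. omega & q :. S --> cEx i q :. S) --> p :. S)"
  unfolding Form_def
  by (rule mem_setof, rule isset_sub[of _ "V_level omega"], (intro Di)[1]) (use bc_Vw in blast)
lemma bcD: "boolean_closed S ==> i :. omega ==> k :. omega ==> cMem i k :. S" "boolean_closed S ==> i :. omega ==> k :. omega ==> cEq i k :. S"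
  "boolean_closed S ==> p :. S ==> cNeg p :. S" "boolean_closed S ==> p :. S ==> q :. S ==> cAnd p q :. S"
  by (simp_all add: boolean_closed_def)
lemma mem_Sigma0: "p :. Sigma0 <-> (ALL S. boolean_closed S &
     (ALL i k \<psi>. i :. omega & k :. omega & i \<noteq> k & \<psi> :. S --> cEx i (cAnd (cMem i k) \<psi>) :. S) --> p :. S)"
proof -
  have "p :. S ==> i :. omega ==> k :. omega ==> boolean_closed S ==> cAnd (cMem i k) p :. S" for p S i k :: 'a by (simp add: bcD)
  then have "i :. omega ==> k :. omega ==> p :. V_level omega ==> cEx i (cAnd (cMem i k) p) :. V_level omega" for i k p :: 'a
    using bc_Vw by blast
  then show ?thesis unfolding Sigma0_def
    by (intro mem_setof isset_sub[of _ "V_level omega"], (intro Di)[1]) (use bc_Vw in blast)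
qed

lemma bcI: "(!!i k. i :. omega ==> k :. omega ==> cMem i k :. S) ==> (!!i k. i :. omega ==> k :. omega ==> cEq i k :. S) ==>
  (!!p. p :. S ==> cNeg p :. S) ==> (!!p q. p :. S ==> q :. S ==> cAnd p q :. S) ==> boolean_closed S"
  by (simp add: boolean_closed_def)

lemma Form_intros: "i :. omega ==> k :. omega ==> cMem i k :. Form" "i :. omega ==> k :. omega ==> cEq i k :. Form"
  "p :. Form ==> cNeg p :. Form" "p :. Form ==> q :. Form ==> cAnd p q :. Form" "i :. omega ==> p :. Form ==> cEx i p :. Form"
  by (simp_all add: mem_Form bcD)
lemma Sigma0_intros: "i :. omega ==> k :. omega ==> cMem i k :. Sigma0" "i :. omega ==> k :. omega ==> cEq i k :. Sigma0"
  "p :. Sigma0 ==> cNeg p :. Sigma0" "p :. Sigma0 ==> q :. Sigma0 ==> cAnd p q :. Sigma0"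
  "i :. omega ==> k :. omega ==> i \<noteq> k ==> p :. Sigma0 ==> cEx i (cAnd (cMem i k) p) :. Sigma0"
  by (simp_all add: mem_Sigma0 bcD)

lemma Form_induct: assumes "p :. Form" "D (%e. P (e 0))" "!!i k. i :. omega ==> k :. omega ==> P (cMem i k)" "!!i k. i :. omega ==> k :. omega ==> P (cEq i k)"
  "!!p. p :. Form ==> P p ==> P (cNeg p)" "!!p q. p :. Form ==> q :. Form ==> P p ==> P q ==> P (cAnd p q)"
  "!!i p. i :. omega ==> p :. Form ==> P p ==> P (cEx i p)" shows "P p"
proof -
  have m: "x :. sep Form P <-> x :. Form & P x" for x by (rule mem_sep[OF assms(2)])
  have "boolean_closed (sep Form P)" by (rule bcI) (simp_all add: m assms(3-7) Form_intros)
  moreover have "ALL i q. i :. omega & q :. sep Form P --> cEx i q :. sep Form P" by (simp add: m assms(3-7) Form_intros)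
  ultimately have "p :. sep Form P" using mem_Form[THEN iffD1, OF assms(1)] by simp
  then show ?thesis using m by blast
qed
lemma Sigma0_induct: assumes "p :. Sigma0" "D (%e. P (e 0))" "!!i k. i :. omega ==> k :. omega ==> P (cMem i k)" "!!i k. i :. omega ==> k :. omega ==> P (cEq i k)"
  "!!p. p :. Sigma0 ==> P p ==> P (cNeg p)" "!!p q. p :. Sigma0 ==> q :. Sigma0 ==> P p ==> P q ==> P (cAnd p q)"
  "!!i k p. i :. omega ==> k :. omega ==> i \<noteq> k ==> p :. Sigma0 ==> P p ==> P (cEx i (cAnd (cMem i k) p))" shows "P p"
proof -
  have m: "x :. sep Sigma0 P <-> x :. Sigma0 & P x" for x by (rule mem_sep[OF assms(2)])
  have "boolean_closed (sep Sigma0 P)" by (rule bcI) (simp_all add: m assms(3-7) Sigma0_intros)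
  moreover have "ALL i k \<psi>. i :. omega & k :. omega & i \<noteq> k & \<psi> :. sep Sigma0 P --> cEx i (cAnd (cMem i k) \<psi>) :. sep Sigma0 P"
    by (simp add: m assms(3-7) Sigma0_intros)
  ultimately have "p :. sep Sigma0 P" using mem_Sigma0[THEN iffD1, OF assms(1)] by simp
  then show ?thesis using m by blast
qed
lemma Sigma0_Form: assumes "p :. Sigma0" shows "p :. Form"
  using assms by (rule Sigma0_induct) ((intro Di)[1], auto intro: Form_intros)

lemma mem_Sigma1: "p :. Sigma1 <-> (ALL S. Sigma0 \<^bold>\<subseteq> S & (ALL i \<psi>. i :. omega & \<psi> :. S --> cEx i \<psi> :. S) --> p :. S)"
  unfolding Sigma1_def
  by (rule mem_setof, rule isset_sub[of _ Form], (intro Di)[1]) (drule spec[of _ Form], simp add: subset_def Sigma0_Form Form_intros)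
lemma dt_cAll [Di]: "dt s ==> dt t ==> dt (%e. cAll (s e) (t e))" unfolding cAll_def by (intro Di)
lemma mem_Pi1: "p :. Pi1 <-> (ALL S. Sigma0 \<^bold>\<subseteq> S & (ALL i \<psi>. i :. omega & \<psi> :. S --> cAll i \<psi> :. S) --> p :. S)"
  unfolding Pi1_def
  by (rule mem_setof, rule isset_sub[of _ Form], (intro Di)[1]) (drule spec[of _ Form], simp add: subset_def cAll_def Sigma0_Form Form_intros)

lemma Sigma1_induct: assumes "p :. Sigma1" "D (%e. P (e 0))" "!!p. p :. Sigma0 ==> P p" "!!i p. i :. omega ==> p :. Form ==> P p ==> P (cEx i p)"
  shows "p :. Form & P p"
proof -
  have m: "x :. sep Form P <-> x :. Form & P x" for x by (rule mem_sep[OF assms(2)])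
  have "Sigma0 \<^bold>\<subseteq> sep Form P" "ALL i \<psi>. i :. omega & \<psi> :. sep Form P --> cEx i \<psi> :. sep Form P"
    by (simp_all add: subset_def m assms(3,4) Sigma0_Form Form_intros)
  then have "p :. sep Form P" using mem_Sigma1[THEN iffD1, OF assms(1), rule_format, of "sep Form P"] by simp
  then show ?thesis using m by blast
qed
lemma Pi1_induct: assumes "p :. Pi1" "D (%e. P (e 0))" "!!p. p :. Sigma0 ==> P p" "!!i p. i :. omega ==> p :. Form ==> P p ==> P (cAll i p)"
  shows "p :. Form & P p"
proof -
  have m: "x :. sep Form P <-> x :. Form & P x" for x by (rule mem_sep[OF assms(2)])
  have "Sigma0 \<^bold>\<subseteq> sep Form P" "ALL i \<psi>. i :. omega & \<psi> :. sep Form P --> cAll i \<psi> :. sep Form P"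
    by (simp add: subset_def m assms(3) Sigma0_Form) (simp add: m cAll_def Form_intros assms(4)[unfolded cAll_def])
  then have "p :. sep Form P" using mem_Pi1[THEN iffD1, OF assms(1), rule_format, of "sep Form P"] by simp
  then show ?thesis using m by blast
qed

section \<open>Assignments and satisfaction\<close>

lemma isset_upd: "isset (%p. p = opair i a | (p :. s & (ALL y. p \<noteq> opair i y)))"
  by (rule isset_sub[of _ "adj1 s i a"], (intro Di)[1]) auto
lemma mem_upd: "p :. upd s i a <-> p = opair i a | (p :. s & (ALL y. p \<noteq> opair i y))"
  unfolding upd_def by (rule mem_setof[OF isset_upd])
lemma dt_upd [Di]: "dt s ==> dt t ==> dt u ==> dt (%e. upd (s e) (t e) (u e))"
  by (rule dt_app3, unfold upd_def, rule dt_setof, (intro Di)[1], rule isset_upd)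
lemma ap_upd [simp]: "ap (upd s i a) k = (if k = i then a else ap s k)"
  by (rule set_eqI) (auto simp: mem_ap mem_upd)

lemma maps_iff: "maps f A B <-> fun_on f A & (ALL x. x :. A --> ap f x :. B)"
  unfolding maps_def using fun_onD(3) by metis
lemma D_maps [Di]: "dt s ==> dt t ==> dt u ==> D (%e. maps (s e) (t e) (u e))"
  by (rule D_app3[of maps], unfold maps_iff, (intro Di)[1])
lemma fun_on_upd: assumes "fun_on s A" "i :. A" shows "fun_on (upd s i a) A"
  unfolding fun_on_def
proof (intro conjI allI impI)
  show "EX x y. x :. A & p = opair x y" if "p :. upd s i a" for p using that assms unfolding mem_upd fun_on_def by blast
  fix x assume "x :. A"
  then have "EX! y. opair x y :. s" using assms(1) unfolding fun_on_def by blast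
  then show "EX! y. opair x y :. upd s i a" by (cases "x = i") (auto simp: mem_upd)
qed
lemma maps_upd: "maps s omega A ==> i :. omega ==> a :. A ==> maps (upd s i a) omega A"
  unfolding maps_iff using fun_on_upd by auto
lemma maps_mono: "maps s omega A ==> A \<^bold>\<subseteq> B ==> maps s omega B" unfolding maps_iff using subD by blast
lemma maps_pw: "maps s omega A ==> s :. pw (prd omega A)"
  unfolding maps_iff using fun_on_mem' by (fastforce simp: subset_def)

text \<open>Tarski's clauses as a recursion on arbitrary sets; a set of none of the five shapes gets
  the empty set. Satisfaction becomes a total definable function, which \<open>Sat\<close> is not by
  its form.\<close>

definition TSG :: "'a::zf => 'a => ('a => 'a) => 'a" where
  "TSG A c F = setof (%s. maps s omega A &
     ((EX i k. i :. omega & k :. omega & c = cMem i k & ap s i :. ap s k) |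
      (EX i k. i :. omega & k :. omega & c = cEq i k & ap s i = ap s k) |
      (EX p. c = cNeg p & ~ s :. F p) | (EX p q. c = cAnd p q & s :. F p & s :. F q) |
      (EX i p. i :. omega & c = cEx i p & (EX a. a :. A & upd s i a :. F p))))"
definition TS :: "'a::zf => 'a => 'a" where "TS A c = recr (TSG A) c"

lemma opair_loc: assumes "transitive S" "opair x y \<^bold>\<subseteq> S" shows "x :. S" "y :. S"
proof -
  have "upair x y :. S" using assms(2) by (simp add: opair_def subset_def)
  then show "x :. S" "y :. S" using transD[OF assms(1)] by auto
qed

lemma loc_TSG: "loc (TSG A)" unfolding loc_def
proof (intro allI impI)
  fix c S :: 'a and F F' :: "'a => 'a" assume h: "transitive S & c \<^bold>\<subseteq> S & (ALL z. z :. S --> F z = F' z)"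
  have 1: "c = cNeg p ==> F p = F' p" for p using h opair_loc unfolding cNeg_def by blast
  have 2: "c = cAnd p q ==> F p = F' p & F q = F' q" for p q using h opair_loc opair_trans unfolding cAnd_def by blast
  have 3: "c = cEx i p ==> F p = F' p" for i p using h opair_loc opair_trans unfolding cEx_def by blast
  have e1: "(EX p. c = cNeg p & ~ s :. F p) <-> (EX p. c = cNeg p & ~ s :. F' p)" for s using 1 by metis
  have e2: "(EX p q. c = cAnd p q & s :. F p & s :. F q) <-> (EX p q. c = cAnd p q & s :. F' p & s :. F' q)" for s using 2 by metis
  have e3: "(EX i p. i :. omega & c = cEx i p & (EX a. a :. A & upd s i a :. F p)) <-> (EX i p. i :. omega & c = cEx i p & (EX a. a :. A & upd s i a :. F' p))" for s using 3 by metis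
  show "TSG A c F = TSG A c F'" unfolding TSG_def e1 e2 e3 ..
qed

lemma isset_TSG: "isset (%s. maps s omega A &
     ((EX i k. i :. omega & k :. omega & c = cMem i k & ap s i :. ap s k) |
      (EX i k. i :. omega & k :. omega & c = cEq i k & ap s i = ap s k) |
      (EX p. c = cNeg p & ~ s :. ap f p) | (EX p q. c = cAnd p q & s :. ap f p & s :. ap f q) |
      (EX i p. i :. omega & c = cEx i p & (EX a. a :. A & upd s i a :. ap f p))))"
  by (rule isset_sub[of _ "pw (prd omega A)"], (intro Di)[1]) (use maps_pw in blast)
lemma dt_TSG: "dt (%e. TSG (e 0) (e 1) (ap (e 2)))" unfolding TSG_def
  by (rule dt_setof[of "%e s. maps s omega (e 0) &
     ((EX i k. i :. omega & k :. omega & e 1 = cMem i k & ap s i :. ap s k) |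
      (EX i k. i :. omega & k :. omega & e 1 = cEq i k & ap s i = ap s k) |
      (EX p. e 1 = cNeg p & ~ s :. ap (e 2) p) | (EX p q. e 1 = cAnd p q & s :. ap (e 2) p & s :. ap (e 2) q) |
      (EX i p. i :. omega & e 1 = cEx i p & (EX a. a :. e 0 & upd s i a :. ap (e 2) p)))", OF _ isset_TSG]) (intro Di)
lemma D_TSG: "D (%e. e 0 = TSG (e 1) (e 2) (ap (e 3)))" using dt_TSG by (simp add: dt_def numeral_2_eq_2 numeral_3_eq_3)
lemma D_TSG': "D (%e. e 0 = TSG A (e 1) (ap (e 2)))"
  by (rule D_subst[of "%x e. e 0 = TSG x (e 1) (ap (e 2))", OF _ dt_const])
    (use D_ren[OF D_TSG, of "%n. if n = 0 then 1 else if n = 1 then 0 else n"] in \<open>simp add: numeral_2_eq_2 numeral_3_eq_3\<close>)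
lemma dt_TS [Di]: "dt s ==> dt t ==> dt (%e. TS (s e) (t e))" unfolding TS_def by (rule dt_recr[OF loc_TSG D_TSG])

lemma mem_TS: "s :. TS A c <-> maps s omega A &
     ((EX i k. i :. omega & k :. omega & c = cMem i k & ap s i :. ap s k) |
      (EX i k. i :. omega & k :. omega & c = cEq i k & ap s i = ap s k) |
      (EX p. c = cNeg p & ~ s :. TS A p) | (EX p q. c = cAnd p q & s :. TS A p & s :. TS A q) |
      (EX i p. i :. omega & c = cEx i p & (EX a. a :. A & upd s i a :. TS A p)))"
proof -
  have 1: "TS A c = TSG A c (TS A)" unfolding TS_def by (rule recr_unfold[OF loc_TSG D_TSG'])
  have "isset (%s. maps s omega A &
     ((EX i k. i :. omega & k :. omega & c = cMem i k & ap s i :. ap s k) |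
      (EX i k. i :. omega & k :. omega & c = cEq i k & ap s i = ap s k) |
      (EX p. c = cNeg p & ~ s :. TS A p) | (EX p q. c = cAnd p q & s :. TS A p & s :. TS A q) |
      (EX i p. i :. omega & c = cEx i p & (EX a. a :. A & upd s i a :. TS A p))))"
    by (rule isset_sub[of _ "pw (prd omega A)"], (intro Di)[1]) (use maps_pw in blast)
  then show ?thesis unfolding 1[unfolded TSG_def] by (rule mem_setof)
qed

lemma TS_simps:
  "i :. omega ==> k :. omega ==> s :. TS A (cMem i k) <-> maps s omega A & ap s i :. ap s k"
  "i :. omega ==> k :. omega ==> s :. TS A (cEq i k) <-> maps s omega A & ap s i = ap s k"
  "s :. TS A (cNeg p) <-> maps s omega A & ~ s :. TS A p"
  "s :. TS A (cAnd p q) <-> maps s omega A & s :. TS A p & s :. TS A q"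
  "i :. omega ==> s :. TS A (cEx i p) <-> maps s omega A & (EX a. a :. A & upd s i a :. TS A p)"
  by (subst mem_TS, simp add: code_inj)+

lemma TS_maps: "s :. TS A p ==> maps s omega A" using mem_TS by blast

text \<open>Recursion gives one satisfaction map, and induction on formulas shows that any other one
  agrees with it.\<close>

lemma Sat_iff: assumes "p :. Form" shows "Sat A p s <-> s :. TS A p"
proof -
  have dT: "dt (%e. TS A (e 0))" by (intro Di)
  define g where "g = lam Form (TS A)"
  have g: "fun_on g Form" "q :. Form ==> app g q = TS A q" for q
    unfolding g_def using fun_on_lam[OF dT] ap_lam[OF dT] fun_onD(3) by metis+
  have sm: "maps s omega A ==> k :. omega ==> app s k = ap s k" for s k using fun_onD(3) by (auto simp: maps_iff)
  have "sat_map A g" unfolding sat_map_def by (simp add: g Form_intros TS_simps sm cong: conj_cong)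
  moreover have "app g' p = TS A p" if g': "sat_map A g'" for g'
  proof -
    have f: "fun_on g' Form" using g' by (simp add: sat_map_def)
    have "ap g' p = TS A p" using assms
    proof (rule Form_induct)
      show "D (%e. ap g' (e 0) = TS A (e 0))" by (intro Di)
    qed (rule set_eqI, simp add: fun_onD(3)[OF f, symmetric] Form_intros TS_simps g'[unfolded sat_map_def] sm cong: conj_cong)+
    then show ?thesis using fun_onD(3)[OF f assms] by simp
  qed
  ultimately show ?thesis unfolding Sat_def using g(2)[OF assms] by metis
qed

lemma omega_dir: assumes "i :. omega" "k :. omega" shows "EX m. m :. omega & (i :. m | i = m) & (k :. m | k = m)"
  using Ord_linear[OF Ord_nat[OF assms(1)] Ord_nat[OF assms(2)]] assms by blast

text \<open>A formula looks only at an initial segment of its assignment. In the uses below,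
  \<open>m\<close> is an element of the internal \<open>omega\<close> and possibly
  nonstandard.\<close>

definition supp :: "'a::zf => 'a => bool" where
  "supp p m <-> (ALL A s s'. maps s omega A & maps s' omega A & (ALL k. k :. m --> ap s k = ap s' k) --> (s :. TS A p <-> s' :. TS A p))"

lemma supp_mono: "supp p m ==> m \<^bold>\<subseteq> n ==> supp p n" unfolding supp_def using subD by blast

lemma supp_ex: assumes "p :. Form" shows "EX m. m :. omega & supp p m"
  using assms
proof (rule Form_induct)
  show "D (%e. EX m. m :. omega & supp (e 0) m)" unfolding supp_def by (intro Di)
  have big: "EX m. m :. omega & i :. m & k :. m" if ik: "i :. omega" "k :. omega" for i k :: 'a
    using omega_dir[OF ik] adj_omega by (metis mem_adj)
  have dir: "EX m. m :. omega & i \<^bold>\<subseteq> m & k \<^bold>\<subseteq> m" if ik: "i :. omega" "k :. omega" for i k :: 'a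
    using omega_dir[OF ik] Ord_sub[OF Ord_nat Ord_nat] ik by metis
  fix i k :: 'a assume ik: "i :. omega" "k :. omega"
  obtain m where m: "m :. omega" "i :. m" "k :. m" using big[OF ik] by blast
  show "EX m. m :. omega & supp (cMem i k) m" "EX m. m :. omega & supp (cEq i k) m"
    by (rule exI[of _ m], simp add: m supp_def TS_simps ik)+
next
  fix p :: 'a assume "EX m. m :. omega & supp p m"
  then show "EX m. m :. omega & supp (cNeg p) m" unfolding supp_def TS_simps by meson
next
  fix p q :: 'a assume "EX m. m :. omega & supp p m" "EX m. m :. omega & supp q m"
  then obtain m m' where m: "m :. omega" "supp p m" "m' :. omega" "supp q m'" by blast
  obtain n where n: "n :. omega" "m \<^bold>\<subseteq> n" "m' \<^bold>\<subseteq> n" using omega_dir[OF m(1,3)] Ord_sub[OF Ord_nat Ord_nat] m by metis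
  have "supp p n" "supp q n" using supp_mono m n by blast+
  then have "supp (cAnd p q) n" unfolding supp_def TS_simps by blast
  then show "EX m. m :. omega & supp (cAnd p q) m" using n by blast
next
  fix i p :: 'a assume i: "i :. omega" and "EX m. m :. omega & supp p m"
  then obtain m where m: "m :. omega" "supp p m" by blast
  have "supp (cEx i p) m" unfolding supp_def
  proof (intro allI impI)
    fix A s s' assume h: "maps s omega A & maps s' omega A & (ALL k. k :. m --> ap s k = ap s' k)"
    have "upd s i a :. TS A p <-> upd s' i a :. TS A p" if "a :. A" for a
    proof -
      have "maps (upd s i a) omega A & maps (upd s' i a) omega A & (ALL k. k :. m --> ap (upd s i a) k = ap (upd s' i a) k)"
        using i that h by (simp add: maps_upd)
      then show ?thesis using m(2) unfolding supp_def by blast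
    qed
    then show "s :. TS A (cEx i p) <-> s' :. TS A (cEx i p)" using h TS_simps(5)[OF i] by blast
  qed
  then show "EX m. m :. omega & supp (cEx i p) m" using m by blast
qed

lemma Sigma0_abs: assumes "p :. Sigma0" "transitive A" "A \<^bold>\<subseteq> B" "maps s omega A" shows "s :. TS A p <-> s :. TS B p"
proof -
  have mB: "maps s omega A ==> maps s omega B" for s using maps_mono assms(3) by blast
  have "ALL s. maps s omega A --> (s :. TS A p <-> s :. TS B p)" using assms(1)
  proof (rule Sigma0_induct)
    show "D (%e. ALL s. maps s omega A --> (s :. TS A (e 0) <-> s :. TS B (e 0)))" by (intro Di)
    fix i k p :: 'a assume h: "i :. omega" "k :. omega" "i \<noteq> k" "ALL s. maps s omega A --> (s :. TS A p <-> s :. TS B p)"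
    show "ALL s. maps s omega A --> (s :. TS A (cEx i (cAnd (cMem i k) p)) <-> s :. TS B (cEx i (cAnd (cMem i k) p)))"
    proof (intro allI impI)
      fix s assume s: "maps s omega A"
      have sk: "ap s k :. A" using s h(2) by (simp add: maps_iff)
      have 1: "upd s i a :. TS C (cAnd (cMem i k) p) <-> maps (upd s i a) omega C & a :. ap s k & upd s i a :. TS C p" for C a
        using h by (auto simp: TS_simps)
      have "(EX a. a :. A & upd s i a :. TS A (cAnd (cMem i k) p)) <-> (EX a. a :. B & upd s i a :. TS B (cAnd (cMem i k) p))"
      proof -
        have "a :. ap s k ==> a :. A" for a using transD[OF assms(2) sk] by blast
        moreover have "a :. A ==> upd s i a :. TS A p <-> upd s i a :. TS B p" for a using h(4) maps_upd[OF s h(1)] by blast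
        ultimately show ?thesis unfolding 1 using maps_upd[OF s h(1)] mB subD[OF assms(3)] by blast
      qed
      then show "s :. TS A (cEx i (cAnd (cMem i k) p)) <-> s :. TS B (cEx i (cAnd (cMem i k) p))"
        using TS_simps(5)[OF h(1)] s mB by blast
    qed
  qed (use mB in \<open>auto simp: TS_simps\<close>)
  then show ?thesis using assms(4) by blast
qed

lemma Sigma1_up: assumes "p :. Sigma1" "transitive A" "A \<^bold>\<subseteq> B" "s :. TS A p" shows "s :. TS B p"
proof -
  have "p :. Form & (ALL s. s :. TS A p --> s :. TS B p)" using assms(1)
  proof (rule Sigma1_induct)
    show "D (%e. ALL s. s :. TS A (e 0) --> s :. TS B (e 0))" by (intro Di)
    show "!!p. p :. Sigma0 ==> ALL s. s :. TS A p --> s :. TS B p" using Sigma0_abs[OF _ assms(2,3)] TS_maps by blast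
    show "ALL s. s :. TS A (cEx i p) --> s :. TS B (cEx i p)" if "i :. omega" "ALL s. s :. TS A p --> s :. TS B p" for i p
      unfolding TS_simps(5)[OF that(1)] using that(2) maps_mono[OF _ assms(3)] subD[OF assms(3)] by blast
  qed
  then show ?thesis using assms(4) by blast
qed
lemma Pi1_down: assumes "p :. Pi1" "transitive A" "A \<^bold>\<subseteq> B" "maps s omega A" "s :. TS B p" shows "s :. TS A p"
proof -
  have "p :. Form & (ALL s. maps s omega A & s :. TS B p --> s :. TS A p)" using assms(1)
  proof (rule Pi1_induct)
    show "D (%e. ALL s. maps s omega A & s :. TS B (e 0) --> s :. TS A (e 0))" by (intro Di)
    show "!!p. p :. Sigma0 ==> ALL s. maps s omega A & s :. TS B p --> s :. TS A p" using Sigma0_abs[OF _ assms(2,3)] by blast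
    fix i p :: 'a assume h: "i :. omega" "ALL s. maps s omega A & s :. TS B p --> s :. TS A p"
    have "s :. TS C (cAll i p) <-> maps s omega C & (ALL a. a :. C --> upd s i a :. TS C p)" for s C
      unfolding cAll_def TS_simps(3) TS_simps(5)[OF h(1)] using maps_upd[OF _ h(1)] by blast
    then show "ALL s. maps s omega A & s :. TS B (cAll i p) --> s :. TS A (cAll i p)"
      using h(2) maps_upd[OF _ h(1)] subD[OF assms(3)] by blast
  qed
  then show ?thesis using assms(4,5) by blast
qed

text \<open>Assignments are infinite objects and need not belong to the hierarchy, whereas finite
  functions do. With the default value empty of \<open>ap\<close>, elements of a level can stand for
  assignments of finite support.\<close>

definition tot :: "'a::zf => 'a" where "tot t = lam omega (ap t)"
lemma tot_props [simp]: "fun_on (tot t) omega" "k :. omega ==> ap (tot t) k = ap t k"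
  unfolding tot_def by (rule fun_on_lam, intro Di) (rule ap_lam, intro Di)
lemma mem_tot: "p :. tot t <-> (EX k. k :. omega & p = opair k (ap t k))" unfolding tot_def by (rule mem_lam) (intro Di)
lemma tot_eq: "x = tot t <-> (ALL p. p :. x <-> (EX k. k :. omega & p = opair k (ap t k)))" using mem_tot by (metis set_eqI)
lemma dt_tot [Di]: "dt s ==> dt (%e. tot (s e))" by (rule dt_app1[of tot], unfold dt_def[of "%e. tot (e 0)"] tot_eq, (intro Di)[1])
lemma maps_tot: "maps (tot t) omega A <-> (ALL k. k :. omega --> ap t k :. A)" by (simp add: maps_iff)
lemma upd_tot: "i :. omega ==> upd (tot t) i a = tot (upd t i a)"
  by (rule fun_on_ext[of _ omega]) (auto intro: fun_on_upd)
lemma Base_V: assumes "Limit d" "omega :. d" shows "Base (V_level d)"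
proof -
  have o: "Ord d" and L: "c :. d ==> adjoin_self c :. d" for c using assms(1) by (auto simp: Limit_def)
  note [simp] = mem_V[OF o]
  have s: "x \<^bold>\<subseteq> V_level c ==> c :. d ==> x :. V_level d" for x c by auto
  have V1: "x \<^bold>\<subseteq> V_level c ==> Ord c ==> x :. V_level (adjoin_self c)" for x c using mem_V[of "adjoin_self c"] by auto
  show ?thesis unfolding Base_def
  proof (intro conjI allI impI)
    show "transitive (V_level d)" by (rule V_trans[OF o])
    show "omega :. V_level d" using s[OF Ord_sub_V[OF Ord_omega] assms(2)] .
    show "Form :. V_level d"
      by (rule s[OF _ assms(2)], rule subI, unfold mem_Form, erule allE[of _ "V_level omega"]) (use bc_Vw in blast)
    fix x assume "x :. V_level d"
    then obtain c where c: "c :. d" "x \<^bold>\<subseteq> V_level c" by auto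
    have oc: "Ord c" using c o Ord_mem by blast
    show "pw x :. V_level d"
    proof (rule s[OF _ L[OF c(1)]], rule subI)
      fix y assume "y :. pw x" then show "y :. V_level (adjoin_self c)" using V1[OF sub_trans[OF _ c(2)] oc] by simp
    qed
    show "set_union x :. V_level d"
      by (rule s[OF _ c(1)], rule subI) (use transD[OF V_trans[OF oc]] subD[OF c(2)] in auto)
  next
    show "upair x y :. V_level d" if "x :. V_level d & y :. V_level d" for x y using V_upair[OF assms(1)] that by blast
  qed
qed

section \<open>Cofinal embeddings and their lifts\<close>

text \<open>The embedding is a relation and all quantifiers are bounded by \<open>B\<close> or
  \<open>U\<close>, so that the statement can be interpreted over a structure of codes, with
  \<open>K\<close> read off a code. The clause on \<open>OP\<close> speaks of selectors fixed by
  \<open>K\<close>; the last clause is cofinality.\<close>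

definition EmbR :: "('a::zf => 'a => bool) => 'a => 'a => bool" where
  "EmbR K B U <-> (ALL x. x :. B --> (EX y. y :. U & K x y)) &
     (ALL x. x :. B --> (ALL y. y :. U & K x y --> (ALL y'. y' :. U & K x y' --> y = y'))) &
     (ALL x. x :. B --> (ALL y. y :. U & K x y --> (ALL x'. x' :. B --> (ALL y'. y' :. U & K x' y' --> (x :. x' <-> y :. y'))))) &
     (ALL w. w :. B & w = omega --> (ALL n. n :. B & (n :. w | n = w) --> K n n)) &
     (ALL s. s :. B & K s s --> (ALL p. p :. B --> (ALL q. q :. B --> (ALL r. r :. B --> (ALL z. z :. B & z = OP s p q r -->
        (ALL p'. p' :. U & K p p' --> (ALL q'. q' :. U & K q q' --> (ALL r'. r' :. U & K r r' --> (ALL z'. z' :. U & K z z' --> z' = OP s p' q' r'))))))))) &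
     (ALL y. y :. U --> (EX x. x :. B & (EX z. z :. U & K x z & y :. z)))"

lemmas EmbR1 = EmbR_def[THEN iffD1, THEN conjunct1]
lemmas EmbR2 = EmbR_def[THEN iffD1, THEN conjunct2, THEN conjunct1]
lemmas EmbR3 = EmbR_def[THEN iffD1, THEN conjunct2, THEN conjunct2, THEN conjunct1]
lemmas EmbR4 = EmbR_def[THEN iffD1, THEN conjunct2, THEN conjunct2, THEN conjunct2, THEN conjunct1]
lemmas EmbR5 = EmbR_def[THEN iffD1, THEN conjunct2, THEN conjunct2, THEN conjunct2, THEN conjunct2, THEN conjunct1]
lemmas EmbR6 = EmbR_def[THEN iffD1, THEN conjunct2, THEN conjunct2, THEN conjunct2, THEN conjunct2, THEN conjunct2]

text \<open>The form in which cofinality \<open>omega\<close> of the height is used. It mentions no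
  ordinals and passes down along embeddings, see \<open>cofw_down\<close>.\<close>

definition cofw :: "'a::zf => bool" where
  "cofw U <-> (EX h. (ALL n. n :. omega --> ap h n :. U) & (ALL y. y :. U --> (EX n. n :. omega & y \<^bold>\<subseteq> ap h n)))"

lemma Base_sub: "Base U ==> y :. U ==> x \<^bold>\<subseteq> y ==> x :. U" unfolding Base_def using transD mem_pw by metis
lemma Base_trans: "Base U ==> y :. U ==> x :. y ==> x :. U" unfolding Base_def using transD by blast
lemma Base_omega: "Base U ==> omega :. U" "Base U ==> n :. omega ==> n :. U" using Base_trans by (auto simp: Base_def)
lemma Base_upair: "Base U ==> x :. U ==> y :. U ==> upair x y :. U" unfolding Base_def by blast
lemma Base_opair: "Base U ==> x :. U ==> y :. U ==> opair x y :. U" unfolding opair_def by (intro Base_upair)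
lemma Base_un: "Base U ==> x :. U ==> y :. U ==> un x y :. U" unfolding un_def using Base_upair Base_def by blast
lemma Base_pw: "Base U ==> x :. U ==> pw x :. U" unfolding Base_def by blast
lemma Base_prd: assumes "Base U" "x :. U" "y :. U" shows "prd x y :. U"
proof (rule Base_sub[OF assms(1), of "pw (pw (un x y))"])
  show "pw (pw (un x y)) :. U" by (rule Base_pw[OF assms(1) Base_pw[OF assms(1) Base_un[OF assms]]])
  show "prd x y \<^bold>\<subseteq> pw (pw (un x y))" by (rule subI, unfold mem_prd) (elim exE conjE, simp add: opair_in_pw del: mem_pw)
qed
lemma tupr_prd: "\<forall>y\<in>set ys. y :. x ==> tupr ys \<^bold>\<subseteq> prd omega x"
  by (induction ys) (auto simp: subset_def)
lemma Base_W: assumes "Base U" "x :. U" shows "W n x :. U"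
proof (rule Base_sub[OF assms(1), of "pw (prd omega x)"])
  show "pw (prd omega x) :. U" by (rule Base_pw[OF assms(1) Base_prd[OF assms(1) Base_omega(1)[OF assms(1)] assms(2)]])
  show "W n x \<^bold>\<subseteq> pw (prd omega x)" by (rule subI, unfold mem_W) (elim exE conjE, simp add: tupr_prd)
qed

lemma dt_ext1 [Di]: "dt s ==> dt t ==> dt u ==> dt (%e. ext1 (s e) (t e) (u e))"
  by (rule dt_app3[of ext1], rule bt_dt, unfold ext1_def, (intro Bi)[1])

lemma dt_W: assumes "dt t" shows "dt (%e. W m (t e))"
proof (induction m)
  case 0 show ?case by (simp add: dt_const)
next
  case (Suc m) then show ?case by (simp only: W.simps) (rule dt_ext1[OF _ assms dt_const])
qed

lemma D_eval: "(!!i. dt (\<sigma> i)) ==> D (%e. eval (%x. x :. B) (%x. x :. A) \<phi> (%i. \<sigma> i e))"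
proof (induction \<phi> arbitrary: \<sigma>)
  case (mMem i j) then show ?case by (simp add: D_mem)
next
  case (mEq i j) then show ?case by (simp add: D_eq)
next
  case (mPr i) then show ?case by (simp add: D_mem dt_const)
next
  case (mNeg \<phi>) then show ?case by (simp add: D_not)
next
  case (mAnd \<phi> \<psi>) then show ?case by (simp add: D_and)
next
  case (mEx \<phi>)
  have "D (%e. eval (%x. x :. B) (%x. x :. A) \<phi> (%i. (case i of 0 => (%e. e 0) | Suc i => (%e. \<sigma> i (%n. e (Suc n)))) e))"
    by (rule mEx.IH) (auto split: nat.split intro: dt_var dt_ren mEx.prems)
  moreover have "(%i. (case i of 0 => (%e. e 0) | Suc i => (%e. \<sigma> i (%n. e (Suc n)))) e) = case_nat (e 0) (%i. \<sigma> i (%n. e (Suc n)))" for e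
    by (auto split: nat.split)
  ultimately have "D (%e. e 0 :. B & eval (%x. x :. B) (%x. x :. A) \<phi> (case_nat (e 0) (%i. \<sigma> i (%n. e (Suc n)))))"
    by (simp add: D_and D_mem dt_var dt_const)
  then show ?case by (simp add: D_ex)
qed

text \<open>Restricting the tuples to a set \<open>x\<close> makes a piece of the satisfaction
  relation small enough to be an element of the rank, so that an embedding can be applied to it. The
  quantifiers of the formula still range over all of \<open>B\<close>.\<close>

definition XX :: "'a::zf => 'a => fm => nat => 'a => 'a" where
  "XX B A \<phi> n x = sep (W n x) (%a. eval (%x. x :. B) (%x. x :. A) \<phi> (%i. ap a (std_num (n - Suc i))))"

lemma mem_XX: assumes "fvb \<phi> \<le> n" shows "a :. XX B A \<phi> n x <-> (EX ys. length ys = n & (\<forall>y\<in>set ys. y :. x) & a = tupr ys & eval (%x. x :. B) (%x. x :. A) \<phi> (%i. ys ! i))"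
proof -
  have "D (%e. eval (%x. x :. B) (%x. x :. A) \<phi> (%i. ap (e 0) (std_num (n - Suc i))))"
    by (rule D_eval) (intro Di)
  then have 1: "a :. XX B A \<phi> n x <-> a :. W n x & eval (%x. x :. B) (%x. x :. A) \<phi> (%i. ap a (std_num (n - Suc i)))"
    unfolding XX_def by (rule mem_sep)
  have 2: "eval (%x. x :. B) (%x. x :. A) \<phi> (%i. ap (tupr ys) (std_num (n - Suc i))) = eval (%x. x :. B) (%x. x :. A) \<phi> (%i. ys ! i)"
    if "length ys = n" for ys by (rule eval_cong) (use that assms ap_tupr[of _ ys] in auto)
  show ?thesis unfolding 1 mem_W using 2 by blast
qed

lemma XX_tupr: "fvb \<phi> \<le> n ==> length ys = n ==> tupr ys :. XX B A \<phi> n x <-> (\<forall>y\<in>set ys. y :. x) & eval (%x. x :. B) (%x. x :. A) \<phi> (%i. ys ! i)"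
  unfolding mem_XX using tupr_inj by metis

lemma XX_eqI: assumes "S \<^bold>\<subseteq> W n x" "!!ys. length ys = n ==> (\<forall>y\<in>set ys. y :. x) ==> tupr ys :. S <-> eval (%x. x :. B) (%x. x :. A) \<phi> (%i. ys ! i)" "fvb \<phi> \<le> n"
  shows "S = XX B A \<phi> n x"
proof (rule set_eqI)
  fix a show "a :. S <-> a :. XX B A \<phi> n x"
  proof
    assume a: "a :. S"
    then obtain ys where ys: "length ys = n" "\<forall>y\<in>set ys. y :. x" "a = tupr ys" using subD[OF assms(1)] mem_W[of a n x] by auto
    then show "a :. XX B A \<phi> n x" using XX_tupr[OF assms(3) ys(1)] assms(2)[OF ys(1,2)] a by simp
  next
    assume "a :. XX B A \<phi> n x"
    then obtain ys where "length ys = n" "\<forall>y\<in>set ys. y :. x" "a = tupr ys" "eval (%x. x :. B) (%x. x :. A) \<phi> (%i. ys ! i)"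
      unfolding mem_XX[OF assms(3)] by (elim exE conjE)
    then show "a :. S" using assms(2) by simp
  qed
qed

locale embd =
  fixes k U' U a' :: "'a::zf"
  assumes BU': "Base U'" and BU: "Base U" and emb: "EmbR (%x y. opair x y :. k) U' U" and cof: "cofw U'"
    and fk: "fun_on k U'" and asub: "a' \<^bold>\<subseteq> U'"
begin

definition j :: "'a => 'a" where "j x = ap k x"

lemma jK: "x :. U' ==> opair x (j x) :. k" unfolding j_def by (rule fun_onD(1)[OF fk])
lemma jU: assumes "x :. U'" shows "j x :. U"
proof -
  obtain y where y: "y :. U" "opair x y :. k" using EmbR1[OF emb, rule_format, OF assms] by (elim exE conjE)
  then have "y = j x" using fun_onD(2)[OF fk assms] j_def by simp
  then show ?thesis using y by simp
qed
lemma Kj: "opair x y :. k <-> x :. U' & y = j x" unfolding j_def by (rule fun_on_mem[OF fk])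
lemma j_mem: assumes "x :. U'" "y :. U'" shows "j x :. j y <-> x :. y"
proof -
  from EmbR3[OF emb, rule_format, OF assms(1) conjI[OF jU[OF assms(1)] jK[OF assms(1)]] assms(2) conjI[OF jU[OF assms(2)] jK[OF assms(2)]]]
  show ?thesis by simp
qed
lemma j_nat: "n :. omega ==> j n = n" and j_omega: "j omega = omega"
proof -
  have *: "n :. omega | n = omega ==> opair n n :. k" for n
    using EmbR4[OF emb, rule_format, OF conjI[OF Base_omega(1)[OF BU'] refl], of n] Base_omega[OF BU'] by blast
  then show "n :. omega ==> j n = n" "j omega = omega" using Kj by metis+
qed
lemma j_OP: assumes "p :. U'" "q :. U'" "r :. U'" "OP (std_num m) p q r :. U'" shows "j (OP (std_num m) p q r) = OP (std_num m) (j p) (j q) (j r)"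
proof -
  have s: "std_num m :. U'" "opair (std_num m) (std_num m) :. k" using Base_omega(2)[OF BU'] Kj j_nat[of "std_num m"] by auto
  have c: "x :. U' ==> j x :. U & opair x (j x) :. k" for x using jU jK by blast
  show ?thesis using EmbR5[OF emb, rule_format, OF conjI[OF s] assms(1,2,3) conjI[OF assms(4) refl] c[OF assms(1)] c[OF assms(2)] c[OF assms(3)] c[OF assms(4)]] .
qed
lemma j_cof: assumes "y :. U" shows "EX x. x :. U' & y :. j x"
proof -
  obtain x z where x: "x :. U'" "opair x z :. k" "y :. z" using EmbR6[OF emb, rule_format, OF assms] by (elim exE conjE)
  then have "z = j x" by (simp add: Kj)
  then show ?thesis using x by (intro exI[of _ x]) simp
qed

lemma j_std: "j (std_num m) = std_num m" by (rule j_nat) simp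
lemma j_upair: "p :. U' ==> q :. U' ==> j (upair p q) = upair (j p) (j q)"
  by (rule j_OP[of p q q 0, unfolded OP_simps]) (simp_all add: Base_upair[OF BU'])
lemma j_diff: assumes "p :. U'" "q :. U'" shows "j (diff p q) = diff (j p) (j q)"
  using j_OP[of p q q 1, unfolded OP_simps] assms Base_sub[OF BU' assms(1), of "diff p q"] by (simp add: subset_def)
lemma sub1: "p :. U' ==> msel p q r :. U'" "p :. U' ==> esel p q r :. U'" "p :. U' ==> psel p q r :. U'" "p :. U' ==> xsel p t :. U'"
  "p :. U' ==> diff p q :. U'" "p :. U' ==> inter p q :. U'"
  by (erule Base_sub[OF BU'], simp add: subset_def)+
lemma j_inter: "p :. U' ==> q :. U' ==> j (inter p q) = inter (j p) (j q)"
  unfolding inter_def by (simp add: j_diff sub1)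
lemma j_un: assumes "p :. U'" "q :. U'" shows "j (un p q) = un (j p) (j q)"
proof -
  have "j (set_union (upair p q)) = set_union (j (upair p q))"
    using j_OP[of "upair p q" p p 2, unfolded OP_simps] assms Base_upair[OF BU'] Base_un[OF BU' assms] by (simp add: un_def)
  then show ?thesis using j_upair assms by (simp add: un_def)
qed
lemma j_sels: assumes "p :. U'" "q :. U'" "r :. U'"
  shows "j (msel p q r) = msel (j p) (j q) (j r)" "j (esel p q r) = esel (j p) (j q) (j r)" "j (psel p q r) = psel (j p) (j q) (j r)" "j (xsel p q) = xsel (j p) (j q)"
  using j_OP[OF assms, of 3, unfolded OP_simps] j_OP[OF assms, of 4, unfolded OP_simps] j_OP[OF assms, of 5, unfolded OP_simps] j_OP[OF assms, of 10, unfolded OP_simps] sub1[OF assms(1)]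
  by auto
lemma j_adj1: assumes "p :. U'" "q :. U'" "r :. U'" shows "adj1 p q r :. U'" "j (adj1 p q r) = adj1 (j p) (j q) (j r)"
proof -
  show "adj1 p q r :. U'" unfolding adj1_def by (intro Base_un[OF BU'] Base_upair[OF BU'] Base_opair[OF BU'] assms)
  then show "j (adj1 p q r) = adj1 (j p) (j q) (j r)" by (rule j_OP[OF assms, of 6, unfolded OP_simps])
qed
lemma stdU: "std_num m :. U'" using Base_omega(2)[OF BU'] by simp
lemma j_ext1W: assumes "x :. U'" "y :. U'" shows "ext1 (W n x) y (std_num n) :. U'" "j (ext1 (W n x) y (std_num n)) = ext1 (j (W n x)) (j y) (std_num n)"
proof -
  have "ext1 (W n x) y (std_num n) \<^bold>\<subseteq> W (Suc n) (un x y)"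
  proof (rule subI)
    fix z assume "z :. ext1 (W n x) y (std_num n)"
    then obtain ys w where h: "length ys = n" "\<forall>v\<in>set ys. v :. x" "w :. y" "z = adj1 (tupr ys) (std_num n) w" by (auto simp: mem_W)
    then show "z :. W (Suc n) (un x y)" unfolding mem_W by (intro exI[of _ "w # ys"]) auto
  qed
  then show 1: "ext1 (W n x) y (std_num n) :. U'" using Base_sub[OF BU' Base_W[OF BU' Base_un[OF BU' assms]]] by blast
  show "j (ext1 (W n x) y (std_num n)) = ext1 (j (W n x)) (j y) (std_num n)"
    using j_OP[OF Base_W[OF BU' assms(1)] assms(2) stdU, of 7, unfolded OP_simps, OF 1] by (simp only: j_std)
qed
lemma j_W: "x :. U' ==> j (W n x) = W n (j x)"
proof (induction n)
  case 0
  have e: "empty :. U'" using stdU[of 0] by simp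
  have "j empty = empty" using j_std[of 0] by simp
  then show ?case using j_upair[OF e e] by simp
next
  case (Suc n) then show ?case using j_ext1W(2)[OF Suc.prems Suc.prems] by simp
qed
lemma j_tupr: "\<forall>y\<in>set ys. y :. U' ==> tupr ys :. U' & j (tupr ys) = tupr (map j ys)"
proof (induction ys)
  case Nil show ?case using stdU[of 0] j_std[of 0] by simp
next
  case (Cons y ys) then show ?case using j_adj1[OF _ stdU, of "tupr ys" y] j_std by simp
qed

text \<open>The usual lift of a predicate: its pieces \<open>inter a' x\<close> are elements of
  \<open>U'\<close>, and their images are glued together.\<close>

definition a :: 'a where "a = sep U (%z. EX x. x :. U' & z :. j (inter a' x))"

lemma mem_a: "z :. a <-> (EX x. x :. U' & z :. j (inter a' x))"
proof -
  have "z :. a <-> z :. U & (EX x. x :. U' & z :. j (inter a' x))" unfolding a_def j_def by (rule mem_sep) (intro Di)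
  moreover have "z :. U" if "x :. U'" "z :. j (inter a' x)" for x
  proof -
    have "inter a' x :. U'" using Base_sub[OF BU' that(1), of "inter a' x"] by (simp add: subset_def)
    then show ?thesis using jU Base_trans[OF BU] that(2) by blast
  qed
  ultimately show ?thesis by blast
qed

lemma j_mono: assumes "p :. U'" "q :. U'" "p \<^bold>\<subseteq> q" shows "j p \<^bold>\<subseteq> j q"
proof -
  have "inter p q = p" by (rule set_eqI) (use assms(3) subD in auto)
  then have "j p = inter (j p) (j q)" using j_inter[OF assms(1,2)] by simp
  then show ?thesis by (metis mem_inter subI)
qed
lemma inU: "x :. U' ==> inter a' x :. U'" using Base_sub[OF BU', of x "inter a' x"] by (simp add: subset_def)

text \<open>The images of the pieces cohere because \<open>j\<close> commutes with intersections and
  is monotone.\<close>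

lemma lift_inter: assumes "x :. U'" shows "inter a (j x) = j (inter a' x)"
proof (rule set_eqI)
  fix z show "z :. inter a (j x) <-> z :. j (inter a' x)"
  proof
    assume "z :. inter a (j x)"
    then obtain y where y: "y :. U'" "z :. j (inter a' y)" "z :. j x" using mem_a by auto
    then have "z :. j (inter (inter a' y) x)" using j_inter[OF inU[OF y(1)] assms] by simp
    moreover have "inter (inter a' y) x \<^bold>\<subseteq> inter a' x" by (simp add: subset_def)
    ultimately show "z :. j (inter a' x)" using j_mono[OF sub1(6)[OF inU[OF y(1)]] inU[OF assms]] subD by blast
  next
    assume z: "z :. j (inter a' x)"
    have "inter a' x \<^bold>\<subseteq> x" by (simp add: subset_def)
    then have "z :. j x" using j_mono[OF inU[OF assms] assms] z subD by blast
    then show "z :. inter a (j x)" using z assms mem_a by auto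
  qed
qed

lemma XU: "x :. U' ==> XX B A \<phi> n x :. U'"
proof -
  assume "x :. U'"
  moreover have "XX B A \<phi> n x \<^bold>\<subseteq> W n x" unfolding XX_def
    by (rule subI, subst (asm) mem_sep, rule D_eval) (auto intro: Di)
  ultimately show ?thesis using Base_sub[OF BU' Base_W[OF BU']] by blast
qed

text \<open>The heart of the lift. Atomic and Boolean steps are operations that \<open>j\<close>
  preserves. For a quantifier over all of \<open>U'\<close>, the tuples with a witness form a union
  of \<open>omega\<close> many sets, one for each bound \<open>ap h m\<close> on the witness. The
  sequence of these sets is a single element of \<open>U'\<close>, and \<open>j\<close> fixes
  \<open>omega\<close> and its elements, so the union is preserved; on the other side the bounds
  \<open>j (ap h m)\<close> are cofinal in \<open>U\<close>.\<close>

lemma elem_sets: "fvb \<phi> \<le> n ==> x :. U' ==> j (XX U' a' \<phi> n x) = XX U a \<phi> n (j x)"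
proof (induction \<phi> arbitrary: n x)
  case (mMem p q)
  have "XX B A (mMem p q) n x = msel (W n x) (std_num (n - Suc p)) (std_num (n - Suc q))" for B A x :: 'a
  proof (rule XX_eqI[symmetric])
    fix ys :: "'a list" assume h: "length ys = n" "\<forall>y\<in>set ys. y :. x"
    then show "tupr ys :. msel (W n x) (std_num (n - Suc p)) (std_num (n - Suc q)) <-> eval (%x. x :. B) (%x. x :. A) (mMem p q) (%i. ys ! i)"
      using tupr_W[OF h] ap_tupr[of p ys] ap_tupr[of q ys] mMem by simp
  qed (use mMem in \<open>auto simp: subset_def\<close>)
  then show ?case using j_sels(1)[OF Base_W[OF BU'] stdU stdU] mMem j_W j_std by metis
next
  case (mEq p q)
  have "XX B A (mEq p q) n x = esel (W n x) (std_num (n - Suc p)) (std_num (n - Suc q))" for B A x :: 'a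
  proof (rule XX_eqI[symmetric])
    fix ys :: "'a list" assume h: "length ys = n" "\<forall>y\<in>set ys. y :. x"
    then show "tupr ys :. esel (W n x) (std_num (n - Suc p)) (std_num (n - Suc q)) <-> eval (%x. x :. B) (%x. x :. A) (mEq p q) (%i. ys ! i)"
      using tupr_W[OF h] ap_tupr[of p ys] ap_tupr[of q ys] mEq by simp
  qed (use mEq in \<open>auto simp: subset_def\<close>)
  then show ?case using j_sels(2)[OF Base_W[OF BU'] stdU stdU] mEq j_W j_std by metis
next
  case (mPr p)
  have "XX B A (mPr p) n x = psel (W n x) (std_num (n - Suc p)) (inter A x)" for B A x :: 'a
  proof (rule XX_eqI[symmetric])
    fix ys :: "'a list" assume h: "length ys = n" "\<forall>y\<in>set ys. y :. x"
    then show "tupr ys :. psel (W n x) (std_num (n - Suc p)) (inter A x) <-> eval (%x. x :. B) (%x. x :. A) (mPr p) (%i. ys ! i)"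
      using tupr_W[OF h] ap_tupr[of p ys] mPr by simp
  qed (use mPr in \<open>auto simp: subset_def\<close>)
  then show ?case using j_sels(3)[OF Base_W[OF BU'] stdU inU] mPr j_W j_std lift_inter by metis
next
  case (mNeg \<phi>)
  have "XX B A (mNeg \<phi>) n x = diff (W n x) (XX B A \<phi> n x)" for B A x :: 'a
  proof (rule XX_eqI[symmetric])
    fix ys :: "'a list" assume h: "length ys = n" "\<forall>y\<in>set ys. y :. x"
    then show "tupr ys :. diff (W n x) (XX B A \<phi> n x) <-> eval (%x. x :. B) (%x. x :. A) (mNeg \<phi>) (%i. ys ! i)"
      using tupr_W[OF h] XX_tupr[of \<phi> n ys] mNeg by simp
  qed (use mNeg in \<open>auto simp: subset_def\<close>)
  then show ?case using j_diff[OF Base_W[OF BU'] XU] mNeg j_W by simp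
next
  case (mAnd \<phi> \<psi>)
  have "XX B A (mAnd \<phi> \<psi>) n x = inter (XX B A \<phi> n x) (XX B A \<psi> n x)" for B A x :: 'a
  proof (rule XX_eqI[symmetric])
    have "fvb \<phi> \<le> n" using mAnd.prems by simp
    then show "inter (XX B A \<phi> n x) (XX B A \<psi> n x) \<^bold>\<subseteq> W n x" by (auto simp: subset_def mem_XX mem_W)
    fix ys :: "'a list" assume h: "length ys = n" "\<forall>y\<in>set ys. y :. x"
    then show "tupr ys :. inter (XX B A \<phi> n x) (XX B A \<psi> n x) <-> eval (%x. x :. B) (%x. x :. A) (mAnd \<phi> \<psi>) (%i. ys ! i)"
      using XX_tupr[of \<phi> n ys] XX_tupr[of \<psi> n ys] mAnd by simp
  qed (use mAnd in auto)
  then show ?case using j_inter[OF XU XU] mAnd by simp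
next
  case (mEx \<phi>)
  have x: "x :. U'" and fv: "fvb \<phi> \<le> Suc n" "fvb (mEx \<phi>) \<le> n" using mEx.prems by auto
  obtain h where h: "n :. omega ==> ap h n :. U'" "y :. U' ==> EX n. n :. omega & y \<^bold>\<subseteq> ap h n" for n y using cof unfolding cofw_def by blast
  have h': "EX n. n :. omega & y :. ap h n" if y: "y :. U'" for y
    using h(2)[OF Base_upair[OF BU' y y]] by (auto simp: subset_def)
  \<comment> \<open>The tuples with a witness bounded by the \<open>m\<close>-th bound. The set
    \<open>x\<close> is joined to the bound because all entries of the longer tuple are drawn from
    one set.\<close>
  define G where "G m = xsel (W n x) (XX U' a' \<phi> (Suc n) (un x (ap h m)))" for m
  \<comment> \<open>The sequence of the \<open>G m\<close> as one set: each tuple receives its index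
    \<open>m\<close> as an extra entry with key \<open>n\<close>.\<close>
  define Z where "Z = sep (ext1 (W n x) omega (std_num n)) (%b. EX m. m :. omega & (EX c. c :. G m & b = adj1 c (std_num n) m))"
  have wU: "W n x :. U'" by (rule Base_W[OF BU' x])
  have env: "(!) (y # ys) = case_nat y ((!) ys)" for y :: 'a and ys by (auto simp: nth_Cons split: nat.split)
  have X1: "tupr (y # ys) :. XX B A \<phi> (Suc n) v <-> y :. v & (\<forall>y\<in>set ys. y :. v) & eval (%x. x :. B) (%x. x :. A) \<phi> (case_nat y (%i. ys ! i))" if "length ys = n" for y ys B A and v :: 'a
    using XX_tupr[OF fv(1), of "y # ys" B A v] that by (auto simp: env)
  have X2: "(EX b. b :. XX B A \<phi> (Suc n) v & tupr ys \<^bold>\<subseteq> b) <-> (EX y. y :. v & (\<forall>y\<in>set ys. y :. v) & eval (%x. x :. B) (%x. x :. A) \<phi> (case_nat y (%i. ys ! i)))" (is "?l <-> ?r") if l: "length ys = n" for ys B A and v :: 'a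
  proof
    assume ?l
    then obtain zs where zs: "length zs = Suc n" "tupr zs :. XX B A \<phi> (Suc n) v" "tupr ys \<^bold>\<subseteq> tupr zs" using mem_XX[OF fv(1)] by metis
    then obtain y where "zs = y # ys" using tupr_sub l by metis
    then show ?r using zs X1[OF l] by auto
  next
    assume ?r then show ?l using X1[OF l] tupr_mono by meson
  qed
  have dG: "D (%e. e 0 :. G (e 1))"
  proof -
    have "D (%e. e 0 :. W n x & (EX b. (b :. W (Suc n) (un x (ap h (e 1))) & eval (%x. x :. U') (%x. x :. a') \<phi> (%i. ap b (std_num (Suc n - Suc i)))) & e 0 \<^bold>\<subseteq> b))"
    proof -
      have "D (%e. eval (%x. x :. U') (%x. x :. a') \<phi> (%i. ap (e 0) (std_num (Suc n - Suc i))))" by (rule D_eval) (intro Di)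
      then show ?thesis by (intro D_and D_ex D_mem D_sub dt_var dt_const dt_W dt_un dt_ap)
    qed
    moreover have "b :. XX U' a' \<phi> (Suc n) v <-> b :. W (Suc n) v & eval (%x. x :. U') (%x. x :. a') \<phi> (%i. ap b (std_num (Suc n - Suc i)))" for b v
      unfolding XX_def by (rule mem_sep, rule D_eval) (intro Di)
    ultimately show ?thesis unfolding G_def by simp
  qed
  have mZ: "b :. Z <-> (EX m c. m :. omega & c :. G m & b = adj1 c (std_num n) m)" for b
  proof -
    have "D (%e. EX m. m :. omega & (EX c. c :. G m & e 0 = adj1 c (std_num n) m))"
    proof (intro D_ex D_and)
      show "D (%e::nat => 'a. e 0 :. omega)" by (intro Di)
      show "D (%e. e 0 :. G (e (Suc 0)))" using dG by simp
      show "D (%e::nat => 'a. e (Suc (Suc 0)) = adj1 (e 0) (std_num n) (e (Suc 0)))" by (intro Di)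
    qed
    then have "b :. Z <-> b :. ext1 (W n x) omega (std_num n) & (EX m. m :. omega & (EX c. c :. G m & b = adj1 c (std_num n) m))"
      unfolding Z_def by (rule mem_sep)
    moreover have "c :. G m ==> c :. W n x" for c m unfolding G_def by simp
    ultimately show ?thesis unfolding mem_ext1 by blast
  qed
  have Zsub: "Z \<^bold>\<subseteq> ext1 (W n x) omega (std_num n)" by (rule subI, unfold mZ mem_ext1 G_def mem_xsel) blast
  have EU: "ext1 (W n x) omega (std_num n) :. U'" by (rule j_ext1W(1)[OF x Base_omega(1)[OF BU']])
  have ZU: "Z :. U'" by (rule Base_sub[OF BU' EU Zsub])
  have jZsub: "j Z \<^bold>\<subseteq> ext1 (W n (j x)) omega (std_num n)"
    using j_mono[OF ZU EU Zsub] j_ext1W(2)[OF x Base_omega(1)[OF BU']] j_omega j_W[OF x] by simp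
  have tw: "adj1 c (std_num n) m = adj1 c' (std_num n) m' ==> c = c' & m = m'" if w: "c :. W n v" "c' :. W n v" for c c' m m' and v :: 'a
  proof -
    obtain ys where ys: "length ys = n" "c = tupr ys" using w(1) unfolding mem_W by blast
    obtain zs where zs: "length zs = n" "c' = tupr zs" using w(2) unfolding mem_W by blast
    assume "adj1 c (std_num n) m = adj1 c' (std_num n) m'"
    then have "tupr (m # ys) = tupr (m' # zs)" using ys zs by simp
    then have "m # ys = m' # zs" by (rule tupr_inj[rotated]) (simp add: ys zs)
    then show ?thesis using ys zs by simp
  qed
  have tsub: "c = c'" if w: "c :. W n v" "c' :. W n v" and s: "c \<^bold>\<subseteq> adj1 c' (std_num n) m" for c c' m and v :: 'a
  proof -
    obtain ys where ys: "length ys = n" "c = tupr ys" using w(1) unfolding mem_W by blast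
    obtain zs where zs: "length zs = n" "c' = tupr zs" using w(2) unfolding mem_W by blast
    have "tupr ys \<^bold>\<subseteq> tupr (m # zs)" using s ys zs by simp
    from tupr_sub[OF this] show ?thesis using ys zs by auto
  qed
  have selZ: "c :. xsel (W n v) Y <-> (EX m. m :. omega & c :. xsel (W n v) (inter Y (ext1 (W n v) (upair m m) (std_num n))))"
    if Y: "Y \<^bold>\<subseteq> ext1 (W n v) omega (std_num n)" for c Y and v :: 'a
  proof
    assume c: "c :. xsel (W n v) Y"
    then obtain b where b: "b :. Y" "c \<^bold>\<subseteq> b" "c :. W n v" by auto
    then obtain c' m where "c' :. W n v" "m :. omega" "b = adj1 c' (std_num n) m" using subD[OF Y b(1)] unfolding mem_ext1 by blast
    then show "EX m. m :. omega & c :. xsel (W n v) (inter Y (ext1 (W n v) (upair m m) (std_num n)))" using b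
      unfolding mem_xsel mem_inter mem_ext1 mem_upair by blast
  qed (unfold mem_xsel mem_inter, blast)
  \<comment> \<open>Cutting \<open>Z\<close> at the tag \<open>m\<close> and projecting recovers
    \<open>G m\<close>. Both are operations preserved by \<open>j\<close>, and \<open>j\<close> does
    not move the tag; this computes \<open>j (G m)\<close> from \<open>j Z\<close>.\<close>
  have sec: "xsel (W n x) (inter Z (ext1 (W n x) (upair m m) (std_num n))) = G m" if m: "m :. omega" for m
  proof (rule set_eqI)
    fix c
    have Gw: "c :. G m ==> c :. W n x" for c m unfolding G_def by simp
    show "c :. xsel (W n x) (inter Z (ext1 (W n x) (upair m m) (std_num n))) <-> c :. G m"
    proof
      assume "c :. xsel (W n x) (inter Z (ext1 (W n x) (upair m m) (std_num n)))"
      then obtain b c' where b: "c :. W n x" "b :. Z" "c' :. W n x" "b = adj1 c' (std_num n) m" "c \<^bold>\<subseteq> b"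
        unfolding mem_xsel mem_inter mem_ext1 mem_upair by blast
      obtain m' c'' where c'': "c'' :. G m'" "b = adj1 c'' (std_num n) m'" using b(2) unfolding mZ by blast
      then have "c' :. G m" using tw[OF b(3) Gw[OF c''(1)], of m m'] b(4) by simp
      then show "c :. G m" using tsub[OF b(1,3), of m] b(4,5) by simp
    next
      assume c: "c :. G m"
      then have "adj1 c (std_num n) m :. Z" using mZ m by blast
      moreover have "c \<^bold>\<subseteq> adj1 c (std_num n) m" by (simp add: subset_def)
      ultimately show "c :. xsel (W n x) (inter Z (ext1 (W n x) (upair m m) (std_num n)))" using Gw[OF c]
        unfolding mem_xsel mem_inter mem_ext1 mem_upair by blast
    qed
  qed
  have jG: "j (G m) = xsel (W n (j x)) (inter (j Z) (ext1 (W n (j x)) (upair m m) (std_num n)))"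
    and jG': "j (G m) = xsel (W n (j x)) (XX U a \<phi> (Suc n) (un (j x) (j (ap h m))))" if m: "m :. omega" for m
  proof -
    have mU: "m :. U'" "upair m m :. U'" using Base_omega(2)[OF BU' m] Base_upair[OF BU'] by auto
    have E: "ext1 (W n x) (upair m m) (std_num n) :. U'" "j (ext1 (W n x) (upair m m) (std_num n)) = ext1 (W n (j x)) (upair m m) (std_num n)"
      using j_ext1W[OF x mU(2)] j_upair[OF mU(1) mU(1)] j_nat[OF m] j_W[OF x] by auto
    show "j (G m) = xsel (W n (j x)) (inter (j Z) (ext1 (W n (j x)) (upair m m) (std_num n)))"
      unfolding sec[OF m, symmetric] using j_sels(4)[OF wU sub1(6)[OF ZU, of "ext1 (W n x) (upair m m) (std_num n)"] wU] j_inter[OF ZU E(1)] E(2) j_W[OF x] by simp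
    have hU: "un x (ap h m) :. U'" "j (un x (ap h m)) = un (j x) (j (ap h m))" using Base_un[OF BU' x h(1)[OF m]] j_un[OF x h(1)[OF m]] by auto
    show "j (G m) = xsel (W n (j x)) (XX U a \<phi> (Suc n) (un (j x) (j (ap h m))))"
      unfolding G_def using j_sels(4)[OF wU XU[OF hU(1)] wU] mEx.IH[OF fv(1) hU(1)] hU(2) j_W[OF x] by simp
  qed
  have "XX U' a' (mEx \<phi>) n x = xsel (W n x) Z"
  proof (rule XX_eqI[symmetric, OF _ _ fv(2)])
    show "xsel (W n x) Z \<^bold>\<subseteq> W n x" by (simp add: subset_def)
    fix ys :: "'a list" assume ys: "length ys = n" "\<forall>y\<in>set ys. y :. x"
    have w: "tupr ys :. W n x" by (rule tupr_W[OF ys])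
    have "tupr ys :. xsel (W n x) Z <-> (EX m. m :. omega & tupr ys :. G m)" unfolding selZ[OF Zsub] by (simp only: sec cong: conj_cong)
    also have "... <-> (EX m y. m :. omega & y :. un x (ap h m) & eval (%x. x :. U') (%x. x :. a') \<phi> (case_nat y (%i. ys ! i)))"
      unfolding G_def mem_xsel X2[OF ys(1)] using w ys(2) by auto
    also have "... <-> (EX y. y :. U' & eval (%x. x :. U') (%x. x :. a') \<phi> (case_nat y (%i. ys ! i)))"
      using h(1) h' Base_trans[OF BU'] x by (metis mem_un)
    finally show "tupr ys :. xsel (W n x) Z <-> eval (%x. x :. U') (%x. x :. a') (mEx \<phi>) (%i. ys ! i)" by simp
  qed
  then have "j (XX U' a' (mEx \<phi>) n x) = xsel (W n (j x)) (j Z)" using j_sels(4)[OF wU ZU wU] j_W[OF x] by simp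
  also have "... = XX U a (mEx \<phi>) n (j x)"
  proof (rule XX_eqI[OF _ _ fv(2)])
    show "xsel (W n (j x)) (j Z) \<^bold>\<subseteq> W n (j x)" by (simp add: subset_def)
    fix ys :: "'a list" assume ys: "length ys = n" "\<forall>y\<in>set ys. y :. j x"
    have w: "tupr ys :. W n (j x)" by (rule tupr_W[OF ys])
    have "tupr ys :. xsel (W n (j x)) (j Z) <-> (EX m. m :. omega & tupr ys :. j (G m))" unfolding selZ[OF jZsub] by (simp only: jG cong: conj_cong)
    also have "... <-> (EX m. m :. omega & tupr ys :. xsel (W n (j x)) (XX U a \<phi> (Suc n) (un (j x) (j (ap h m)))))" by (simp only: jG' cong: conj_cong)
    also have "... <-> (EX m y. m :. omega & y :. un (j x) (j (ap h m)) & eval (%x. x :. U) (%x. x :. a) \<phi> (case_nat y (%i. ys ! i)))"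
      unfolding mem_xsel X2[OF ys(1)] using w ys(2) by auto
    also have "... <-> (EX y. y :. U & eval (%x. x :. U) (%x. x :. a) \<phi> (case_nat y (%i. ys ! i)))" (is "?L <-> ?R")
    proof
      assume ?L
      then show ?R using Base_trans[OF BU jU] x h(1) by (metis mem_un)
    next
      assume ?R
      then obtain y where y: "y :. U" "eval (%x. x :. U) (%x. x :. a) \<phi> (case_nat y (%i. ys ! i))" by blast
      then obtain u where u: "u :. U'" "y :. j u" using j_cof by blast
      obtain m where m: "m :. omega" "u \<^bold>\<subseteq> ap h m" using h(2)[OF u(1)] by blast
      then have "y :. j (ap h m)" using subD[OF j_mono[OF u(1) h(1)[OF m(1)] m(2)] u(2)] by blast
      then show ?L using m(1) y(2) by (intro exI[of _ m] exI[of _ y]) simp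
    qed
    finally show "tupr ys :. xsel (W n (j x)) (j Z) <-> eval (%x. x :. U) (%x. x :. a) (mEx \<phi>) (%i. ys ! i)" by simp
  qed
  finally show ?case .
qed

text \<open>The finitely many parameters lie in one element \<open>x\<close> of \<open>U'\<close>,
  so truth becomes membership of a tuple in a truth set, which \<open>j\<close> respects.\<close>

lemma elem: assumes "ALL n. e n :. U'" shows "eval (%x. x :. U') (%x. x :. a') \<phi> e <-> eval (%x. x :. U) (%x. x :. a) \<phi> (%n. j (e n))"
proof -
  let ?n = "fvb \<phi>" let ?ys = "map e [0..<?n]"
  have "EX x. x :. U' & (\<forall>y\<in>set ys. y :. x)" if "\<forall>y\<in>set ys. y :. U'" for ys using that
  proof (induction ys)
    case Nil show ?case using stdU by auto
  next
    case (Cons y ys)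
    then obtain x where "x :. U'" "\<forall>y\<in>set ys. y :. x" by auto
    then show ?case using Cons.prems Base_un[OF BU'] Base_upair[OF BU'] by (intro exI[of _ "un x (upair y y)"]) auto
  qed
  moreover have yU: "\<forall>y\<in>set ?ys. y :. U'" using assms by auto
  ultimately obtain x where x: "x :. U'" "\<forall>y\<in>set ?ys. y :. x" by blast
  have "eval (%x. x :. U') (%x. x :. a') \<phi> e <-> eval (%x. x :. U') (%x. x :. a') \<phi> (%i. ?ys ! i)" by (rule eval_cong) simp
  also have "... <-> tupr ?ys :. XX U' a' \<phi> ?n x" using XX_tupr[of \<phi> ?n ?ys U' a' x] x(2) by simp
  also have "... <-> tupr (map j ?ys) :. XX U a \<phi> ?n (j x)"
    using j_mem[of "tupr ?ys" "XX U' a' \<phi> ?n x"] j_tupr[OF yU] XU[OF x(1)] elem_sets[of \<phi> ?n x] x(1) by simp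
  also have "... <-> eval (%x. x :. U) (%x. x :. a) \<phi> (%i. map j ?ys ! i)"
  proof -
    have "\<forall>y\<in>set (map j ?ys). y :. j x" using x yU j_mem by auto
    then show ?thesis using XX_tupr[of \<phi> ?n "map j ?ys" U a "j x"] by simp
  qed
  also have "... <-> eval (%x. x :. U) (%x. x :. a) \<phi> (%n. j (e n))" by (rule eval_cong) simp
  finally show ?thesis .
qed

text \<open>One formula defines \<open>P'\<close> over \<open>(U', a')\<close> and \<open>P\<close>
  over \<open>(U, a)\<close>. The rules for \<open>tr\<close> prove this from the shape of the
  predicates, so that no formula has to be written down.\<close>

definition tr :: "((nat => 'a) => bool) => ((nat => 'a) => bool) => bool" where
  "tr P' P <-> (EX \<phi>. (ALL e. (ALL n. e n :. U') --> P' e = eval (%x. x :. U') (%x. x :. a') \<phi> e) &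
     (ALL e. (ALL n. e n :. U) --> P e = eval (%x. x :. U) (%x. x :. a) \<phi> e))"

lemma trE: assumes "tr P' P" obtains \<phi> where "!!e. (ALL n. e n :. U') ==> P' e = eval (%x. x :. U') (%x. x :. a') \<phi> e"
    "!!e. (ALL n. e n :. U) ==> P e = eval (%x. x :. U) (%x. x :. a) \<phi> e"
  using assms unfolding tr_def by auto
lemma trI: "(!!e. (ALL n. e n :. U') ==> P' e = eval (%x. x :. U') (%x. x :. a') \<phi> e) ==>
    (!!e. (ALL n. e n :. U) ==> P e = eval (%x. x :. U) (%x. x :. a) \<phi> e) ==> tr P' P"
  unfolding tr_def by blast

lemma tr_at: assumes "tr P' P" "ALL n. e n :. U'" shows "P' e = P (%n. j (e n))"
proof -
  obtain \<phi> where "!!e. (ALL n. e n :. U') ==> P' e = eval (%x. x :. U') (%x. x :. a') \<phi> e"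
    "!!e. (ALL n. e n :. U) ==> P e = eval (%x. x :. U) (%x. x :. a) \<phi> e" using trE[OF assms(1)] by blast
  then show ?thesis using elem[OF assms(2), of \<phi>] assms(2) jU by simp
qed
lemma tr_sent: "tr (%e. P') (%e. P) ==> P' = P" using tr_at[of "%e. P'" "%e. P" "%n. omega"] Base_omega(1)[OF BU'] by simp

lemma tr_d0: assumes "d0 P" shows "tr P P"
proof -
  obtain \<phi> where \<phi>: "!!e. P e = bev mem (=) \<phi> e" using assms by (auto simp: d0_def)
  show ?thesis
    by (rule trI[of _ "fmb \<phi>"]; subst eval_fmb) (auto simp: \<phi> intro: Base_trans[OF BU'] Base_trans[OF BU])
qed
lemma tr_not: assumes "tr P' P" shows "tr (%e. ~ P' e) (%e. ~ P e)"
proof -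
  obtain \<phi> where "!!e. (ALL n. e n :. U') ==> P' e = eval (%x. x :. U') (%x. x :. a') \<phi> e"
    "!!e. (ALL n. e n :. U) ==> P e = eval (%x. x :. U) (%x. x :. a) \<phi> e" using trE[OF assms] by blast
  then show ?thesis by (intro trI[of _ "mNeg \<phi>"]) auto
qed
lemma tr_and: assumes "tr P' P" "tr Q' Q" shows "tr (%e. P' e & Q' e) (%e. P e & Q e)"
proof -
  obtain \<phi> where "!!e. (ALL n. e n :. U') ==> P' e = eval (%x. x :. U') (%x. x :. a') \<phi> e"
    "!!e. (ALL n. e n :. U) ==> P e = eval (%x. x :. U) (%x. x :. a) \<phi> e" using trE[OF assms(1)] by blast
  moreover obtain \<psi> where "!!e. (ALL n. e n :. U') ==> Q' e = eval (%x. x :. U') (%x. x :. a') \<psi> e"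
    "!!e. (ALL n. e n :. U) ==> Q e = eval (%x. x :. U) (%x. x :. a) \<psi> e" using trE[OF assms(2)] by blast
  ultimately show ?thesis by (intro trI[of _ "mAnd \<phi> \<psi>"]) auto
qed
lemma tr_or: assumes "tr P' P" "tr Q' Q" shows "tr (%e. P' e | Q' e) (%e. P e | Q e)"
proof -
  have "tr (%e. ~ (~ P' e & ~ Q' e)) (%e. ~ (~ P e & ~ Q e))" by (rule tr_not[OF tr_and[OF tr_not[OF assms(1)] tr_not[OF assms(2)]]])
  then show ?thesis by simp
qed
lemma tr_imp: assumes "tr P' P" "tr Q' Q" shows "tr (%e. P' e --> Q' e) (%e. P e --> Q e)"
  unfolding imp_conv_disj by (rule tr_or[OF tr_not[OF assms(1)] assms(2)])
lemma tr_iff: assumes "tr P' P" "tr Q' Q" shows "tr (%e. P' e = Q' e) (%e. P e = Q e)"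
  unfolding iff_conv_conj_imp by (rule tr_and[OF tr_imp[OF assms] tr_imp[OF assms(2,1)]])
lemma tr_ex: assumes "tr (%e. Q' (e 0) (%n. e (Suc n))) (%e. Q (e 0) (%n. e (Suc n)))"
  shows "tr (%e. EX x. x :. U' & Q' x e) (%e. EX x. x :. U & Q x e)"
proof -
  obtain \<phi> where \<phi>: "!!e. (ALL n. e n :. U') ==> Q' (e 0) (%n. e (Suc n)) = eval (%x. x :. U') (%x. x :. a') \<phi> e"
    "!!e. (ALL n. e n :. U) ==> Q (e 0) (%n. e (Suc n)) = eval (%x. x :. U) (%x. x :. a) \<phi> e" using trE[OF assms] by blast
  show ?thesis
  proof (rule trI[of _ "mEx \<phi>"])
    fix e :: "nat => 'a" assume e: "ALL n. e n :. U'"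
    have "x :. U' ==> ALL n. case_nat x e n :. U'" for x using e by (auto split: nat.split)
    then show "(EX x. x :. U' & Q' x e) = eval (%x. x :. U') (%x. x :. a') (mEx \<phi>) e" using \<phi>(1)[of "case_nat _ e"] by simp metis
  next
    fix e :: "nat => 'a" assume e: "ALL n. e n :. U"
    have "x :. U ==> ALL n. case_nat x e n :. U" for x using e by (auto split: nat.split)
    then show "(EX x. x :. U & Q x e) = eval (%x. x :. U) (%x. x :. a) (mEx \<phi>) e" using \<phi>(2)[of "case_nat _ e"] by simp metis
  qed
qed
lemma tr_all: assumes "tr (%e. Q' (e 0) (%n. e (Suc n))) (%e. Q (e 0) (%n. e (Suc n)))"
  shows "tr (%e. ALL x. x :. U' --> Q' x e) (%e. ALL x. x :. U --> Q x e)"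
proof -
  have "tr (%e. ~ (EX x. x :. U' & ~ Q' x e)) (%e. ~ (EX x. x :. U & ~ Q x e))" by (rule tr_not, rule tr_ex, rule tr_not, rule assms)
  then show ?thesis by simp
qed
lemma tr_ren: assumes "tr P' P" shows "tr (%e. P' (%n. e (f n))) (%e. P (%n. e (f n)))"
proof -
  obtain \<phi> where "!!e. (ALL n. e n :. U') ==> P' e = eval (%x. x :. U') (%x. x :. a') \<phi> e"
    "!!e. (ALL n. e n :. U) ==> P e = eval (%x. x :. U) (%x. x :. a) \<phi> e" using trE[OF assms] by blast
  then show ?thesis by (intro trI[of _ "ren \<phi> f"]) (simp_all add: eval_ren)
qed
lemma tr_cong: assumes "tr P' P" "!!e. (ALL n. e n :. U') ==> P' e = Q' e" "!!e. (ALL n. e n :. U) ==> P e = Q e" shows "tr Q' Q"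
  using assms unfolding tr_def by metis
lemma tr_pr: "tr (%e. e i :. a') (%e. e i :. a)" by (rule trI[of _ "mPr i"]) auto
lemma tr_bex: assumes "tr (%e. Q' (e 0) (%n. e (Suc n))) (%e. Q (e 0) (%n. e (Suc n)))"
  shows "tr (%e. EX x. x :. e i & Q' x e) (%e. EX x. x :. e i & Q x e)"
proof (rule tr_cong)
  show "tr (%e. EX x. x :. U' & (x :. e i & Q' x e)) (%e. EX x. x :. U & (x :. e i & Q x e))"
    by (rule tr_ex, rule tr_and[OF tr_d0 assms]) (intro Bi)
qed (use Base_trans[OF BU'] Base_trans[OF BU] in blast)+
lemma tr_ball: assumes "tr (%e. Q' (e 0) (%n. e (Suc n))) (%e. Q (e 0) (%n. e (Suc n)))"
  shows "tr (%e. ALL x. x :. e i --> Q' x e) (%e. ALL x. x :. e i --> Q x e)"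
proof -
  have "tr (%e. ~ (EX x. x :. e i & ~ Q' x e)) (%e. ~ (EX x. x :. e i & ~ Q x e))" by (rule tr_not, rule tr_bex, rule tr_not, rule assms)
  then show ?thesis by simp
qed

end

section \<open>Codes for the elements of the hierarchy\<close>

lemma lam_img: "lam A F = img A (%x. opair x (F x))" by (simp add: lam_def img_def)
lemma dt_lam [Di]: assumes "dt t" "dt (%e. F (e 0) (%n. e (Suc n)))" shows "dt (%e. lam (t e) (%z. F z e))"
  unfolding lam_img by (intro dt_img dt_opair dt_var assms)
lemma dt_vl [Di]: "dt s ==> dt t ==> dt (%e. vl (s e) (t e))"
  by (rule dt_app2[of vl], rule bt_dt, (intro Bi)[1])

text \<open>Internally finite support, with empty as the value outside. For such assignments codes
  of all values can be gathered without choice, and one level contains all values.\<close>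

definition fa :: "'a::zf => 'a => bool" where
  "fa A f <-> maps f omega A & (EX m. m :. omega & (ALL i. i :. omega & ~ i :. m --> ap f i = empty))"
lemma D_fa [Di]: "dt s ==> dt t ==> D (%e. fa (s e) (t e))" by (rule D_app2[of fa], unfold fa_def, (intro Di)[1])

lemma Base_upd: assumes "Base U" "s :. U" "i :. U" "c :. U" shows "upd s i c :. U"
proof (rule Base_sub[OF assms(1)])
  show "un s (upair (opair i c) (opair i c)) :. U" by (intro Base_un Base_upair Base_opair assms)
  show "upd s i c \<^bold>\<subseteq> un s (upair (opair i c) (opair i c))" by (auto intro!: subI simp: mem_upd)
qed

text \<open>Induction on the support adds one code at a time; all places outside the support share
  the code \<open>c0\<close> of the empty set.\<close>

lemma fin_choice: assumes B: "Base U" and R: "D (%e. R (e 0) (e 1))" and f: "fa A f" and c0: "c0 :. U" "R c0 empty"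
  and ex: "!!i. i :. omega ==> EX c. c :. U & R c (ap f i)"
  shows "EX s. s :. U & fun_on s omega & (ALL i. i :. omega --> ap s i :. U & R (ap s i) (ap f i))"
proof -
  obtain m where m: "m :. omega" "ALL i. i :. omega & ~ i :. m --> ap f i = empty" using f unfolding fa_def by blast
  let ?P = "%m. EX s. s :. U & fun_on s omega & (ALL i. i :. omega --> ap s i :. U & (i :. m --> R (ap s i) (ap f i)) & (~ i :. m --> ap s i = c0))"
  have "?P m" using m(1)
  proof (rule omega_induct)
    have R': "dt s ==> dt t ==> D (%e. R (s e) (t e))" for s t by (rule D_app2[of R, OF R])
    show "D (%e. ?P (e 0))" by (intro Di R')
    have d: "dt (%e::nat => 'a. c0)" by (rule dt_const)
    have "lam omega (%i. c0) :. U"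
    proof (rule Base_sub[OF B Base_prd[OF B Base_omega(1)[OF B] Base_upair[OF B c0(1) c0(1)]]])
      show "lam omega (%i. c0) \<^bold>\<subseteq> prd omega (upair c0 c0)" by (rule subI) (auto simp: mem_lam[OF d])
    qed
    moreover have "i :. omega ==> ap (lam omega (%i. c0)) i = c0" for i by (rule ap_lam[OF d])
    ultimately show "?P empty" using fun_on_lam[OF d, of omega] c0(1) by (intro exI[of _ "lam omega (%i. c0)"]) simp
    fix k assume k: "k :. omega" "?P k"
    then obtain s where s: "s :. U" "fun_on s omega" "ALL i. i :. omega --> ap s i :. U & (i :. k --> R (ap s i) (ap f i)) & (~ i :. k --> ap s i = c0)" by blast
    obtain c where c: "c :. U" "R c (ap f k)" using ex[OF k(1)] by blast
    show "?P (adjoin_self k)"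
      by (rule exI[of _ "upd s k c"]) (use Base_upd[OF B s(1) Base_omega(2)[OF B k(1)] c(1)] fun_on_upd[OF s(2) k(1)] s(3) c in auto)
  qed
  then obtain s where s: "s :. U" "fun_on s omega" "ALL i. i :. omega --> ap s i :. U & (i :. m --> R (ap s i) (ap f i)) & (~ i :. m --> ap s i = c0)" by blast
  have "ap s i :. U & R (ap s i) (ap f i)" if i: "i :. omega" for i
  proof (cases "i :. m")
    case False
    then have "ap f i = empty" using m(2) i by blast
    then show ?thesis using s(3) i False c0 by simp
  qed (use s(3) i in blast)
  then show ?thesis using s(1,2) by blast
qed

text \<open>Truth at some level up to \<open>b\<close> is monotone in \<open>b\<close> for every
  formula, while truth at the level \<open>b\<close> itself need not be.\<close>

definition Qs :: "'a::zf => 'a => 'a => 'a => 'a => 'a => bool" where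
  "Qs U b p n t x <-> (EX c. (c :. b | c = b) & upd t n x :. TS (JJ U c) p)"

text \<open>A failure of collection at \<open>JJ U l\<close>. The least limit ordinal without such a failure replaces the
  least admissible ordinal.\<close>

definition fails :: "'a::zf => 'a => bool" where
  "fails U l <-> (EX p n t d. p :. Form & n :. omega & fa (JJ U l) t & d :. JJ U l & (ALL x. x :. d --> (EX b. b :. l & Qs U b p n t x)) &
     ~ (EX b. b :. l & (ALL x. x :. d --> Qs U b p n t x)))"

definition astar :: "'a::zf => 'a => bool" where
  "astar U l <-> Limit l & ~ fails U l & (ALL m. m :. l & Limit m --> fails U m)"

lemma D_fails [Di]: "dt s ==> dt t ==> D (%e. fails (s e) (t e))"
  by (rule D_app2[of fails], unfold fails_def Qs_def, (intro Di)[1])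

text \<open>The level at the least stage where the formula becomes true. Describing it by its
  elements makes it empty if there is no such stage, hence total and definable.\<close>

definition gJ :: "'a::zf => 'a => 'a => 'a => 'a => 'a" where
  "gJ U p n t x = setof (%z. EX b. Ord b & upd t n x :. TS (JJ U b) p & (ALL c. c :. b --> ~ upd t n x :. TS (JJ U c) p) & z :. JJ U b)"
lemma gJ_unique: assumes "Ord b" "Ord b'" "P b" "ALL c. c :. b --> ~ P c" "P b'" "ALL c. c :. b' --> ~ P c" shows "b = b'"
  using Ord_linear[OF assms(1,2)] assms by blast
lemma isset_gJ: "isset (%z. EX b. Ord b & upd t n x :. TS (JJ U b) p & (ALL c. c :. b --> ~ upd t n x :. TS (JJ U c) p) & z :. JJ U b)"
proof (cases "EX b. Ord b & upd t n x :. TS (JJ U b) p & (ALL c. c :. b --> ~ upd t n x :. TS (JJ U c) p)")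
  case True
  then obtain b where b: "Ord b" "upd t n x :. TS (JJ U b) p" "ALL c. c :. b --> ~ upd t n x :. TS (JJ U c) p" by blast
  have "b' = b" if "Ord b'" "upd t n x :. TS (JJ U b') p" "ALL c. c :. b' --> ~ upd t n x :. TS (JJ U c) p" for b'
    by (rule gJ_unique[of b' b "%b. upd t n x :. TS (JJ U b) p"]) (use b that in auto)
  then show ?thesis unfolding isset_def using b by (intro exI[of _ "JJ U b"]) metis
next
  case False then show ?thesis unfolding isset_def by (intro exI[of _ empty]) auto
qed
lemma dt_gJ: "dt (%e. gJ (e 0) (e 1) (e 2) (e 3) (e 4))"
  unfolding gJ_def by (rule dt_setof[OF _ isset_gJ]) (intro Di)

definition Lim :: "'a::zf => 'a => 'a => 'a => 'a => 'a" where "Lim U p n t d = big_union d (%x. gJ U p n t x)"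
lemma dt_Lim0: "dt (%e. Lim (e 0) (e 1) (e 2) (e 3) (e 4))"
proof -
  have "dt (%e. gJ (e 1) (e 2) (e 3) (e 4) (e 0))"
    using dt_ren[OF dt_gJ, of "%n. if n = 4 then 0 else Suc n"] by (simp add: numeral_2_eq_2 numeral_3_eq_3 eval_nat_numeral)
  then show ?thesis unfolding Lim_def by (intro dt_big_union dt_var) (simp add: eval_nat_numeral)
qed
lemma dt_Lim [Di]: assumes "dt r" "dt s" "dt t" "dt u" "dt v" shows "dt (%e. Lim (r e) (s e) (t e) (u e) (v e))"
  apply (rule dt_subst[of "%x e. Lim x (s e) (t e) (u e) (v e)", OF _ assms(1)])
  apply (rule dt_subst[of "%x e. Lim (e 0) x (t (%n. e (Suc n))) (u (%n. e (Suc n))) (v (%n. e (Suc n)))", OF _ dt_ren[OF assms(2)]])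
  apply (rule dt_subst[of "%x e. Lim (e (Suc 0)) (e 0) x (u (%n. e (Suc (Suc n)))) (v (%n. e (Suc (Suc n))))", OF _ dt_ren[OF assms(3)]])
  apply (rule dt_subst[of "%x e. Lim (e (Suc (Suc 0))) (e (Suc 0)) (e 0) x (v (%n. e (Suc (Suc (Suc n)))))", OF _ dt_ren[OF assms(4)]])
  apply (rule dt_subst[of "%x e. Lim (e (Suc (Suc (Suc 0)))) (e (Suc (Suc 0))) (e (Suc 0)) (e 0) x", OF _ dt_ren[OF assms(5)]])
  using dt_ren[OF dt_Lim0, of "%n. 4 - n"] by (simp add: eval_nat_numeral)

lemma mem_Lim: "z :. Lim U p n t d <-> (EX x. x :. d & (EX b. Ord b & upd t n x :. TS (JJ U b) p & (ALL c. c :. b --> ~ upd t n x :. TS (JJ U c) p) & z :. JJ U b))"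
proof -
  let ?P = "%x b. upd t n x :. TS (JJ U b) p"
  have dg: "dt (%e. gJ U p n t (e 0))" using dt_fix[of "%x e. gJ (e 0) (e 1) (e 2) (e 3) x" "%i. if i = 0 then U else if i = 1 then p else if i = 2 then n else t"]
      dt_ren[OF dt_gJ, of "%n. if n = 4 then 0 else Suc n"] by (simp add: eval_nat_numeral)
  have mg: "z :. gJ U p n t x <-> (EX b. Ord b & ?P x b & (ALL c. c :. b --> ~ ?P x c) & z :. JJ U b)" for x unfolding gJ_def by (rule mem_setof[OF isset_gJ])
  show ?thesis unfolding Lim_def mem_big_union[OF dg] mg ..
qed

text \<open>The least stages for the \<open>x\<close> in \<open>d\<close> lie below
  \<open>l\<close>, and they are cofinal, because no \<open>b\<close> below \<open>l\<close> serves
  all \<open>x\<close>. So the levels at these stages unite to the limit level.\<close>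

lemma Lim_fails: assumes T: "transitive U" "omega :. U" and l: "Limit l" and h: "ALL x. x :. d --> (EX b. b :. l & Qs U b p n t x)" "~ (EX b. b :. l & (ALL x. x :. d --> Qs U b p n t x))"
  shows "Lim U p n t d = JJ U l"
proof (rule set_eqI)
  fix z
  have ol: "Ord l" using l by (simp add: Limit_def)
  let ?P = "%x b. upd t n x :. TS (JJ U b) p"
  have ml: "z :. Lim U p n t d <-> (EX x. x :. d & (EX b. Ord b & ?P x b & (ALL c. c :. b --> ~ ?P x c) & z :. JJ U b))" by (rule mem_Lim)
  have least: "EX b. b :. l & Ord b & ?P x b & (ALL c. c :. b --> ~ ?P x c)" if xd: "x :. d" for x
  proof -
    obtain b c where b: "b :. l" "c :. b | c = b" "?P x c" using h(1)[rule_format, OF xd] unfolding Qs_def by (elim exE conjE)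
    then have c: "c :. l" "Ord c" using ol Ord_trans Ord_mem by blast+
    have "D (%e. ?P x (e 0))" by (intro Di)
    then obtain m where m: "Ord m" "?P x m" "ALL y. y :. m --> ~ ?P x y" using least_ord[of c "?P x"] c(2) b(3) by blast
    then have "m :. c | m = c" using Ord_linear[OF m(1) c(2)] b(3) by blast
    then have "m :. l" using c ol Ord_trans by blast
    then show ?thesis using m by blast
  qed
  show "z :. Lim U p n t d <-> z :. JJ U l"
  proof
    assume "z :. Lim U p n t d"
    then obtain x b where b: "x :. d" "Ord b" "?P x b" "ALL c. c :. b --> ~ ?P x c" "z :. JJ U b" using ml by blast
    obtain b' where b': "b' :. l" "Ord b'" "?P x b'" "ALL c. c :. b' --> ~ ?P x c" using least[OF b(1)] by blast
    have "b = b'" using gJ_unique[of b b' "?P x"] b b' by blast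
    then show "z :. JJ U l" using mem_JJ_Limit[OF l] b(5) b'(1) by blast
  next
    assume "z :. JJ U l"
    then obtain c where c: "c :. l" "z :. JJ U c" using mem_JJ_Limit[OF l] by blast
    obtain x where x: "x :. d" "~ Qs U c p n t x" using h(2) c(1) by blast
    obtain b where b: "b :. l" "Ord b" "?P x b" "ALL c. c :. b --> ~ ?P x c" using least[OF x(1)] by blast
    have "~ (b :. c | b = c)" using x(2) b(3) unfolding Qs_def by blast
    then have "c :. b" using Ord_linear[OF b(2), of c] c(1) ol Ord_mem by blast
    then have "z :. JJ U b" using JJ_sub[OF T b(2)] c(2) by blast
    then show "z :. Lim U p n t d" using ml x(1) b by blast
  qed
qed

text \<open>Composition of \<open>F\<close> with \<open>s\<close>. The union over
  \<open>vl s i\<close> applies \<open>F\<close> only to sets that occur in \<open>s\<close>, as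
  \<open>loc\<close> requires; \<open>ap s i\<close> need not occur there if \<open>s\<close> is not
  a function.\<close>

definition vf :: "('a::zf => 'a) => 'a => 'a" where "vf F s = lam omega (%i. big_union (vl s i) F)"
lemma vf_props: assumes "dt (%e. F (e 0))" "fun_on s omega"
  shows "fun_on (vf F s) omega" "i :. omega ==> ap (vf F s) i = F (ap s i)"
proof -
  have d: "dt (%e. big_union (vl s (e 0)) F)" by (intro dt_big_union dt_vl dt_var dt_const assms(1))
  show "fun_on (vf F s) omega" unfolding vf_def by (rule fun_on_lam[OF d])
  assume i: "i :. omega"
  have "ap (vf F s) i = big_union (vl s i) F" unfolding vf_def by (rule ap_lam[OF d i])
  also have "... = F (ap s i)"
  proof (rule set_eqI)
    show "z :. big_union (vl s i) F <-> z :. F (ap s i)" for z unfolding mem_big_union[OF assms(1)] mem_vl fun_on_mem[OF assms(2)] using i by blast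
  qed
  finally show "ap (vf F s) i = F (ap s i)" .
qed

text \<open>The clauses give codes for the elements of \<open>U\<close>, for \<open>U\<close>, for the sets produced by one operation,
  for the finite stages and the limit of a rudimentary closure, and for a limit level that is pinned down by a failure of collection.\<close>

definition valP :: "'a::zf => 'a => ('a => 'a) => 'a => bool" where
  "valP U c F z <-> (EX x. c = opair (std_num 0) x & z :. x) | (c = opair (std_num 1) empty & z :. U) |
     (EX s p q r X. c = opair (std_num 2) (opair s (opair p (opair q (opair r X)))) & z :. inter (F X) (OP (F s) (F p) (F q) (F r))) |
     (EX n x. c = opair (std_num 3) (opair n x) & z :. it (F x) n) | (EX x. c = opair (std_num 4) x & z :. nx (F x)) |
     (EX p n t d. c = opair (std_num 5) (opair p (opair n (opair t d))) & z :. Lim U p n (vf F t) (F d)) |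
     (EX x. c = opair (std_num 6) x & z :. adjoin_self (F x))"
definition valG :: "'a::zf => 'a => ('a => 'a) => 'a" where "valG U c F = setof (valP U c F)"
definition val :: "'a::zf => 'a => 'a" where "val U c = recr (valG U) c"

lemma valP_simps: "valP U (opair (std_num 0) x) F z <-> z :. x" "valP U (opair (std_num 1) empty) F z <-> z :. U"
  "valP U (opair (std_num 2) (opair s (opair p (opair q (opair r X))))) F z <-> z :. inter (F X) (OP (F s) (F p) (F q) (F r))"
  "valP U (opair (std_num 3) (opair n x)) F z <-> z :. it (F x) n" "valP U (opair (std_num 4) x) F z <-> z :. nx (F x)"
  "valP U (opair (std_num 5) (opair p (opair n (opair t d)))) F z <-> z :. Lim U p n (vf F t) (F d)"
  "valP U (opair (std_num 6) x) F z <-> z :. adjoin_self (F x)"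
  unfolding valP_def opair_inj std_inj by auto

lemma isset_valP: "isset (valP U c F)"
proof -
  consider x where "c = opair (std_num 0) x" | "c = opair (std_num 1) empty" | s p q r X where "c = opair (std_num 2) (opair s (opair p (opair q (opair r X))))"
    | n x where "c = opair (std_num 3) (opair n x)" | x where "c = opair (std_num 4) x" | p n t d where "c = opair (std_num 5) (opair p (opair n (opair t d)))"
    | x where "c = opair (std_num 6) x" | "ALL z. ~ valP U c F z" unfolding valP_def by blast
  then show ?thesis unfolding isset_def
  proof cases
    case 8 then show "EX x. ALL y. (y :. x) = valP U c F y" by (intro exI[of _ empty]) simp
  qed (simp_all only: valP_simps, blast+)
qed

lemma loc_valG: "loc (valG U)" unfolding loc_def
proof (intro allI impI)
  fix c S :: 'a and F F' :: "'a => 'a" assume h: "transitive S & c \<^bold>\<subseteq> S & (ALL z. z :. S --> F z = F' z)"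
  have 1: "c = opair s x ==> x :. S" for s x using h opair_loc by blast
  have F: "x :. S ==> F x = F' x" for x using h by blast
  have 2: "opair x y :. S ==> x :. S & y :. S" for x y using h opair_trans by blast
  have "valP U c F z = valP U c F' z" for z
  proof -
    consider x where "c = opair (std_num 0) x" | "c = opair (std_num 1) empty" | s p q r X where "c = opair (std_num 2) (opair s (opair p (opair q (opair r X))))"
      | n x where "c = opair (std_num 3) (opair n x)" | x where "c = opair (std_num 4) x" | p n t d where "c = opair (std_num 5) (opair p (opair n (opair t d)))"
      | x where "c = opair (std_num 6) x" | "~ valP U c F z & ~ valP U c F' z" unfolding valP_def by blast
    then show ?thesis
    proof cases
      case 3
      then have "s :. S" "p :. S" "q :. S" "r :. S" "X :. S" using 1 2 by blast+
      then show ?thesis using 3 F by (simp only: valP_simps)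
    next
      case 6
      then have td: "t :. S" "d :. S" using 1 2 by blast+
      have "z :. vl t i ==> z :. S" for z i using td(1) h 2 unfolding mem_vl using transD by metis
      then have "vf F t = vf F' t" unfolding vf_def using big_union_cong[of _ F F'] F by metis
      then show ?thesis using 6 F td by (simp only: valP_simps)
    next
      case 4
      then have "x :. S" using 1 2 by blast
      then show ?thesis using 4 F by (simp only: valP_simps)
    next
      case 5 then show ?thesis using F[OF 1] by (simp only: valP_simps)
    next
      case 7 then show ?thesis using F[OF 1] by (simp only: valP_simps)
    qed (simp_all only: valP_simps simp_thms)
  qed
  then show "valG U c F = valG U c F'" unfolding valG_def by presburger
qed
lemma dt_valG: "dt (%e. valG (e 0) (e 1) (ap (e 2)))" unfolding valG_def
  by (rule dt_setof[of "%e. valP (e 0) (e 1) (ap (e 2))", OF _ isset_valP], unfold valP_def vf_def) (intro Di)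
lemma D_valG: "D (%e. e 0 = valG (e 1) (e 2) (ap (e 3)))" using dt_valG by (simp add: dt_def numeral_2_eq_2 numeral_3_eq_3)
lemma D_valG': "D (%e. e 0 = valG U (e 1) (ap (e 2)))"
  by (rule D_subst[of "%x e. e 0 = valG x (e 1) (ap (e 2))", OF _ dt_const])
    (use D_ren[OF D_valG, of "%n. if n = 0 then 1 else if n = 1 then 0 else n"] in \<open>simp add: numeral_2_eq_2 numeral_3_eq_3\<close>)
lemma dt_val [Di]: "dt s ==> dt t ==> dt (%e. val (s e) (t e))" unfolding val_def by (rule dt_recr[OF loc_valG D_valG])

lemma mem_val: "z :. val U c <-> valP U c (val U) z"
proof -
  have "val U c = valG U c (val U)" unfolding val_def by (rule recr_unfold[OF loc_valG D_valG'])
  then show ?thesis unfolding valG_def using mem_setof[OF isset_valP] by metis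
qed
lemma val_simps: "val U (opair (std_num 0) x) = x" "val U (opair (std_num 1) empty) = U"
  "val U (opair (std_num 2) (opair s (opair p (opair q (opair r X))))) = inter (val U X) (OP (val U s) (val U p) (val U q) (val U r))"
  "val U (opair (std_num 3) (opair n x)) = it (val U x) n" "val U (opair (std_num 4) x) = nx (val U x)"
  "val U (opair (std_num 5) (opair p (opair n (opair t d)))) = Lim U p n (vf (val U) t) (val U d)"
  "val U (opair (std_num 6) x) = adjoin_self (val U x)"
  by (rule set_eqI, simp only: mem_val valP_simps)+

definition inH :: "'a::zf => 'a => bool" where "inH U x <-> (EX c. c :. U & x = val U c)"
lemma inH_rules: assumes B: "Base U"
  shows "x :. U ==> inH U x" "inH U U" "inH U s ==> inH U p ==> inH U q ==> inH U r ==> inH U X ==> inH U (inter X (OP s p q r))"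
    "n :. U ==> inH U x ==> inH U (it x n)" "inH U x ==> inH U (nx x)" "inH U x ==> inH U (adjoin_self x)"
    "p' :. U ==> n :. U ==> t :. U ==> inH U d ==> inH U (Lim U p' n (vf (val U) t) d)"
proof -
  have o: "x :. U ==> y :. U ==> opair x y :. U" for x y using Base_opair[OF B] .
  have s: "std_num k :. U" for k using Base_omega(2)[OF B] by simp
  have e: "empty :. U" using s[of 0] by simp
  note v = val_simps[symmetric]
  show "x :. U ==> inH U x" unfolding inH_def using v(1) o s by metis
  show "inH U U" unfolding inH_def using v(2) o s e by metis
  show "inH U s ==> inH U p ==> inH U q ==> inH U r ==> inH U X ==> inH U (inter X (OP s p q r))"
    unfolding inH_def by (elim exE conjE, rule exI, rule conjI[rotated], simp only: v(3)) (intro o s)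
  show "n :. U ==> inH U x ==> inH U (it x n)"
    unfolding inH_def by (elim exE conjE, rule exI, rule conjI[rotated], simp only: v(4)) (intro o s)
  show "inH U x ==> inH U (nx x)" unfolding inH_def using v(5) o s by metis
  show "inH U x ==> inH U (adjoin_self x)" unfolding inH_def using v(7) o s by metis
  show "p' :. U ==> n :. U ==> t :. U ==> inH U d ==> inH U (Lim U p' n (vf (val U) t) d)"
    unfolding inH_def by (elim exE conjE, rule exI, rule conjI[rotated], simp only: v(6)) (intro o s)
qed

text \<open>New elements of a stage arise by one operation from elements of the stage before, and
  codes combine accordingly. Only existence of codes is carried along, so nothing is chosen.\<close>

lemma nx_inH: assumes B: "Base U" and "inH U X" "ALL x. x :. X --> inH U x" "x :. nx X" shows "inH U x"
proof -
  obtain n where n: "n :. omega" "x :. it X n" using assms(4) mem_nx by blast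
  have "inH U (it X n) & (ALL x. x :. it X n --> inH U x)" using n(1)
  proof (rule omega_induct)
    show "D (%e. inH U (it X (e 0)) & (ALL x. x :. it X (e 0) --> inH U x))" unfolding inH_def by (intro Di)
    show "inH U (it X empty) & (ALL x. x :. it X empty --> inH U x)" using assms by simp
    fix n assume n: "n :. omega" and h: "inH U (it X n) & (ALL x. x :. it X n --> inH U x)"
    have "inH U (it X (adjoin_self n))" by (rule inH_rules(4)[OF B Base_omega(2)[OF B adj_omega[OF n]] assms(2)])
    moreover have "inH U x" if x: "x :. it X (adjoin_self n)" for x
    proof -
      consider "x :. it X n" | "x = it X n" | s p q r where "s :. it X n" "p :. it X n" "q :. it X n" "r :. it X n" "x = inter (it X n) (OP s p q r)"
        using x unfolding it_Suc mem_step by blast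
      then show ?thesis by cases (use h inH_rules(3)[OF B] in blast)+
    qed
    ultimately show "inH U (it X (adjoin_self n)) & (ALL x. x :. it X (adjoin_self n) --> inH U x)" by blast
  qed
  then show ?thesis using n(2) by blast
qed

lemma Form_U: "Base U ==> p :. Form ==> p :. U" using Base_trans unfolding Base_def by blast

text \<open>At a limit the failure of collection is itself the code: formula and index are elements
  of \<open>U\<close>, the set \<open>d\<close> has a code by induction, and
  \<open>fin_choice\<close> gathers codes of the parameters into one element of
  \<open>U\<close>.\<close>

lemma JJ_inH: assumes B: "Base U" "Ord b" "ALL l. (l :. b | l = b) & Limit l --> fails U l"
  shows "inH U (JJ U b) & (ALL x. x :. JJ U b --> inH U x)"
proof -
  have T: "transitive U" "omega :. U" using B(1) by (auto simp: Base_def)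
  have "(ALL l. (l :. b | l = b) & Limit l --> fails U l) --> inH U (JJ U b) & (ALL x. x :. JJ U b --> inH U x)" using B(2)
  proof (rule ord_induct)
    show "D (%e. (ALL l. (l :. e 0 | l = e 0) & Limit l --> fails U l) --> inH U (JJ U (e 0)) & (ALL x. x :. JJ U (e 0) --> inH U x))"
      unfolding inH_def by (intro Di)
    fix b assume b: "Ord b" "!!c. c :. b ==> (ALL l. (l :. c | l = c) & Limit l --> fails U l) --> inH U (JJ U c) & (ALL x. x :. JJ U c --> inH U x)"
    show "(ALL l. (l :. b | l = b) & Limit l --> fails U l) --> inH U (JJ U b) & (ALL x. x :. JJ U b --> inH U x)"
    proof
      assume f: "ALL l. (l :. b | l = b) & Limit l --> fails U l"
      have IH: "inH U (JJ U c) & (ALL x. x :. JJ U c --> inH U x)" if "c :. b" for c using b that f Ord_trans by blast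
      consider "b = empty" | "Limit b" | c where "c :. b" "b = adjoin_self c" using Ord_cases[OF b(1)] by blast
      then show "inH U (JJ U b) & (ALL x. x :. JJ U b --> inH U x)"
      proof cases
        case 1
        have "inH U (adjoin_self U)" "x :. adjoin_self U ==> inH U x" for x
          using inH_rules(1,2,6)[OF B(1)] unfolding mem_adj by blast+
        then show ?thesis unfolding 1 JJ_0 by blast
      next
        case 3
        have "inH U (JJ U c)" "ALL x. x :. JJ U c --> inH U x" using IH[OF 3(1)] by blast+
        then have "inH U (nx (JJ U c)) & (ALL x. x :. nx (JJ U c) --> inH U x)" using nx_inH[OF B(1)] inH_rules(5)[OF B(1)] by blast
        then show ?thesis unfolding 3(2) JJ_Suc .
      next
        case 2
        have el: "ALL x. x :. JJ U b --> inH U x" unfolding mem_JJ_Limit[OF 2] using IH by blast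
        obtain p n t d where w: "p :. Form" "n :. omega" "fa (JJ U b) t" "d :. JJ U b" "ALL x. x :. d --> (EX c. c :. b & Qs U c p n t x)" "~ (EX c. c :. b & (ALL x. x :. d --> Qs U c p n t x))"
          using f[rule_format, OF conjI[OF disjI2[OF refl] 2]] unfolding fails_def by (elim exE conjE)
        have tm: "maps t omega (JJ U b)" using w(3) unfolding fa_def by blast
        have "EX s. s :. U & fun_on s omega & (ALL i. i :. omega --> ap s i :. U & ap t i = val U (ap s i))"
        proof (rule fin_choice[OF B(1) _ w(3)])
          show "D (%e. e 1 = val U (e 0))" by (intro Di)
          show "opair (std_num 0) empty :. U" using Base_opair[OF B(1)] Base_omega(2)[OF B(1), of "std_num 0"] by simp
          show "empty = val U (opair (std_num 0) empty)" by (simp only: val_simps)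
          show "EX c. c :. U & ap t i = val U c" if "i :. omega" for i using el tm that unfolding maps_iff inH_def by blast
        qed
        then obtain s where s: "s :. U" "fun_on s omega" "ALL i. i :. omega --> ap s i :. U & ap t i = val U (ap s i)" by blast
        have dv: "dt (%e. val U (e 0))" by (intro Di)
        have "vf (val U) s = t"
          by (rule fun_on_ext[of _ omega]) (use vf_props[OF dv s(2)] tm s(3) in \<open>auto simp: maps_iff\<close>)
        then have "inH U (Lim U p n t d)" using inH_rules(7)[OF B(1) Form_U[OF B(1) w(1)] Base_omega(2)[OF B(1) w(2)] s(1)] el w(4) by metis
        then show ?thesis using Lim_fails[OF T 2 w(5,6)] el by simp
      qed
    qed
  qed
  then show ?thesis using B(3) by blast
qed

text \<open>If every limit level failed, every level would have a code in \<open>U\<close>. Distinct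
  ordinals have distinct levels, so Replacement on \<open>U\<close> would produce a set of all
  ordinals.\<close>

lemma astar_ex: assumes "Base U" shows "EX l. astar U l"
proof (rule ccontr)
  assume n: "~ (EX l. astar U l)"
  have T: "transitive U" "omega :. U" using assms by (auto simp: Base_def)
  have all: "fails U l" if L: "Limit l" for l
  proof (rule ccontr)
    assume nf: "~ fails U l"
    have "D (%e. Limit (e 0) & ~ fails U (e 0))" by (intro Di)
    then obtain m where "Ord m" "Limit m & ~ fails U m" "ALL y. y :. m --> ~ (Limit y & ~ fails U y)"
      using least_ord[of l "%l. Limit l & ~ fails U l", OF L[unfolded Limit_def, THEN conjunct1] conjI[OF L nf]] by blast
    then show False using n unfolding astar_def by blast
  qed
  \<comment> \<open>Values that are no level are sent to empty, so that the relation is total as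
    Replacement demands.\<close>
  let ?R = "%h b. (Ord b & h = JJ U b) | ((~ (EX b. Ord b & h = JJ U b)) & b = empty)"
  have inj: "b = b'" if "Ord b" "Ord b'" "JJ U b = JJ U b'" for b b'
    using Ord_linear[OF that(1,2)] JJ_mem[OF T that(1), of b'] JJ_mem[OF T that(2), of b] that(3) mem_not_refl by metis
  have "isset (%b. EX c. c :. U & ?R (val U c) b)"
    by (rule replacement[of "%c b. ?R (val U c) b"], (intro Di)[1]) (use inj in metis)
  then obtain s where s: "ALL b. b :. s <-> (EX c. c :. U & ?R (val U c) b)" unfolding isset_def by blast
  have "b :. s" if "Ord b" for b
  proof -
    have "inH U (JJ U b)" using JJ_inH[OF assms that] all by blast
    then obtain c where "c :. U" "JJ U b = val U c" unfolding inH_def by blast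
    then show ?thesis using s that by metis
  qed
  then show False using no_set_of_ords[of s] by blast
qed

lemma astar_inH: assumes "Base U" "astar U l" shows "b :. l ==> inH U (JJ U b)" "x :. JJ U l ==> inH U x"
proof -
  have l: "Limit l" "Ord l" using assms(2) by (auto simp: astar_def Limit_def)
  have *: "b :. l ==> inH U (JJ U b) & (ALL x. x :. JJ U b --> inH U x)" for b
    by (rule JJ_inH[OF assms(1) Ord_mem[OF l(2)]]) (use assms(2) l(2) Ord_trans in \<open>unfold astar_def, blast\<close>)+
  then show "b :. l ==> inH U (JJ U b)" by blast
  show "x :. JJ U l ==> inH U x" unfolding mem_JJ_Limit[OF l(1)] using * by blast
qed

section \<open>Structures of codes\<close>

text \<open>Any second component \<open>y\<close> of a pair \<open>p\<close> is an element of an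
  element of \<open>p\<close>; with this bound the update is a simple function.\<close>

lemma upd_sep: "upd s i c = un (upair (opair i c) (opair i c)) (sep s (%p. ~ (EX u. u :. p & (EX y. y :. u & p = opair i y))))"
proof (rule set_eqI)
  fix p
  have "D (%e. ~ (EX u. u :. e 0 & (EX y. y :. u & e 0 = opair i y)))" by (intro Di)
  note m = mem_sep[OF this]
  have "(EX u. u :. p & (EX y. y :. u & p = opair i y)) <-> (EX y. p = opair i y)"
  proof
    assume "EX y. p = opair i y"
    then obtain y where "p = opair i y" ..
    then show "EX u. u :. p & (EX y. y :. u & p = opair i y)" by (intro exI[of _ "upair i y"] conjI exI[of _ y]) (simp_all add: opair_def)
  qed blast
  then show "p :. upd s i c <-> p :. un (upair (opair i c) (opair i c)) (sep s (%p. ~ (EX u. u :. p & (EX y. y :. u & p = opair i y))))"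
    unfolding mem_un m mem_upd mem_upair by blast
qed
lemma bt_upd [Bi]: "bt s ==> bt t ==> bt u ==> bt (%e. upd (s e) (t e) (u e))"
  by (rule bt_app4[of "%s t u _. upd s t u" s t u u]) (unfold upd_sep, intro Bi)

lemma omega_iff: "x = omega <-> empty :. x & (ALL n. n :. x --> adjoin_self n :. x) & (ALL n. n :. x --> n = empty | (EX m. m :. x & n = adjoin_self m))"
proof
  assume e: "x = omega" show "empty :. x & (ALL n. n :. x --> adjoin_self n :. x) & (ALL n. n :. x --> n = empty | (EX m. m :. x & n = adjoin_self m))"
    unfolding e by (intro conjI allI impI) (rule empty_omega, erule adj_omega, erule omega_cases)
qed (elim conjE, rule omega_eq, simp_all)
lemma d0_omega [Bi]: "bt t ==> d0 (%e. t e = omega)"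
  by (rule d0_subst[of "%x e. x = omega"], unfold omega_iff, (intro Bi)[1])

text \<open>Subformulas are not elements of a code but lie in its transitive closure, that is, in
  every transitive set that includes it.\<close>

lemma tc_induct: assumes d: "D (%e. P (e 0))" and st: "!!x. (!!y. (!!S. transitive S ==> x \<^bold>\<subseteq> S ==> y :. S) ==> P y) ==> P x" shows "P x"
proof -
  let ?t = "%x y. ALL S. transitive S & x \<^bold>\<subseteq> S --> y :. S"
  have dP: "dt t ==> D (%e. P (t e))" for t by (rule D_app1[OF d])
  have "P x & (ALL y. ?t x y --> P y)"
  proof (rule mem_induct)
    show "D (%e. P (e 0) & (ALL y. ?t (e 0) y --> P y))" by (intro Di dP)
    fix x assume IH: "!!z. z :. x ==> P z & (ALL y. ?t z y --> P y)"
    obtain T where T: "transitive T" "x :. T" using ex_trans by blast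
    have dS: "D (%e. EX z. z :. x & (e 0 = z | ?t z (e 0)))" by (intro Di)
    let ?S = "sep T (%y. EX z. z :. x & (y = z | ?t z y))"
    have tr: "transitive ?S"
    proof (rule transI)
      fix y u assume "y :. ?S" and u: "u :. y"
      then obtain z where y: "y :. T" "z :. x" "y = z | ?t z y" unfolding mem_sep[OF dS] by blast
      have "?t z u"
      proof (intro allI impI)
        fix S assume S: "transitive S & z \<^bold>\<subseteq> S"
        then have "y = z | y :. S" using y(3) by blast
        then show "u :. S" using S u transD subD by blast
      qed
      then show "u :. ?S" unfolding mem_sep[OF dS] using y(2) transD[OF T(1) y(1) u] by blast
    qed
    have "x \<^bold>\<subseteq> ?S" by (rule subI, unfold mem_sep[OF dS]) (use transD[OF T] in blast)
    then have *: "P y" if "?t x y" for y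
    proof -
      have "y :. ?S" using that tr \<open>x \<^bold>\<subseteq> ?S\<close> by blast
      then show "P y" unfolding mem_sep[OF dS] using IH by blast
    qed
    then show "P x & (ALL y. ?t x y --> P y)" using st[of x] by blast
  qed
  then show ?thesis ..
qed

text \<open>Closure under the formation rules together with decomposability of each element inside
  the set. Well-foundedness leaves only one such set, so the quantifier over all closed sets is
  replaced by a condition bounded in \<open>x\<close> and \<open>omega\<close>.\<close>

lemma Form_iff: "x = Form <-> (ALL i. i :. omega --> (ALL k. k :. omega --> cMem i k :. x & cEq i k :. x)) & (ALL p. p :. x --> cNeg p :. x & (ALL q. q :. x --> cAnd p q :. x) & (ALL i. i :. omega --> cEx i p :. x)) &
  (ALL p. p :. x --> (EX i. i :. omega & (EX k. k :. omega & (p = cMem i k | p = cEq i k))) | (EX q. q :. x & (p = cNeg q | (EX r. r :. x & p = cAnd q r) | (EX i. i :. omega & p = cEx i q))))"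
  (is "_ <-> ?A x & ?B x & ?C x")
proof
  have cases: "?C Form"
  proof (intro allI impI)
    fix p :: 'a assume "p :. Form"
    then show "(EX i. i :. omega & (EX k. k :. omega & (p = cMem i k | p = cEq i k))) | (EX q. q :. Form & (p = cNeg q | (EX r. r :. Form & p = cAnd q r) | (EX i. i :. omega & p = cEx i q)))" (is "?P p")
    proof (rule Form_induct)
      show "D (%e. ?P (e 0))" by (intro Di)
    qed blast+
  qed
  assume "x = Form" then show "?A x & ?B x & ?C x" using cases by (simp add: Form_intros)
next
  assume h: "?A x & ?B x & ?C x"
  note hA = h[THEN conjunct1, rule_format] and hB = h[THEN conjunct2, THEN conjunct1, rule_format]
  have 1: "p :. x" if "p :. Form" for p using that
  proof (rule Form_induct)
    show "D (%e. e 0 :. x)" by (intro Di)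
    show "i :. omega ==> k :. omega ==> cMem i k :. x" "i :. omega ==> k :. omega ==> cEq i k :. x" for i k using hA[of i k] by simp_all
    show "p :. x ==> cNeg p :. x" for p using hB[of p] by simp
    show "p :. x ==> q :. x ==> cAnd p q :. x" for p q using hB[of p] by simp
    show "i :. omega ==> p :. x ==> cEx i p :. x" for i p using hB[of p] by simp
  qed
  have 2: "p :. x --> p :. Form" for p
  proof -
    have d: "D (%e. e 0 :. x --> e 0 :. Form)" by (intro Di)
    show ?thesis
    proof (rule tc_induct[OF d])
      fix p assume IH: "!!q. (!!S. transitive S ==> p \<^bold>\<subseteq> S ==> q :. S) ==> q :. x --> q :. Form"
      have o: "q :. Form" if "p = opair k (opair i q) | p = opair k (opair q i) | p = opair k q" "q :. x" for k i q
      proof (rule IH[rule_format, OF _ that(2)])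
        fix S assume "transitive S" "p \<^bold>\<subseteq> S"
        then show "q :. S" using that(1) opair_loc[of S] opair_trans[of S] by blast
      qed
      show "p :. x --> p :. Form"
      proof
        assume p: "p :. x"
        from h[THEN conjunct2, THEN conjunct2, rule_format, OF p]
        consider i k where "i :. omega" "k :. omega" "p = cMem i k | p = cEq i k" | q where "q :. x" "p = cNeg q"
          | q r where "q :. x" "r :. x" "p = cAnd q r" | i q where "q :. x" "i :. omega" "p = cEx i q" by blast
        then show "p :. Form"
        proof cases
          case 1 then show ?thesis using Form_intros(1,2) by blast
        next
          case 2 then show ?thesis using o[of "std_num 2" empty q] Form_intros(3)[of q] unfolding cNeg_def by blast
        next
          case 3 then show ?thesis using o[of "std_num 3" q r] o[of "std_num 3" r q] Form_intros(4)[of q r] unfolding cAnd_def by blast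
        next
          case 4 then show ?thesis using o[of "std_num 4" i q] Form_intros(5)[of i q] unfolding cEx_def by blast
        qed
      qed
    qed
  qed
  show "x = Form" by (rule set_eqI) (use 1 2 in blast)
qed

abbreviation "K0 x \<equiv> opair (std_num 0) x"
abbreviation "K1 \<equiv> opair (std_num 1) empty"
abbreviation "K2 s p q r X \<equiv> opair (std_num 2) (opair s (opair p (opair q (opair r X))))"
abbreviation "K3 n x \<equiv> opair (std_num 3) (opair n x)"
abbreviation "K4 x \<equiv> opair (std_num 4) x"
abbreviation "K5 p n s d \<equiv> opair (std_num 5) (opair p (opair n (opair s d)))"
abbreviation "K6 x \<equiv> opair (std_num 6) x"

text \<open>A set has many codes, so equality in a structure of codes is having the same elements.
  The companion \<open>Dm\<close> singles out the codes of elements of some level.\<close>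

definition EQ :: "'a::zf => ('a => 'a => bool) => 'a => 'a => bool" where
  "EQ U E c d <-> (ALL z. z :. U --> (E z c <-> E z d))"
definition Dm :: "'a::zf => ('a => 'a => bool) => ('a => bool) => 'a => bool" where
  "Dm U E L c <-> (EX q. q :. U & (L q & E c q))"
definition BO :: "'a::zf => ('a => 'a => bool) => bf => 'a => 'a => 'a => 'a => 'a => bool" where
  "BO U E \<chi> z s p q r <-> bev E (EQ U E) \<chi> (%n. if n = 0 then z else if n = 1 then s else if n = 2 then p else if n = 3 then q else r)"
definition As :: "'a::zf => ('a => 'a => bool) => 'a => 'a => bool" where
  "As U E q s <-> (ALL i. i :. U --> (i :. omega --> E (ap s i) q))"

text \<open>The axioms are true of the codes for \<open>JJ U l\<close> where \<open>astar U l\<close>, they are first order over \<open>U\<close>,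
  and every structure satisfying them has an initial part isomorphic to \<open>JJ U l\<close>.\<close>

definition PHE :: "'a::zf => ('a => 'a => bool) => ('a => bool) => bool" where
  "PHE U E L <-> (ALL z. z :. U --> (ALL d. d :. U --> (E z d --> Dm U E L z & Dm U E L d))) &
     (ALL c. c :. U --> (ALL c'. c' :. U --> (ALL d. d :. U --> (Dm U E L c' --> EQ U E c c' --> E c d --> E c' d)))) &
     (ALL q. q :. U --> (L q --> Dm U E L q)) &
     (ALL q. q :. U --> (ALL r. r :. U --> (L q --> L r --> E q r | EQ U E q r | E r q))) &
     (ALL q. q :. U --> (L q --> E K1 q)) &
     (ALL q. q :. U --> (ALL r. r :. U --> (L q --> L r --> E r q --> E (K4 r) q | EQ U E (K4 r) q)))"
definition PH0 :: "'a::zf => ('a => 'a => bool) => ('a => bool) => bool" where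
  "PH0 U E L <-> (ALL x. x :. U --> (Dm U E L (K0 x) & (ALL z. z :. U --> (E z (K0 x) <-> Dm U E L z & (EX y. y :. U & (y :. x & EQ U E z (K0 y))))))) &
     (Dm U E L K1 & (ALL z. z :. U --> (E z K1 <-> Dm U E L z & (EX y. y :. U & EQ U E z (K0 y))))) &
     (L (K6 K1) & (ALL z. z :. U --> (E z (K6 K1) <-> E z K1 | (Dm U E L z & EQ U E z K1))))"
definition PH2 :: "'a::zf => ('a => 'a => bool) => ('a => bool) => bf => bool" where
  "PH2 U E L \<chi> <-> (ALL s. s :. U --> (ALL p. p :. U --> (ALL q. q :. U --> (ALL r. r :. U --> (ALL X. X :. U --> (Dm U E L s --> Dm U E L p --> Dm U E L q --> Dm U E L r --> Dm U E L X -->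
     Dm U E L (K2 s p q r X) & (ALL z. z :. U --> (E z (K2 s p q r X) <-> E z X & BO U E \<chi> z s p q r))))))))"
definition PH3 :: "'a::zf => ('a => 'a => bool) => ('a => bool) => bool" where
  "PH3 U E L <-> (ALL x. x :. U --> (Dm U E L x --> EQ U E (K3 empty x) x & (ALL n. n :. U --> (n :. omega --> Dm U E L (K3 n x) &
     (ALL z. z :. U --> (E z (K3 (adjoin_self n) x) <-> E z (K3 n x) | (Dm U E L z & (EQ U E z (K3 n x) |
        (EX s. s :. U & (EX p. p :. U & (EX q. q :. U & (EX r. r :. U & (E s (K3 n x) & E p (K3 n x) & E q (K3 n x) & E r (K3 n x) & EQ U E z (K2 s p q r (K3 n x))))))))))))))) &
     (ALL q. q :. U --> (L q --> L (K4 q) & (ALL z. z :. U --> (E z (K4 q) <-> (EX n. n :. U & (n :. omega & E z (K3 n q)))))))"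
text \<open>The premises do not ask for a failure of collection, only that every element of
  \<open>d\<close> is served by some level. The result is a level in any case, namely at the
  supremum of the least stages; for empty \<open>d\<close> the union would be empty, hence the
  premise on \<open>d\<close>.\<close>

definition PH5 :: "'a::zf => ('a => 'a => bool) => ('a => bool) => ('a => 'a => 'a => bool) => bool" where
  "PH5 U E L F <-> (ALL p. p :. U --> (ALL n. n :. U --> (ALL s. s :. U --> (ALL d. d :. U --> (p :. Form --> n :. omega --> fun_on s omega --> Dm U E L d --> (EX x. x :. U & E x d) -->
     (ALL i. i :. U --> (i :. omega --> Dm U E L (ap s i))) --> (EX m. m :. U & (m :. omega & (ALL i. i :. U --> (i :. omega --> ~ i :. m --> EQ U E (ap s i) (K0 empty))))) -->
     (ALL x. x :. U --> (E x d --> (EX q. q :. U & (L q & F q p (upd s n x))))) -->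
     L (K5 p n s d) & (ALL z. z :. U --> (E z (K5 p n s d) <-> (EX x. x :. U & (E x d & (EX q. q :. U & (L q & F q p (upd s n x) &
        (ALL r. r :. U --> (L r --> E r q --> ~ F r p (upd s n x))) & E z q)))))))))))"
definition PHF :: "'a::zf => ('a => 'a => bool) => ('a => bool) => ('a => 'a => 'a => bool) => bool" where
  "PHF U E L F <-> (ALL q. q :. U --> (ALL s. s :. U --> (L q --> fun_on s omega -->
     (ALL i. i :. U --> (i :. omega --> (ALL k. k :. U --> (k :. omega --> (F q (cMem i k) s <-> As U E q s & E (ap s i) (ap s k)) & (F q (cEq i k) s <-> As U E q s & EQ U E (ap s i) (ap s k)))))) &
     (ALL p. p :. U --> (F q (cNeg p) s <-> As U E q s & ~ F q p s)) &
     (ALL p. p :. U --> (ALL p'. p' :. U --> (F q (cAnd p p') s <-> As U E q s & F q p s & F q p' s))) &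
     (ALL i. i :. U --> (i :. omega --> (ALL p. p :. U --> (F q (cEx i p) s <-> As U E q s & (EX c. c :. U & (E c q & F q p (upd s i c)))))))))) "
definition PH :: "'a::zf => ('a => 'a => bool) => ('a => bool) => ('a => 'a => 'a => bool) => bf => bool" where
  "PH U E L F \<chi> <-> PHE U E L & PH0 U E L & PH2 U E L \<chi> & PH3 U E L & PH5 U E L F & PHF U E L F"

text \<open>The formula is an argument of the axioms, so both structures use the same one; the type
  argument ties it to the model at hand.\<close>

definition opf :: "bf => 'a::zf itself => bool" where
  "opf \<chi> t <-> (\<forall>e :: nat => 'a. (e 0 :. OP (e 1) (e 2) (e 3) (e 4)) = bev mem (=) \<chi> e)"
lemma ex_opf: "EX \<chi>. opf \<chi> TYPE('a::zf)"
proof -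
  have "d0 (%e :: nat => 'a. e 0 :. OP (e 1) (e 2) (e 3) (e 4))" by (intro Bi)
  then show ?thesis unfolding d0_def opf_def .
qed

text \<open>A back-and-forth relation for membership preserves bounded formulas, since their
  quantifiers only move to elements.\<close>

lemma bev_rel: assumes 1: "!!c x d y. R c x ==> R d y ==> (E c d <-> x :. y) & (Q c d <-> x = y)"
    and 2: "!!c x z. R c x ==> E z c ==> EX y. y :. x & R z y" and 3: "!!c x y. R c x ==> y :. x ==> EX z. E z c & R z y"
  shows "(!!n. R (e n) (e' n)) ==> bev E Q \<phi> e = bev mem (=) \<phi> e'"
proof (induction \<phi> arbitrary: e e')
  case (bEx i \<phi>)
  have *: "bev E Q \<phi> (case_nat z e) = bev mem (=) \<phi> (case_nat y e')" if "R z y" for z y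
    by (rule bEx.IH) (use that bEx.prems in \<open>auto split: nat.split\<close>)
  show ?case unfolding bev.simps using 2[OF bEx.prems] 3[OF bEx.prems] * by metis
qed (use 1 in auto)

lemma BO_rel: assumes "opf \<chi> TYPE('a)" and 1: "!!c (x::'a::zf) d y. R c x ==> R d y ==> (E c d <-> x :. y) & (EQ U E c d <-> x = y)"
    and 2: "!!c x z. R c x ==> E z c ==> EX y. y :. x & R z y" and 3: "!!c x y. R c x ==> y :. x ==> EX z. E z c & R z y"
    and r: "R z z'" "R s s'" "R p p'" "R q q'" "R r r'"
  shows "BO U E \<chi> z s p q r <-> z' :. OP s' p' q' r'"
proof -
  have "BO U E \<chi> z s p q r <-> bev mem (=) \<chi> (%n. if n = 0 then z' else if n = 1 then s' else if n = 2 then p' else if n = 3 then q' else r')"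
    unfolding BO_def by (rule bev_rel[of R, OF 1 2 3]) (use r in auto)
  also have "... <-> z' :. OP s' p' q' r'" using assms(1)[unfolded opf_def, rule_format, symmetric] by simp
  finally show ?thesis .
qed

locale codes =
  fixes U l :: "'a::zf" and \<chi> :: bf
  assumes B: "Base U" and as: "astar U l" and ch: "opf \<chi> TYPE('a)"
begin

abbreviation v where "v \<equiv> val U"
abbreviation M where "M \<equiv> JJ U l"

definition TE where "TE c d <-> c :. U & d :. U & v c :. v d & v d :. M"
definition TL where "TL q <-> q :. U & (EX b. b :. l & v q = JJ U b)"
definition TF where "TF q p s <-> p :. U & s :. U & TL q & vf v s :. TS (v q) p"

lemma l: "Limit l" "Ord l" using as by (auto simp: astar_def Limit_def)
lemma T: "transitive U" "omega :. U" using B by (auto simp: Base_def)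
lemma Mt: "y :. M ==> x :. y ==> x :. M" using good_trans[OF good_JJ[OF T l(2)]] .
lemma l_adj: "b :. l ==> adjoin_self b :. l" using l(1) by (simp add: Limit_def)
lemma l0: "empty :. l" using l Ord_linear[OF Ord_empty l(2)] by (auto simp: Limit_def)
lemma lO: "b :. l ==> Ord b" using Ord_mem[OF l(2)] .
lemma JM: "b :. l ==> JJ U b :. M" by (rule JJ_mem[OF T l(2)])
lemma memM: "x :. M <-> (EX b. b :. l & x :. JJ U b)" by (rule mem_JJ_Limit[OF l(1)])
lemma UM: "U :. M" "x :. U ==> x :. M" unfolding memM by (rule exI[of _ empty], simp add: l0)+
lemma code: "x :. M ==> EX c. c :. U & v c = x" by (drule astar_inH(2)[OF B as], unfold inH_def) (auto dest: sym)
lemma codeJ: "b :. l ==> EX q. q :. U & v q = JJ U b" by (drule astar_inH(1)[OF B as], unfold inH_def) (auto dest: sym)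
lemma OU: "x :. U ==> y :. U ==> opair x y :. U" by (rule Base_opair[OF B])
lemma SU: "std_num k :. U" using Base_omega(2)[OF B] by simp
lemma eU: "empty :. U" using SU[of 0] by simp
lemma nU: "n :. omega ==> n :. U" by (rule Base_omega(2)[OF B])
lemmas KU = OU SU eU

lemma rM: "rud_closed M" unfolding rud_closed_def
proof (intro allI impI, elim conjE)
  fix n and f :: "'a list => 'a" and xs assume f: "rudimentary n f" "length xs = n" "\<forall>x\<in>set xs. x :. M"
  have "EX b. b :. l & (\<forall>x\<in>set xs. x :. JJ U b)" using f(3)
  proof (induction xs)
    case Nil then show ?case using l0 by auto
  next
    case (Cons x xs)
    then obtain b where b: "b :. l" "\<forall>x\<in>set xs. x :. JJ U b" by auto
    have "x :. M" using Cons.prems by simp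
    then obtain c where c: "c :. l" "x :. JJ U c" unfolding memM by blast
    from Ord_linear[OF lO[OF b(1)] lO[OF c(1)]] show ?case
    proof (elim disjE)
      assume "b :. c" then show ?thesis using b c JJ_sub[OF T lO[OF c(1)]] by (intro exI[of _ c]) auto
    next
      assume "b = c" then show ?thesis using b c by (intro exI[of _ c]) auto
    next
      assume "c :. b" then show ?thesis using b c JJ_sub[OF T lO[OF b(1)]] by (intro exI[of _ b]) auto
    qed
  qed
  then obtain b where b: "b :. l" "\<forall>x\<in>set xs. x :. JJ U b" by blast
  have "f xs :. nx (JJ U b)" using rud_closed_nx[OF good_JJ[OF T lO[OF b(1)]], unfolded rud_closed_def, rule_format, of n f xs] f b(2) sub_nx by blast
  then show "f xs :. M" unfolding memM by (intro exI[of _ "adjoin_self b"]) (simp add: l_adj[OF b(1)])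
qed
lemma M2: assumes "s :. M" "p :. M" "q :. M" "r :. M" "X :. M" shows "inter X (OP s p q r) :. M"
proof -
  have "rf 5 (%xs::'a list. inter (xs ! 4) (OP (xs ! 0) (xs ! 1) (xs ! 2) (xs ! 3)))" by (intro rf_inter rf_OP rf_var) simp_all
  from rud_closed_rf[OF rM this, of "[s, p, q, r, X]"] show ?thesis using assms by auto
qed
lemma Mit: assumes "x :. M" "n :. omega" shows "it x n :. M" using assms(2)
proof (rule omega_induct)
  show "D (%e. it x (e 0) :. M)" by (intro Di)
  show "it x empty :. M" using assms by simp
  fix n assume "it x n :. M"
  moreover have "rf 1 (%xs::'a list. step (xs ! 0))" by (intro rf_step rf_var) simp
  ultimately show "it x (adjoin_self n) :. M" using rud_closed_rf[OF rM, of 1 "%xs. step (xs ! 0)" "[it x n]"] by simp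
qed

lemma TLv: "TL q ==> q :. U & v q :. M" unfolding TL_def using JM by auto
lemma Dmc: assumes "c :. U" shows "Dm U TE TL c <-> v c :. M"
proof
  assume "Dm U TE TL c" then show "v c :. M" unfolding Dm_def TE_def using Mt by blast
next
  assume "v c :. M"
  then obtain b where b: "b :. l" "v c :. JJ U b" unfolding memM by blast
  obtain q where "q :. U" "v q = JJ U b" using codeJ[OF b(1)] by blast
  then show "Dm U TE TL c" unfolding Dm_def TE_def TL_def using b JM[OF b(1)] assms by metis
qed
text \<open>Elements of sets in \<open>M\<close> belong to \<open>M\<close> and therefore have
  codes, so comparing codes of elements compares all elements.\<close>

lemma EQc: assumes "c :. U" "d :. U" "v c :. M" "v d :. M" shows "EQ U TE c d <-> v c = v d"
proof
  assume h: "EQ U TE c d"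
  show "v c = v d"
  proof (rule set_eqI)
    fix x
    show "x :. v c <-> x :. v d"
    proof (cases "x :. M")
      case True
      then obtain z where "z :. U" "v z = x" using code by blast
      then show ?thesis using h assms unfolding EQ_def TE_def by blast
    next
      case False then show ?thesis using Mt assms by blast
    qed
  qed
qed (use assms in \<open>simp add: EQ_def TE_def\<close>)
lemma Ec: "c :. U ==> d :. U ==> v d :. M ==> TE c d <-> v c :. v d" unfolding TE_def by blast
lemma DEQ: assumes "z :. U" "d :. U" "v d :. M" shows "Dm U TE TL z & EQ U TE z d <-> v z = v d"
  unfolding Dmc[OF assms(1)] using EQc[OF assms(1,2) _ assms(3)] assms(3) by metis

lemma tPHE: "PHE U TE TL" unfolding PHE_def
proof (intro conjI allI impI)
  show "TE z d ==> Dm U TE TL z" "TE z d ==> Dm U TE TL d" if "z :. U" "d :. U" for z d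
    unfolding Dmc[OF that(1)] Dmc[OF that(2)] unfolding TE_def using Mt by blast+
  show "TE c' d" if "c :. U" "c' :. U" "d :. U" "Dm U TE TL c'" "EQ U TE c c'" "TE c d" for c c' d
  proof -
    have "v d :. M" "v c :. v d" using that(6) unfolding TE_def by blast+
    moreover have "v c = v c'" using EQc[OF that(1,2) Mt[OF calculation]] that(4,5) unfolding Dmc[OF that(2)] by blast
    ultimately show ?thesis using that(2,3) unfolding TE_def by simp
  qed
  show "TL q ==> Dm U TE TL q" if "q :. U" for q unfolding Dmc[OF that] using TLv by blast
  fix q r assume qr: "q :. U" "r :. U" "TL q" "TL r"
  then obtain b c where bc: "b :. l" "v q = JJ U b" "c :. l" "v r = JJ U c" unfolding TL_def by blast
  have m: "v q :. M" "v r :. M" using TLv qr by blast+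
  from Ord_linear[OF lO[OF bc(1)] lO[OF bc(3)]] show "TE q r | EQ U TE q r | TE r q"
    unfolding Ec[OF qr(1,2) m(2)] Ec[OF qr(2,1) m(1)] EQc[OF qr(1,2) m] bc(2,4)
    using JJ_mem[OF T lO[OF bc(3)]] JJ_mem[OF T lO[OF bc(1)]] by blast
next
  fix q assume q: "q :. U" "TL q"
  then obtain b where b: "b :. l" "v q = JJ U b" unfolding TL_def by blast
  have K: "K1 :. U" by (intro KU)
  have U0: "U :. JJ U empty" by simp
  have "U :. JJ U b"
  proof (cases "b = empty")
    case False
    then have "empty :. b" using Ord_linear[OF Ord_empty lO[OF b(1)]] by auto
    then show ?thesis using JJ_sub[OF T lO[OF b(1)]] U0 by blast
  qed (use U0 in simp)
  then show "TE K1 q" unfolding Ec[OF K q(1) conjunct2[OF TLv[OF q(2)]]] b(2) val_simps .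
next
  fix q r assume q: "q :. U" "r :. U" "TL q" "TL r" "TE r q"
  then obtain b c where bc: "b :. l" "v q = JJ U b" "c :. l" "v r = JJ U c" unfolding TL_def by blast
  have qM: "v q :. M" using TLv q(3) by blast
  have K: "K4 r :. U" by (intro KU q)
  have e: "v (K4 r) = JJ U (adjoin_self c)" unfolding val_simps bc(4) JJ_Suc ..
  have eM: "v (K4 r) :. M" unfolding e by (rule JM[OF l_adj[OF bc(3)]])
  have "JJ U c :. JJ U b" using q(5) unfolding TE_def bc by blast
  then have cb: "c :. b" using Ord_linear[OF lO[OF bc(3)] lO[OF bc(1)]] JJ_mem[OF T lO[OF bc(3)], of b] mem_asym mem_not_refl by metis
  have "adjoin_self c :. b | adjoin_self c = b"
    using Ord_linear[OF Ord_adj[OF lO[OF bc(3)]] lO[OF bc(1)]] cb mem_asym[OF cb] mem_not_refl unfolding mem_adj by metis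
  then show "TE (K4 r) q | EQ U TE (K4 r) q" unfolding Ec[OF K q(1) qM] EQc[OF K q(1) eM qM] unfolding e bc(2)
    using JJ_mem[OF T lO[OF bc(1)]] by blast
qed

lemma tPH0: "PH0 U TE TL"
proof -
  have K: "x :. U ==> K0 x :. U" "K1 :. U" "K6 K1 :. U" for x by (intro KU | assumption)+
  have 0: "Dm U TE TL z & (EX y. y :. U & (P y & EQ U TE z (K0 y))) <-> (EX y. y :. U & P y & v z = y)" if z: "z :. U" for z P
  proof -
    have "y :. U ==> Dm U TE TL z & EQ U TE z (K0 y) <-> v z = y" for y using DEQ[OF z K(1), of y] UM(2) by (simp only: val_simps)
    then show ?thesis by blast
  qed
  have u: "x :. U ==> y :. x ==> y :. U" for x y using Base_trans[OF B] by blast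
  show ?thesis unfolding PH0_def
  proof (intro conjI allI impI)
    fix x assume x: "x :. U"
    show "Dm U TE TL (K0 x)" unfolding Dmc[OF K(1)[OF x]] val_simps by (rule UM(2)[OF x])
    show "TE z (K0 x) <-> Dm U TE TL z & (EX y. y :. U & (y :. x & EQ U TE z (K0 y)))" if z: "z :. U" for z
      unfolding 0[OF z] Ec[OF z K(1)[OF x], unfolded val_simps, OF UM(2)[OF x]] using u[OF x] by blast
  next
    show "Dm U TE TL K1" unfolding Dmc[OF K(2)] val_simps by (rule UM(1))
    show "TE z K1 <-> Dm U TE TL z & (EX y. y :. U & EQ U TE z (K0 y))" if z: "z :. U" for z
      using 0[OF z, of "%_. True"] unfolding Ec[OF z K(2), unfolded val_simps, OF UM(1)] by auto
  next
    have aM: "adjoin_self U :. M" using JM[OF l0] by simp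
    show "TL (K6 K1)" unfolding TL_def val_simps using K(3) l0 by (intro conjI exI[of _ empty]) simp_all
    show "TE z (K6 K1) <-> TE z K1 | Dm U TE TL z & EQ U TE z K1" if z: "z :. U" for z
      unfolding DEQ[OF z K(2), unfolded val_simps, OF UM(1)] Ec[OF z K(2), unfolded val_simps, OF UM(1)] Ec[OF z K(3), unfolded val_simps, OF aM] mem_adj ..
  qed
qed

lemma rel: "(c :. U & x = v c & x :. M) ==> (d :. U & y = v d & y :. M) ==> (TE c d <-> x :. y) & (EQ U TE c d <-> x = y)"
  "(c :. U & x = v c & x :. M) ==> TE z c ==> EX y. y :. x & (z :. U & y = v z & y :. M)"
  "(c :. U & x = v c & x :. M) ==> y :. x ==> EX z. TE z c & (z :. U & y = v z & y :. M)"
proof -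
  show "(c :. U & x = v c & x :. M) ==> (d :. U & y = v d & y :. M) ==> (TE c d <-> x :. y) & (EQ U TE c d <-> x = y)"
    by (elim conjE, hypsubst, intro conjI) (rule Ec EQc; assumption)+
  show "(c :. U & x = v c & x :. M) ==> TE z c ==> EX y. y :. x & (z :. U & y = v z & y :. M)" unfolding TE_def using Mt by blast
  show "(c :. U & x = v c & x :. M) ==> y :. x ==> EX z. TE z c & (z :. U & y = v z & y :. M)" unfolding TE_def using Mt code by metis
qed

lemma tPH2: "PH2 U TE TL \<chi>" unfolding PH2_def
proof (intro allI impI)
  fix s p q r X assume u: "s :. U" "p :. U" "q :. U" "r :. U" "X :. U" and d: "Dm U TE TL s" "Dm U TE TL p" "Dm U TE TL q" "Dm U TE TL r" "Dm U TE TL X"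
  note m = d[unfolded Dmc[OF u(1)] Dmc[OF u(2)] Dmc[OF u(3)] Dmc[OF u(4)] Dmc[OF u(5)]]
  have K: "K2 s p q r X :. U" by (intro KU u)
  show "Dm U TE TL (K2 s p q r X) & (ALL z. z :. U --> (TE z (K2 s p q r X) <-> TE z X & BO U TE \<chi> z s p q r))"
  proof (intro conjI allI impI)
    show "Dm U TE TL (K2 s p q r X)" unfolding Dmc[OF K] val_simps by (rule M2[OF m])
    fix z assume z: "z :. U"
    show "TE z (K2 s p q r X) <-> TE z X & BO U TE \<chi> z s p q r"
    proof (cases "v z :. M")
      case True
      have "BO U TE \<chi> z s p q r <-> v z :. OP (v s) (v p) (v q) (v r)"
        by (rule BO_rel[where R="%c x. c :. U & x = v c & x :. M", OF ch rel]) (use True z u m in auto)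
      then show ?thesis unfolding Ec[OF z K, unfolded val_simps, OF M2[OF m]] Ec[OF z u(5) m(5)] mem_inter by blast
    next
      case False
      then show ?thesis unfolding Ec[OF z K, unfolded val_simps, OF M2[OF m]] Ec[OF z u(5) m(5)] mem_inter using Mt m(5) by blast
    qed
  qed
qed

lemma tPH3: "PH3 U TE TL" unfolding PH3_def
proof (intro conjI allI impI)
  fix x assume x: "x :. U" "Dm U TE TL x"
  note xm = x(2)[unfolded Dmc[OF x(1)]]
  have K3: "n :. omega ==> K3 n x :. U" "n :. omega ==> v (K3 n x) :. M" for n
    by (intro KU x nU, assumption) (simp only: val_simps, rule Mit[OF xm])
  show "EQ U TE (K3 empty x) x" unfolding EQc[OF K3(1)[OF empty_omega] x(1) K3(2)[OF empty_omega] xm] val_simps it_0 ..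
  fix n :: 'a assume n: "n :. omega"
  note a = K3[OF n] and b = K3[OF adj_omega[OF n]]
  show "Dm U TE TL (K3 n x)" unfolding Dmc[OF a(1)] by (rule a(2))
  fix z assume z: "z :. U"
  have K2v: "Dm U TE TL z & EQ U TE z (K2 s p q r (K3 n x)) <-> v z = inter (it (v x) n) (OP (v s) (v p) (v q) (v r))"
    if "s :. U" "p :. U" "q :. U" "r :. U" "v s :. M" "v p :. M" "v q :. M" "v r :. M" for s p q r
  proof -
    have "K2 s p q r (K3 n x) :. U" by (intro OU SU that a(1))
    from DEQ[OF z this, unfolded val_simps, OF M2[OF that(5-8) a(2)[unfolded val_simps]]] show ?thesis .
  qed
  have am: "y :. it (v x) n ==> y :. M" for y using Mt[OF a(2)] unfolding val_simps .
  show "TE z (K3 (adjoin_self n) x) <-> TE z (K3 n x) | (Dm U TE TL z & (EQ U TE z (K3 n x) |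
        (EX s. s :. U & (EX p. p :. U & (EX q. q :. U & (EX r. r :. U & (TE s (K3 n x) & TE p (K3 n x) & TE q (K3 n x) & TE r (K3 n x) & EQ U TE z (K2 s p q r (K3 n x)))))))))"
    (is "?l <-> ?A | (?D & (?Q | ?X))")
  proof -
    have "?l <-> v z :. step (it (v x) n)" unfolding Ec[OF z b] val_simps it_Suc ..
    moreover have "?A <-> v z :. it (v x) n" unfolding Ec[OF z a] val_simps ..
    moreover have "?D & ?Q <-> v z = it (v x) n" using DEQ[OF z a] unfolding val_simps .
    moreover have "?D & ?X <-> (EX s p q r. s :. it (v x) n & p :. it (v x) n & q :. it (v x) n & r :. it (v x) n & v z = inter (it (v x) n) (OP s p q r))" (is "_ <-> ?Y")
    proof
      assume "?D & ?X"
      then obtain s p q r where h: "?D" "s :. U" "p :. U" "q :. U" "r :. U" "TE s (K3 n x)" "TE p (K3 n x)" "TE q (K3 n x)" "TE r (K3 n x)" "EQ U TE z (K2 s p q r (K3 n x))" by blast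
      have m: "v s :. it (v x) n" "v p :. it (v x) n" "v q :. it (v x) n" "v r :. it (v x) n"
        using h(6-9) unfolding Ec[OF h(2) a] Ec[OF h(3) a] Ec[OF h(4) a] Ec[OF h(5) a] val_simps .
      have "v z = inter (it (v x) n) (OP (v s) (v p) (v q) (v r))"
        using K2v[OF h(2-5) am[OF m(1)] am[OF m(2)] am[OF m(3)] am[OF m(4)]] h(1,10) by blast
      then show ?Y using m by blast
    next
      assume ?Y
      then obtain s p q r where h: "s :. it (v x) n" "p :. it (v x) n" "q :. it (v x) n" "r :. it (v x) n" "v z = inter (it (v x) n) (OP s p q r)" by blast
      obtain s' p' q' r' where u: "s' :. U" "p' :. U" "q' :. U" "r' :. U" and e: "v s' = s" "v p' = p" "v q' = q" "v r' = r"
        using code[OF am[OF h(1)]] code[OF am[OF h(2)]] code[OF am[OF h(3)]] code[OF am[OF h(4)]] by blast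
      have "TE s' (K3 n x)" "TE p' (K3 n x)" "TE q' (K3 n x)" "TE r' (K3 n x)"
        unfolding Ec[OF u(1) a] Ec[OF u(2) a] Ec[OF u(3) a] Ec[OF u(4) a] val_simps e by (fact h)+
      moreover have "?D & EQ U TE z (K2 s' p' q' r' (K3 n x))" using K2v[OF u, unfolded e, OF am[OF h(1)] am[OF h(2)] am[OF h(3)] am[OF h(4)]] h(5) by blast
      ultimately show "?D & ?X" using u by blast
    qed
    ultimately show ?thesis unfolding mem_step by blast
  qed
next
  fix q assume q: "q :. U" "TL q"
  then obtain b where b: "b :. l" "v q = JJ U b" unfolding TL_def by blast
  have K: "K4 q :. U" by (intro KU q)
  have e: "v (K4 q) = JJ U (adjoin_self b)" unfolding val_simps b(2) JJ_Suc ..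
  show "TL (K4 q)" unfolding TL_def using K e l_adj[OF b(1)] by blast
  fix z assume z: "z :. U"
  have "TE z (K4 q) <-> v z :. nx (v q)" unfolding Ec[OF z K, unfolded e, OF JM[OF l_adj[OF b(1)]]] b(2) JJ_Suc ..
  moreover have "n :. omega ==> TE z (K3 n q) <-> v z :. it (v q) n" for n
    using Ec[OF z, of "K3 n q", unfolded val_simps, OF OU[OF SU OU[OF nU q(1)]] Mit[OF conjunct2[OF TLv[OF q(2)]]]] .
  ultimately show "TE z (K4 q) <-> (EX n. n :. U & (n :. omega & TE z (K3 n q)))" unfolding mem_nx using nU by blast
qed

lemma dv: "dt (%e. v (e 0))" by (intro Di)
lemma apU: assumes "s :. U" "fun_on s omega" "i :. omega" shows "ap s i :. U"
  using opair_trans(2)[OF T(1) Base_trans[OF B assms(1) fun_onD(1)[OF assms(2,3)]]] .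
lemma vfu: assumes "fun_on s omega" "n :. omega" shows "vf v (upd s n x) = upd (vf v s) n (v x)"
  by (rule fun_on_ext[of _ omega]) (use vf_props[OF dv fun_on_upd[OF assms]] vf_props[OF dv assms(1)] fun_on_upd[OF vf_props(1)[OF dv assms(1)] assms(2)] in auto)

text \<open>Let \<open>g\<close> be the least bound for the witnessing stages; it lies below
  \<open>l\<close> because collection does not fail at \<open>l\<close>. If some least stage equals
  \<open>g\<close>, the union is \<open>JJ U g\<close>. Otherwise \<open>g\<close> is a limit at
  which collection fails, and \<open>Lim_fails\<close> applies; \<open>y0\<close> guarantees that
  \<open>g\<close> is not empty there.\<close>

lemma K5_level: assumes p: "p :. Form" "n :. omega" "s :. U" "fun_on s omega" and d: "d :. M" "y0 :. d" and f: "f = vf v s" "fa M f"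
    and ex: "!!y. y :. d ==> EX b. b :. l & upd f n y :. TS (JJ U b) p"
  shows "EX b. b :. l & Lim U p n f d = JJ U b"
proof -
  let ?P = "%b y. upd f n y :. TS (JJ U b) p"
  have dP: "D (%e. ?P (e 0) y)" for y by (intro Di)
  have "ALL y. y :. d --> (EX b. b :. l & Qs U b p n f y)" using ex unfolding Qs_def by blast
  moreover have "~ fails U l" using as unfolding astar_def by blast
  ultimately obtain b where b: "b :. l" "ALL y. y :. d --> Qs U b p n f y" unfolding fails_def using p(1,2) f(2) d(1) by blast
  have "D (%e. ALL y. y :. d --> Qs U (e 0) p n f y)" unfolding Qs_def by (intro Di)
  from least_ord[of b "%b. ALL y. y :. d --> Qs U b p n f y", OF lO[OF b(1)] b(2) this]
  obtain g where g: "Ord g" "ALL y. y :. d --> Qs U g p n f y" "ALL c. c :. g --> ~ (ALL y. y :. d --> Qs U c p n f y)" by blast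
  have "g :. b | g = b" using Ord_linear[OF g(1) lO[OF b(1)]] g(3) b(2) by blast
  then have gl: "g :. l" using b(1) Ord_trans[OF l(2) b(1)] by blast
  have least: "EX b. (b :. g | b = g) & Ord b & ?P b y & (ALL c. c :. b --> ~ ?P c y)" if y: "y :. d" for y
  proof -
    obtain c where c: "c :. g | c = g" "?P c y" using g(2)[rule_format, OF y] unfolding Qs_def by (elim exE conjE)
    have oc: "Ord c" using c(1) g(1) Ord_mem by blast
    obtain m where m: "Ord m" "?P m y" "ALL x. x :. m --> ~ ?P x y" using least_ord[of c "%b. ?P b y", OF oc c(2) dP] by (elim exE conjE)
    have "m :. c | m = c" using Ord_linear[OF m(1) oc] m(3) c(2) by blast
    then have "m :. g | m = g" using c(1) Ord_trans[OF g(1)] by blast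
    then show ?thesis using m by blast
  qed
  have "Lim U p n f d = JJ U g"
  proof (cases "EX y. y :. d & ?P g y & (ALL c. c :. g --> ~ ?P c y)")
    case True
    show ?thesis
    proof (rule set_eqI)
      fix z show "z :. Lim U p n f d <-> z :. JJ U g"
      proof
        assume "z :. Lim U p n f d"
        then obtain x b where x: "x :. d" "Ord b" "?P b x" "ALL c. c :. b --> ~ ?P c x" "z :. JJ U b" unfolding mem_Lim by (elim exE conjE)
        obtain b' where b': "b' :. g | b' = g" "Ord b'" "?P b' x" "ALL c. c :. b' --> ~ ?P c x" using least[OF x(1)] by (elim exE conjE)
        have "b = b'" by (rule gJ_unique[of b b' "%b. ?P b x"]) (fact x b')+
        then show "z :. JJ U g" using b'(1) x(5) JJ_sub[OF T g(1)] by blast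
      next
        assume "z :. JJ U g" then show "z :. Lim U p n f d" unfolding mem_Lim using True g(1) by blast
      qed
    qed
  next
    case False
    have below: "EX b. b :. g & ?P b y" if y: "y :. d" for y
    proof -
      obtain b where b: "b :. g | b = g" "?P b y" "ALL c. c :. b --> ~ ?P c y" using least[OF y] by (elim exE conjE)
      then show ?thesis using False y by blast
    qed
    have h2: "~ (EX b. b :. g & (ALL x. x :. d --> Qs U b p n f x))" using g(3) by blast
    have "g \<noteq> empty" using below[OF d(2)] by auto
    moreover have "~ (EX c. c :. g & Ord c & g = adjoin_self c)"
    proof
      assume "EX c. c :. g & Ord c & g = adjoin_self c"
      then obtain c where c: "c :. g" "g = adjoin_self c" by blast
      have "Qs U c p n f y" if "y :. d" for y using below[OF that] unfolding c(2) mem_adj Qs_def .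
      then show False using g(3) c(1) by blast
    qed
    ultimately have "Limit g" using Ord_cases[OF g(1)] by blast
    moreover have "ALL y. y :. d --> (EX b. b :. g & Qs U b p n f y)" using below unfolding Qs_def by blast
    ultimately show ?thesis using Lim_fails[OF T _ _ h2] by blast
  qed
  then show ?thesis using gl by blast
qed

lemma TFv: assumes "q :. U" "v q = JJ U b" "b :. l" "p :. U" "s :. U" "fun_on s omega" "n :. omega" "x :. U"
  shows "TF q p (upd s n x) <-> upd (vf v s) n (v x) :. TS (JJ U b) p"
  unfolding TF_def vfu[OF assms(6,7)] assms(2) using assms Base_upd[OF B assms(5) nU[OF assms(7)] assms(8)] unfolding TL_def by blast

lemma tPH5: "PH5 U TE TL TF" unfolding PH5_def
proof (intro allI impI)
  fix p n s d
  assume u: "p :. U" "n :. U" "s :. U" "d :. U" and p: "p :. Form" "n :. omega" "fun_on s omega" and Dd: "Dm U TE TL d" and ne: "EX x. x :. U & TE x d"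
    and sm: "ALL i. i :. U --> (i :. omega --> Dm U TE TL (ap s i))" and fin: "EX m. m :. U & (m :. omega & (ALL i. i :. U --> (i :. omega --> ~ i :. m --> EQ U TE (ap s i) (K0 empty))))"
    and ex: "ALL x. x :. U --> (TE x d --> (EX q. q :. U & (TL q & TF q p (upd s n x))))"
  note dm = Dd[unfolded Dmc[OF u(4)]]
  define f where "f = vf v s"
  let ?P = "%b y. upd f n y :. TS (JJ U b) p"
  note TFx = TFv[OF _ _ _ u(1,3) p(3,2), folded f_def]
  have sM: "i :. omega ==> v (ap s i) :. M" for i using sm[rule_format, OF nU, of i] Dmc[OF apU[OF u(3) p(3)], of i] by blast
  have fm: "maps f omega M" unfolding f_def maps_iff using vf_props[OF dv p(3)] sM by simp
  obtain m where m: "m :. omega" "ALL i. i :. U --> (i :. omega --> ~ i :. m --> EQ U TE (ap s i) (K0 empty))" using fin by blast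
  have "ap f i = empty" if i: "i :. omega" "~ i :. m" for i
  proof -
    have "EQ U TE (ap s i) (K0 empty)" using m(2) i nU by blast
    then show ?thesis using EQc[OF apU[OF u(3) p(3) i(1)] OU[OF SU[of 0] eU] sM[OF i(1)], unfolded val_simps, OF UM(2)[OF eU]]
      unfolding f_def vf_props(2)[OF dv p(3) i(1)] by blast
  qed
  then have faf: "fa M f" unfolding fa_def using fm m(1) by blast
  have exP: "EX b. b :. l & ?P b y" if y: "y :. v d" for y
  proof -
    obtain x where x: "x :. U" "v x = y" using code[OF Mt[OF dm y]] by blast
    have "TE x d" unfolding Ec[OF x(1) u(4) dm] x(2) by (rule y)
    then obtain q where q: "q :. U" "TL q" "TF q p (upd s n x)" using ex x(1) by blast
    obtain b where b: "b :. l" "v q = JJ U b" using q(2) unfolding TL_def by blast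
    show ?thesis using q(3) TFx[OF q(1) b(2,1) x(1)] b(1) unfolding x(2) by blast
  qed
  obtain y0 where y0: "y0 :. v d" using ne unfolding TE_def by blast
  have KK: "K5 p n s d :. U" by (intro KU u)
  have vK: "v (K5 p n s d) = Lim U p n f (v d)" unfolding val_simps f_def ..
  obtain g where g: "g :. l" "Lim U p n f (v d) = JJ U g" using K5_level[OF p(1,2) u(3) p(3) dm y0 f_def faf exP] by blast
  show "TL (K5 p n s d) & (ALL z. z :. U --> (TE z (K5 p n s d) <-> (EX x. x :. U & (TE x d & (EX q. q :. U & (TL q & TF q p (upd s n x) &
        (ALL r. r :. U --> (TL r --> TE r q --> ~ TF r p (upd s n x))) & TE z q))))))"
  proof (intro conjI allI impI)
    show "TL (K5 p n s d)" unfolding TL_def vK g(2) using KK g(1) by blast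
    fix z assume z: "z :. U"
    have "TE z (K5 p n s d) <-> v z :. Lim U p n f (v d)" unfolding Ec[OF z KK, unfolded vK g(2), OF JM[OF g(1)]] g(2) ..
    also have "... <-> (EX x. x :. U & (TE x d & (EX q. q :. U & (TL q & TF q p (upd s n x) &
        (ALL r. r :. U --> (TL r --> TE r q --> ~ TF r p (upd s n x))) & TE z q))))"
    proof
      assume "v z :. Lim U p n f (v d)"
      then obtain y b where y: "y :. v d" "Ord b" "?P b y" "ALL c. c :. b --> ~ ?P c y" "v z :. JJ U b" unfolding mem_Lim by (elim exE conjE)
      obtain b' where b': "b' :. l" "?P b' y" using exP[OF y(1)] by blast
      have "b :. b' | b = b'" using Ord_linear[OF y(2) lO[OF b'(1)]] y(4) b'(2) by blast
      then have bl: "b :. l" using b'(1) Ord_trans[OF l(2) b'(1)] by blast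
      obtain x where x: "x :. U" "v x = y" using code[OF Mt[OF dm y(1)]] by blast
      obtain q where q: "q :. U" "v q = JJ U b" using codeJ[OF bl] by blast
      have qM: "v q :. M" using q JM[OF bl] by simp
      have "~ TF r p (upd s n x)" if r: "r :. U" "TL r" "TE r q" for r
      proof -
        obtain c where c: "c :. l" "v r = JJ U c" using r(2) unfolding TL_def by blast
        have "JJ U c :. JJ U b" using r(3) unfolding TE_def c(2) q(2) by blast
        then have "c :. b" using Ord_linear[OF lO[OF c(1)] y(2)] JJ_mem[OF T lO[OF c(1)], of b] mem_asym mem_not_refl by metis
        then show ?thesis using y(4) unfolding TFx[OF r(1) c(2,1) x(1)] x(2) by blast
      qed
      moreover have "TE x d" unfolding Ec[OF x(1) u(4) dm] x(2) by (rule y(1))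
      moreover have "TL q" unfolding TL_def using q bl by blast
      moreover have "TF q p (upd s n x)" unfolding TFx[OF q bl x(1)] x(2) by (rule y(3))
      moreover have "TE z q" unfolding Ec[OF z q(1) qM] q(2) by (rule y(5))
      ultimately show "EX x. x :. U & (TE x d & (EX q. q :. U & (TL q & TF q p (upd s n x) &
        (ALL r. r :. U --> (TL r --> TE r q --> ~ TF r p (upd s n x))) & TE z q)))" using x(1) q(1) by blast
    next
      assume "EX x. x :. U & (TE x d & (EX q. q :. U & (TL q & TF q p (upd s n x) &
        (ALL r. r :. U --> (TL r --> TE r q --> ~ TF r p (upd s n x))) & TE z q)))"
      then obtain x q where x: "x :. U" "TE x d" and q: "q :. U" "TL q" "TF q p (upd s n x)" "ALL r. r :. U --> (TL r --> TE r q --> ~ TF r p (upd s n x))" "TE z q" by blast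
      obtain b where b: "b :. l" "v q = JJ U b" using q(2) unfolding TL_def by blast
      have "~ ?P c (v x)" if c: "c :. b" for c
      proof -
        have cl: "c :. l" using Ord_trans[OF l(2) b(1) c] .
        obtain r where r: "r :. U" "v r = JJ U c" using codeJ[OF cl] by blast
        have "TE r q" unfolding TE_def r(2) b(2) using r q(1) JJ_mem[OF T lO[OF b(1)] c] JM[OF b(1)] by blast
        moreover have "TL r" unfolding TL_def using r cl by blast
        ultimately show ?thesis using q(4) r(1) unfolding TFx[OF r cl x(1), symmetric] by blast
      qed
      moreover have "?P b (v x)" using q(3) unfolding TFx[OF q(1) b(2,1) x(1)] .
      moreover have "v z :. JJ U b" "v x :. v d" using q(5) x(2) unfolding TE_def b(2) by blast+
      ultimately show "v z :. Lim U p n f (v d)" unfolding mem_Lim using lO[OF b(1)] by blast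
    qed
    finally show "TE z (K5 p n s d) <-> (EX x. x :. U & (TE x d & (EX q. q :. U & (TL q & TF q p (upd s n x) &
        (ALL r. r :. U --> (TL r --> TE r q --> ~ TF r p (upd s n x))) & TE z q))))" .
  qed
qed

lemma tPHF: "PHF U TE TL TF" unfolding PHF_def
proof (intro allI impI)
  fix q s assume q: "q :. U" "s :. U" "TL q" "fun_on s omega"
  have qM: "v q :. M" using TLv[OF q(3)] by blast
  note au = apU[OF q(2,4)] and vp = vf_props[OF dv q(4)]
  have As: "As U TE q s <-> maps (vf v s) omega (v q)" unfolding As_def maps_iff using vp Ec[OF au q(1) qM] nU by auto
  have F: "TF q p s <-> vf v s :. TS (v q) p" if "p :. U" for p unfolding TF_def using that q by blast
  have vM: "ap (vf v s) i = v (ap s i)" "maps (vf v s) omega (v q) ==> v (ap s i) :. M" if "i :. omega" for i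
    using vp(2)[OF that] Mt[OF qM] that unfolding maps_iff by auto
  have cU: "i :. U ==> k :. U ==> cMem i k :. U" "i :. U ==> k :. U ==> cEq i k :. U" "i :. U ==> cNeg i :. U" "i :. U ==> k :. U ==> cAnd i k :. U" "i :. U ==> k :. U ==> cEx i k :. U" for i k
    unfolding code_defs by (intro KU, assumption+)+
  show "(ALL i. i :. U --> (i :. omega --> (ALL k. k :. U --> (k :. omega --> (TF q (cMem i k) s <-> As U TE q s & TE (ap s i) (ap s k)) & (TF q (cEq i k) s <-> As U TE q s & EQ U TE (ap s i) (ap s k)))))) &
     (ALL p. p :. U --> (TF q (cNeg p) s <-> As U TE q s & ~ TF q p s)) &
     (ALL p. p :. U --> (ALL p'. p' :. U --> (TF q (cAnd p p') s <-> As U TE q s & TF q p s & TF q p' s))) &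
     (ALL i. i :. U --> (i :. omega --> (ALL p. p :. U --> (TF q (cEx i p) s <-> As U TE q s & (EX c. c :. U & (TE c q & TF q p (upd s i c)))))))"
  proof (intro conjI allI impI)
    fix i k assume ik: "i :. U" "i :. omega" "k :. U" "k :. omega"
    show "TF q (cMem i k) s <-> As U TE q s & TE (ap s i) (ap s k)"
      unfolding F[OF cU(1)[OF ik(1,3)]] TS_simps(1)[OF ik(2,4)] As vM(1)[OF ik(2)] vM(1)[OF ik(4)]
      using Ec[OF au[OF ik(2)] au[OF ik(4)]] vM(2)[OF ik(4)] by blast
    show "TF q (cEq i k) s <-> As U TE q s & EQ U TE (ap s i) (ap s k)"
      unfolding F[OF cU(2)[OF ik(1,3)]] TS_simps(2)[OF ik(2,4)] As vM(1)[OF ik(2)] vM(1)[OF ik(4)]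
      using EQc[OF au[OF ik(2)] au[OF ik(4)]] vM(2)[OF ik(2)] vM(2)[OF ik(4)] by blast
  next
    fix p assume p: "p :. U"
    show "TF q (cNeg p) s <-> As U TE q s & ~ TF q p s" unfolding F[OF cU(3)[OF p]] F[OF p] TS_simps As ..
    show "TF q (cAnd p p') s <-> As U TE q s & TF q p s & TF q p' s" if "p' :. U" for p' unfolding F[OF cU(4)[OF p that]] F[OF p] F[OF that] TS_simps As ..
  next
    fix i p assume i: "i :. U" "i :. omega" and p: "p :. U"
    have "(EX a. a :. v q & upd (vf v s) i a :. TS (v q) p) <-> (EX c. c :. U & (TE c q & TF q p (upd s i c)))"
    proof -
      have 1: "TE c q & TF q p (upd s i c) <-> v c :. v q & upd (vf v s) i (v c) :. TS (v q) p" if c: "c :. U" for c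
        unfolding Ec[OF c q(1) qM] TF_def vfu[OF q(4) i(2)] using p q Base_upd[OF B q(2) i(1) c] by blast
      show ?thesis
      proof
        assume "EX a. a :. v q & upd (vf v s) i a :. TS (v q) p"
        then obtain a where a: "a :. v q" "upd (vf v s) i a :. TS (v q) p" by blast
        obtain c where c: "c :. U" "v c = a" using code[OF Mt[OF qM a(1)]] by blast
        then show "EX c. c :. U & (TE c q & TF q p (upd s i c))" using a 1[OF c(1)] by blast
      next
        assume "EX c. c :. U & (TE c q & TF q p (upd s i c))"
        then show "EX a. a :. v q & upd (vf v s) i a :. TS (v q) p" using 1 by blast
      qed
    qed
    then show "TF q (cEx i p) s <-> As U TE q s & (EX c. c :. U & (TE c q & TF q p (upd s i c)))"
      unfolding F[OF cU(5)[OF i(1) p]] TS_simps(5)[OF i(2)] As by blast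
  qed
qed

lemma tPH: "PH U TE TL TF \<chi>" unfolding PH_def using tPHE tPH0 tPH2 tPH3 tPH5 tPHF by blast

text \<open>The language of the lift has a single unary predicate, so the three relations are packed
  into one subset of \<open>U\<close> by tags.\<close>

definition AA :: 'a where
  "AA = sep U (%p. (EX c d. p = opair (std_num 0) (opair c d) & TE c d) | (EX q. p = opair (std_num 1) q & TL q) |
     (EX q r s. p = opair (std_num 2) (opair q (opair r s)) & TF q r s))"
lemma AA: "opair (std_num 0) (opair c d) :. AA <-> TE c d" "opair (std_num 1) q :. AA <-> TL q" "opair (std_num 2) (opair q (opair r s)) :. AA <-> TF q r s" "AA \<^bold>\<subseteq> U"
proof -
  have m: "p :. AA <-> p :. U & ((EX c d. p = opair (std_num 0) (opair c d) & TE c d) | (EX q. p = opair (std_num 1) q & TL q) |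
     (EX q r s. p = opair (std_num 2) (opair q (opair r s)) & TF q r s))" for p unfolding AA_def
    by (rule mem_sep, unfold TE_def TL_def TF_def vf_def) (intro Di)
  have U: "TE c d ==> opair (std_num 0) (opair c d) :. U" "TL q ==> opair (std_num 1) q :. U" "TF q r s ==> opair (std_num 2) (opair q (opair r s)) :. U"
    unfolding TE_def TL_def TF_def using OU SU by blast+
  show "opair (std_num 0) (opair c d) :. AA <-> TE c d" "opair (std_num 1) q :. AA <-> TL q" "opair (std_num 2) (opair q (opair r s)) :. AA <-> TF q r s"
    unfolding m opair_inj std_inj using U by auto
  show "AA \<^bold>\<subseteq> U" by (rule subI) (simp add: m)
qed

end

section \<open>The axioms for codes are first order\<close>

definition E0 :: "'a::zf => 'a => 'a => bool" where "E0 A c d <-> opair (std_num 0) (opair c d) :. A"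
definition L0 :: "'a::zf => 'a => bool" where "L0 A q <-> opair (std_num 1) q :. A"
definition F0 :: "'a::zf => 'a => 'a => 'a => bool" where "F0 A q p s <-> opair (std_num 2) (opair q (opair p s)) :. A"
text \<open>The graph named by the code \<open>c\<close>, as the structure sees it:
  \<open>K0\<close> turns a pair in \<open>U\<close> into its own code.\<close>

definition Sn :: "'a::zf => 'a => 'a => 'a => bool" where "Sn A c x y <-> E0 A (K0 (opair x y)) c"
definition Mv :: "'a::zf => 'a => 'a => bool" where
  "Mv U A x <-> (EX c. c :. U & (EmbR (Sn A c) U U & (EX y. y :. U & (Sn A c x y & ~ y = x))))"
text \<open>\<open>Base\<close> in a form that is first order over \<open>U\<close>: a power set is
  recognized by the subsets that belong to \<open>U\<close>, and \<open>omega\<close> is introduced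
  by a quantifier.\<close>

definition Bu :: "'a::zf => 'a => bool" where
  "Bu U u <-> (ALL x. x :. u --> (ALL y. y :. x --> y :. u)) & (EX w. w :. u & w = omega) & (ALL x. x :. u --> (EX y. y :. u & (ALL z. z :. U --> (z :. y <-> z \<^bold>\<subseteq> x)))) &
     (ALL x. x :. u --> (ALL y. y :. u --> upair x y :. u)) & (ALL x. x :. u --> set_union x :. u) & Form :. u"
definition Bs :: "'a::zf => 'a => bool" where
  "Bs U A <-> (EX u. u :. U & (Bu U u & (EX c. c :. U & EmbR (Sn A c) u U)))"

lemma Bu_Base: assumes B: "Base U" and u: "u :. U" shows "Bu U u <-> Base u"
proof -
  have 1: "(EX y. y :. u & (ALL z. z :. U --> (z :. y <-> z \<^bold>\<subseteq> x))) <-> pw x :. u" if x: "x :. u" for x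
  proof
    have xU: "x :. U" by (rule Base_trans[OF B u x])
    assume "EX y. y :. u & (ALL z. z :. U --> (z :. y <-> z \<^bold>\<subseteq> x))"
    then obtain y where y: "y :. u" "ALL z. z :. U --> (z :. y <-> z \<^bold>\<subseteq> x)" by blast
    have yU: "y :. U" by (rule Base_trans[OF B u y(1)])
    have "y = pw x" by (rule set_eqI, unfold mem_pw) (use y(2) Base_trans[OF B yU] Base_sub[OF B xU] in blast)
    then show "pw x :. u" using y(1) by simp
  next
    assume "pw x :. u" then show "EX y. y :. u & (ALL z. z :. U --> (z :. y <-> z \<^bold>\<subseteq> x))" by (intro exI[of _ "pw x"]) simp
  qed
  have "(ALL x. x :. u --> (EX y. y :. u & (ALL z. z :. U --> (z :. y <-> z \<^bold>\<subseteq> x)))) <-> (ALL x. x :. u --> pw x :. u)" using 1 by blast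
  note p = this
  have t: "transitive u <-> (ALL x. x :. u --> (ALL y. y :. x --> y :. u))" unfolding transitive_def subset_def ..
  have w: "(EX w. w :. u & w = omega) <-> omega :. u" by blast
  have r: "(ALL x y. x :. u & y :. u --> upair x y :. u) <-> (ALL x. x :. u --> (ALL y. y :. u --> upair x y :. u))" by blast
  show ?thesis unfolding Bu_def Base_def p t w r ..
qed

text \<open>The characterization in \<open>Form_iff\<close> with a variable in place of
  \<open>omega\<close>, so that the formula itself is bounded.\<close>

definition FD :: "'a::zf => 'a => bool" where
  "FD w x <-> (ALL i. i :. w --> (ALL k. k :. w --> cMem i k :. x & cEq i k :. x)) & (ALL p. p :. x --> cNeg p :. x & (ALL q. q :. x --> cAnd p q :. x) & (ALL i. i :. w --> cEx i p :. x)) &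
  (ALL p. p :. x --> (EX i. i :. w & (EX k. k :. w & (p = cMem i k | p = cEq i k))) | (EX q. q :. x & (p = cNeg q | (EX r. r :. x & p = cAnd q r) | (EX i. i :. w & p = cEx i q))))"
lemma FD_Form: "FD omega x <-> x = Form" unfolding FD_def by (rule Form_iff[symmetric])
lemma d0_FD: "d0 (%e. FD (e 0) (e 1))" unfolding FD_def by (intro Bi)

lemma fun_on_d0: "fun_on f A <-> (ALL p. p :. f --> (EX x. x :. A & (EX y. y :. set_union (set_union f) & p = opair x y))) &
  (ALL x. x :. A --> (EX y. y :. set_union (set_union f) & (opair x y :. f & (ALL y'. y' :. set_union (set_union f) --> opair x y' :. f --> y' = y))))"
proof -
  have 1: "opair x y :. f <-> y :. set_union (set_union f) & opair x y :. f" for x y using opair_mem_Un by blast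
  have "(ALL p. p :. f --> (EX x y. x :. A & p = opair x y)) <-> (ALL p. p :. f --> (EX x. x :. A & (EX y. y :. set_union (set_union f) & p = opair x y)))"
    using opair_mem_Un(2) by blast
  moreover have "(EX! y. opair x y :. f) <-> (EX y. y :. set_union (set_union f) & (opair x y :. f & (ALL y'. y' :. set_union (set_union f) --> opair x y' :. f --> y' = y)))" for x
    unfolding Ex1_def using opair_mem_Un(2)[of x _ f] by blast
  ultimately show ?thesis unfolding fun_on_def by presburger
qed
lemma d0_fun_on: "d0 (%e. fun_on (e 0) (e 1))" unfolding fun_on_d0 by (intro Bi)

context embd
begin

lemma a_sub: "z :. a ==> z :. U" unfolding mem_a using Base_trans[OF BU jU[OF inU]] by blast
lemma tU: "transitive U'" "transitive U" using BU' BU by (simp_all add: Base_def)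
lemma tr_mem: assumes "bt u" shows "tr (%e. u e :. a') (%e. u e :. a)"
proof (rule tr_cong)
  show "tr (%e. EX p. p :. U' & (p = u e & p :. a')) (%e. EX p. p :. U & (p = u e & p :. a))"
    by (rule tr_ex, rule tr_and[OF tr_d0 tr_pr], rule d0_var_eq[OF bt_shift[OF assms]])
qed (use subD[OF asub] a_sub in blast)+
text \<open>The language has no names for \<open>omega\<close> and \<open>Form\<close>. They are
  introduced by a quantifier over the element that satisfies their characterization, which is the
  same on both sides.\<close>

lemma tr_par: assumes "c :. U'" "c :. U" "tr (%e. e 0 = c) (%e. e 0 = c)" "tr (%e. Q' (e 0) (%n. e (Suc n))) (%e. Q (e 0) (%n. e (Suc n)))"
  shows "tr (%e. Q' c e) (%e. Q c e)"
proof (rule tr_cong)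
  show "tr (%e. EX x. x :. U' & (x = c & Q' x e)) (%e. EX x. x :. U & (x = c & Q x e))" by (rule tr_ex, rule tr_and[OF assms(3,4)])
qed (use assms(1,2) in auto)
lemma tr_omega0: "tr (%e. e 0 = omega) (%e. e 0 = omega)" by (rule tr_d0) (intro Bi)
lemmas tr_om = tr_par[OF Base_omega(1)[OF BU'] Base_omega(1)[OF BU] tr_omega0]
lemma tr_omega: "bt t ==> tr (%e. t e :. omega) (%e. t e :. omega)"
  by (rule tr_om[of "%w e. t e :. w" "%w e. t e :. w"], rule tr_d0) (intro d0_mem bt_var, erule bt_shift)
lemma tr_fun_on: assumes "bt s" shows "tr (%e. fun_on (s e) omega) (%e. fun_on (s e) omega)"
proof (rule tr_om[of "%w e. fun_on (s e) w" "%w e. fun_on (s e) w"], rule tr_d0)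
  have "d0 (%e. fun_on (e 0) (e (Suc 0)))" using d0_fun_on by simp
  from d0_subst[of "%x e. fun_on x (e 0)", OF this bt_shift[OF assms]] show "d0 (%e. fun_on (s (%n. e (Suc n))) (e 0))" .
qed
lemma FU: "Form :. U'" "Form :. U" using BU BU' unfolding Base_def by blast+
lemma tr_Form0: "tr (%e. e 0 = Form) (%e. e 0 = Form)"
  unfolding FD_Form[symmetric] by (rule tr_om[of "%w e. FD w (e 0)" "%w e. FD w (e 0)"], rule tr_d0) (use d0_FD in simp)
lemmas tr_Fm = tr_par[OF FU tr_Form0]
lemma tr_Form: "bt t ==> tr (%e. t e :. Form) (%e. t e :. Form)"
  by (rule tr_Fm[of "%w e. t e :. w" "%w e. t e :. w"], rule tr_d0) (intro d0_mem bt_var, erule bt_shift)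
lemma tr_Form': "tr (%e. Form :. e i) (%e. Form :. e i)"
  by (rule tr_Fm[of "%w e. w :. e i" "%w e. w :. e i"], rule tr_d0) (intro Bi)

lemma tr_E: "bt s ==> bt t ==> tr (%e. E0 a' (s e) (t e)) (%e. E0 a (s e) (t e))" unfolding E0_def by (rule tr_mem) (intro bt_opair bt_std)
lemma tr_L: "bt s ==> tr (%e. L0 a' (s e)) (%e. L0 a (s e))" unfolding L0_def by (rule tr_mem) (intro bt_opair bt_std)
lemma tr_F: "bt s ==> bt t ==> bt u ==> tr (%e. F0 a' (s e) (t e) (u e)) (%e. F0 a (s e) (t e) (u e))" unfolding F0_def by (rule tr_mem) (intro bt_opair bt_std)
lemma tr_EQ: assumes "bt s" "bt t" shows "tr (%e. EQ U' (E0 a') (s e) (t e)) (%e. EQ U (E0 a) (s e) (t e))"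
  unfolding EQ_def by (rule tr_all, intro tr_iff tr_E bt_var bt_shift[OF assms(1)] bt_shift[OF assms(2)])
lemma tr_Dm: assumes "bt s" shows "tr (%e. Dm U' (E0 a') (L0 a') (s e)) (%e. Dm U (E0 a) (L0 a) (s e))"
  unfolding Dm_def by (rule tr_ex, intro tr_and tr_E tr_L bt_var bt_shift[OF assms])
lemma tr_As: assumes "bt s" "bt t" shows "tr (%e. As U' (E0 a') (s e) (t e)) (%e. As U (E0 a) (s e) (t e))"
  unfolding As_def by (rule tr_all, intro tr_imp tr_omega tr_E bt_ap bt_var bt_shift[OF assms(1)] bt_shift[OF assms(2)])
lemma tr_bev: "tr (%e. bev (E0 a') (EQ U' (E0 a')) \<phi> e) (%e. bev (E0 a) (EQ U (E0 a)) \<phi> e)"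
proof (induction \<phi>)
  case (bEx i \<phi>)
  have c: "case_nat (e 0) (%n. e (Suc n)) = e" for e :: "nat => 'a" by (auto split: nat.split)
  have t: "tr (%e. EX x. x :. U' & (E0 a' x (e i) & bev (E0 a') (EQ U' (E0 a')) \<phi> (case_nat x e))) (%e. EX x. x :. U & (E0 a x (e i) & bev (E0 a) (EQ U (E0 a)) \<phi> (case_nat x e)))"
    by (rule tr_ex, rule tr_and, (intro tr_E bt_var)[1], unfold c, rule bEx.IH)
  have m': "E0 a' x y ==> x :. U'" for x y unfolding E0_def
    by (rule opair_trans(1)[OF tU(1) opair_trans(2)[OF tU(1) subD[OF asub]]])
  have m: "E0 a x y ==> x :. U" for x y unfolding E0_def
    by (rule opair_trans(1)[OF tU(2) opair_trans(2)[OF tU(2) a_sub]])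
  show ?case unfolding bev.simps by (rule tr_cong[OF t]) (use m m' in blast)+
qed (auto intro: tr_E tr_EQ tr_not tr_and bt_var)
lemma tr_BO: "tr (%e. BO U' (E0 a') \<chi> (e i0) (e i1) (e i2) (e i3) (e i4)) (%e. BO U (E0 a) \<chi> (e i0) (e i1) (e i2) (e i3) (e i4))"
proof -
  have "(%n. if n = 0 then e i0 else if n = 1 then e i1 else if n = 2 then e i2 else if n = 3 then e i3 else e i4) = (%n::nat. e (if n = 0 then i0 else if n = 1 then i1 else if n = 2 then i2 else if n = 3 then i3 else i4))" for e :: "nat => 'a" by auto
  then show ?thesis unfolding BO_def using tr_ren[OF tr_bev[of \<chi>], of "%n. if n = 0 then i0 else if n = 1 then i1 else if n = 2 then i2 else if n = 3 then i3 else i4"] by simp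
qed

lemmas TI = tr_all tr_ex tr_and tr_or tr_imp tr_iff tr_not tr_E tr_L tr_F tr_EQ tr_Dm tr_As tr_BO tr_omega tr_Form tr_fun_on

lemma trPHE: "tr (%e. PHE U' (E0 a') (L0 a')) (%e. PHE U (E0 a) (L0 a))" unfolding PHE_def by (intro TI Bi)
lemma trPH0: "tr (%e. PH0 U' (E0 a') (L0 a')) (%e. PH0 U (E0 a) (L0 a))" unfolding PH0_def by (intro TI Bi) (rule tr_d0, (intro Bi)[1])+
lemma trPH2: "tr (%e. PH2 U' (E0 a') (L0 a') \<chi>) (%e. PH2 U (E0 a) (L0 a) \<chi>)" unfolding PH2_def by (intro TI Bi)
lemma trPH3: "tr (%e. PH3 U' (E0 a') (L0 a')) (%e. PH3 U (E0 a) (L0 a))" unfolding PH3_def by (intro TI Bi)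
lemma trPH5: "tr (%e. PH5 U' (E0 a') (L0 a') (F0 a')) (%e. PH5 U (E0 a) (L0 a) (F0 a))" unfolding PH5_def by (intro TI Bi) (rule tr_d0, (intro Bi)[1])+
lemma trPHF: "tr (%e. PHF U' (E0 a') (L0 a') (F0 a')) (%e. PHF U (E0 a) (L0 a) (F0 a))" unfolding PHF_def by (intro TI Bi)
lemma trPH: "PH U' (E0 a') (L0 a') (F0 a') \<chi> ==> PH U (E0 a) (L0 a) (F0 a) \<chi>"
  unfolding PH_def using tr_sent[OF trPHE] tr_sent[OF trPH0] tr_sent[OF trPH2] tr_sent[OF trPH3] tr_sent[OF trPH5] tr_sent[OF trPHF] by blast

lemma tr_EmbU: "tr (%e. EmbR (Sn a' (e i)) U' U') (%e. EmbR (Sn a (e i)) U U)"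
  unfolding EmbR_def Sn_def imp_conjL by (intro TI Bi) (rule tr_d0, (intro Bi)[1])+
lemma tr_Embu: "tr (%e. EmbR (Sn a' (e i)) (e m) U') (%e. EmbR (Sn a (e i)) (e m) U)"
  unfolding EmbR_def Sn_def imp_conjL by (intro TI tr_ball tr_bex Bi) (rule tr_d0, (intro Bi)[1])+
lemma tr_Sn: "tr (%e. Sn a' (e i) (e m) (e n)) (%e. Sn a (e i) (e m) (e n))" unfolding Sn_def by (intro TI Bi)
lemma tr_Mv: "tr (%e. Mv U' a' (e i)) (%e. Mv U a (e i))"
  unfolding Mv_def by (intro TI tr_EmbU tr_Sn Bi) (rule tr_d0, (intro Bi)[1])+
lemma tr_Bs: "tr (%e. Bs U' a') (%e. Bs U a)"
  unfolding Bs_def Bu_def by (intro TI tr_Embu tr_Form' tr_ball tr_bex Bi) (rule tr_d0, (intro Bi)[1])+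

end

section \<open>Comparison\<close>

text \<open>Any structure satisfying the axioms, well-founded or not. The definability assumptions
  make recursions and inductions that mention it legitimate.\<close>

locale cmp =
  fixes U l :: "'a::zf" and E L F \<chi>
  assumes B: "Base U" and as: "astar U l" and ch: "opf \<chi> TYPE('a)" and ph: "PH U E L F \<chi>"
    and EU: "!!c d. E c d ==> c :. U & d :. U" and LU: "!!q. L q ==> q :. U"
    and dE0: "D (%e. E (e 0) (e 1))" and dL0: "D (%e. L (e 0))" and dF0: "D (%e. F (e 0) (e 1) (e 2))"
begin

abbreviation "dm \<equiv> Dm U E L"
abbreviation "eq \<equiv> EQ U E"

lemma T: "transitive U" "omega :. U" using B by (auto simp: Base_def)
lemma KU: "x :. U ==> y :. U ==> opair x y :. U" "std_num k :. U" "empty :. U"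
  using Base_opair[OF B] Base_omega(2)[OF B, of "std_num k"] Base_omega(2)[OF B, of empty] by simp_all
lemma nU: "n :. omega ==> n :. U" by (rule Base_omega(2)[OF B])
lemma dE: "dt s ==> dt t ==> D (%e. E (s e) (t e))" by (rule D_app2[of E, OF dE0])
lemma dL: "dt s ==> D (%e. L (s e))" by (rule D_app1[of L, OF dL0])
lemma dF: "dt s ==> dt t ==> dt u ==> D (%e. F (s e) (t e) (u e))" by (rule D_app3[of F, OF dF0])
lemma dDm: "dt s ==> D (%e. dm (s e))" by (rule D_app1[of dm], unfold Dm_def, intro Di dE dL)

lemma phs: "PHE U E L" "PH0 U E L" "PH2 U E L \<chi>" "PH3 U E L" "PH5 U E L F" "PHF U E L F" using ph unfolding PH_def by blast+
lemma e1: "E z d ==> dm z & dm d" using phs(1)[unfolded PHE_def, THEN conjunct1] EU by blast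
lemma e2: "c' :. U ==> dm c' ==> eq c c' ==> E c d ==> E c' d" using phs(1)[unfolded PHE_def, THEN conjunct2, THEN conjunct1] EU by blast
lemma e3: "L q ==> dm q" using phs(1)[unfolded PHE_def, THEN conjunct2, THEN conjunct2, THEN conjunct1] LU by blast
lemma e4: "L q ==> L r ==> E q r | eq q r | E r q" using phs(1)[unfolded PHE_def, THEN conjunct2, THEN conjunct2, THEN conjunct2, THEN conjunct1] LU by blast
lemma e5: "L q ==> E K1 q" using phs(1)[unfolded PHE_def, THEN conjunct2, THEN conjunct2, THEN conjunct2, THEN conjunct2, THEN conjunct1] LU by blast
lemma e6: "L q ==> L r ==> E r q ==> E (K4 r) q | eq (K4 r) q" using phs(1)[unfolded PHE_def, THEN conjunct2, THEN conjunct2, THEN conjunct2, THEN conjunct2, THEN conjunct2] LU by blast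
lemma eq_sym: "eq c d ==> eq d c" unfolding EQ_def by blast
lemma eqD: "eq c d ==> E z c <-> E z d" unfolding EQ_def using EU by blast

text \<open>The set of codes that represent the real set \<open>x\<close>, by a back-and-forth
  condition between elements. The recursion is on \<open>x\<close>, because the membership relation
  \<open>E\<close> of the structure may be ill-founded.\<close>

definition RG :: "'a => ('a => 'a) => 'a" where
  "RG x G = sep U (%c. dm c & (ALL z. E z c --> (EX y. y :. x & z :. G y)) & (ALL y. y :. x --> (EX z. E z c & z :. G y)))"
definition Rp :: "'a => 'a" where "Rp x = recr RG x"

lemma loc_RG: "loc RG" unfolding loc_def
proof (intro allI impI)
  fix x S and G G' :: "'a => 'a" assume h: "transitive S & x \<^bold>\<subseteq> S & (ALL z. z :. S --> G z = G' z)"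
  then have "y :. x ==> G y = G' y" for y using subD by blast
  then have "(%c. dm c & (ALL z. E z c --> (EX y. y :. x & z :. G y)) & (ALL y. y :. x --> (EX z. E z c & z :. G y))) = (%c. dm c & (ALL z. E z c --> (EX y. y :. x & z :. G' y)) & (ALL y. y :. x --> (EX z. E z c & z :. G' y)))"
    by (intro ext) metis
  then show "RG x G = RG x G'" unfolding RG_def by presburger
qed
lemma D_RG: "D (%e. e 0 = RG (e 1) (ap (e 2)))" unfolding RG_def by (intro Di dE dDm)
lemma dt_Rp [Di]: "dt t ==> dt (%e. Rp (t e))" unfolding Rp_def
  by (rule dt_recr[of "%_. RG" "%e. empty", OF loc_RG], unfold RG_def, intro Di dE dDm) (intro Di, assumption)
lemma mem_Rp: "c :. Rp x <-> c :. U & dm c & (ALL z. E z c --> (EX y. y :. x & z :. Rp y)) & (ALL y. y :. x --> (EX z. E z c & z :. Rp y))"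
proof -
  have "Rp x = RG x Rp" unfolding Rp_def by (rule recr_unfold[OF loc_RG D_RG])
  moreover have "D (%e. dm (e 0) & (ALL z. E z (e 0) --> (EX y. y :. x & z :. Rp y)) & (ALL y. y :. x --> (EX z. E z (e 0) & z :. Rp y)))" by (intro Di dE dDm)
  ultimately show ?thesis unfolding RG_def using mem_sep[of "%c. dm c & (ALL z. E z c --> (EX y. y :. x & z :. Rp y)) & (ALL y. y :. x --> (EX z. E z c & z :. Rp y))" c U] by simp
qed
lemma RU: "c :. Rp x ==> c :. U" "c :. Rp x ==> dm c" by (drule mem_Rp[THEN iffD1], elim conjE, assumption)+
lemma R1: "c :. Rp x ==> E z c ==> EX y. y :. x & z :. Rp y" by (drule mem_Rp[THEN iffD1]) blast
lemma R2: "c :. Rp x ==> y :. x ==> EX z. E z c & z :. Rp y" by (drule mem_Rp[THEN iffD1]) blast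
lemma RI: "c :. U ==> dm c ==> (!!z. E z c ==> EX y. y :. x & z :. Rp y) ==> (!!y. y :. x ==> EX z. E z c & z :. Rp y) ==> c :. Rp x"
  by (rule mem_Rp[THEN iffD2]) blast

lemma R_uniq: assumes "c :. Rp x" "c :. Rp x'" shows "x = x'"
proof -
  have "ALL c x'. c :. Rp x & c :. Rp x' --> x = x'"
  proof (rule mem_induct)
    show "D (%e. ALL c x'. c :. Rp (e 0) & c :. Rp x' --> e 0 = x')" by (intro Di)
    fix x assume IH: "!!y. y :. x ==> ALL c x'. c :. Rp y & c :. Rp x' --> y = x'"
    show "ALL c x'. c :. Rp x & c :. Rp x' --> x = x'"
    proof (intro allI impI, elim conjE)
      fix c x' assume c: "c :. Rp x" "c :. Rp x'"
      show "x = x'"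
      proof (rule set_eqI, rule iffI)
        fix y assume y: "y :. x"
        obtain z where z: "E z c" "z :. Rp y" using R2[OF c(1) y] by blast
        obtain y' where "y' :. x'" "z :. Rp y'" using R1[OF c(2) z(1)] by blast
        then show "y :. x'" using IH[OF y] z(2) by blast
      next
        fix y' assume y: "y' :. x'"
        obtain z where z: "E z c" "z :. Rp y'" using R2[OF c(2) y] by blast
        obtain y where y': "y :. x" "z :. Rp y" using R1[OF c(1) z(1)] by blast
        then show "y' :. x" using IH[OF y'(1)] z(2) by blast
      qed
    qed
  qed
  then show ?thesis using assms by blast
qed
lemma R_EQ: assumes "c :. Rp x" "c' :. Rp x" shows "eq c c'"
proof -
  have "ALL c c'. c :. Rp x & c' :. Rp x --> eq c c'"
  proof (rule mem_induct[where P="%x. ALL c c'. c :. Rp x & c' :. Rp x --> eq c c'"])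
    show "D (%e. ALL c c'. c :. Rp (e 0) & c' :. Rp (e 0) --> eq c c')" unfolding EQ_def by (intro Di dE)
    fix x assume IH: "!!y. y :. x ==> ALL c c'. c :. Rp y & c' :. Rp y --> eq c c'"
    have *: "E z c'" if c: "c :. Rp x" "c' :. Rp x" "E z c" for c c' z
    proof -
      obtain y where y: "y :. x" "z :. Rp y" using R1[OF c(1,3)] by blast
      obtain z' where z': "E z' c'" "z' :. Rp y" using R2[OF c(2) y(1)] by blast
      have "eq z' z" using IH[OF y(1)] y(2) z'(2) by blast
      then show ?thesis using e2[OF RU[OF y(2)] _ z'(1)] by blast
    qed
    show "ALL c c'. c :. Rp x & c' :. Rp x --> eq c c'" unfolding EQ_def using * by blast
  qed
  then show ?thesis using assms by blast
qed
lemma R_cong: assumes "c :. Rp x" "c' :. U" "dm c'" "eq c c'" shows "c' :. Rp x"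
  by (rule RI[OF assms(2,3)], unfold eqD[OF assms(4), symmetric]) (rule R1[OF assms(1)], assumption, rule R2[OF assms(1)])
lemma R_rel: assumes "c :. Rp x" "d :. Rp y" shows "(E c d <-> x :. y) & (eq c d <-> x = y)"
proof (intro conjI iffI)
  assume "E c d"
  then obtain y' where "y' :. y" "c :. Rp y'" using R1[OF assms(2)] by blast
  then show "x :. y" using R_uniq[OF assms(1)] by blast
next
  assume "x :. y"
  then obtain z where z: "E z d" "z :. Rp x" using R2[OF assms(2)] by blast
  then show "E c d" using e2[OF RU[OF assms(1)] R_EQ[OF z(2) assms(1)] z(1)] by blast
next
  assume "eq c d" then show "x = y" using R_uniq[OF R_cong[OF assms(1) RU[OF assms(2)]] assms(2)] by blast
next
  assume "x = y" then show "eq c d" using R_EQ assms by blast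
qed
lemmas R_E = R_rel[THEN conjunct1]

lemma k0: "x :. U ==> dm (K0 x)" "x :. U ==> z :. U ==> E z (K0 x) <-> dm z & (EX y. y :. U & (y :. x & eq z (K0 y)))"
  using phs(2)[unfolded PH0_def, THEN conjunct1] by blast+
lemma k1: "dm K1" "z :. U ==> E z K1 <-> dm z & (EX y. y :. U & eq z (K0 y))"
  using phs(2)[unfolded PH0_def, THEN conjunct2, THEN conjunct1] by blast+
lemma k6: "L (K6 K1)" "z :. U ==> E z (K6 K1) <-> E z K1 | (dm z & eq z K1)"
  using phs(2)[unfolded PH0_def, THEN conjunct2, THEN conjunct2] by blast+

lemma R_0: assumes "x :. U" shows "K0 x :. Rp x"
proof -
  have "x :. U --> K0 x :. Rp x"
  proof (rule mem_induct[where P="%x. x :. U --> K0 x :. Rp x"])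
    show "D (%e. e 0 :. U --> K0 (e 0) :. Rp (e 0))" by (intro Di)
    fix x assume IH: "!!y. y :. x ==> y :. U --> K0 y :. Rp y"
    show "x :. U --> K0 x :. Rp x"
    proof
      assume x: "x :. U"
      show "K0 x :. Rp x"
      proof (rule RI[OF KU(1)[OF KU(2) x] k0(1)[OF x]])
        fix z assume z: "E z (K0 x)"
        then obtain y where y: "y :. U" "y :. x" "eq z (K0 y)" "dm z" using k0(2)[OF x] EU by blast
        then show "EX y. y :. x & z :. Rp y" using R_cong[OF IH[OF y(2), rule_format, OF y(1)] _ y(4) eq_sym[OF y(3)]] EU[OF z] by blast
      next
        fix y assume y: "y :. x"
        have yU: "y :. U" by (rule Base_trans[OF B x y])
        have "eq (K0 y) (K0 y)" unfolding EQ_def by blast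
        then have "E (K0 y) (K0 x)" using k0(2)[OF x KU(1)[OF KU(2) yU]] k0(1)[OF yU] y yU by blast
        then show "EX z. E z (K0 x) & z :. Rp y" using IH[OF y] yU by blast
      qed
    qed
  qed
  then show ?thesis using assms by blast
qed
lemma K1U: "K1 :. U" "K6 K1 :. U" by (intro KU)+
lemma R_K1: "K1 :. Rp U"
proof (rule RI[OF K1U(1) k1(1)])
  fix z assume z: "E z K1"
  then obtain y where y: "y :. U" "eq z (K0 y)" "dm z" using k1(2) EU by blast
  then show "EX y. y :. U & z :. Rp y" using R_cong[OF R_0[OF y(1)] _ y(3) eq_sym[OF y(2)]] EU[OF z] by blast
next
  fix y assume y: "y :. U"
  have "eq (K0 y) (K0 y)" unfolding EQ_def by blast
  then have "E (K0 y) K1" using k1(2)[OF KU(1)[OF KU(2) y]] k0(1)[OF y] y by blast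
  then show "EX z. E z K1 & z :. Rp y" using R_0[OF y] by blast
qed
lemma R_K6: "K6 K1 :. Rp (adjoin_self U)"
proof (rule RI[OF K1U(2) e3[OF k6(1)]])
  fix z assume z: "E z (K6 K1)"
  then have "E z K1 | (dm z & eq z K1)" using k6(2) EU by blast
  then show "EX y. y :. adjoin_self U & z :. Rp y" unfolding mem_adj using R1[OF R_K1] R_cong[OF R_K1 _ _ eq_sym] EU[OF z] by blast
next
  fix y assume "y :. adjoin_self U"
  then consider "y :. U" | "y = U" by auto
  then show "EX z. E z (K6 K1) & z :. Rp y"
  proof cases
    case 1
    then obtain z where "E z K1" "z :. Rp y" using R2[OF R_K1] by blast
    then show ?thesis using k6(2) EU by blast
  next
    case 2
    have "eq K1 K1" unfolding EQ_def by blast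
    then show ?thesis using k6(2)[OF K1U(1)] k1(1) R_K1 2 by blast
  qed
qed

lemma R_K2: assumes "s :. Rp s'" "p :. Rp p'" "q :. Rp q'" "r :. Rp r'" "X :. Rp X'" shows "K2 s p q r X :. Rp (inter X' (OP s' p' q' r'))"
proof -
  note u = RU(1)[OF assms(1)] RU(1)[OF assms(2)] RU(1)[OF assms(3)] RU(1)[OF assms(4)] RU(1)[OF assms(5)]
  have K: "K2 s p q r X :. U" by (intro KU u)
  note k = phs(3)[unfolded PH2_def, rule_format, OF u RU(2)[OF assms(1)] RU(2)[OF assms(2)] RU(2)[OF assms(3)] RU(2)[OF assms(4)] RU(2)[OF assms(5)]]
  have kz: "z :. U ==> E z (K2 s p q r X) <-> E z X & BO U E \<chi> z s p q r" for z using k by blast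
  have bo: "BO U E \<chi> z s p q r <-> y :. OP s' p' q' r'" if "z :. Rp y" for z y
    by (rule BO_rel[where R="%c x. c :. Rp x", OF ch R_rel R1 R2]) (use that assms in auto)
  show ?thesis
  proof (rule RI[OF K conjunct1[OF k]])
    fix z assume z: "E z (K2 s p q r X)"
    then have h: "E z X" "BO U E \<chi> z s p q r" using kz EU by blast+
    obtain y where "y :. X'" "z :. Rp y" using R1[OF assms(5) h(1)] by blast
    then show "EX y. y :. inter X' (OP s' p' q' r') & z :. Rp y" using bo h(2) unfolding mem_inter by blast
  next
    fix y assume "y :. inter X' (OP s' p' q' r')"
    then have y: "y :. X'" "y :. OP s' p' q' r'" by auto
    obtain z where z: "E z X" "z :. Rp y" using R2[OF assms(5) y(1)] by blast
    then show "EX z. E z (K2 s p q r X) & z :. Rp y" using kz[OF RU(1)[OF z(2)]] bo[OF z(2)] y(2) by blast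
  qed
qed

lemma R_K3: assumes "c :. Rp X" "n :. omega" shows "K3 n c :. Rp (it X n)"
  using assms(2)
proof (rule omega_induct)
  have cU: "c :. U" "dm c" using RU[OF assms(1)] by blast+
  note k = phs(4)[unfolded PH3_def, THEN conjunct1, rule_format, OF cU]
  have K3U: "n :. omega ==> K3 n c :. U" for n by (intro KU nU cU)
  have Kdm: "n :. omega ==> dm (K3 n c)" for n using k nU by blast
  show "D (%e. K3 (e 0) c :. Rp (it X (e 0)))" by (intro Di)
  show "K3 empty c :. Rp (it X empty)" unfolding it_0
    using R_cong[OF assms(1) K3U[OF empty_omega] Kdm[OF empty_omega] eq_sym] k by blast
  fix n assume n: "n :. omega" and IH: "K3 n c :. Rp (it X n)"
  define C where "C = K3 n c"
  have kz: "E z (K3 (adjoin_self n) c) <-> E z C | (dm z & (eq z C | (EX s. s :. U & (EX p. p :. U & (EX q. q :. U & (EX r. r :. U & (E s C & E p C & E q C & E r C & eq z (K2 s p q r C))))))))" if "z :. U" for z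
    unfolding C_def by (rule k[THEN conjunct2, rule_format, OF nU[OF n] n, THEN conjunct2, rule_format, OF that])
  note C = IH[folded C_def]
  show "K3 (adjoin_self n) c :. Rp (it X (adjoin_self n))" unfolding it_Suc
  proof (rule RI[OF K3U[OF adj_omega[OF n]] Kdm[OF adj_omega[OF n]]])
    fix z assume "E z (K3 (adjoin_self n) c)"
    then have zU: "z :. U" using EU by blast
    from \<open>E z (K3 (adjoin_self n) c)\<close> consider "E z C" | "dm z" "eq z C" | s p q r where "dm z" "E s C" "E p C" "E q C" "E r C" "eq z (K2 s p q r C)"
      unfolding kz[OF zU] by blast
    then show "EX y. y :. step (it X n) & z :. Rp y"
    proof cases
      case 1 then show ?thesis using R1[OF C] unfolding mem_step by blast
    next
      case 2 then show ?thesis using R_cong[OF C zU 2(1) eq_sym[OF 2(2)]] unfolding mem_step by blast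
    next
      case 3
      obtain s' p' q' r' where h: "s' :. it X n" "p' :. it X n" "q' :. it X n" "r' :. it X n" and "s :. Rp s'" "p :. Rp p'" "q :. Rp q'" "r :. Rp r'"
        using R1[OF C 3(2)] R1[OF C 3(3)] R1[OF C 3(4)] R1[OF C 3(5)] by blast
      note R = R_cong[OF R_K2[OF this(5-8) C] zU 3(1) eq_sym[OF 3(6)]]
      have "inter (it X n) (OP s' p' q' r') :. step (it X n)"
        by (rule mem_step[THEN iffD2], intro disjI2 exI[of _ s'] exI[of _ p'] exI[of _ q'] exI[of _ r'] conjI h refl)
      then show ?thesis using R by (intro exI conjI)
    qed
  next
    fix y assume "y :. step (it X n)"
    then consider "y :. it X n" | "y = it X n" | s p q r where "s :. it X n" "p :. it X n" "q :. it X n" "r :. it X n" "y = inter (it X n) (OP s p q r)" unfolding mem_step by blast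
    then show "EX z. E z (K3 (adjoin_self n) c) & z :. Rp y"
    proof cases
      case 1
      then obtain z where z: "E z C" "z :. Rp y" using R2[OF C] by blast
      then show ?thesis using kz[OF RU(1)[OF z(2)]] by blast
    next
      case 2
      have "eq C C" unfolding EQ_def by blast
      then show ?thesis using kz[OF RU(1)[OF C]] RU(2)[OF C] C 2 by blast
    next
      case 3
      obtain s' p' q' r' where h: "E s' C" "E p' C" "E q' C" "E r' C" and "s' :. Rp s" "p' :. Rp p" "q' :. Rp q" "r' :. Rp r"
        using R2[OF C 3(1)] R2[OF C 3(2)] R2[OF C 3(3)] R2[OF C 3(4)] by blast
      note K = R_K2[OF this(5-8) C]
      have "eq (K2 s' p' q' r' C) (K2 s' p' q' r' C)" unfolding EQ_def by blast
      then have "E (K2 s' p' q' r' C) (K3 (adjoin_self n) c)" unfolding kz[OF RU(1)[OF K]] using RU(2)[OF K] h EU[OF h(1)] EU[OF h(2)] EU[OF h(3)] EU[OF h(4)] by blast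
      then show ?thesis using K 3(5) by blast
    qed
  qed
qed

lemma R_K4: assumes "L q" "q :. Rp X" shows "L (K4 q)" "K4 q :. Rp (nx X)"
proof -
  note k = phs(4)[unfolded PH3_def, THEN conjunct2, rule_format, OF LU[OF assms(1)] assms(1)]
  show L: "L (K4 q)" using k by blast
  have kz: "z :. U ==> E z (K4 q) <-> (EX n. n :. U & (n :. omega & E z (K3 n q)))" for z using k by blast
  show "K4 q :. Rp (nx X)"
  proof (rule RI[OF LU[OF L] e3[OF L]])
    fix z assume "E z (K4 q)"
    then obtain n where n: "n :. omega" "E z (K3 n q)" using kz EU by blast
    then show "EX y. y :. nx X & z :. Rp y" using R1[OF R_K3[OF assms(2) n(1)] n(2)] unfolding mem_nx by blast
  next
    fix y assume "y :. nx X"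
    then obtain n where n: "n :. omega" "y :. it X n" unfolding mem_nx by blast
    obtain z where z: "E z (K3 n q)" "z :. Rp y" using R2[OF R_K3[OF assms(2) n(1)] n(2)] by blast
    then show "EX z. E z (K4 q) & z :. Rp y" using kz[OF RU(1)[OF z(2)]] n(1) nU by blast
  qed
qed

text \<open>The relation \<open>F\<close> obeys Tarski's clauses by \<open>PHF\<close>, so induction
  on internal formulas forces it to be real satisfaction at a represented level.\<close>

lemma R_F: assumes q: "L q" "q :. Rp X" and p: "p :. Form"
  shows "ALL s f. s :. U & fun_on s omega & fun_on f omega & (ALL i. i :. omega --> ap s i :. Rp (ap f i)) --> (F q p s <-> f :. TS X p)" (is "?P p")
  using p
proof (rule Form_induct)
  show "D (%e. ?P (e 0))" by (intro Di dF)
  note k = phs(6)[unfolded PHF_def, rule_format, OF LU[OF q(1)] _ q(1)]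
  have As: "As U E q s <-> maps f omega X" if "fun_on f omega" "ALL i. i :. omega --> ap s i :. Rp (ap f i)" for s f
    unfolding As_def maps_iff using R_E[OF _ q(2)] that nU by blast
  show "?P (cMem i k)" if ik: "i :. omega" "k :. omega" for i k
  proof (intro allI impI, elim conjE)
    fix s f assume s: "s :. U" "fun_on s omega" "fun_on f omega" "ALL i. i :. omega --> ap s i :. Rp (ap f i)"
    show "F q (cMem i k) s <-> f :. TS X (cMem i k)" unfolding TS_simps(1)[OF ik] As[OF s(3,4), symmetric]
      using k[OF s(1,2), THEN conjunct1, rule_format, OF nU[OF ik(1)] ik(1) nU[OF ik(2)] ik(2)] R_E[of "ap s i" "ap f i" "ap s k" "ap f k"] s(4) ik by blast
  qed
  show "?P (cEq i k)" if ik: "i :. omega" "k :. omega" for i k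
  proof (intro allI impI, elim conjE)
    fix s f assume s: "s :. U" "fun_on s omega" "fun_on f omega" "ALL i. i :. omega --> ap s i :. Rp (ap f i)"
    show "F q (cEq i k) s <-> f :. TS X (cEq i k)" unfolding TS_simps(2)[OF ik] As[OF s(3,4), symmetric]
      using k[OF s(1,2), THEN conjunct1, rule_format, OF nU[OF ik(1)] ik(1) nU[OF ik(2)] ik(2)] R_rel[of "ap s i" "ap f i" "ap s k" "ap f k"] s(4) ik by blast
  qed
  show "?P (cNeg p)" if p: "p :. Form" "?P p" for p
  proof (intro allI impI, elim conjE)
    fix s f assume s: "s :. U" "fun_on s omega" "fun_on f omega" "ALL i. i :. omega --> ap s i :. Rp (ap f i)"
    show "F q (cNeg p) s <-> f :. TS X (cNeg p)" unfolding TS_simps As[OF s(3,4), symmetric]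
      using k[OF s(1,2), THEN conjunct2, THEN conjunct1, rule_format, OF Form_U[OF B p(1)]] p(2)[rule_format, OF conjI[OF s(1) conjI[OF s(2) conjI[OF s(3,4)]]]] by blast
  qed
  show "?P (cAnd p p')" if p: "p :. Form" "p' :. Form" "?P p" "?P p'" for p p'
  proof (intro allI impI, elim conjE)
    fix s f assume s: "s :. U" "fun_on s omega" "fun_on f omega" "ALL i. i :. omega --> ap s i :. Rp (ap f i)"
    note c = conjI[OF s(1) conjI[OF s(2) conjI[OF s(3,4)]]]
    show "F q (cAnd p p') s <-> f :. TS X (cAnd p p')" unfolding TS_simps As[OF s(3,4), symmetric]
      using k[OF s(1,2), THEN conjunct2, THEN conjunct2, THEN conjunct1, rule_format, OF Form_U[OF B p(1)] Form_U[OF B p(2)]] p(3)[rule_format, OF c] p(4)[rule_format, OF c] by blast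
  qed
  show "?P (cEx i p)" if i: "i :. omega" and p: "p :. Form" "?P p" for i p
  proof (intro allI impI, elim conjE)
    fix s f assume s: "s :. U" "fun_on s omega" "fun_on f omega" "ALL i. i :. omega --> ap s i :. Rp (ap f i)"
    have c: "F q p (upd s i c) <-> upd f i y :. TS X p" if "c :. Rp y" for c y
      by (rule p(2)[rule_format], intro conjI) (use Base_upd[OF B s(1) nU[OF i] RU(1)[OF that]] fun_on_upd[OF s(2) i] fun_on_upd[OF s(3) i] s(4) that in auto)
    have "(EX c. c :. U & (E c q & F q p (upd s i c))) <-> (EX y. y :. X & upd f i y :. TS X p)"
    proof
      assume "EX c. c :. U & (E c q & F q p (upd s i c))"
      then obtain c where c1: "E c q" "F q p (upd s i c)" by blast
      obtain y where "y :. X" "c :. Rp y" using R1[OF q(2) c1(1)] by blast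
      then show "EX y. y :. X & upd f i y :. TS X p" using c c1(2) by blast
    next
      assume "EX y. y :. X & upd f i y :. TS X p"
      then obtain y where y: "y :. X" "upd f i y :. TS X p" by blast
      obtain z where "E z q" "z :. Rp y" using R2[OF q(2) y(1)] by blast
      then show "EX c. c :. U & (E c q & F q p (upd s i c))" using c y(2) EU by blast
    qed
    then show "F q (cEx i p) s <-> f :. TS X (cEx i p)" unfolding TS_simps(5)[OF i] As[OF s(3,4), symmetric]
      using k[OF s(1,2), THEN conjunct2, THEN conjunct2, THEN conjunct2, rule_format, OF nU[OF i] i Form_U[OF B p(1)]] by blast
  qed
qed

text \<open>The structure could have extra level codes; those representing an element of a real
  level are excluded by comparison. A code above the predecessor is at or above the successor by
  \<open>e6\<close>, and at the bottom \<open>e5\<close> puts \<open>U\<close> into every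
  level.\<close>

lemma below: assumes "Ord c" "!!b. b :. c ==> EX q. L q & q :. Rp (JJ U b)" "L q" "q :. Rp x" "x :. JJ U c"
  shows "EX b. b :. c & x = JJ U b"
proof -
  have "(ALL b. b :. c --> (EX q. L q & q :. Rp (JJ U b))) --> (ALL q x. L q & q :. Rp x & x :. JJ U c --> (EX b. b :. c & x = JJ U b))" using assms(1)
  proof (rule ord_induct)
    show "D (%e. (ALL b. b :. e 0 --> (EX q. L q & q :. Rp (JJ U b))) --> (ALL q x. L q & q :. Rp x & x :. JJ U (e 0) --> (EX b. b :. e 0 & x = JJ U b)))" by (intro Di dL)
    fix c assume c: "Ord c" "!!d. d :. c ==> (ALL b. b :. d --> (EX q. L q & q :. Rp (JJ U b))) --> (ALL q x. L q & q :. Rp x & x :. JJ U d --> (EX b. b :. d & x = JJ U b))"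
    show "(ALL b. b :. c --> (EX q. L q & q :. Rp (JJ U b))) --> (ALL q x. L q & q :. Rp x & x :. JJ U c --> (EX b. b :. c & x = JJ U b))"
    proof (intro impI allI, elim conjE)
      fix q x assume lev: "ALL b. b :. c --> (EX q. L q & q :. Rp (JJ U b))" and q: "L q" "q :. Rp x" "x :. JJ U c"
      have IH: "EX b. b :. c & x = JJ U b" if d: "d :. c" "x :. JJ U d" for d
      proof -
        have "ALL b. b :. d --> (EX q. L q & q :. Rp (JJ U b))" using lev Ord_trans[OF c(1) d(1)] by blast
        then obtain b where "b :. d" "x = JJ U b" using c(2)[OF d(1)] q(1,2) d(2) by blast
        then show ?thesis using Ord_trans[OF c(1) d(1)] by blast
      qed
      have Ux: "U :. x" using R_E[OF R_K1 q(2)] e5[OF q(1)] by blast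
      from Ord_cases[OF c(1)] show "EX b. b :. c & x = JJ U b"
      proof (elim disjE exE conjE)
        assume "c = empty"
        then have "x :. U | x = U" using q(3) by simp
        then show ?thesis using Ux mem_asym mem_not_refl by blast
      next
        assume "Limit c"
        then show ?thesis using IH q(3) mem_JJ_Limit[of c x U] by blast
      next
        fix d assume d: "d :. c" "Ord d" "c = adjoin_self d"
        obtain r where r: "L r" "r :. Rp (JJ U d)" using lev d(1) by blast
        have K: "K4 r :. Rp (JJ U c)" using R_K4(2)[OF r] unfolding d(3) JJ_Suc .
        from e4[OF q(1) r(1)] show ?thesis
        proof (elim disjE)
          assume "E q r" then show ?thesis using IH[OF d(1)] R_E[OF q(2) r(2)] by blast
        next
          assume "eq q r" then show ?thesis using R_rel[OF q(2) r(2)] d(1) by blast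
        next
          assume "E r q"
          then have "E (K4 r) q | eq (K4 r) q" by (rule e6[OF q(1) r(1)])
          then have "JJ U c :. x | JJ U c = x" using R_rel[OF K q(2)] by blast
          then show ?thesis using q(3) mem_asym[OF q(3)] mem_not_refl by blast
        qed
      qed
    qed
  qed
  then show ?thesis using assms(2-5) by blast
qed

text \<open>At a limit below \<open>l\<close> minimality of \<open>l\<close> provides a failure of
  collection. Its data are represented by induction, and \<open>PH5\<close> then supplies a level
  code. By \<open>below\<close>, a stage that is least among real levels is also least among all
  level codes of the structure.\<close>

lemma level: assumes "b :. l" shows "EX q. L q & q :. Rp (JJ U b)"
proof -
  have l: "Limit l" "Ord l" using as by (auto simp: astar_def Limit_def)
  have "b :. l --> (EX q. L q & q :. Rp (JJ U b))" using Ord_mem[OF l(2) assms]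
  proof (rule ord_induct)
    show "D (%e. e 0 :. l --> (EX q. L q & q :. Rp (JJ U (e 0))))" by (intro Di dL)
    fix b assume b: "Ord b" "!!c. c :. b ==> c :. l --> (EX q. L q & q :. Rp (JJ U c))"
    show "b :. l --> (EX q. L q & q :. Rp (JJ U b))"
    proof
      assume bl: "b :. l"
      have IH: "EX q. L q & q :. Rp (JJ U c)" if "c :. b" for c using b(2)[OF that] Ord_trans[OF l(2) bl that] by blast
      from Ord_cases[OF b(1)] show "EX q. L q & q :. Rp (JJ U b)"
      proof (elim disjE exE conjE)
        assume "b = empty" then show ?thesis using k6(1) R_K6 by auto
      next
        fix c assume c: "c :. b" "b = adjoin_self c"
        then obtain q where "L q" "q :. Rp (JJ U c)" using IH by blast
        from R_K4[OF this] show ?thesis unfolding c(2) JJ_Suc by blast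
      next
        assume Lb: "Limit b"
        have "fails U b" using as bl Lb unfolding astar_def by blast
        then obtain p n f d where w: "p :. Form" "n :. omega" "fa (JJ U b) f" "d :. JJ U b" "ALL x. x :. d --> (EX c. c :. b & Qs U c p n f x)" "~ (EX c. c :. b & (ALL x. x :. d --> Qs U c p n f x))"
          unfolding fails_def by (elim exE conjE)
        let ?P = "%c y. upd f n y :. TS (JJ U c) p"
        have el: "EX c. c :. Rp x" if x: "x :. JJ U b" for x
        proof -
          obtain c where c: "c :. b" "x :. JJ U c" using x unfolding mem_JJ_Limit[OF Lb] by blast
          obtain q where "q :. Rp (JJ U c)" using IH[OF c(1)] by blast
          from R2[OF this c(2)] show ?thesis by blast
        qed
        have fm: "fun_on f omega" "i :. omega ==> ap f i :. JJ U b" for i using w(3) unfolding fa_def maps_iff by blast+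
        obtain m where m: "m :. omega" "ALL i. i :. omega & ~ i :. m --> ap f i = empty" using w(3) unfolding fa_def by blast
        have "EX s. s :. U & fun_on s omega & (ALL i. i :. omega --> ap s i :. U & ap s i :. Rp (ap f i))"
        proof (rule fin_choice[where R="%c x. c :. Rp x", OF B _ w(3) _ R_0[OF KU(3)]])
          show "D (%e. e 0 :. Rp (e 1))" by (intro Di)
          show "K0 empty :. U" by (intro KU)
          show "EX c. c :. U & c :. Rp (ap f i)" if "i :. omega" for i using el[OF fm(2)[OF that]] RU(1) by blast
        qed
        then obtain s where s: "s :. U" "fun_on s omega" "ALL i. i :. omega --> ap s i :. Rp (ap f i)" by blast
        obtain d' where d': "d' :. Rp d" using el[OF w(4)] by blast
        have FF: "F q p (upd s n x) <-> ?P c y" if "L q" "q :. Rp (JJ U c)" "x :. Rp y" for q c x y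
          by (rule R_F[OF that(1,2) w(1), rule_format], intro conjI)
            (use Base_upd[OF B s(1) nU[OF w(2)] RU(1)[OF that(3)]] fun_on_upd[OF s(2) w(2)] fun_on_upd[OF fm(1) w(2)] s(3) that(3) in auto)
        have least: "EX c. c :. b & ?P c y & (ALL c'. c' :. c --> ~ ?P c' y)" if y: "y :. d" for y
        proof -
          obtain c0 c where c: "c0 :. b" "c :. c0 | c = c0" "?P c y" using w(5)[rule_format, OF y] unfolding Qs_def by (elim exE conjE)
          have cb: "c :. b" using c(1,2) Ord_trans[OF b(1) c(1)] by blast
          have oc: "Ord c" by (rule Ord_mem[OF b(1) cb])
          have "D (%e. ?P (e 0) y)" by (intro Di)
          from least_ord[of c "%c. ?P c y", OF oc c(3) this] obtain g where g: "Ord g" "?P g y" "ALL x. x :. g --> ~ ?P x y" by (elim exE conjE)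
          have "g :. c | g = c" using Ord_linear[OF g(1) oc] g(3) c(3) by blast
          then have "g :. b" using cb Ord_trans[OF b(1) cb] by blast
          then show ?thesis using g by blast
        qed
        have nolow: "~ F r p (upd s n x)" if c: "c :. b" "q :. Rp (JJ U c)" "ALL c'. c' :. c --> ~ ?P c' y" "x :. Rp y" "L r" "E r q" for c q r x y
        proof -
          obtain x' where x': "x' :. JJ U c" "r :. Rp x'" using R1[OF c(2,6)] by blast
          obtain c' where "c' :. c" "x' = JJ U c'" using below[OF Ord_mem[OF b(1) c(1)] IH[OF Ord_trans[OF b(1) c(1)]] c(5) x'(2,1)] by blast
          then show ?thesis using FF[OF c(5) _ c(4), of c'] x'(2) c(3) by blast
        qed
        define K where "K = K5 p n s d'"
        obtain b0 where "b0 :. b" using Lb ne_emptyD[of b] unfolding Limit_def by blast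
        then have ne: "EX y. y :. d" using w(6) by blast
        have k: "L K & (ALL z. z :. U --> (E z K <-> (EX x. x :. U & (E x d' & (EX q. q :. U & (L q & F q p (upd s n x) &
            (ALL r. r :. U --> (L r --> E r q --> ~ F r p (upd s n x))) & E z q))))))" unfolding K_def
        proof (rule phs(5)[unfolded PH5_def, rule_format, OF Form_U[OF B w(1)] nU[OF w(2)] s(1) RU(1)[OF d'] w(1,2) s(2) RU(2)[OF d']])
          show "EX x. x :. U & E x d'" using ne R2[OF d'] EU by blast
          show "dm (ap s i)" if "i :. omega" for i using s(3) that RU(2) by blast
          show "EX m. m :. U & (m :. omega & (ALL i. i :. U --> (i :. omega --> ~ i :. m --> eq (ap s i) (K0 empty))))"
          proof (intro exI[of _ m] conjI allI impI nU[OF m(1)] m(1))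
            fix i assume i: "i :. omega" "~ i :. m"
            then have "ap s i :. Rp empty" using s(3) m(2) by metis
            then show "eq (ap s i) (K0 empty)" by (rule R_EQ[OF _ R_0[OF KU(3)]])
          qed
          fix x assume x: "E x d'"
          obtain y where y: "y :. d" "x :. Rp y" using R1[OF d' x] by blast
          obtain c where c: "c :. b" "?P c y" using least[OF y(1)] by blast
          obtain q where q: "L q" "q :. Rp (JJ U c)" using IH[OF c(1)] by blast
          then show "EX q. q :. U & (L q & F q p (upd s n x))" using FF[OF q y(2)] c(2) LU by blast
        qed
        have LK: "L K" using k by blast
        have kz: "E z K <-> (EX x. x :. U & (E x d' & (EX q. q :. U & (L q & F q p (upd s n x) &
            (ALL r. r :. U --> (L r --> E r q --> ~ F r p (upd s n x))) & E z q))))" if "z :. U" for z using k that by blast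
        have Lim: "JJ U b = Lim U p n f d" by (rule Lim_fails[OF T Lb w(5,6), symmetric])
        have "K :. Rp (JJ U b)"
        proof (rule RI[OF LU[OF LK] e3[OF LK]])
          fix z assume z: "E z K"
          have zU: "z :. U" using EU[OF z] by blast
          obtain x q where x: "E x d'" and q: "L q" "F q p (upd s n x)" "ALL r. r :. U --> (L r --> E r q --> ~ F r p (upd s n x))" "E z q"
            using z unfolding kz[OF zU] by blast
          obtain y where y: "y :. d" "x :. Rp y" using R1[OF d' x] by blast
          obtain c where c: "c :. b" "?P c y" "ALL c'. c' :. c --> ~ ?P c' y" using least[OF y(1)] by blast
          \<comment> \<open>The level \<open>q\<close> offered by the structure is not known to be
            represented. Comparing it with the represented level \<open>r\<close> at the least real
            stage shows that both have the same elements.\<close>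
          obtain r where r: "L r" "r :. Rp (JJ U c)" using IH[OF c(1)] by blast
          have Fr: "F r p (upd s n x)" using FF[OF r y(2)] c(2) by blast
          have "~ E r q" using q(3) r(1) Fr LU by blast
          moreover have "~ E q r" using nolow[OF c(1) r(2) c(3) y(2) q(1)] q(2) by blast
          ultimately have "eq q r" using e4[OF q(1) r(1)] by blast
          then have "E z r" using eqD q(4) by blast
          then obtain y' where "y' :. JJ U c" "z :. Rp y'" using R1[OF r(2)] by blast
          then show "EX y. y :. JJ U b & z :. Rp y" unfolding mem_JJ_Limit[OF Lb] using c(1) by blast
        next
          fix y' assume "y' :. JJ U b"
          then obtain y c0 where y: "y :. d" and c0: "Ord c0" "?P c0 y" "ALL c. c :. c0 --> ~ ?P c y" "y' :. JJ U c0" unfolding Lim mem_Lim by (elim exE conjE)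
          obtain c where c: "c :. b" "?P c y" "ALL c'. c' :. c --> ~ ?P c' y" using least[OF y] by blast
          have "c0 = c" by (rule gJ_unique[of c0 c "%c. ?P c y", OF c0(1) Ord_mem[OF b(1) c(1)]]) (fact c0 c)+
          then have y': "y' :. JJ U c" using c0(4) by simp
          obtain x where x: "E x d'" "x :. Rp y" using R2[OF d' y] by blast
          obtain r where r: "L r" "r :. Rp (JJ U c)" using IH[OF c(1)] by blast
          obtain z where z: "E z r" "z :. Rp y'" using R2[OF r(2) y'] by blast
          have "F r p (upd s n x)" using FF[OF r x(2)] c(2) by blast
          moreover have "ALL r'. r' :. U --> (L r' --> E r' r --> ~ F r' p (upd s n x))" using nolow[OF c(1) r(2) c(3) x(2)] by blast
          ultimately have "E z K" unfolding kz[OF RU(1)[OF z(2)]] using x(1) EU[OF x(1)] r(1) LU[OF r(1)] z(1) by blast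
          then show "EX z. E z K & z :. Rp y'" using z(2) by blast
        qed
        then show ?thesis using LK by blast
      qed
    qed
  qed
  then show ?thesis using assms by blast
qed

text \<open>The trace on \<open>U\<close> of a set in the hierarchy is visible to the structure.
  Conversely, a code of an ill-founded structure need not represent anything.\<close>

lemma seen: assumes "x :. JJ U l" shows "EX c. c :. U & (ALL y. y :. U --> (E (K0 y) c <-> y :. x))"
proof -
  have l: "Limit l" using as by (simp add: astar_def)
  obtain b where b: "b :. l" "x :. JJ U b" using assms unfolding mem_JJ_Limit[OF l] by blast
  obtain q where "q :. Rp (JJ U b)" using level[OF b(1)] by blast
  from R2[OF this b(2)] obtain c where c: "c :. Rp x" by blast
  show ?thesis using RU(1)[OF c] R_E[OF R_0 c] by blast
qed

end

section \<open>There is no embedding in the hierarchy\<close>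

lemma EmbR_cong: assumes "!!x y. x :. B ==> y :. U ==> K x y = K' x y" "EmbR K B U" "B \<^bold>\<subseteq> U" shows "EmbR K' B U"
proof -
  note h = assms(2)
  have k: "x :. B ==> y :. U ==> K' x y ==> K x y" "x :. B ==> y :. U ==> K x y ==> K' x y" for x y using assms(1) by blast+
  have s: "x :. B ==> x :. U" for x by (rule subD[OF assms(3)])
  show ?thesis unfolding EmbR_def
  proof (intro conjI)
    show "ALL x. x :. B --> (EX y. y :. U & K' x y)" using EmbR1[OF h] k(2) by blast
    show "ALL x. x :. B --> (ALL y. y :. U & K' x y --> (ALL y'. y' :. U & K' x y' --> y = y'))" using EmbR2[OF h] k(1) by blast
    show "ALL x. x :. B --> (ALL y. y :. U & K' x y --> (ALL x'. x' :. B --> (ALL y'. y' :. U & K' x' y' --> (x :. x' <-> y :. y'))))" using EmbR3[OF h] k(1) by blast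
    show "ALL w. w :. B & w = omega --> (ALL n. n :. B & (n :. w | n = w) --> K' n n)" using EmbR4[OF h] k(2) s by blast
    show "ALL y. y :. U --> (EX x. x :. B & (EX z. z :. U & K' x z & y :. z))" using EmbR6[OF h] k(2) by blast
    show "ALL s. s :. B & K' s s --> (ALL p. p :. B --> (ALL q. q :. B --> (ALL r. r :. B --> (ALL z. z :. B & z = OP s p q r -->
        (ALL p'. p' :. U & K' p p' --> (ALL q'. q' :. U & K' q q' --> (ALL r'. r' :. U & K' r r' --> (ALL z'. z' :. U & K' z z' --> z' = OP s p' q' r'))))))))"
    proof (intro allI impI, elim conjE)
      fix s' p q r z p' q' r' z' assume a: "s' :. B" "K' s' s'" "p :. B" "q :. B" "r :. B" "z :. B" "z = OP s' p q r" "p' :. U" "K' p p'" "q' :. U" "K' q q'" "r' :. U" "K' r r'" "z' :. U" "K' z z'"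
      show "z' = OP s' p' q' r'"
        using EmbR5[OF h, rule_format, OF conjI[OF a(1) k(1)[OF a(1) s[OF a(1)] a(2)]] a(3,4,5) conjI[OF a(6,7)] conjI[OF a(8) k(1)[OF a(3,8,9)]] conjI[OF a(10) k(1)[OF a(4,10,11)]] conjI[OF a(12) k(1)[OF a(5,12,13)]] conjI[OF a(14) k(1)[OF a(6,14,15)]]] .
    qed
  qed
qed

lemma EmbR_graph: assumes B: "Base B" "Base U" and h: "EmbR (%x y. opair x y :. X) B U" and s: "B \<^bold>\<subseteq> U"
  shows "fun_on (inter X (prd B U)) B" "EmbR (%x y. opair x y :. inter X (prd B U)) B U"
proof -
  show "EmbR (%x y. opair x y :. inter X (prd B U)) B U" by (rule EmbR_cong[OF _ h s]) simp
  show "fun_on (inter X (prd B U)) B" unfolding fun_on_def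
  proof (intro conjI allI impI)
    fix p assume "p :. inter X (prd B U)" then show "EX x y. x :. B & p = opair x y" unfolding mem_inter mem_prd by blast
  next
    fix x assume x: "x :. B"
    obtain y where y: "y :. U" "opair x y :. X" using EmbR1[OF h, rule_format, OF x] by blast
    show "EX! y. opair x y :. inter X (prd B U)"
    proof (rule ex1I[of _ y])
      show "opair x y :. inter X (prd B U)" using x y by simp
      fix y' assume "opair x y' :. inter X (prd B U)"
      then have y': "y' :. U" "opair x y' :. X" by auto
      show "y' = y" using EmbR2[OF h, rule_format, OF x conjI[OF y'] conjI[OF y]] .
    qed
  qed
qed

text \<open>The preimages of the bounds \<open>ap g n\<close> absorb \<open>B\<close>. They are
  elements of \<open>B\<close>: by cofinality \<open>ap g n\<close> lies in some
  \<open>ap k x\<close>, and then the preimage is included in \<open>set_union x\<close>.\<close>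

lemma cofw_down: assumes B: "Base B" "Base U" and h: "EmbR (%x y. opair x y :. k) B U" and f: "fun_on k B" and c: "cofw U" shows "cofw B"
proof -
  have jU: "x :. B ==> ap k x :. U" for x
  proof -
    assume x: "x :. B"
    obtain y where "y :. U" "opair x y :. k" using EmbR1[OF h, rule_format, OF x] by blast
    then show "ap k x :. U" using fun_onD(2)[OF f x] by metis
  qed
  have jm: "x :. B ==> y :. B ==> x :. y <-> ap k x :. ap k y" for x y
    using EmbR3[OF h, rule_format, of x "ap k x" y "ap k y"] jU fun_onD(1)[OF f] by blast
  obtain g where g: "n :. omega ==> ap g n :. U" "y :. U ==> EX n. n :. omega & y \<^bold>\<subseteq> ap g n" for n y using c unfolding cofw_def by blast
  have d: "D (%e. ap k (e 0) :. ap g n)" for n by (intro Di)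
  have dl: "dt (%e. sep B (%x. ap k x :. ap g (e 0)))" by (intro Di)
  have gB: "sep B (%x. ap k x :. ap g n) :. B" if n: "n :. omega" for n
  proof -
    obtain x z where x: "x :. B" "opair x z :. k" "ap g n :. z" using EmbR6[OF h, rule_format, OF g(1)[OF n]] by (elim exE conjE)
    have "z = ap k x" using x fun_onD(2)[OF f] by blast
    then have gx: "ap g n :. ap k x" using x by simp
    have ux: "set_union x :. B" using B(1) x(1) unfolding Base_def by blast
    have "std_num 2 :. B" using Base_omega(2)[OF B(1)] by simp
    moreover have w: "opair (std_num 2) (std_num 2) :. k" using EmbR4[OF h, rule_format, OF conjI[OF Base_omega(1)[OF B(1)] refl], of "std_num 2"] Base_omega(2)[OF B(1), of "std_num 2"] by simp
    ultimately have "ap k (set_union x) = OP (std_num 2) (ap k x) (ap k x) (ap k x)"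
      using EmbR5[OF h, rule_format, of "std_num 2" x x x "set_union x" "ap k x" "ap k x" "ap k x" "ap k (set_union x)"] x(1) ux jU fun_onD(1)[OF f] by (simp add: OP_simps)
    then have e: "ap k (set_union x) = set_union (ap k x)" by (simp only: OP_simps)
    show ?thesis
    proof (rule Base_sub[OF B(1) ux], rule subI)
      fix y assume "y :. sep B (%x. ap k x :. ap g n)"
      then have y: "y :. B" "ap k y :. ap g n" unfolding mem_sep[OF d] by blast+
      have "ap k y :. ap k (set_union x)" unfolding e mem_union using y(2) gx by blast
      then show "y :. set_union x" using jm[OF y(1) ux] by blast
    qed
  qed
  show ?thesis unfolding cofw_def
  proof (rule exI[of _ "lam omega (%n. sep B (%x. ap k x :. ap g n))"], intro conjI allI impI)
    fix n :: 'a assume n: "n :. omega" show "ap (lam omega (%n. sep B (%x. ap k x :. ap g n))) n :. B" unfolding ap_lam[OF dl n] by (rule gB[OF n])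
  next
    fix y assume y: "y :. B"
    obtain n where n: "n :. omega" "ap k y \<^bold>\<subseteq> ap g n" using g(2)[OF jU[OF y]] by blast
    have "y \<^bold>\<subseteq> sep B (%x. ap k x :. ap g n)"
    proof (rule subI, unfold mem_sep[OF d], rule conjI)
      fix z assume z: "z :. y"
      show zB: "z :. B" by (rule Base_trans[OF B(1) y z])
      show "ap k z :. ap g n" using jm[OF zB y] z subD[OF n(2)] by blast
    qed
    then show "EX n. n :. omega & y \<^bold>\<subseteq> ap (lam omega (%n. sep B (%x. ap k x :. ap g n))) n" using n(1) ap_lam[OF dl n(1)] by (intro exI[of _ n]) simp
  qed
qed

text \<open>A summary of the last sections. On the side of \<open>U'\<close> the structure
  \<open>a'\<close> is known exactly: its graphs are those coded in the hierarchy. Its lift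
  \<open>a\<close> is only known to see everything in \<open>JJ U l\<close>. The properties
  \<open>Mv\<close> and \<open>Bs\<close> connect the two sides.\<close>

lemma lift: fixes X :: "'a::zf"
  assumes B: "Base U'" "Base U" "U' \<^bold>\<subseteq> U" and c: "cofw U'" and l: "astar U' l'" "astar U l" and h: "EmbR (%x y. opair x y :. X) U' U"
  shows "EX a' a k. (ALL x. x :. U' --> k x :. U & opair x (k x) :. X) & (ALL x y. x :. U' & y :. U' --> (k x :. k y <-> x :. y)) &
    (ALL c x y. c :. U' & x :. U' & y :. U' --> (Sn a' c x y <-> opair x y :. val U' c & val U' c :. JJ U' l')) &
    (ALL x. x :. JJ U l --> (EX c. c :. U & (ALL y z. y :. U & z :. U --> (Sn a c y z <-> opair y z :. x)))) &
    (ALL x. x :. U' --> ((EX w. w :. U' & (w :. x & Mv U' a' w)) <-> (EX w. w :. U & (w :. k x & Mv U a w)))) & (Bs U' a' <-> Bs U a)"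
proof -
  obtain \<chi> where ch: "opf \<chi> TYPE('a)" using ex_opf by blast
  interpret c: codes U' l' \<chi> by unfold_locales (fact B(1) l(1) ch)+
  define k where "k = inter X (prd U' U)"
  have g: "fun_on k U'" "EmbR (%x y. opair x y :. k) U' U" unfolding k_def by (rule EmbR_graph[OF B(1,2) h B(3)])+
  interpret e: embd k U' U c.AA by unfold_locales (fact B(1,2) g c c.AA(4))+
  have TT: "E0 c.AA = c.TE" "L0 c.AA = c.TL" "F0 c.AA = c.TF" by (intro ext, simp only: E0_def L0_def F0_def c.AA)+
  have ph: "PH U (E0 e.a) (L0 e.a) (F0 e.a) \<chi>" by (rule e.trPH) (unfold TT, rule c.tPH)
  have op: "opair x y :. e.a ==> y :. U" "opair x y :. U ==> x :. U & y :. U" for x y using e.a_sub opair_trans[OF e.tU(2)] by blast+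
  interpret p: cmp U l "E0 e.a" "L0 e.a" "F0 e.a" \<chi>
  proof unfold_locales
    show "Base U" "astar U l" "opf \<chi> TYPE('a)" "PH U (E0 e.a) (L0 e.a) (F0 e.a) \<chi>" by (fact B(2) l(2) ch ph)+
    show "E0 e.a c d ==> c :. U & d :. U" for c d unfolding E0_def using op by blast
    show "L0 e.a q ==> q :. U" for q unfolding L0_def using op by blast
    show "D (%x. E0 e.a (x 0) (x 1))" unfolding E0_def by (intro Di)
    show "D (%x. L0 e.a (x 0))" unfolding L0_def by (intro Di)
    show "D (%x. F0 e.a (x 0) (x 1) (x 2))" unfolding F0_def by (intro Di)
  qed
  show ?thesis
  proof (rule exI[of _ c.AA], rule exI[of _ e.a], rule exI[of _ e.j], intro conjI allI impI)
    show "x :. U' ==> e.j x :. U" for x by (rule e.jU)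
    show "x :. U' ==> opair x (e.j x) :. X" for x using e.jK unfolding k_def by simp
    show "e.j x :. e.j y <-> x :. y" if "x :. U' & y :. U'" for x y using e.j_mem that by blast
    show "Sn c.AA c x y <-> opair x y :. val U' c & val U' c :. JJ U' l'" if "c :. U' & x :. U' & y :. U'" for c x y
    proof -
      have "K0 (opair x y) :. U'" using that c.KU by blast
      then show ?thesis unfolding Sn_def TT c.TE_def val_simps using that by blast
    qed
    show "EX c. c :. U & (ALL y z. y :. U & z :. U --> (Sn e.a c y z <-> opair y z :. x))" if "x :. JJ U l" for x
      unfolding Sn_def using p.seen[OF that] Base_opair[OF B(2)] by blast
    have "e.tr (%x. EX w. w :. U' & (w :. x 0 & Mv U' c.AA w)) (%x. EX w. w :. U & (w :. x 0 & Mv U e.a w))"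
      by (rule e.tr_ex, rule e.tr_and[OF e.tr_d0 e.tr_Mv]) (intro Bi)
    note t = this
    show "(EX w. w :. U' & (w :. x & Mv U' c.AA w)) <-> (EX w. w :. U & (w :. e.j x & Mv U e.a w))" if "x :. U'" for x
      using e.tr_at[OF t, of "%_. x"] that by simp
    show "Bs U' c.AA <-> Bs U e.a" by (rule e.tr_sent[OF e.tr_Bs])
  qed
qed

lemma no_self: fixes U :: "'a::zf"
  assumes B: "Base U" and c: "cofw U" and l: "astar U l" and X: "X :. JJ U l" "EmbR (%x y. opair x y :. X) U U"
    and x: "x :. U" "opair x y :. X" "y :. U" "y \<noteq> x"
  shows False
proof -
  let ?m = "%x. EX X. X :. JJ U l & EmbR (%x y. opair x y :. X) U U & (EX y. y :. U & opair x y :. X & y \<noteq> x)"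
  have "D (%e. ?m (e 0))" unfolding EmbR_def by (intro Di)
  moreover have "?m x" using X x by blast
  ultimately obtain x0 where x0: "x0 :. U" "?m x0" "ALL y. y :. U & y :. x0 --> ~ ?m y" using foundation[of ?m x U] x(1) by blast
  obtain X0 y0 where X0: "X0 :. JJ U l" "EmbR (%x y. opair x y :. X0) U U" "y0 :. U" "opair x0 y0 :. X0" "y0 \<noteq> x0" using x0(2) by blast
  obtain a' a k where k0: "ALL x. x :. U --> k x :. U & opair x (k x) :. X0" and km0: "ALL x y. x :. U & y :. U --> (k x :. k y <-> x :. y)"
    and s': "ALL c x y. c :. U & x :. U & y :. U --> (Sn a' c x y <-> opair x y :. val U c & val U c :. JJ U l)"
    and s: "ALL x. x :. JJ U l --> (EX c. c :. U & (ALL y z. y :. U & z :. U --> (Sn a c y z <-> opair y z :. x)))"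
    and tr: "ALL x. x :. U --> ((EX w. w :. U & (w :. x & Mv U a' w)) <-> (EX w. w :. U & (w :. k x & Mv U a w)))"
    using lift[OF B B sub_refl c l l X0(2)] by (elim exE conjE)
  note k = k0[rule_format] and km = km0[rule_format, OF conjI]
  \<comment> \<open>In the exact structure \<open>a'\<close> coded embeddings are real; in the
    lifted structure \<open>a\<close> only the converse \<open>Mva\<close> is available. Each
    direction is used on its own side of the transfer.\<close>
  have Mv': "?m x" if x: "x :. U" "Mv U a' x" for x
  proof -
    obtain c y where c: "c :. U" "EmbR (Sn a' c) U U" "y :. U" "Sn a' c x y" "y \<noteq> x" using x(2) unfolding Mv_def by blast
    have v: "val U c :. JJ U l" "opair x y :. val U c" using s' c x by blast+
    have "EmbR (%x y. opair x y :. val U c) U U" by (rule EmbR_cong[OF _ c(2) sub_refl]) (use s' c(1) v(1) in blast)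
    then show "?m x" using v c(3,5) by blast
  qed
  have Mva: "Mv U a x" if x: "x :. U" "?m x" for x
  proof -
    obtain X y where X: "X :. JJ U l" "EmbR (%x y. opair x y :. X) U U" "y :. U" "opair x y :. X" "y \<noteq> x" using x(2) by blast
    obtain c where c: "c :. U" "ALL y z. y :. U & z :. U --> (Sn a c y z <-> opair y z :. X)" using s X(1) by blast
    have "EmbR (Sn a c) U U" by (rule EmbR_cong[OF _ X(2) sub_refl]) (use c(2) in blast)
    then show ?thesis unfolding Mv_def using c X(3,4,5) x(1) by blast
  qed
  have kx: "k x0 = y0" using EmbR2[OF X0(2), rule_format, OF x0(1), of "k x0" y0] k[OF x0(1)] X0(3,4) by blast
  have fixd: "k z = z" if z: "z :. U" "~ ?m z" for z
  proof (rule ccontr)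
    assume "k z \<noteq> z" then show False using z X0(1,2) k[OF z(1)] by blast
  qed
  have "k x0 = x0"
  proof (rule set_eqI, rule iffI)
    fix z assume z: "z :. x0"
    have zU: "z :. U" by (rule Base_trans[OF B x0(1) z])
    have "k z = z" using fixd[OF zU] x0(3) zU z by blast
    then show "z :. k x0" using km[OF zU x0(1)] z by simp
  next
    fix z assume z: "z :. k x0"
    have zU: "z :. U" using Base_trans[OF B _ z] k[OF x0(1)] by blast
    \<comment> \<open>Minimality of \<open>x0\<close> says nothing directly about elements of
      \<open>k x0\<close>. A moved one would be a witness for \<open>Mv U a\<close>, and
      elementarity would put a moved set into \<open>x0\<close>.\<close>
    have "k z = z"
    proof (rule fixd[OF zU], rule notI)
      assume mz: "?m z"
      have "EX w. w :. U & (w :. k x0 & Mv U a w)" using Mva[OF zU mz] z zU by blast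
      then obtain w where "w :. U" "w :. x0" "Mv U a' w" using tr x0(1) by blast
      then show False using x0(3) Mv' by blast
    qed
    then show "z :. x0" using km[OF zU x0(1)] z by simp
  qed
  then show False using kx X0(5) by blast
qed

lemma D_Emb: "dt t ==> dt u ==> dt v ==> D (%e. EmbR (%x y. opair x y :. t e) (u e) (v e))"
  by (rule D_app3[of "%X B U. EmbR (%x y. opair x y :. X) B U"], unfold EmbR_def, (intro Di)[1])
lemma D_Base: "dt t ==> D (%e. Base (t e))" by (rule D_app1[of Base], unfold Base_def, (intro Di)[1])
lemma D_cofw: "dt t ==> D (%e. cofw (t e))" by (rule D_app1[of cofw], unfold cofw_def, (intro Di)[1])
lemma D_astar: "dt t ==> dt u ==> D (%e. astar (t e) (u e))" by (rule D_app2[of astar], unfold astar_def, (intro Di)[1])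

lemma no_down: fixes U :: "'a::zf"
  assumes "Base U" "U' :. U" "Base U'" "cofw U'" "astar U l" "X :. JJ U l" "EmbR (%x y. opair x y :. X) U' U"
  shows False
proof -
  let ?Q = "%U. ~ (EX U' X l. Base U & U' :. U & Base U' & cofw U' & astar U l & X :. JJ U l & EmbR (%x y. opair x y :. X) U' U)"
  have "?Q U"
  proof (rule mem_induct[where P="?Q"])
    show "D (%e. ?Q (e 0))" by (intro Di D_Base D_cofw D_astar D_Emb)
    fix U assume IH: "!!V. V :. U ==> ?Q V"
    show "?Q U"
    proof (rule notI, elim exE conjE)
      fix U' X l assume B: "Base U" "U' :. U" "Base U'" "cofw U'" and l: "astar U l" and X: "X :. JJ U l" "EmbR (%x y. opair x y :. X) U' U"
      have sub: "U' \<^bold>\<subseteq> U" by (rule subI) (rule Base_trans[OF B(1,2)])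
      obtain l' where l': "astar U' l'" using astar_ex[OF B(3)] by blast
      obtain a' a k where s': "ALL c x y. c :. U' & x :. U' & y :. U' --> (Sn a' c x y <-> opair x y :. val U' c & val U' c :. JJ U' l')"
        and s: "ALL x. x :. JJ U l --> (EX c. c :. U & (ALL y z. y :. U & z :. U --> (Sn a c y z <-> opair y z :. x)))" and bs: "Bs U' a' <-> Bs U a"
        using lift[OF B(3,1) sub B(4) l' l X(2)] by (elim exE conjE)
      obtain c where c: "c :. U" "ALL y z. y :. U & z :. U --> (Sn a c y z <-> opair y z :. X)" using s X(1) by blast
      have "EmbR (Sn a c) U' U" by (rule EmbR_cong[OF _ X(2) sub]) (use c(2) subD[OF sub] in blast)
      then have "Bs U a" unfolding Bs_def using B(2) c(1) Bu_Base[OF B(1,2)] B(3) by blast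
      then obtain u d where u: "u :. U'" "Bu U' u" "d :. U'" "EmbR (Sn a' d) u U'" using bs unfolding Bs_def by blast
      have Bu: "Base u" using Bu_Base[OF B(3) u(1)] u(2) by blast
      have us: "u \<^bold>\<subseteq> U'" by (rule subI) (rule Base_trans[OF B(3) u(1)])
      \<comment> \<open>One pair seen by \<open>Sn a' d\<close> suffices to conclude that
        \<open>d\<close> codes an element of the hierarchy over \<open>U'\<close>.\<close>
      obtain y where "y :. U'" "Sn a' d omega y" using EmbR1[OF u(4), rule_format, OF Base_omega(1)[OF Bu]] by blast
      then have v: "val U' d :. JJ U' l'" using s' u(3) Base_omega(1)[OF B(3)] by blast
      have e: "EmbR (%x y. opair x y :. val U' d) u U'" by (rule EmbR_cong[OF _ u(4) us]) (use s' u(3) v subD[OF us] in blast)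
      note g = EmbR_graph[OF Bu B(3) e us]
      have "cofw u" by (rule cofw_down[OF Bu B(3) g(2,1) B(4)])
      then show False using IH[OF B(2)] B(3) u(1) Bu l' v e by blast
    qed
  qed
  then show False using assms by blast
qed

section \<open>Definable subsets and admissibility\<close>

lemma rf_upd: assumes "rf n s" "rf n t" "rf n u" shows "rf n (%xs. upd (s xs) (t xs) (u xs))"
proof -
  have "d0 (%e. ~ (EX u. u :. e 0 & (EX y. y :. u & e 0 = opair (e 2) y)))" by (intro Bi)
  from rf_sep3[of "%z t u. ~ (EX u. u :. z & (EX y. y :. u & z = opair t y))", OF this assms(1,2,2)]
  show ?thesis unfolding upd_sep by (intro rf_un rf_upair rf_opair assms)
qed
lemma rf_ups: "rf 3 (%xs::'a::zf list. big_union (xs ! 0) (%a. img (xs ! 1) (%b. upd a (xs ! 2) b)))"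
proof -
  have 1: "rf 5 (%zs::'a list. upd (zs ! 1) (zs ! 4) (zs ! 0))" by (intro rf_upd rf_var) simp_all
  have 2: "rf 4 (%ys::'a list. img (ys ! 2) (%b. upd ((b # ys) ! 1) ((b # ys) ! 4) ((b # ys) ! 0)))" by (rule rf_img'[OF _ rf_var 1]) simp_all
  have 3: "rf 3 (%xs::'a list. big_union (xs ! 0) (%a. (%ys. img (ys ! 2) (%b. upd ((b # ys) ! 1) ((b # ys) ! 4) ((b # ys) ! 0))) (a # xs)))"
    by (rule rf_big_union'[OF _ rf_var 2]) simp_all
  then show ?thesis by simp
qed
lemma rf_imgu: "rf 3 (%xs::'a::zf list. img (xs ! 0) (%b. upd (xs ! 1) (xs ! 2) b))"
proof -
  have 1: "rf 4 (%zs::'a list. upd (zs ! 2) (zs ! 3) (zs ! 0))" by (intro rf_upd rf_var) simp_all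
  have "rf 3 (%ys::'a list. img (ys ! 0) (%b. upd ((b # ys) ! 2) ((b # ys) ! 3) ((b # ys) ! 0)))" by (rule rf_img'[OF _ rf_var 1]) simp_all
  then show ?thesis by simp
qed

text \<open>Formulas of the model may have nonstandard length, so the induction takes place inside
  the model, each step using one rudimentary function under which \<open>nx X\<close> is closed.
  Elements \<open>a\<close> of \<open>w\<close> stand for the assignments
  \<open>tot a\<close>.\<close>

lemma def_sets: assumes X: "good X" and p: "p :. Form" shows "ALL w. w :. nx X --> sep w (%a. tot a :. TS X p) :. nx X" (is "?P p")
  using p
proof (rule Form_induct)
  let ?N = "nx X"
  note rc = rud_closed_rf[OF rud_closed_nx[OF X]]
  have XN: "X :. ?N" "omega :. ?N" using self_nx sub_nx X by (auto simp: good_def)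
  have nN: "n :. omega ==> n :. ?N" for n using transD[OF trans_nx XN(2)] X by (auto simp: good_def)
  have ms: "a :. sep w (%a. tot a :. TS X p) <-> a :. w & tot a :. TS X p" for a w p by (rule mem_sep) (intro Di)
  define S where "S w = sep w (%z. ALL k. k :. omega --> ap z k :. X)" for w
  have mS: "a :. S w <-> a :. w & maps (tot a) omega X" for a w unfolding S_def maps_tot by (rule mem_sep) (intro Di)
  have SN: "S w :. ?N" if "w :. ?N" for w
  proof -
    have "d0 (%e. ALL k. k :. e 2 --> ap (e 0) k :. e 3)" by (intro Bi)
    from rf_sep3[of "%z t u. ALL k. k :. t --> ap z k :. u" 3 "%xs. xs ! 0" "%xs. xs ! 1" "%xs. xs ! 2", OF this]
    have "rf 3 (%xs. sep (xs ! 0) (%z. ALL k. k :. xs ! 1 --> ap z k :. xs ! 2))" by (simp add: rf_var)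
    from rc[OF this, of "[w, omega, X]"] show ?thesis unfolding S_def using that XN by auto
  qed
  show "D (%e. ?P (e 0))" by (intro Di)
  show "?P (cMem i k)" if ik: "i :. omega" "k :. omega" for i k
  proof (intro allI impI)
    fix w assume w: "w :. ?N"
    have "rf 3 (%xs::'a list. msel (xs ! 0) (xs ! 1) (xs ! 2))" by (intro rf_msel rf_var) simp_all
    from rc[OF this, of "[S w, i, k]"] have "msel (S w) i k :. ?N" using SN[OF w] nN ik by auto
    moreover have "sep w (%a. tot a :. TS X (cMem i k)) = msel (S w) i k"
      by (rule set_eqI, unfold ms mem_msel mS, unfold TS_simps(1)[OF ik]) (use ik in auto)
    ultimately show "sep w (%a. tot a :. TS X (cMem i k)) :. ?N" by simp
  qed
  show "?P (cEq i k)" if ik: "i :. omega" "k :. omega" for i k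
  proof (intro allI impI)
    fix w assume w: "w :. ?N"
    have "rf 3 (%xs::'a list. esel (xs ! 0) (xs ! 1) (xs ! 2))" by (intro rf_esel rf_var) simp_all
    from rc[OF this, of "[S w, i, k]"] have "esel (S w) i k :. ?N" using SN[OF w] nN ik by auto
    moreover have "sep w (%a. tot a :. TS X (cEq i k)) = esel (S w) i k"
      by (rule set_eqI, unfold ms mem_esel mS, unfold TS_simps(2)[OF ik]) (use ik in auto)
    ultimately show "sep w (%a. tot a :. TS X (cEq i k)) :. ?N" by simp
  qed
  show "?P (cNeg p)" if "?P p" for p
  proof (intro allI impI)
    fix w assume w: "w :. ?N"
    have "rf 2 (%xs::'a list. diff (xs ! 0) (xs ! 1))" by (intro rf_diff rf_var) simp_all
    from rc[OF this, of "[S w, sep w (%a. tot a :. TS X p)]"] have "diff (S w) (sep w (%a. tot a :. TS X p)) :. ?N" using SN[OF w] that w by auto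
    moreover have "sep w (%a. tot a :. TS X (cNeg p)) = diff (S w) (sep w (%a. tot a :. TS X p))"
      by (rule set_eqI, unfold ms mem_diff mS, unfold TS_simps) blast
    ultimately show "sep w (%a. tot a :. TS X (cNeg p)) :. ?N" by simp
  qed
  show "?P (cAnd p q)" if "?P p" "?P q" for p q
  proof (intro allI impI)
    fix w assume w: "w :. ?N"
    have "rf 2 (%xs::'a list. inter (xs ! 0) (xs ! 1))" by (intro rf_inter rf_var) simp_all
    from rc[OF this, of "[sep w (%a. tot a :. TS X p), sep w (%a. tot a :. TS X q)]"]
    have "inter (sep w (%a. tot a :. TS X p)) (sep w (%a. tot a :. TS X q)) :. ?N" using that w by auto
    moreover have "sep w (%a. tot a :. TS X (cAnd p q)) = inter (sep w (%a. tot a :. TS X p)) (sep w (%a. tot a :. TS X q))"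
      by (rule set_eqI, unfold ms mem_inter, unfold TS_simps) (use TS_maps in blast)
    ultimately show "sep w (%a. tot a :. TS X (cAnd p q)) :. ?N" by simp
  qed
  show "?P (cEx i p)" if i: "i :. omega" and p: "?P p" for i p
  proof (intro allI impI)
    fix w assume w: "w :. ?N"
    \<comment> \<open>All changes of members of \<open>w\<close> at place \<open>i\<close> by
      elements of \<open>X\<close>. The induction hypothesis for \<open>w'\<close> evaluates the
      body, and a member of \<open>w\<close> satisfies the quantified formula if one of its changes
      is in \<open>T\<close>.\<close>
    define w' where "w' = big_union w (%a. img X (%b. upd a i b))"
    have mw: "c :. w' <-> (EX a. a :. w & (EX b. b :. X & c = upd a i b))" for c
    proof -
      have d1: "dt (%e. upd a i (e 0))" for a by (intro Di)
      have d2: "dt (%e. img X (%b. upd (e 0) i b))" by (intro Di)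
      show ?thesis unfolding w'_def mem_big_union[OF d2] mem_img[OF d1] ..
    qed
    have w'N: "w' :. ?N" unfolding w'_def using rc[OF rf_ups, of "[w, X, i]"] w XN nN[OF i] by auto
    define T where "T = sep w' (%a. tot a :. TS X p)"
    have TN: "T :. ?N" unfolding T_def using p w'N by blast
    have d: "D (%e. EX c. c :. T & c = upd (e 0) i (ap c i))" by (intro Di)
    have "d0 (%e. EX c. c :. e 3 & c = upd (e 0) (e 2) (ap c (e 2)))" by (intro Bi)
    from rf_sep3[of "%z t u. EX c. c :. u & c = upd z t (ap c t)" 3 "%xs. xs ! 0" "%xs. xs ! 1" "%xs. xs ! 2", OF this]
    have "rf 3 (%xs. sep (xs ! 0) (%z. EX c. c :. xs ! 2 & c = upd z (xs ! 1) (ap c (xs ! 1))))" by (simp add: rf_var)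
    from rc[OF this, of "[S w, i, T]"] have "sep (S w) (%z. EX c. c :. T & c = upd z i (ap c i)) :. ?N" using SN[OF w] nN[OF i] TN by auto
    moreover have "sep w (%a. tot a :. TS X (cEx i p)) = sep (S w) (%z. EX c. c :. T & c = upd z i (ap c i))"
    proof (rule set_eqI, unfold ms mem_sep[OF d] mS, unfold TS_simps(5)[OF i])
      fix a
      have "(EX b. b :. X & upd (tot a) i b :. TS X p) <-> (EX c. c :. T & c = upd a i (ap c i))" if aw: "a :. w"
      proof
        assume "EX b. b :. X & upd (tot a) i b :. TS X p"
        then obtain b where b: "b :. X" "upd (tot a) i b :. TS X p" by blast
        have "upd a i b :. T" unfolding T_def ms mw using aw b unfolding upd_tot[OF i] by blast
        then show "EX c. c :. T & c = upd a i (ap c i)" by (intro exI[of _ "upd a i b"]) simp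
      next
        assume "EX c. c :. T & c = upd a i (ap c i)"
        then obtain c where c: "c :. T" "c = upd a i (ap c i)" by blast
        have tc: "tot c :. TS X p" using c(1) unfolding T_def ms by blast
        have "ap c i :. X" using TS_maps[OF tc] i unfolding maps_tot by blast
        then show "EX b. b :. X & upd (tot a) i b :. TS X p" using tc c(2) unfolding upd_tot[OF i] by metis
      qed
      then show "(a :. w & maps (tot a) omega X & (EX b. b :. X & upd (tot a) i b :. TS X p)) <-> ((a :. w & maps (tot a) omega X) & (EX c. c :. T & c = upd a i (ap c i)))" by blast
    qed
    ultimately show "sep w (%a. tot a :. TS X (cEx i p)) :. ?N" by simp
  qed
qed

lemma fa_code: assumes X: "good X" and f: "fa X f" shows "EX a. a :. nx X & tot a = f"
proof -
  note rc = rud_closed_rf[OF rud_closed_nx[OF X]]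
  obtain m where m: "m :. omega" "ALL i. i :. omega & ~ i :. m --> ap f i = empty" and fm: "maps f omega X" using f unfolding fa_def by blast
  let ?P = "%m. EX a. a :. nx X & (ALL i. i :. omega --> (i :. m --> ap a i = ap f i) & (~ i :. m --> ap a i = empty))"
  have oN: "n :. omega ==> n :. nx X" for n using transD[of X] sub_nx X unfolding good_def by blast
  have "?P m" using m(1)
  proof (rule omega_induct)
    show "D (%e. ?P (e 0))" by (intro Di)
    have "ap empty i = (empty :: 'a)" for i by (rule ap_none) simp
    then show "?P empty" using oN[OF empty_omega] by (intro exI[of _ empty]) simp
    fix k assume k: "k :. omega" "?P k"
    then obtain a where a: "a :. nx X" "ALL i. i :. omega --> (i :. k --> ap a i = ap f i) & (~ i :. k --> ap a i = empty)" by blast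
    have "rf 3 (%xs::'a list. upd (xs ! 0) (xs ! 1) (xs ! 2))" by (intro rf_upd rf_var) simp_all
    from rc[OF this, of "[a, k, ap f k]"] have "upd a k (ap f k) :. nx X" using a(1) oN[OF k(1)] sub_nx fm k(1) unfolding maps_iff by auto
    then show "?P (adjoin_self k)" using a(2) by (intro exI[of _ "upd a k (ap f k)"]) auto
  qed
  then obtain a where a: "a :. nx X" "ALL i. i :. omega --> (i :. m --> ap a i = ap f i) & (~ i :. m --> ap a i = empty)" by blast
  have "tot a = f" by (rule fun_on_ext[of _ omega]) (use fm a(2) m(2) in \<open>auto simp: maps_iff\<close>)
  then show ?thesis using a(1) by blast
qed

text \<open>The elements of \<open>d\<close> are inserted at place \<open>n\<close> of an element
  coding \<open>f\<close>; the truth set is cut out by \<open>def_sets\<close>, and the values at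
  \<open>n\<close> are read off.\<close>

lemma def_sub: assumes X: "good X" and p: "p :. Form" and f: "fa X f" and n: "n :. omega" and d: "d :. nx X"
  shows "sep d (%x. upd f n x :. TS X p) :. nx X"
proof -
  note rc = rud_closed_rf[OF rud_closed_nx[OF X]]
  obtain a where a: "a :. nx X" "tot a = f" using fa_code[OF X f] by blast
  have nN: "n :. nx X" using transD[of X] sub_nx X n unfolding good_def by blast
  define w where "w = img d (%x. upd a n x)"
  have du: "dt (%e. upd a n (e 0))" by (intro Di)
  have wN: "w :. nx X" unfolding w_def using rc[OF rf_imgu, of "[d, a, n]"] a(1) nN d by auto
  define T where "T = sep w (%a. tot a :. TS X p)"
  have TN: "T :. nx X" unfolding T_def using def_sets[OF X p] wN by blast
  have mT: "c :. T <-> c :. w & tot c :. TS X p" for c unfolding T_def by (rule mem_sep) (intro Di)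
  have "rf 2 (%xs::'a list. vals (xs ! 0) (xs ! 1))" by (intro rf_vals rf_var) simp_all
  from rc[OF this, of "[T, n]"] have "vals T n :. nx X" using TN nN by auto
  moreover have "sep d (%x. upd f n x :. TS X p) = vals T n"
  proof (rule set_eqI)
    fix x
    have D: "D (%e. upd f n (e 0) :. TS X p)" by (intro Di)
    have 1: "opair n x :. upd a n y <-> x = y" for y unfolding mem_upd by auto
    have "x :. vals T n <-> (EX y. y :. d & tot (upd a n y) :. TS X p & opair n x :. upd a n y)" unfolding mem_vals mT w_def mem_img[OF du] by blast
    also have "... <-> x :. d & upd f n x :. TS X p" unfolding 1 upd_tot[OF n, symmetric] a(2) by blast
    finally show "x :. sep d (%x. upd f n x :. TS X p) <-> x :. vals T n" unfolding mem_sep[OF D] by blast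
  qed
  ultimately show ?thesis by simp
qed

text \<open>Parameters in \<open>Sat\<close> are arbitrary functions on \<open>omega\<close>. Beyond
  the support of a formula they may be replaced by empty, and the result is coded in the
  hierarchy.\<close>

lemma trunc0: assumes m: "m :. omega" and s: "maps s omega A" "empty :. A" shows "EX f. fa A f & (ALL k. k :. m --> ap s k = ap f k)"
proof -
  have d: "dt (%e. if e 0 :. m then ap s (e 0) else empty)" by (intro Di)
  let ?f = "lam omega (%i. if i :. m then ap s i else empty)"
  have a: "i :. omega ==> ap ?f i = (if i :. m then ap s i else empty)" for i by (rule ap_lam[OF d])
  have "maps ?f omega A" unfolding maps_iff using fun_on_lam[OF d] a s unfolding maps_iff by simp
  then have "fa A ?f" unfolding fa_def using m a by auto
  moreover have "k :. m ==> ap s k = ap ?f k" for k using a[of k] transD[OF trans_omega m] by simp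
  ultimately show ?thesis by blast
qed
lemma trunc: assumes "p :. Form" "maps s omega A" "empty :. A"
  shows "EX f m. fa A f & m :. omega & supp p m & (ALL k. k :. m --> ap s k = ap f k)"
  using supp_ex[OF assms(1)] trunc0[OF _ assms(2,3)] by blast
lemma supp_upd: assumes "supp p m" "ALL k. k :. m --> ap s k = ap f k" "maps s omega A" "maps f omega A" "n :. omega" "x :. A"
  shows "upd s n x :. TS A p <-> upd f n x :. TS A p"
  by (rule assms(1)[unfolded supp_def, rule_format]) (use maps_upd[OF assms(3,5,6)] maps_upd[OF assms(4,5,6)] assms(2) in auto)

section \<open>Admissibility of the level without failures, and definable graphs\<close>

context codes
begin

lemma lmax: assumes "b :. l" "c :. l" shows "EX d. d :. l & (b :. d | b = d) & (c :. d | c = d)"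
  using Ord_linear[OF lO[OF assms(1)] lO[OF assms(2)]] assms by blast
lemma JJle: "c :. l ==> b :. c | b = c ==> x :. JJ U b ==> x :. JJ U c" using JJ_sub[OF T lO] by blast
lemma JJsubM: "b :. l ==> JJ U b \<^bold>\<subseteq> M" by (rule subI) (unfold memM, blast)
lemma JJtr: "b :. l ==> transitive (JJ U b)" using good_JJ[OF T lO] unfolding good_def by blast
lemma eJ: "b :. l ==> n :. omega ==> n :. JJ U b" using good_trans[OF good_JJ[OF T lO]] good_JJ[OF T lO] unfolding good_def by blast

text \<open>An internal induction on the support collects the values of \<open>f\<close> in one
  level; every later level then serves as well.\<close>

lemma fa_bound: assumes "fa M f" "d :. M" shows "EX b. b :. l & d :. JJ U b & (ALL c. c :. l & (b :. c | b = c) --> fa (JJ U c) f)"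
proof -
  obtain m where m: "m :. omega" "ALL i. i :. omega & ~ i :. m --> ap f i = empty" and fm: "maps f omega M" using assms(1) unfolding fa_def by blast
  have "EX b. b :. l & d :. JJ U b & (ALL i. i :. m --> i :. omega --> ap f i :. JJ U b)" using m(1)
  proof (rule omega_induct)
    show "D (%e. EX b. b :. l & d :. JJ U b & (ALL i. i :. e 0 --> i :. omega --> ap f i :. JJ U b))" by (intro Di)
    show "EX b. b :. l & d :. JJ U b & (ALL i. i :. empty --> i :. omega --> ap f i :. JJ U b)" using assms(2) unfolding memM by simp
    fix k assume k: "k :. omega" "EX b. b :. l & d :. JJ U b & (ALL i. i :. k --> i :. omega --> ap f i :. JJ U b)"
    then obtain b where b: "b :. l" "d :. JJ U b" "ALL i. i :. k --> i :. omega --> ap f i :. JJ U b" by blast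
    have "ap f k :. M" using fm k(1) unfolding maps_iff by blast
    then obtain c where c: "c :. l" "ap f k :. JJ U c" unfolding memM by blast
    obtain g where g: "g :. l" "b :. g | b = g" "c :. g | c = g" using lmax[OF b(1) c(1)] by blast
    show "EX b. b :. l & d :. JJ U b & (ALL i. i :. adjoin_self k --> i :. omega --> ap f i :. JJ U b)"
      by (rule exI[of _ g], unfold mem_adj) (use g(1) JJle[OF g(1,2)] JJle[OF g(1,3)] b c in blast)
  qed
  then obtain b where b: "b :. l" "d :. JJ U b" "ALL i. i :. m --> i :. omega --> ap f i :. JJ U b" by blast
  have "fa (JJ U c) f" if c: "c :. l" "b :. c | b = c" for c
  proof -
    have "ap f i :. JJ U c" if i: "i :. omega" for i
    proof (cases "i :. m")
      case True then show ?thesis using b(3) i JJle[OF c] by blast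
    next
      case False then show ?thesis using m(2) i eJ[OF c(1) empty_omega] by simp
    qed
    then show ?thesis using fm m unfolding fa_def maps_iff by blast
  qed
  then show ?thesis using b(1,2) by blast
qed

lemma fa_upd: assumes "fa A f" "n :. omega" "x :. A" shows "fa A (upd f n x)"
proof -
  obtain m where m: "m :. omega" "ALL i. i :. omega & ~ i :. m --> ap f i = empty" and fm: "maps f omega A" using assms(1) unfolding fa_def by blast
  obtain g where g: "g :. omega" "m :. g | m = g" "n :. g | n = g" using omega_dir[OF m(1) assms(2)] by blast
  have "ap (upd f n x) i = empty" if i: "i :. omega & ~ i :. adjoin_self g" for i
  proof -
    have "i \<noteq> n" "~ i :. m" using i g(2,3) transD[OF trans_nat[OF g(1)]] by auto
    then show ?thesis using m(2) i by simp
  qed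
  then show ?thesis unfolding fa_def using maps_upd[OF fm assms(2,3)] adj_omega[OF g(1)] by blast
qed

text \<open>Truth in \<open>M\<close> is inherited by all late levels. This links truth in
  \<open>M\<close> to the collection principle, which speaks of truth in levels; it holds for Sigma1
  formulas and for negations of Pi1 formulas.\<close>

definition local where
  "local p <-> (ALL s. fa M s & s :. TS M p --> (EX b. b :. l & (ALL c. c :. l & (b :. c | b = c) --> s :. TS (JJ U c) p)))"
lemma D_local: "dt t ==> D (%e. local (t e))" by (rule D_app1[of local], unfold local_def, (intro Di)[1])

lemma local0: assumes "p :. Sigma0" shows "local p" unfolding local_def
proof (intro allI impI, elim conjE)
  fix s assume s: "fa M s" "s :. TS M p"
  obtain b where b: "b :. l" "ALL c. c :. l & (b :. c | b = c) --> fa (JJ U c) s" using fa_bound[OF s(1) UM(1)] by blast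
  have "s :. TS (JJ U c) p" if c: "c :. l" "b :. c | b = c" for c
  proof -
    have "maps s omega (JJ U c)" using b(2) c unfolding fa_def by blast
    then show ?thesis using Sigma0_abs[OF assms JJtr[OF c(1)] JJsubM[OF c(1)]] s(2) by blast
  qed
  then show "EX b. b :. l & (ALL c. c :. l & (b :. c | b = c) --> s :. TS (JJ U c) p)" using b(1) by blast
qed
lemma local_ex: assumes i: "i :. omega" and p: "local p" and s: "fa M s" and a: "a :. M" "upd s i a :. TS M p"
  shows "EX b. b :. l & (ALL c. c :. l & (b :. c | b = c) --> maps s omega (JJ U c) & a :. JJ U c & upd s i a :. TS (JJ U c) p)"
proof -
  obtain b where b: "b :. l" "a :. JJ U b" "ALL c. c :. l & (b :. c | b = c) --> fa (JJ U c) s" using fa_bound[OF s a(1)] by blast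
  obtain b' where b': "b' :. l" "ALL c. c :. l & (b' :. c | b' = c) --> upd s i a :. TS (JJ U c) p" using p fa_upd[OF s i a(1)] a(2) unfolding local_def by blast
  obtain g where g: "g :. l" "b :. g | b = g" "b' :. g | b' = g" using lmax[OF b(1) b'(1)] by blast
  have "maps s omega (JJ U c) & a :. JJ U c & upd s i a :. TS (JJ U c) p" if c: "c :. l" "g :. c | g = c" for c
  proof -
    have "b :. c | b = c" "b' :. c | b' = c" using g c Ord_trans[OF lO[OF c(1)]] by blast+
    then show ?thesis using b b' c(1) JJle[OF c(1), of b] unfolding fa_def by blast
  qed
  then show ?thesis using g(1) by blast
qed
lemma local1: assumes "p :. Sigma1" shows "local p"
proof -
  have "p :. Form & local p" using assms
  proof (rule Sigma1_induct)
    show "D (%e. local (e 0))" by (intro D_local Di)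
    show "p :. Sigma0 ==> local p" for p by (rule local0)
    fix i p :: 'a assume i: "i :. omega" and p: "local p"
    show "local (cEx i p)" unfolding local_def
    proof (intro allI impI, elim conjE)
      fix s assume s: "fa M s" "s :. TS M (cEx i p)"
      obtain a where a: "a :. M" "upd s i a :. TS M p" using s(2) unfolding TS_simps(5)[OF i] by blast
      from local_ex[OF i p s(1) a] show "EX b. b :. l & (ALL c. c :. l & (b :. c | b = c) --> s :. TS (JJ U c) (cEx i p))" unfolding TS_simps(5)[OF i] by blast
    qed
  qed
  then show ?thesis ..
qed
lemma local_Pi1: assumes "p :. Pi1" shows "local (cNeg p)"
proof -
  have "p :. Form & local (cNeg p)" using assms
  proof (rule Pi1_induct)
    show "D (%e. local (cNeg (e 0)))" by (intro D_local Di)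
    show "p :. Sigma0 ==> local (cNeg p)" for p by (intro local0 Sigma0_intros)
    fix i p :: 'a assume i: "i :. omega" and p: "local (cNeg p)"
    have n: "s :. TS A (cNeg (cAll i p)) <-> maps s omega A & (EX a. a :. A & upd s i a :. TS A (cNeg p))" for s A
      unfolding cAll_def TS_simps(3)[of _ _ "cNeg (cEx i (cNeg p))"] TS_simps(3)[of _ _ "cEx i (cNeg p)"] TS_simps(5)[OF i] by blast
    show "local (cNeg (cAll i p))" unfolding local_def
    proof (intro allI impI, elim conjE)
      fix s assume s: "fa M s" "s :. TS M (cNeg (cAll i p))"
      obtain a where a: "a :. M" "upd s i a :. TS M (cNeg p)" using s(2) unfolding n by blast
      from local_ex[OF i p s(1) a] show "EX b. b :. l & (ALL c. c :. l & (b :. c | b = c) --> s :. TS (JJ U c) (cNeg (cAll i p)))" unfolding n by blast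
    qed
  qed
  then show ?thesis ..
qed

lemma coll: assumes p: "p :. Form" "local p" and f: "fa M f" and n: "n :. omega" and d: "d :. M" "!!x. x :. d ==> upd f n x :. TS M p"
  shows "EX b. b :. l & (ALL x. x :. d --> Qs U b p n f x)"
proof -
  have "ALL x. x :. d --> (EX b. b :. l & Qs U b p n f x)"
  proof (intro allI impI)
    fix x assume x: "x :. d"
    have "fa M (upd f n x)" by (rule fa_upd[OF f n Mt[OF d(1) x]])
    then obtain b where b: "b :. l" "ALL c. c :. l & (b :. c | b = c) --> upd f n x :. TS (JJ U c) p" using p(2) d(2)[OF x] unfolding local_def by blast
    then show "EX b. b :. l & Qs U b p n f x" unfolding Qs_def by blast
  qed
  moreover have "~ fails U l" using as unfolding astar_def by blast
  ultimately show ?thesis unfolding fails_def using p(1) n f d(1) by blast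
qed

lemma eM: "n :. omega ==> n :. M" using UM(2)[OF nU] .
lemma M1: "x :. M ==> y :. M ==> upair x y :. M"
proof -
  assume xy: "x :. M" "y :. M"
  have "rf 2 (%xs::'a list. upair (xs ! 0) (xs ! 1))" by (intro rf_upair rf_var) simp_all
  from rud_closed_rf[OF rM this, of "[x, y]"] show "upair x y :. M" using xy by auto
qed

text \<open>Separation is \<open>def_sub\<close> at a level, together with absoluteness of Sigma0
  formulas. For Collection, \<open>local1\<close> brings the hypothesis down to levels, non-failure
  bounds the stages by some \<open>b\<close>, and Sigma1 truth persists upwards; the level
  \<open>JJ U b\<close> is the collecting set.\<close>

lemma admissible_M: "admissible M" unfolding admissible_def
proof (intro conjI)
  show "transitive M" by (rule transI) (rule Mt)
  show "sat_Pairing M" unfolding sat_Pairing_def using M1 mem_upair by blast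
  show "sat_Infinity M" unfolding sat_Infinity_def
  proof (rule exI[of _ omega], intro conjI allI impI)
    show "omega :. M" by (rule UM(2)[OF T(2)])
    show "EX e. e :. M & e :. omega & (ALL w. w :. M --> ~ w :. e)" using eM[OF empty_omega] by (intro exI[of _ empty]) simp
    show "EX y. y :. M & y :. omega & (ALL w. w :. M --> (w :. y <-> w :. x | w = x))" if "x :. M & x :. omega" for x
      using eM[OF adj_omega] that by (intro exI[of _ "adjoin_self x"]) simp
  qed
  show "sat_Sigma0_Separation M" unfolding sat_Sigma0_Separation_def
  proof (intro allI impI, elim conjE)
    fix p s d :: 'a assume p: "p :. Sigma0" and s: "maps s omega M" and d: "d :. M"
    note pF = Sigma0_Form[OF p]
    obtain f m where f: "fa M f" "supp p m" "ALL k. k :. m --> ap s k = ap f k" using trunc[OF pF s eM[OF empty_omega]] by blast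
    have fm: "maps f omega M" using f(1) unfolding fa_def by blast
    obtain b where b: "b :. l" "d :. JJ U b" "fa (JJ U b) f" using fa_bound[OF f(1) d] by blast
    have fb: "maps f omega (JJ U b)" using b(3) unfolding fa_def by blast
    let ?e = "sep d (%x. upd f (std_num 0) x :. TS (JJ U b) p)"
    have "?e :. nx (JJ U b)" by (rule def_sub[OF good_JJ[OF T lO[OF b(1)]] pF b(3) std_omega sub_nx[OF b(2)]])
    then have eM: "?e :. M" unfolding memM using l_adj[OF b(1)] by (intro exI[of _ "adjoin_self b"]) simp
    have D: "D (%e. upd f (std_num 0) (e 0) :. TS (JJ U b) p)" by (intro Di)
    have "x :. ?e <-> x :. d & Sat M p (upd s (std_num 0) x)" if x: "x :. M" for x
    proof -
      have "upd f (std_num 0) x :. TS (JJ U b) p <-> upd f (std_num 0) x :. TS M p" if xd: "x :. d"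
        by (rule Sigma0_abs[OF p JJtr[OF b(1)] JJsubM[OF b(1)] maps_upd[OF fb std_omega]]) (rule good_trans[OF good_JJ[OF T lO[OF b(1)]] b(2) xd])
      then show ?thesis unfolding mem_sep[OF D] Sat_iff[OF pF] supp_upd[OF f(2,3) s fm std_omega x] by blast
    qed
    then show "EX e. e :. M & (ALL x. x :. M --> (x :. e <-> x :. d & Sat M p (upd s (std_num 0) x)))" using eM by blast
  qed
  show "sat_Sigma1_Collection M" unfolding sat_Sigma1_Collection_def
  proof (intro allI impI, elim conjE)
    fix p s d :: 'a assume p: "p :. Sigma1" and s: "maps s omega M" and d: "d :. M"
      and h: "ALL x. x :. M & x :. d --> (EX y. y :. M & Sat M p (upd (upd s (std_num 0) x) (std_num 1) y))"
    have pF: "p :. Form" using Sigma1_induct[OF p, of "%_. True"] D_True by blast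
    define q where "q = cEx (std_num 1) p"
    have q1: "q :. Sigma1" unfolding q_def mem_Sigma1 using p[unfolded mem_Sigma1] std_omega by blast
    have qF: "q :. Form" unfolding q_def by (intro Form_intros std_omega pF)
    obtain m1 m2 where mm: "m1 :. omega" "supp q m1" "m2 :. omega" "supp p m2" using supp_ex[OF qF] supp_ex[OF pF] by blast
    obtain m where m: "m :. omega" "m1 :. m | m1 = m" "m2 :. m | m2 = m" using omega_dir[OF mm(1,3)] by blast
    have sub: "k :. m | k = m ==> k \<^bold>\<subseteq> m" for k using trans_nat[OF m(1)] unfolding transitive_def by auto
    have sp: "supp q m" "supp p m" using supp_mono[OF mm(2) sub[OF m(2)]] supp_mono[OF mm(4) sub[OF m(3)]] .
    obtain f where f: "fa M f" "ALL k. k :. m --> ap s k = ap f k" using trunc0[OF m(1) s eM[OF empty_omega]] by blast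
    have fm: "maps f omega M" using f(1) unfolding fa_def by blast
    have qM: "upd s (std_num 0) x :. TS M q <-> (EX y. y :. M & Sat M p (upd (upd s (std_num 0) x) (std_num 1) y))" if "x :. M" for x
      unfolding q_def TS_simps(5)[OF std_omega] Sat_iff[OF pF] using maps_upd[OF s std_omega that] by blast
    have "upd f (std_num 0) x :. TS M q" if x: "x :. d" for x
      using h qM[OF Mt[OF d x]] supp_upd[OF sp(1) f(2) s fm std_omega Mt[OF d x], of 0] Mt[OF d x] x by blast
    from coll[OF qF local1[OF q1] f(1) std_omega d this] obtain b where b: "b :. l" "ALL x. x :. d --> Qs U b q (std_num 0) f x" by blast
    have "EX y. y :. M & y :. JJ U b & Sat M p (upd (upd s (std_num 0) x) (std_num 1) y)" if x: "x :. M & x :. d" for x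
    proof -
      obtain c where c: "c :. b | c = b" "upd f (std_num 0) x :. TS (JJ U c) q" using b(2) x unfolding Qs_def by blast
      have cl: "c :. l" using c(1) b(1) Ord_trans[OF l(2) b(1)] by blast
      obtain y where y: "y :. JJ U c" "upd (upd f (std_num 0) x) (std_num 1) y :. TS (JJ U c) p" using c(2) unfolding q_def TS_simps(5)[OF std_omega] by blast
      have yb: "y :. JJ U b" using JJle[OF b(1) c(1) y(1)] .
      have yM: "y :. M" using yb subD[OF JJsubM[OF b(1)]] by blast
      have "upd (upd f (std_num 0) x) (std_num 1) y :. TS M p" by (rule Sigma1_up[OF p JJtr[OF cl] JJsubM[OF cl] y(2)])
      then have "upd (upd s (std_num 0) x) (std_num 1) y :. TS M p"
        by (rule supp_upd[OF sp(2) _ maps_upd[OF s] maps_upd[OF fm], THEN iffD2, rotated -1]) (use f(2) x yM in auto)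
      then show ?thesis unfolding Sat_iff[OF pF] using yb yM by blast
    qed
    then show "EX e. e :. M & (ALL x. x :. M & x :. d --> (EX y. y :. M & y :. e & Sat M p (upd (upd s (std_num 0) x) (std_num 1) y)))" using JM[OF b(1)] by blast
  qed
qed

text \<open>Collection is applied to the formula that says that some element of \<open>D\<close>
  satisfies \<open>q\<close>. The variable \<open>n\<close> for \<open>D\<close> lies above the
  support of \<open>q\<close>, so that storing \<open>D\<close> there does not disturb
  \<open>q\<close>; by \<open>up\<close> all witnesses still work at a common level.\<close>

lemma coll2: assumes q: "q :. Form" "local q" and up: "!!c c' s. c :. l ==> c' :. l ==> c :. c' | c = c' ==> s :. TS (JJ U c) q ==> s :. TS (JJ U c') q"
    and f: "fa M f" and d: "d :. M" and e: "e :. M" and h: "!!D. D :. d ==> EX z. z :. D & upd f (std_num 0) z :. TS M q"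
  shows "EX b. b :. l & e :. JJ U b & fa (JJ U b) f & (ALL D. D :. d --> (EX z. z :. D & upd f (std_num 0) z :. TS (JJ U b) q))"
proof -
  obtain m where m: "m :. omega" "supp q m" using supp_ex[OF q(1)] by blast
  define n where "n = adjoin_self m"
  have n: "n :. omega" "n \<noteq> std_num 0" "~ n :. m" unfolding n_def using m(1) mem_asym[of "adjoin_self m" m] by auto
  define p where "p = cEx (std_num 0) (cAnd (cMem (std_num 0) n) q)"
  have p: "p :. Form" unfolding p_def by (intro Form_intros std_omega n q)
  have ev: "upd f n D :. TS A p <-> maps (upd f n D) omega A & (EX z. z :. A & z :. D & upd (upd f n D) (std_num 0) z :. TS A q)" for A D
    unfolding p_def TS_simps(5)[OF std_omega] TS_simps(4) TS_simps(1)[OF std_omega n(1)] using n(2) TS_maps by auto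
  have sw: "upd (upd f n D) (std_num 0) z :. TS A q <-> upd f (std_num 0) z :. TS A q" if "maps f omega A" "D :. A" "z :. A" for A D z
    by (rule supp_upd[OF m(2) _ maps_upd[OF that(1) n(1) that(2)] that(1) std_omega that(3)]) (use n(3) in auto)
  have "ALL D. D :. d --> (EX b. b :. l & Qs U b p n f D)"
  proof (intro allI impI)
    fix D assume D: "D :. d"
    have DM: "D :. M" by (rule Mt[OF d D])
    obtain z where z: "z :. D" "upd f (std_num 0) z :. TS M q" using h[OF D] by blast
    obtain b1 where b1: "b1 :. l" "ALL c. c :. l & (b1 :. c | b1 = c) --> upd f (std_num 0) z :. TS (JJ U c) q"
      using q(2) fa_upd[OF f std_omega Mt[OF DM z(1)], of 0] z(2) unfolding local_def by blast
    obtain b2 where b2: "b2 :. l" "D :. JJ U b2" "ALL c. c :. l & (b2 :. c | b2 = c) --> fa (JJ U c) f" using fa_bound[OF f DM] by blast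
    obtain g where g: "g :. l" "b1 :. g | b1 = g" "b2 :. g | b2 = g" using lmax[OF b1(1) b2(1)] by blast
    have Dg: "D :. JJ U g" by (rule JJle[OF g(1,3) b2(2)])
    have zg: "z :. JJ U g" by (rule transD[OF JJtr[OF g(1)] Dg z(1)])
    have fg: "maps f omega (JJ U g)" using b2(3) g unfolding fa_def by blast
    have "upd f n D :. TS (JJ U g) p" unfolding ev using maps_upd[OF fg n(1) Dg] zg z(1) sw[OF fg Dg zg] b1(2) g(1,2) by blast
    then show "EX b. b :. l & Qs U b p n f D" unfolding Qs_def using g(1) by blast
  qed
  moreover have "~ fails U l" using as unfolding astar_def by blast
  ultimately obtain b where b: "b :. l" "ALL D. D :. d --> Qs U b p n f D" unfolding fails_def using p n(1) f d by blast
  obtain b2 where b2: "b2 :. l" "e :. JJ U b2" "ALL c. c :. l & (b2 :. c | b2 = c) --> fa (JJ U c) f" using fa_bound[OF f e] by blast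
  obtain g where g: "g :. l" "b :. g | b = g" "b2 :. g | b2 = g" using lmax[OF b(1) b2(1)] by blast
  have fg: "fa (JJ U g) f" "maps f omega (JJ U g)" using b2(3) g unfolding fa_def by blast+
  have "EX z. z :. D & upd f (std_num 0) z :. TS (JJ U g) q" if D: "D :. d" for D
  proof -
    obtain c where c: "c :. b | c = b" "upd f n D :. TS (JJ U c) p" using b(2) D unfolding Qs_def by blast
    have cl: "c :. l" using c(1) b(1) Ord_trans[OF l(2) b(1)] by blast
    have cg: "c :. g | c = g" using c(1) g(2) Ord_trans[OF lO[OF g(1)]] by blast
    obtain z where z: "z :. JJ U c" "z :. D" "upd (upd f n D) (std_num 0) z :. TS (JJ U c) q" and mp: "maps (upd f n D) omega (JJ U c)" using c(2) unfolding ev by blast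
    have "ap (upd f n D) n :. JJ U c" using mp n(1) unfolding maps_iff by blast
    then have Dg: "D :. JJ U g" using JJle[OF g(1) cg, of D] by simp
    have "upd f (std_num 0) z :. TS (JJ U g) q" using up[OF cl g(1) cg z(3)] sw[OF fg(2) Dg JJle[OF g(1) cg z(1)]] by blast
    then show ?thesis using z(2) by blast
  qed
  then show ?thesis using g(1) JJle[OF g(1,3) b2(2)] fg(1) by blast
qed

text \<open>The graph is a subset of the rectangle \<open>P\<close>, and a level
  \<open>JJ U b\<close> is found that decides all of \<open>P\<close> correctly. If the graph is
  Sigma1, by level \<open>b\<close> every row has its point of the graph confirmed. If it is Pi1,
  two distinct points of a row are never both in the graph, and by level \<open>b\<close> one of
  them is refuted.\<close>

lemma graph_in_M: assumes U': "U' :. M" and j: "fun_on j U'" "!!x. x :. U' ==> ap j x :. U"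
    and p: "p :. Sigma1 | p :. Pi1" and s: "maps s omega M" and df: "!!x. x :. j <-> x :. M & Sat M p (upd s (std_num 0) x)"
  shows "j :. M"
proof -
  have pF: "p :. Form" using p Sigma1_induct[of p "%_. True"] Pi1_induct[of p "%_. True"] D_True by blast
  obtain f m where f: "fa M f" "m :. omega" "supp p m" "ALL k. k :. m --> ap s k = ap f k" using trunc[OF pF s eM[OF empty_omega]] by blast
  have fm: "maps f omega M" using f(1) unfolding fa_def by blast
  have dj: "x :. j <-> x :. M & upd f (std_num 0) x :. TS M p" for x
    unfolding df Sat_iff[OF pF] using supp_upd[OF f(3,4) s fm std_omega, of x 0] by blast
  \<comment> \<open>The rows of the rectangle, one for each argument.\<close>
  define d where "d = img U' (%x. img U (%y. opair x y))"
  have dd: "dt (%e. opair x (e 0))" "dt (%e. img U (%y. opair (e 0) y))" for x by (intro Di)+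
  have md: "D :. d <-> (EX x. x :. U' & D = img U (%y. opair x y))" for D unfolding d_def mem_img[OF dd(2)] ..
  have mi: "z :. img U (%y. opair x y) <-> (EX y. y :. U & z = opair x y)" for x z unfolding mem_img[OF dd(1)] ..
  have dM: "d :. M"
  proof -
    have 1: "rf 4 (%zs::'a list. opair (zs ! 1) (zs ! 0))" by (intro rf_opair rf_var) simp_all
    have 2: "rf 3 (%ys::'a list. img (ys ! 2) (%b. opair ((b # ys) ! 1) ((b # ys) ! 0)))" by (rule rf_img'[OF _ rf_var 1]) simp_all
    have "rf 2 (%xs::'a list. img (xs ! 0) (%a. (%ys. img (ys ! 2) (%b. opair ((b # ys) ! 1) ((b # ys) ! 0))) (a # xs)))" by (rule rf_img'[OF _ rf_var 2]) simp_all
    from rud_closed_rf[OF rM this, of "[U', U]"] show ?thesis unfolding d_def using U' UM(1) by auto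
  qed
  define P where "P = set_union d"
  have mP: "z :. P <-> (EX x y. x :. U' & y :. U & z = opair x y)" for z unfolding P_def mem_union md using mi by blast
  have PM: "P :. M"
  proof -
    have "rf 1 (%xs::'a list. set_union (xs ! 0))" by (intro rf_union rf_var) simp_all
    from rud_closed_rf[OF rM this, of "[d]"] show ?thesis unfolding P_def using dM by auto
  qed
  have jP: "z :. j ==> z :. P" for z unfolding mP fun_on_mem'[OF j(1)] using j(2) by blast
  have finish: "j :. M" if b: "b :. l" "P :. JJ U b" "fa (JJ U b) f" and eq: "!!z. z :. P ==> z :. j <-> upd f (std_num 0) z :. TS (JJ U b) p" for b
  proof -
    have D: "D (%e. upd f (std_num 0) (e 0) :. TS (JJ U b) p)" by (intro Di)
    have "j = sep P (%z. upd f (std_num 0) z :. TS (JJ U b) p)" by (rule set_eqI, unfold mem_sep[OF D]) (use jP eq in blast)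
    moreover have "sep P (%z. upd f (std_num 0) z :. TS (JJ U b) p) :. nx (JJ U b)"
      by (rule def_sub[OF good_JJ[OF T lO[OF b(1)]] pF b(3) std_omega sub_nx[OF b(2)]])
    ultimately show ?thesis unfolding memM using l_adj[OF b(1)] by (intro exI[of _ "adjoin_self b"]) simp
  qed
  have le: "JJ U c \<^bold>\<subseteq> JJ U c'" if "c :. l" "c' :. l" "c :. c' | c = c'" for c c' by (rule subI) (rule JJle[OF that(2,3)])
  from p show ?thesis
  proof
    assume p: "p :. Sigma1"
    have "EX b. b :. l & P :. JJ U b & fa (JJ U b) f & (ALL D. D :. d --> (EX z. z :. D & upd f (std_num 0) z :. TS (JJ U b) p))"
    proof (rule coll2[OF pF local1[OF p] _ f(1) dM PM])
      show "s :. TS (JJ U c') p" if "c :. l" "c' :. l" "c :. c' | c = c'" "s :. TS (JJ U c) p" for c c' s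
        by (rule Sigma1_up[OF p JJtr[OF that(1)] le[OF that(1,2,3)] that(4)])
      fix D assume "D :. d"
      then obtain x where x: "x :. U'" "D = img U (%y. opair x y)" unfolding md by blast
      have "opair x (ap j x) :. j" by (rule fun_onD(1)[OF j(1) x(1)])
      then show "EX z. z :. D & upd f (std_num 0) z :. TS M p" unfolding x(2) mi using dj j(2)[OF x(1)] by blast
    qed
    then obtain b where b: "b :. l" "P :. JJ U b" "fa (JJ U b) f" "ALL D. D :. d --> (EX z. z :. D & upd f (std_num 0) z :. TS (JJ U b) p)" by blast
    have toj: "z :. j" if "z :. P" "upd f (std_num 0) z :. TS (JJ U b) p" for z
      unfolding dj using Mt[OF PM that(1)] Sigma1_up[OF p JJtr[OF b(1)] JJsubM[OF b(1)] that(2)] by blast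
    show ?thesis
    proof (rule finish[OF b(1-3)], rule iffI)
      fix z assume z: "z :. P" "z :. j"
      obtain x where x: "x :. U'" "z = opair x (ap j x)" using z(2) unfolding fun_on_mem'[OF j(1)] by blast
      obtain z' where z': "z' :. img U (%y. opair x y)" "upd f (std_num 0) z' :. TS (JJ U b) p" using b(4) x(1) md by blast
      obtain y where y: "y :. U" "z' = opair x y" using z'(1) unfolding mi by blast
      have "z' :. P" unfolding mP using x(1) y by blast
      then have "opair x y :. j" using toj z'(2) y(2) by blast
      then have "z' = z" using fun_on_mem[OF j(1)] x(2) y(2) by simp
      then show "upd f (std_num 0) z :. TS (JJ U b) p" using z'(2) by simp
    qed (rule toj)
  next
    assume p: "p :. Pi1"
    define d1 where "d1 = big_union P (%z. img P (%z'. upair z z'))"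
    have dd1: "dt (%e. upair z (e 0))" "dt (%e. img P (%z'. upair (e 0) z'))" for z by (intro Di)+
    have md1: "D :. d1 <-> (EX z. z :. P & (EX z'. z' :. P & D = upair z z'))" for D unfolding d1_def mem_big_union[OF dd1(2)] mem_img[OF dd1(1)] ..
    have d1M: "d1 :. M"
    proof -
      have 1: "rf 3 (%zs::'a list. upair (zs ! 1) (zs ! 0))" by (intro rf_upair rf_var) simp_all
      have 2: "rf 2 (%ys::'a list. img (ys ! 1) (%b. upair ((b # ys) ! 1) ((b # ys) ! 0)))" by (rule rf_img'[OF _ rf_var 1]) simp_all
      have "rf 1 (%xs::'a list. big_union (xs ! 0) (%a. (%ys. img (ys ! 1) (%b. upair ((b # ys) ! 1) ((b # ys) ! 0))) (a # xs)))" by (rule rf_big_union'[OF _ rf_var 2]) simp_all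
      from rud_closed_rf[OF rM this, of "[P]"] show ?thesis unfolding d1_def using PM by auto
    qed
    \<comment> \<open>The pairs of distinct points in a common row. Asking for a refuted point in
      each such pair is a collection over a set, whereas the graph is not yet known to be one in
      \<open>M\<close>.\<close>
    define d2 where "d2 = sep d1 (%D. EX z. z :. D & (EX z'. z' :. D & (z \<noteq> z' & (EX E. E :. d & (z :. E & z' :. E)))))"
    have md2: "D :. d2 <-> D :. d1 & (EX z. z :. D & (EX z'. z' :. D & (z \<noteq> z' & (EX E. E :. d & (z :. E & z' :. E)))))" for D unfolding d2_def by (rule mem_sep) (intro Di)
    have d2M: "d2 :. M"
    proof -
      have "d0 (%e. EX z. z :. e 0 & (EX z'. z' :. e 0 & (z \<noteq> z' & (EX E. E :. e 2 & (z :. E & z' :. E)))))" by (intro Bi)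
      from rf_sep3[of "%D t u. EX z. z :. D & (EX z'. z' :. D & (z \<noteq> z' & (EX E. E :. t & (z :. E & z' :. E))))" 2 "%xs. xs ! 0" "%xs. xs ! 1" "%xs. xs ! 1", OF this]
      have "rf 2 (%xs. sep (xs ! 0) (%D. EX z. z :. D & (EX z'. z' :. D & (z \<noteq> z' & (EX E. E :. xs ! 1 & (z :. E & z' :. E))))))" by (simp add: rf_var)
      from rud_closed_rf[OF rM this, of "[d1, d]"] show ?thesis unfolding d2_def using d1M dM by auto
    qed
    have nf: "cNeg p :. Form" by (intro Form_intros pF)
    have dn: "upd f (std_num 0) z :. TS M (cNeg p) <-> ~ z :. j" if "z :. M" for z
      unfolding TS_simps dj using maps_upd[OF fm std_omega that] that by blast
    have up: "s :. TS B (cNeg p)" if "transitive A" "A \<^bold>\<subseteq> B" "s :. TS A (cNeg p)" for A B s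
    proof -
      have sA: "maps s omega A" "~ s :. TS A p" using that(3) unfolding TS_simps by blast+
      then show ?thesis unfolding TS_simps using Pi1_down[OF p that(1,2) sA(1)] maps_mono[OF sA(1) that(2)] by blast
    qed
    have "EX b. b :. l & P :. JJ U b & fa (JJ U b) f & (ALL D. D :. d2 --> (EX z. z :. D & upd f (std_num 0) z :. TS (JJ U b) (cNeg p)))"
    proof (rule coll2[OF nf local_Pi1[OF p] _ f(1) d2M PM])
      show "s :. TS (JJ U c') (cNeg p)" if "c :. l" "c' :. l" "c :. c' | c = c'" "s :. TS (JJ U c) (cNeg p)" for c c' s
        by (rule up[OF JJtr[OF that(1)] le[OF that(1,2,3)] that(4)])
      fix D assume "D :. d2"
      then obtain z z' E where z: "z :. D" "z' :. D" "z \<noteq> z'" "E :. d" "z :. E" "z' :. E" unfolding md2 by blast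
      obtain x where x: "x :. U'" "E = img U (%y. opair x y)" using z(4) unfolding md by blast
      obtain y y' where y: "y :. U" "z = opair x y" "y' :. U" "z' = opair x y'" using z(5,6) unfolding x(2) mi by blast
      have zP: "z :. P" "z' :. P" unfolding mP using x(1) y by blast+
      have "~ (z :. j & z' :. j)" using z(3) fun_on_mem[OF j(1)] unfolding y(2,4) by auto
      then show "EX z. z :. D & upd f (std_num 0) z :. TS M (cNeg p)" using z(1,2) dn[OF Mt[OF PM zP(1)]] dn[OF Mt[OF PM zP(2)]] by blast
    qed
    then obtain b where b: "b :. l" "P :. JJ U b" "fa (JJ U b) f" "ALL D. D :. d2 --> (EX z. z :. D & upd f (std_num 0) z :. TS (JJ U b) (cNeg p))" by blast
    have nj: "~ z :. j" if "z :. P" "upd f (std_num 0) z :. TS (JJ U b) (cNeg p)" for z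
      using dn[OF Mt[OF PM that(1)]] up[OF JJtr[OF b(1)] JJsubM[OF b(1)] that(2)] by blast
    show ?thesis
    proof (rule finish[OF b(1-3)], rule iffI)
      fix z assume z: "z :. P" "z :. j"
      have "maps (upd f (std_num 0) z) omega (JJ U b)" using maps_upd[OF _ std_omega transD[OF JJtr[OF b(1)] b(2) z(1)]] b(3) unfolding fa_def by blast
      then show "upd f (std_num 0) z :. TS (JJ U b) p" using Pi1_down[OF p JJtr[OF b(1)] JJsubM[OF b(1)]] z(2) unfolding dj by blast
    next
      fix z assume z: "z :. P" "upd f (std_num 0) z :. TS (JJ U b) p"
      show "z :. j"
      proof (rule ccontr)
        assume zj: "~ z :. j"
        obtain x y where x: "x :. U'" "y :. U" "z = opair x y" using z(1) unfolding mP by blast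
        \<comment> \<open>The true point of the row of \<open>z\<close>. In the pair of both, the
          refuted one can only be \<open>z\<close>.\<close>
        define z' where "z' = opair x (ap j x)"
        have z'j: "z' :. j" unfolding z'_def by (rule fun_onD(1)[OF j(1) x(1)])
        have "img U (%y. opair x y) :. d" "z :. img U (%y. opair x y)" "z' :. img U (%y. opair x y)" unfolding md mi z'_def using x j(2)[OF x(1)] by blast+
        moreover have "z \<noteq> z'" using zj z'j by blast
        ultimately have "upair z z' :. d2" unfolding md2 md1 mem_upair using z(1) jP[OF z'j] by blast
        then obtain w where w: "w = z | w = z'" "upd f (std_num 0) w :. TS (JJ U b) (cNeg p)" using b(4) unfolding mem_upair[symmetric] by blast
        have "w = z" using w nj[OF jP[OF z'j]] z'j by blast
        then show False using w(2) z(2) unfolding TS_simps by blast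
      qed
    qed
  qed
qed

text \<open>At a level strictly below \<open>l\<close> a subset of \<open>U\<close> definable there
  by a formula of any complexity appears in the next level.\<close>

lemma graph_below: assumes t: "t :. l" and p: "p :. Form" and s: "maps s omega (JJ U t)" and j: "j \<^bold>\<subseteq> U"
    and df: "!!x. x :. j <-> x :. JJ U t & Sat (JJ U t) p (upd s (std_num 0) x)"
  shows "j :. M"
proof -
  obtain f m where f: "fa (JJ U t) f" "supp p m" "ALL k. k :. m --> ap s k = ap f k" using trunc[OF p s eJ[OF t empty_omega]] by blast
  have fm: "maps f omega (JJ U t)" using f(1) unfolding fa_def by blast
  have Ut: "U :. JJ U t" "x :. U ==> x :. JJ U t" for x
  proof -
    have "empty :. t | empty = t" using Ord_linear[OF Ord_empty lO[OF t]] by auto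
    then show "U :. JJ U t" "x :. U ==> x :. JJ U t" using JJle[OF t, of empty] by auto
  qed
  have D: "D (%e. upd f (std_num 0) (e 0) :. TS (JJ U t) p)" by (intro Di)
  have "x :. j <-> x :. U & upd f (std_num 0) x :. TS (JJ U t) p" for x
    using df[of x] subD[OF j, of x] Ut(2)[of x] supp_upd[OF f(2,3) s fm std_omega, of x 0] unfolding Sat_iff[OF p] by blast
  then have "j = sep U (%x. upd f (std_num 0) x :. TS (JJ U t) p)" by (intro set_eqI, unfold mem_sep[OF D]) blast
  moreover have "sep U (%x. upd f (std_num 0) x :. TS (JJ U t) p) :. nx (JJ U t)"
    by (rule def_sub[OF good_JJ[OF T lO[OF t]] p f(1) std_omega sub_nx[OF Ut(1)]])
  ultimately show ?thesis unfolding memM using l_adj[OF t] by (intro exI[of _ "adjoin_self t"]) simp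
qed

end

section \<open>Elementary embeddings between ranks\<close>

text \<open>Standard bounded formulas as codes of the model. The map \<open>r\<close> gives the
  variable of each de Bruijn index, and \<open>m\<close>, larger than all variables in use, becomes
  the next bound variable.\<close>

primrec cd :: "bf => (nat => nat) => nat => 'a::zf" where
  "cd (bMem i k) r m = cMem (std_num (r i)) (std_num (r k))"
| "cd (bEq i k) r m = cEq (std_num (r i)) (std_num (r k))"
| "cd (bNeg \<phi>) r m = cNeg (cd \<phi> r m)"
| "cd (bAnd \<phi> \<psi>) r m = cAnd (cd \<phi> r m) (cd \<psi> r m)"
| "cd (bEx i \<phi>) r m = cEx (std_num m) (cAnd (cMem (std_num m) (std_num (r i))) (cd \<phi> (case_nat m r) (Suc m)))"

lemma cd_bound: "ALL n. r n < m ==> ALL n. case_nat m r n < Suc m" by (auto split: nat.split simp: less_SucI)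
lemma cd_Sigma0: "ALL n. r n < m ==> cd \<phi> r m :. Sigma0"
proof (induction \<phi> arbitrary: r m)
  case (bEx i \<phi>)
  have "m \<noteq> r i" using bEx.prems[rule_format, of i] by simp
  then show ?case unfolding cd.simps by (intro Sigma0_intros std_omega bEx.IH[OF cd_bound[OF bEx.prems]]) simp
qed (simp_all add: Sigma0_intros)
lemma cd_TS: assumes A: "transitive A" shows "ALL n. r n < m ==> maps s omega A ==> s :. TS A (cd \<phi> r m) <-> bev mem (=) \<phi> (%n. ap s (std_num (r n)))"
proof (induction \<phi> arbitrary: r m s)
  case (bEx i \<phi>)
  have ri: "std_num m \<noteq> (std_num (r i) :: 'a)" "std_num (r n) \<noteq> (std_num m :: 'a)" for n using bEx.prems(1)[rule_format, of i] bEx.prems(1)[rule_format, of n] by auto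
  have IH: "upd s (std_num m) a :. TS A (cd \<phi> (case_nat m r) (Suc m)) <-> bev mem (=) \<phi> (case_nat a (%n. ap s (std_num (r n))))" if a: "a :. A" for a
  proof -
    have "(%n. ap (upd s (std_num m) a) (std_num (case_nat m r n))) = case_nat a (%n. ap s (std_num (r n)))"
      using ri(2) by (intro ext) (auto split: nat.split)
    then show ?thesis using bEx.IH[OF cd_bound[OF bEx.prems(1)] maps_upd[OF bEx.prems(2) std_omega a]] by simp
  qed
  have im: "ap s (std_num (r i)) :. A" using bEx.prems(2) unfolding maps_iff by simp
  have "s :. TS A (cd (bEx i \<phi>) r m) <-> (EX a. a :. A & a :. ap s (std_num (r i)) & upd s (std_num m) a :. TS A (cd \<phi> (case_nat m r) (Suc m)))"
    unfolding cd.simps TS_simps(5)[OF std_omega] TS_simps(4) TS_simps(1)[OF std_omega std_omega] using bEx.prems(2) maps_upd[OF bEx.prems(2) std_omega] ri(1) by auto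
  also have "... <-> (EX a. a :. ap s (std_num (r i)) & bev mem (=) \<phi> (case_nat a (%n. ap s (std_num (r n)))))" using IH transD[OF A im] by blast
  finally show ?case by simp
qed (simp_all add: TS_simps)

text \<open>Only the entries up to \<open>N\<close> follow \<open>e\<close>; the default
  \<open>e 0\<close> elsewhere makes the assignment total on the internal
  \<open>omega\<close>.\<close>

primrec asg :: "(nat => 'a::zf) => nat => 'a" where
  "asg e 0 = lam omega (%i. e 0)"
| "asg e (Suc n) = upd (asg e n) (std_num (Suc n)) (e (Suc n))"
lemma asg: assumes "ALL n. e n :. A" shows "maps (asg e N) omega A & (\<forall>i\<le>N. ap (asg e N) (std_num i) = e i)"
proof (induction N)
  case 0
  have d: "dt (%x::nat => 'a. e 0)" by (rule dt_const)
  have z: "i :. omega ==> ap (lam omega (%i. e 0)) i = e 0" for i by (rule ap_lam[OF d])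
  show ?case using fun_on_lam[OF d, of omega] z assms z[OF empty_omega] by (simp add: maps_iff)
next
  case (Suc N)
  then show ?case using maps_upd[OF _ std_omega, of "asg e N" A "e (Suc N)" "Suc N"] assms by (auto simp: le_Suc_eq simp del: std_num.simps)
qed

section \<open>Consequences of Sigma1-elementarity\<close>

context
  fixes j A B :: "'a::zf"
  assumes el: "Sigma1_elementary j A B" and tA: "transitive A" and tB: "transitive B"
begin

lemma mj: "fun_on j A" "x :. A ==> ap j x :. B" using el unfolding Sigma1_elementary_def maps_iff by blast+
lemma push: assumes "maps s omega A" shows "maps (push j s) omega B" "k :. omega ==> ap (push j s) k = ap j (ap s k)"
proof -
  have s: "fun_on s omega" "k :. omega ==> ap s k :. A" for k using assms unfolding maps_iff by blast+
  have "app j (app s k) = ap j (ap s k)" if "k :. omega" for k using fun_onD(3)[OF s(1) that] fun_onD(3)[OF mj(1) s(2)[OF that]] by simp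
  then have "push j s = lam omega (%k. ap j (ap s k))" unfolding push_def lam_def by metis
  moreover have d: "dt (%e. ap j (ap s (e 0)))" by (intro Di)
  ultimately have p: "fun_on (push j s) omega" "k :. omega ==> ap (push j s) k = ap j (ap s k)" for k using fun_on_lam[OF d] ap_lam[OF d] by simp_all
  show "maps (push j s) omega B" "k :. omega ==> ap (push j s) k = ap j (ap s k)" unfolding maps_iff using p mj(2) s(2) by simp_all
qed
lemma el1: "p :. Sigma1 ==> maps s omega A ==> Sat A p s <-> Sat B p (push j s)" using el unfolding Sigma1_elementary_def by blast
lemma S01: "p :. Sigma0 ==> p :. Sigma1" unfolding mem_Sigma1 using subD by blast

text \<open>The index \<open>min n N\<close> reduces an environment to finitely many values, which a
  single assignment of the model can carry.\<close>

lemma el0: assumes P: "d0 P" and e: "ALL n. e n :. A" shows "P (%n. e (min n N)) <-> P (%n. ap j (e (min n N)))"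
proof -
  obtain \<phi> where \<phi>: "!!e. P e = bev mem (=) \<phi> e" using P by (auto simp: d0_def)
  let ?s = "asg e N" let ?p = "cd \<phi> (%n. min n N) (Suc N) :: 'a"
  have s: "maps ?s omega A" "i \<le> N ==> ap ?s (std_num i) = e i" for i using asg[OF e] by blast+
  have r: "ALL n. min n N < Suc N" by (auto simp: min_def)
  note p0 = cd_Sigma0[OF r, of \<phi>]
  have "P (%n. e (min n N)) <-> ?s :. TS A ?p" unfolding cd_TS[OF tA r s(1)] \<phi> using s(2) by simp
  also have "... <-> push j ?s :. TS B ?p" using el1[OF S01[OF p0] s(1)] unfolding Sat_iff[OF Sigma0_Form[OF p0]] .
  also have "... <-> P (%n. ap j (e (min n N)))" unfolding cd_TS[OF tB r push(1)[OF s(1)]] \<phi> using push(2)[OF s(1) std_omega] s(2) by simp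
  finally show ?thesis .
qed
lemma el2: assumes "d0 (%e. R (e 0) (e 1))" "x :. A" "y :. A" shows "R x y <-> R (ap j x) (ap j y)"
  using el0[OF assms(1), of "%n. if n = 0 then x else y" 1] assms(2,3) by simp
lemma el5: assumes "d0 (%e. R (e 0) (e 1) (e 2) (e 3) (e 4))" "x :. A" "y :. A" "z :. A" "u :. A" "v :. A"
  shows "R x y z u v <-> R (ap j x) (ap j y) (ap j z) (ap j u) (ap j v)"
  using el0[OF assms(1), of "%n. if n = 0 then x else if n = 1 then y else if n = 2 then z else if n = 3 then u else v" 4] assms(2-) by simp
lemma el_mem: "x :. A ==> y :. A ==> x :. y <-> ap j x :. ap j y" by (rule el2[of "%x y. x :. y"]) (intro Bi)

text \<open>Being an element of something is a Sigma1 property and hence reflects from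
  \<open>B\<close> to \<open>A\<close>. This is what excludes successor heights in
  \<open>el_Limit\<close>.\<close>

lemma el_up: assumes x: "x :. A" and y: "EX y. y :. B & ap j x :. y" shows "EX y. y :. A & x :. y"
proof -
  let ?s = "asg (%n. x) 0" let ?p = "cEx (std_num 1) (cMem (std_num 0) (std_num 1)) :: 'a"
  have s: "maps ?s omega A" "ap ?s (std_num 0) = x" using asg[of "%n. x" A 0] x by auto
  have p: "?p :. Sigma1" unfolding mem_Sigma1 using subD Sigma0_intros(1)[OF std_omega std_omega] std_omega by blast
  have pF: "?p :. Form" by (intro Form_intros std_omega)
  have ev: "t :. TS C ?p <-> maps t omega C & (EX y. y :. C & ap t (std_num 0) :. y)" for t C
    unfolding TS_simps(5)[OF std_omega] TS_simps(1)[OF std_omega std_omega] using maps_upd[of t C "std_num 1"] by (auto simp: adj_ne_empty[symmetric])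
  have "push j ?s :. TS B ?p" unfolding ev using push[OF s(1)] push(2)[OF s(1) std_omega, of 0] s(2) y by simp
  then show ?thesis using el1[OF p s(1)] unfolding Sat_iff[OF pF] ev s(2) by blast
qed

lemma el_nat: assumes "omega :. A | omega = A" "n :. omega" shows "ap j n = n"
  using assms(2)
proof (rule omega_induct)
  have nA: "n :. omega ==> n :. A" for n using assms(1) transD[OF tA] by blast
  show "D (%e. ap j (e 0) = e 0)" by (intro Di)
  show "ap j empty = empty" using el2[of "%x y. x = empty", OF _ nA[OF empty_omega] nA[OF empty_omega]] by (simp add: d0_eq bt_var bt_empty)
  fix n assume n: "n :. omega" "ap j n = n"
  show "ap j (adjoin_self n) = adjoin_self n"
    using el2[of "%x y. x = adjoin_self y", OF _ nA[OF adj_omega[OF n(1)]] nA[OF n(1)]] n(2) by (simp add: d0_eq bt_var bt_adj)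
qed

lemma el_EmbR: assumes "omega :. A" "mem_cofinal j A B" shows "EmbR (%x y. opair x y :. j) A B"
proof -
  have k: "opair x y :. j <-> x :. A & y = ap j x" for x y by (rule fun_on_mem[OF mj(1)])
  have jw: "ap j omega = omega" using el2[of "%x y. x = omega", OF _ assms(1) assms(1)] by (simp add: d0_omega bt_var)
  have n: "n :. omega ==> ap j n = n" for n using el_nat assms(1) by blast
  show ?thesis unfolding EmbR_def k
  proof (intro conjI)
    show "ALL x. x :. A --> (EX y. y :. B & x :. A & y = ap j x)" using mj(2) by blast
    show "ALL x. x :. A --> (ALL y. y :. B & x :. A & y = ap j x --> (ALL y'. y' :. B & x :. A & y' = ap j x --> y = y'))" by blast
    show "ALL x. x :. A --> (ALL y. y :. B & x :. A & y = ap j x --> (ALL x'. x' :. A --> (ALL y'. y' :. B & x' :. A & y' = ap j x' --> (x :. x' <-> y :. y'))))" using el_mem by blast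
    show "ALL w. w :. A & w = omega --> (ALL m. m :. A & (m :. w | m = w) --> m :. A & m = ap j m)" using jw n by auto
    show "ALL y. y :. B --> (EX x. x :. A & (EX z. z :. B & (x :. A & z = ap j x) & y :. z))"
    proof (intro allI impI)
      fix y assume "y :. B"
      then obtain x where x: "x :. A" "y :. app j x" using assms(2) unfolding mem_cofinal_def by blast
      then show "EX x. x :. A & (EX z. z :. B & (x :. A & z = ap j x) & y :. z)" using mj(2)[OF x(1)] fun_onD(3)[OF mj(1) x(1)] by (intro exI[of _ x] conjI exI[of _ "ap j x"]) simp_all
    qed
    show "ALL s. s :. A & s :. A & s = ap j s --> (ALL p. p :. A --> (ALL q. q :. A --> (ALL r. r :. A --> (ALL z. z :. A & z = OP s p q r -->
        (ALL p'. p' :. B & p :. A & p' = ap j p --> (ALL q'. q' :. B & q :. A & q' = ap j q --> (ALL r'. r' :. B & r :. A & r' = ap j r --> (ALL z'. z' :. B & z :. A & z' = ap j z --> z' = OP s p' q' r'))))))))"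
    proof (intro allI impI, elim conjE)
      fix s p q r z p' q' r' z' assume a: "s :. A" "s = ap j s" "p :. A" "q :. A" "r :. A" "z :. A" "z = OP s p q r" and e: "p' = ap j p" "q' = ap j q" "r' = ap j r" "z' = ap j z"
      have d: "d0 (%e. e 0 = OP (e 1) (e 2) (e 3) (e 4))" by (intro Bi)
      have "ap j z = OP (ap j s) (ap j p) (ap j q) (ap j r)" using el5[of "%z s p q r. z = OP s p q r", OF d a(6,1,3,4,5)] a(7) by blast
      then show "z' = OP s p' q' r'" unfolding e a(2)[symmetric] .
    qed
  qed
qed

end

lemma V_Limit_up: assumes "Limit d" "x :. V_level d" shows "EX y. y :. V_level d & x :. y"
  using V_upair[OF assms(1,2,2)] by (intro exI[of _ "upair x x"]) simp

text \<open>If \<open>d'\<close> were the successor of \<open>c\<close>, no element of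
  \<open>V_level d'\<close> would have \<open>V_level c\<close> as an element. But the image of
  \<open>V_level c\<close> belongs to something in \<open>V_level d\<close>, and
  \<open>el_up\<close> reflects this.\<close>

lemma el_Limit: assumes d: "Limit d" "Ord d'" and el: "Sigma1_elementary j (V_level d') (V_level d)" and co: "mem_cofinal j (V_level d') (V_level d)"
  shows "Limit d'"
proof -
  have o: "Ord d" using d(1) by (simp add: Limit_def)
  note t = V_trans[OF d(2)] V_trans[OF o]
  obtain c where "c :. d" using d(1) ne_emptyD[of d] unfolding Limit_def by blast
  then obtain x where x: "x :. V_level d'" using co subD[OF Ord_sub_V[OF o]] unfolding mem_cofinal_def by blast
  have "d' \<noteq> empty" using x unfolding mem_V[OF d(2)] by auto
  moreover have False if c: "c :. d'" "Ord c" "d' = adjoin_self c" for c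
  proof -
    have V: "V_level c :. V_level d'" by (rule V_mem[OF d(2) c(1)])
    obtain y where y: "y :. V_level d'" "V_level c :. y" using el_up[OF el t V V_Limit_up[OF d(1) mj(2)[OF el t V]]] by blast
    obtain b where b: "b :. adjoin_self c" "y \<^bold>\<subseteq> V_level b" using y(1) unfolding mem_V[OF d(2)] unfolding c(3) by blast
    then have "V_level c :. V_level b" using y(2) subD by blast
    then show False using b(1) V_mono[OF c(2)] mem_not_refl unfolding mem_adj by blast
  qed
  ultimately show ?thesis using Ord_cases[OF d(2)] by blast
qed

text \<open>By induction on \<open>n\<close> the set \<open>v n\<close> and all its elements are
  fixed. A subset of \<open>v n\<close> is fixed because its image is again a subset of
  \<open>v n\<close>; the image of the next stage gains nothing, since having only subsets of
  \<open>v n\<close> as elements is a bounded condition.\<close>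

lemma el_Vomega: fixes j :: "'a::zf" assumes el: "Sigma1_elementary j (V_level omega) B" "transitive B" and x: "x :. V_level omega" shows "ap j x = x"
proof -
  define v where "v = recr (VG :: 'a => ('a => 'a) => 'a)"
  have vV: "Ord a ==> V_level a = v a" for a unfolding v_def by (rule V_level_recr)
  have dv: "dt t ==> dt (%e. v (t e))" for t unfolding v_def by (rule dt_app1[OF dt_VV])
  note t = el(1) V_trans[OF Ord_omega] el(2)
  note em = el_mem[OF t] and e2 = el2[OF t]
  have vin: "n :. omega ==> v n :. V_level omega" for n using V_mem[OF Ord_omega] vV[OF Ord_nat] by metis
  have vt: "n :. omega ==> y :. v n ==> y :. V_level omega" for n y using transD[OF V_trans[OF Ord_omega] vin] by blast
  have vS: "y :. v (adjoin_self n) <-> y \<^bold>\<subseteq> v n" if n: "n :. omega" for y n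
  proof -
    have "y :. V_level (adjoin_self n) <-> (EX c. c :. adjoin_self n & y \<^bold>\<subseteq> V_level c)" by (rule mem_V[OF Ord_nat[OF adj_omega[OF n]]])
    also have "... <-> y \<^bold>\<subseteq> V_level n" unfolding mem_adj subset_def using V_mono[OF Ord_nat[OF n]] by blast
    finally show ?thesis unfolding vV[OF Ord_nat[OF n]] vV[OF Ord_nat[OF adj_omega[OF n]]] .
  qed
  have *: "ap j (v n) = v n & (ALL y. y :. v n --> ap j y = y)" if "n :. omega" for n using that
  proof (rule omega_induct)
    show "D (%e. ap j (v (e 0)) = v (e 0) & (ALL y. y :. v (e 0) --> ap j y = y))" by (intro Di dv)
    have v0: "v empty = empty" by (rule eq_emptyI) (simp add: vV[OF Ord_empty, symmetric] mem_V[OF Ord_empty])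
    have eV: "empty :. V_level omega" using subD[OF Ord_sub_V[OF Ord_omega] empty_omega] .
    have "ap j empty = empty" using e2[of "%x y. x = empty", OF _ eV eV] by (simp add: d0_eq bt_var bt_empty)
    then show "ap j (v empty) = v empty & (ALL y. y :. v empty --> ap j y = y)" unfolding v0 by simp
    fix n assume n: "n :. omega" and IH: "ap j (v n) = v n & (ALL y. y :. v n --> ap j y = y)"
    have fx: "ap j y = y" if y: "y :. v (adjoin_self n)" for y
    proof (rule set_eqI)
      fix z
      have yV: "y :. V_level omega" by (rule vt[OF adj_omega[OF n] y])
      have ys: "y \<^bold>\<subseteq> v n" using y vS[OF n] by blast
      have js: "ap j y \<^bold>\<subseteq> v n" using e2[of "%x y. x \<^bold>\<subseteq> y", OF _ yV vin[OF n]] ys IH by (simp add: d0_sub bt_var)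
      show "z :. ap j y <-> z :. y"
      proof (cases "z :. v n")
        case True
        then have "ap j z = z" using IH by blast
        then show ?thesis using em[OF vt[OF n True] yV] by simp
      next
        case False then show ?thesis using subD[OF ys] subD[OF js] by blast
      qed
    qed
    have "ap j (v (adjoin_self n)) = v (adjoin_self n)"
    proof (rule set_eqI, rule iffI)
      have d: "d0 (%e. ALL z. z :. e 0 --> z \<^bold>\<subseteq> e 1)" by (intro Bi)
      have "ALL z. z :. v (adjoin_self n) --> z \<^bold>\<subseteq> v n" using vS[OF n] by blast
      then have h: "ALL z. z :. ap j (v (adjoin_self n)) --> z \<^bold>\<subseteq> v n"
        using e2[of "%x y. ALL z. z :. x --> z \<^bold>\<subseteq> y", OF d vin[OF adj_omega[OF n]] vin[OF n]] IH by simp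
      fix z assume "z :. ap j (v (adjoin_self n))" then show "z :. v (adjoin_self n)" using h vS[OF n] by blast
    next
      fix z assume z: "z :. v (adjoin_self n)"
      then show "z :. ap j (v (adjoin_self n))" using em[OF vt[OF adj_omega[OF n] z] vin[OF adj_omega[OF n]]] fx[OF z] by simp
    qed
    then show "ap j (v (adjoin_self n)) = v (adjoin_self n) & (ALL y. y :. v (adjoin_self n) --> ap j y = y)" using fx by blast
  qed
  obtain n where n: "n :. omega" "x \<^bold>\<subseteq> V_level n" using x unfolding mem_V[OF Ord_omega] by blast
  have "x :. v (adjoin_self n)" using n(2) unfolding vS[OF n(1)] vV[OF Ord_nat[OF n(1)]] .
  then show ?thesis using *[OF adj_omega[OF n(1)]] by blast
qed

text \<open>The definite description in \<open>cofinality\<close> denotes, because the identity is a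
  cofinal map and least ordinals exist. The ranks at the values of a cofinal map on
  \<open>omega\<close> then absorb \<open>V_level d\<close>.\<close>

lemma cofw_V: fixes d :: "'a::zf" assumes d: "Limit d" "cofinality d = omega" shows "cofw (V_level d)"
proof -
  have o: "Ord d" using d(1) by (simp add: Limit_def)
  let ?C = "%g. EX f. maps f g d & (ALL b. b :. d --> (EX x. x :. g & b \<^bold>\<subseteq> ap f x))"
  have cm: "(EX f. cofinal_map f g d) <-> ?C g" for g
  proof -
    have "cofinal_map f g d <-> maps f g d & (ALL b. b :. d --> (EX x. x :. g & b \<^bold>\<subseteq> ap f x))" for f
    proof (cases "maps f g d")
      case True
      then have "x :. g ==> app f x = ap f x" for x using fun_onD(3) unfolding maps_iff by blast
      then show ?thesis unfolding cofinal_map_def by metis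
    qed (simp add: cofinal_map_def)
    then show ?thesis by blast
  qed
  have dC: "D (%e. ?C (e 0))" by (intro Di)
  have di: "dt (%e::nat => 'a. e 0)" by (rule dt_var)
  have "?C d"
  proof (rule exI[of _ "lam d (%x. x)"], intro conjI allI impI)
    show "maps (lam d (%x. x)) d d" unfolding maps_iff using fun_on_lam[OF di, of d] ap_lam[OF di, of _ d] by simp
    show "EX x. x :. d & b \<^bold>\<subseteq> ap (lam d (%x. x)) x" if "b :. d" for b using ap_lam[OF di that] that sub_refl[of b] by metis
  qed
  from least_ord[of d ?C, OF o this dC] obtain g where g: "Ord g" "?C g" "ALL y. y :. g --> ~ ?C y" by blast
  have "cofinality d = g" unfolding cofinality_def cm
  proof (rule the_equality)
    show "Ord g & ?C g & (ALL b. b :. g --> ~ ?C b)" using g by blast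
    fix h assume h: "Ord h & ?C h & (ALL b. b :. h --> ~ ?C b)"
    then show "h = g" using Ord_linear[of h g] g by blast
  qed
  then have "?C omega" using g(2) d(2) by simp
  then obtain f where f: "maps f omega d" "ALL b. b :. d --> (EX x. x :. omega & b \<^bold>\<subseteq> ap f x)" by blast
  have fd: "n :. omega ==> ap f n :. d" for n using f(1) unfolding maps_iff by blast
  have dl: "dt (%e. recr VG (ap f (e 0)))" by (rule dt_app1[OF dt_VV]) (intro Di)
  have hv: "ap (lam omega (%n. recr VG (ap f n))) n = V_level (ap f n)" if "n :. omega" for n
    unfolding ap_lam[OF dl that] by (rule V_level_recr[symmetric, OF Ord_mem[OF o fd[OF that]]])
  show ?thesis unfolding cofw_def
  proof (rule exI[of _ "lam omega (%n. recr VG (ap f n))"], intro conjI allI impI)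
    show "ap (lam omega (%n. recr VG (ap f n))) n :. V_level d" if "n :. omega" for n unfolding hv[OF that] by (rule V_mem[OF o fd[OF that]])
    fix y assume "y :. V_level d"
    then obtain c where c: "c :. d" "y \<^bold>\<subseteq> V_level c" unfolding mem_V[OF o] by blast
    obtain n where n: "n :. omega" "c \<^bold>\<subseteq> ap f n" using f(2) c(1) by blast
    have on: "Ord (ap f n)" by (rule Ord_mem[OF o fd[OF n(1)]])
    have "c :. ap f n | c = ap f n" using Ord_sub[OF Ord_mem[OF o c(1)] on] n(2) by blast
    then have "V_level c \<^bold>\<subseteq> V_level (ap f n)" using V_mono[OF on] unfolding subset_def by blast
    then show "EX n. n :. omega & y \<^bold>\<subseteq> ap (lam omega (%n. recr VG (ap f n))) n" using n(1) sub_trans[OF c(2)] hv[OF n(1)] by metis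
  qed
qed

theorem theorem7p6:
  fixes \<delta> \<delta>' j \<theta> :: "'a::zf"
  assumes "Limit \<delta>" and "cofinality \<delta> = omega"
    and "Ord \<delta>'" and "\<delta>' \<^bold>\<in> \<delta> \<or> \<delta>' = \<delta>"
    and "Sigma1_elementary j (V_level \<delta>') (V_level \<delta>)"
    and "mem_cofinal j (V_level \<delta>') (V_level \<delta>)"
    and nontrivial: "\<exists>x. x \<^bold>\<in> V_level \<delta>' \<and> app j x \<noteq> x"
    and "Ord \<theta>" and "admissible (J_level (V_level \<delta>) \<theta>)"
    and "\<forall>\<alpha>. \<alpha> \<^bold>\<in> \<theta> \<longrightarrow> \<not> admissible (J_level (V_level \<delta>) \<alpha>)"
  shows "\<not> j \<^bold>\<in> J_level (V_level \<delta>) \<theta> \<and>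
    \<not> definable_over Sigma1 (J_level (V_level \<delta>) \<theta>) j \<and>
    \<not> definable_over Pi1 (J_level (V_level \<delta>) \<theta>) j"
proof -
  define U U' where "U = V_level \<delta>" and "U' = V_level \<delta>'"
  have o: "Ord \<delta>" using assms(1) by (simp add: Limit_def)
  note el = assms(5)[folded U_def U'_def] and co = assms(6)[folded U_def U'_def]
  have tU: "transitive U" "transitive U'" unfolding U_def U'_def by (rule V_trans[OF o], rule V_trans[OF assms(3)])
  note t = el tU(2,1)
  have L': "Limit \<delta>'" by (rule el_Limit[OF assms(1,3,5,6)])
  obtain x where x: "x :. U'" "ap j x \<noteq> x" using nontrivial fun_onD(3)[OF mj(1)[OF t]] unfolding U'_def by metis
  \<comment> \<open>At height \<open>omega\<close> the embedding would be the identity;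
    nontriviality excludes this and gives \<open>omega\<close> room below the height, as
    \<open>Base\<close> requires.\<close>
  have "omega \<noteq> \<delta>'"
  proof
    assume "omega = \<delta>'"
    then show False using el_Vomega[of j U x] el tU(1) x unfolding U'_def by simp
  qed
  then have w': "omega :. \<delta>'" using Limit_omega_sub[OF L'] by blast
  then have w: "omega :. \<delta>" using assms(4) Ord_trans[OF o] by blast
  have B: "Base U" "Base U'" unfolding U_def U'_def by (rule Base_V[OF assms(1) w], rule Base_V[OF L' w'])
  have UU: "U' :. U | U' = U" unfolding U_def U'_def using assms(4) V_mem[OF o] by blast
  then have sub: "U' \<^bold>\<subseteq> U" using tU(1) unfolding transitive_def by auto
  have emb: "EmbR (%x y. opair x y :. j) U' U" by (rule el_EmbR[OF t Base_omega(1)[OF B(2)] co])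
  have cU: "cofw U" unfolding U_def by (rule cofw_V[OF assms(1,2)])
  have cU': "cofw U'" by (rule cofw_down[OF B(2,1) emb mj(1)[OF t] cU])
  obtain l where l: "astar U l" using astar_ex[OF B(1)] by blast
  obtain \<chi> where ch: "opf \<chi> TYPE('a)" using ex_opf by blast
  interpret c: codes U l \<chi> by unfold_locales (fact B(1) l ch)+
  have no: "~ j :. JJ U l"
  proof
    assume jM: "j :. JJ U l"
    from UU show False
    proof
      assume "U' :. U" then show False using no_down[OF B(1) _ B(2) cU' l jM emb] by blast
    next
      assume e: "U' = U"
      have "opair x (ap j x) :. j" by (rule fun_onD(1)[OF mj(1)[OF t] x(1)])
      then show False using no_self[OF B(1) cU l jM emb[unfolded e] x(1)[unfolded e] _ mj(2)[OF t x(1)] x(2)] by blast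
    qed
  qed
  have J: "Ord a ==> J_level U a = JJ U a" for a by (rule J_level_JJ[OF c.T])
  \<comment> \<open>The level \<open>l\<close> is admissible, so minimality of
    \<open>\<theta>\<close> applies to it.\<close>
  have "~ l :. \<theta>" using assms(10)[folded U_def] c.admissible_M J[OF c.l(2)] by metis
  then have tl: "\<theta> :. l | \<theta> = l" using Ord_linear[OF assms(8) c.l(2)] by blast
  note Jt = J[OF assms(8)]
  have jU: "j \<^bold>\<subseteq> U"
  proof (rule subI)
    fix p assume "p :. j"
    then obtain y where y: "y :. U'" "p = opair y (ap j y)" unfolding fun_on_mem'[OF mj(1)[OF t]] by blast
    show "p :. U" unfolding y(2) by (rule c.OU[OF subD[OF sub y(1)] mj(2)[OF t y(1)]])
  qed
  have U'M: "U' :. JJ U l" using UU c.UM by blast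
  \<comment> \<open>Both kinds of definability are reduced to membership in level \<open>l\<close>.
    Strictly below \<open>l\<close> any formula would do; at \<open>l\<close> itself the graph must
    be bounded and decided at an earlier level, which is where its complexity matters.\<close>
  have df: "j :. JJ U l" if G: "\<Gamma> = Sigma1 | \<Gamma> = Pi1" and h: "definable_over \<Gamma> (JJ U \<theta>) j" for \<Gamma>
  proof -
    obtain p s where p: "p :. \<Gamma>" "maps s omega (JJ U \<theta>)" "!!x. x :. j <-> x :. JJ U \<theta> & Sat (JJ U \<theta>) p (upd s (std_num 0) x)"
      using h unfolding definable_over_def by blast
    have p1: "p :. Sigma1 | p :. Pi1" using G p(1) by blast
    then have pF: "p :. Form" using Sigma1_induct[of p "%_. True"] Pi1_induct[of p "%_. True"] D_True by blast
    from tl show ?thesis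
    proof
      assume "\<theta> :. l" then show ?thesis by (rule c.graph_below[OF _ pF p(2) jU p(3)])
    next
      assume e: "\<theta> = l"
      show ?thesis by (rule c.graph_in_M[OF U'M mj(1)[OF t] mj(2)[OF t] p1 p(2)[unfolded e] p(3)[unfolded e]])
    qed
  qed
  have "~ j :. JJ U \<theta>" using no tl c.JJle[of \<theta> \<theta> j] subD[OF c.JJsubM, of \<theta> j] by blast
  then show ?thesis unfolding U_def[symmetric] Jt using df no by blast
qed

end
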